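(* Let $R$ be a discrete valuation ring with fraction field $K$, $\Delta$ a maximal $R$-order in a $K$-central division algebra $K\Delta$ with $\Delta/\mathrm{rad}\,\Delta\simeq M_r(D)$ for a division ring $D$, and $\Lambda\subseteq M_n(\Delta)$ a normal hereditary $R$-order in $M_n(K\Delta)$ with exactly $d$ isomorphism classes of simple modules. Then there exist $b\mid r$ and a positive integer $c$ such that $M_b(\Lambda)\simeq M_c(\Delta_d)$.
   Context: $\Lambda$ is normal if its Jacobson radical is free of rank one as a left and as a right $\Lambda$-module. $\Delta_d$ denotes the subring of $M_d(\Delta)$ of matrices with entries in $\Delta$ on and above the diagonal and entries in $\mathrm{rad}\,\Delta$ strictly below the diagonal. *)

theory Defs
  imports "HOL-Algebra.Algebra"
begin

definition restr :: "('a, 'c) ring_scheme \<Rightarrow> 'a set \<Rightarrow> 'a ring" where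
  "restr A S = \<lparr>carrier = S, monoid.mult = monoid.mult A, monoid.one = monoid.one A, ring.zero = ring.zero A, ring.add = ring.add A\<rparr>"

definition opp_ring :: "('a, 'c) ring_scheme \<Rightarrow> 'a ring" where
  "opp_ring A = \<lparr>carrier = carrier A, monoid.mult = (\<lambda>x y. y \<otimes>\<^bsub>A\<^esub> x),
                 monoid.one = monoid.one A, ring.zero = ring.zero A, ring.add = ring.add A\<rparr>"

definition division_ring :: "('a, 'c) ring_scheme \<Rightarrow> bool" where
  "division_ring D \<longleftrightarrow> ring D \<and> \<one>\<^bsub>D\<^esub> \<noteq> \<zero>\<^bsub>D\<^esub> \<and>
     (\<forall>x \<in> carrier D - {\<zero>\<^bsub>D\<^esub>}. x \<in> Units D)"

definition mat_carrier :: "nat \<Rightarrow> ('a, 'c) ring_scheme \<Rightarrow> (nat \<Rightarrow> nat \<Rightarrow> 'a) set" where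
  "mat_carrier n A = {M. (\<forall>i j. i < n \<and> j < n \<longrightarrow> M i j \<in> carrier A) \<and>
                         (\<forall>i j. \<not> (i < n \<and> j < n) \<longrightarrow> M i j = undefined)}"

definition mat_ring :: "nat \<Rightarrow> ('a, 'c) ring_scheme \<Rightarrow> (nat \<Rightarrow> nat \<Rightarrow> 'a) ring" where
  "mat_ring n A =
    \<lparr>carrier = mat_carrier n A,
     monoid.mult = (\<lambda>M N i j. if i < n \<and> j < n
               then finsum A (\<lambda>k. M i k \<otimes>\<^bsub>A\<^esub> N k j) {..<n} else undefined),
     monoid.one = (\<lambda>i j. if i < n \<and> j < n then (if i = j then \<one>\<^bsub>A\<^esub> else \<zero>\<^bsub>A\<^esub>) else undefined),
     ring.zero = (\<lambda>i j. if i < n \<and> j < n then \<zero>\<^bsub>A\<^esub> else undefined),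
     ring.add = (\<lambda>M N i j. if i < n \<and> j < n then M i j \<oplus>\<^bsub>A\<^esub> N i j else undefined)\<rparr>"

definition scal :: "nat \<Rightarrow> ('a, 'c) ring_scheme \<Rightarrow> 'a \<Rightarrow> (nat \<Rightarrow> nat \<Rightarrow> 'a)" where
  "scal n A a = (\<lambda>i j. if i < n \<and> j < n then (if i = j then a else \<zero>\<^bsub>A\<^esub>) else undefined)"

definition left_ideal :: "'a set \<Rightarrow> ('a, 'c) ring_scheme \<Rightarrow> bool" where
  "left_ideal I A \<longleftrightarrow> additive_subgroup I A \<and>
     (\<forall>a \<in> carrier A. \<forall>x \<in> I. a \<otimes>\<^bsub>A\<^esub> x \<in> I)"

definition maximal_left_ideal :: "'a set \<Rightarrow> ('a, 'c) ring_scheme \<Rightarrow> bool" where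
  "maximal_left_ideal I A \<longleftrightarrow> left_ideal I A \<and> I \<noteq> carrier A \<and>
     (\<forall>J. left_ideal J A \<and> I \<subseteq> J \<and> J \<noteq> carrier A \<longrightarrow> J = I)"

definition jrad :: "('a, 'c) ring_scheme \<Rightarrow> 'a set" where
  "jrad A = carrier A \<inter> \<Inter> {I. maximal_left_ideal I A}"

definition lmod :: "('a, 'c) ring_scheme \<Rightarrow> ('a, 'm, 'd) module_scheme \<Rightarrow> bool" where
  "lmod A M \<longleftrightarrow> ring A \<and> abelian_group M \<and>
     (\<forall>a \<in> carrier A. \<forall>x \<in> carrier M. a \<odot>\<^bsub>M\<^esub> x \<in> carrier M) \<and>
     (\<forall>a \<in> carrier A. \<forall>b \<in> carrier A. \<forall>x \<in> carrier M.
        (a \<oplus>\<^bsub>A\<^esub> b) \<odot>\<^bsub>M\<^esub> x = a \<odot>\<^bsub>M\<^esub> x \<oplus>\<^bsub>M\<^esub> b \<odot>\<^bsub>M\<^esub> x) \<and>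
     (\<forall>a \<in> carrier A. \<forall>x \<in> carrier M. \<forall>y \<in> carrier M.
        a \<odot>\<^bsub>M\<^esub> (x \<oplus>\<^bsub>M\<^esub> y) = a \<odot>\<^bsub>M\<^esub> x \<oplus>\<^bsub>M\<^esub> a \<odot>\<^bsub>M\<^esub> y) \<and>
     (\<forall>a \<in> carrier A. \<forall>b \<in> carrier A. \<forall>x \<in> carrier M.
        (a \<otimes>\<^bsub>A\<^esub> b) \<odot>\<^bsub>M\<^esub> x = a \<odot>\<^bsub>M\<^esub> (b \<odot>\<^bsub>M\<^esub> x)) \<and>
     (\<forall>x \<in> carrier M. \<one>\<^bsub>A\<^esub> \<odot>\<^bsub>M\<^esub> x = x)"

definition lhom :: "('a, 'c) ring_scheme \<Rightarrow> ('a, 'm, 'd) module_scheme \<Rightarrow>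
                      ('a, 'n, 'e) module_scheme \<Rightarrow> ('m \<Rightarrow> 'n) set" where
  "lhom A M N = {f. f \<in> carrier M \<rightarrow> carrier N \<and>
     (\<forall>x \<in> carrier M. \<forall>y \<in> carrier M. f (x \<oplus>\<^bsub>M\<^esub> y) = f x \<oplus>\<^bsub>N\<^esub> f y) \<and>
     (\<forall>a \<in> carrier A. \<forall>x \<in> carrier M. f (a \<odot>\<^bsub>M\<^esub> x) = a \<odot>\<^bsub>N\<^esub> f x)}"

definition lmod_iso :: "('a, 'c) ring_scheme \<Rightarrow> ('a, 'm, 'd) module_scheme \<Rightarrow>
                      ('a, 'n, 'e) module_scheme \<Rightarrow> bool" where
  "lmod_iso A M N \<longleftrightarrow> (\<exists>f \<in> lhom A M N. bij_betw f (carrier M) (carrier N))"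

definition submodule :: "('a, 'c) ring_scheme \<Rightarrow> ('a, 'm, 'd) module_scheme \<Rightarrow> 'm set \<Rightarrow> bool" where
  "submodule A M S \<longleftrightarrow> additive_subgroup S M \<and>
     (\<forall>a \<in> carrier A. \<forall>x \<in> S. a \<odot>\<^bsub>M\<^esub> x \<in> S)"

definition simple_lmod :: "('a, 'c) ring_scheme \<Rightarrow> ('a, 'm, 'd) module_scheme \<Rightarrow> bool" where
  "simple_lmod A M \<longleftrightarrow> lmod A M \<and> carrier M \<noteq> {\<zero>\<^bsub>M\<^esub>} \<and>
     (\<forall>S. submodule A M S \<longrightarrow> S = {\<zero>\<^bsub>M\<^esub>} \<or> S = carrier M)"

definition ideal_mod :: "('a, 'c) ring_scheme \<Rightarrow> 'a set \<Rightarrow> ('a, 'a) module" where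
  "ideal_mod A I = \<lparr>carrier = I, monoid.mult = monoid.mult A, monoid.one = monoid.one A, ring.zero = ring.zero A, ring.add = ring.add A,
                    smult = monoid.mult A\<rparr>"

definition projective_lmod :: "('a, 'c) ring_scheme \<Rightarrow> ('a, 'p, 'd) module_scheme \<Rightarrow> bool" where
  "projective_lmod A P \<longleftrightarrow> lmod A P \<and>
     (\<forall>(M :: ('a, 'p \<Rightarrow> 'a) module) (N :: ('a, 'p) module) g f.
        lmod A M \<and> lmod A N \<and> g \<in> lhom A M N \<and> g ` carrier M = carrier N \<and>
        f \<in> lhom A P N \<longrightarrow>
        (\<exists>h \<in> lhom A P M. \<forall>x \<in> carrier P. g (h x) = f x))"

definition hereditary :: "('a, 'c) ring_scheme \<Rightarrow> bool" where
  "hereditary A \<longleftrightarrow> ring A \<and> (\<forall>I. left_ideal I A \<longrightarrow> projective_lmod A (ideal_mod A I))"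

text \<open>Normal: rad A is free of rank one as a left and as a right A-module.
  Right A-modules are left modules over the opposite ring.\<close>
definition normal_ring :: "('a, 'c) ring_scheme \<Rightarrow> bool" where
  "normal_ring A \<longleftrightarrow>
     lmod_iso A (ideal_mod A (jrad A)) (ideal_mod A (carrier A)) \<and>
     lmod_iso (opp_ring A) (ideal_mod (opp_ring A) (jrad A)) (ideal_mod (opp_ring A) (carrier A))"

text \<open>A has exactly d isomorphism classes of simple left modules. Carriers range over
  'm set, which suffices since every simple module is isomorphic to a quotient A/m
  whose elements are cosets (sets of elements of A).\<close>
definition num_simple_classes :: "('m, 'c) ring_scheme \<Rightarrow> nat \<Rightarrow> bool" where
  "num_simple_classes A d \<longleftrightarrow>
     (\<exists>S :: nat \<Rightarrow> ('m, 'm set) module.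
        (\<forall>i < d. simple_lmod A (S i)) \<and>
        (\<forall>i < d. \<forall>j < d. i \<noteq> j \<longrightarrow> \<not> lmod_iso A (S i) (S j)) \<and>
        (\<forall>M :: ('m, 'm set) module. simple_lmod A M \<longrightarrow> (\<exists>i < d. lmod_iso A M (S i))))"

definition dvr :: "('a, 'c) ring_scheme \<Rightarrow> 'a set \<Rightarrow> bool" where
  "dvr E R \<longleftrightarrow> subring R E \<and> domain (restr E R) \<and>
     (\<exists>\<pi> \<in> R. \<pi> \<noteq> \<zero>\<^bsub>E\<^esub> \<and> \<pi> \<notin> Units (restr E R) \<and>
        (\<forall>x \<in> R - {\<zero>\<^bsub>E\<^esub>}. \<exists>u n. u \<in> Units (restr E R) \<and> x = u \<otimes>\<^bsub>E\<^esub> (\<pi> [^]\<^bsub>E\<^esub> (n::nat))))"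

definition center :: "('a, 'c) ring_scheme \<Rightarrow> 'a set" where
  "center E = {z \<in> carrier E. \<forall>x \<in> carrier E. z \<otimes>\<^bsub>E\<^esub> x = x \<otimes>\<^bsub>E\<^esub> z}"

definition fraction_field :: "('a, 'c) ring_scheme \<Rightarrow> 'a set \<Rightarrow> 'a set \<Rightarrow> bool" where
  "fraction_field E R K \<longleftrightarrow> R \<subseteq> K \<and> subfield K E \<and>
     K = {a \<otimes>\<^bsub>E\<^esub> inv\<^bsub>E\<^esub> b | a b. a \<in> R \<and> b \<in> R \<and> b \<noteq> \<zero>\<^bsub>E\<^esub>}"

definition lin_comb :: "('a, 'c) ring_scheme \<Rightarrow> 'a set \<Rightarrow> 'a set \<Rightarrow> 'a set" where
  "lin_comb A S T = {y. \<exists>(m::nat) c v. (\<forall>i < m. c i \<in> S \<and> v i \<in> T) \<and>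
                        y = finsum A (\<lambda>i. monoid.mult A (c i) (v i)) {..<m}}"

text \<open>L is an R-order in the K-algebra A (R, K given as central subsets of A):
  a subring containing R, finitely generated as R-module, with K L = A.\<close>
definition order :: "('a, 'c) ring_scheme \<Rightarrow> 'a set \<Rightarrow> 'a set \<Rightarrow> 'a set \<Rightarrow> bool" where
  "order A R K L \<longleftrightarrow> subring L A \<and> R \<subseteq> L \<and>
     (\<exists>B. finite B \<and> B \<subseteq> L \<and> L = lin_comb A R B) \<and> lin_comb A K L = carrier A"

definition maximal_order :: "('a, 'c) ring_scheme \<Rightarrow> 'a set \<Rightarrow> 'a set \<Rightarrow> 'a set \<Rightarrow> bool" where
  "maximal_order A R K L \<longleftrightarrow> order A R K L \<and>
     (\<forall>G. order A R K G \<and> L \<subseteq> G \<longrightarrow> G = L)"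

definition central_division_algebra :: "('a, 'c) ring_scheme \<Rightarrow> 'a set \<Rightarrow> bool" where
  "central_division_algebra E K \<longleftrightarrow> division_ring E \<and> K = center E \<and>
     (\<exists>B. finite B \<and> B \<subseteq> carrier E \<and> lin_comb E K B = carrier E)"

definition Delta_d :: "nat \<Rightarrow> ('a, 'c) ring_scheme \<Rightarrow> (nat \<Rightarrow> nat \<Rightarrow> 'a) ring" where
  "Delta_d d Dl = (mat_ring d Dl)\<lparr>carrier :=
     {M \<in> mat_carrier d Dl. \<forall>i j. j < i \<and> i < d \<longrightarrow> M i j \<in> jrad Dl}\<rparr>"

end

theory Submission
  imports Defs
begin

text \<open>Write \<open>A = M\<^sub>n(K\<Delta>)\<close>. Normality gives a generator \<open>y\<close> of the radical of \<open>\<Lambda>\<close> which is a unit of \<open>A\<close> normalizing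
  \<open>\<Lambda>\<close>. For a column lattice \<open>M = c \<Delta>\<^sup>n\<close> inside \<open>\<Lambda>\<close>, projective because \<open>\<Lambda>\<close> is hereditary, the endomorphism
  ring is \<open>\<Delta>\<close>, and the top of \<open>y\<^sup>k M\<close> is \<open>r\<close> copies of a simple module \<open>S\<^sub>k\<close>. Multiplication by \<open>y\<close> shifts these
  classes, and every simple module occurs because a power of \<open>y\<close> lies in \<open>c \<Lambda>\<close>; so the \<open>d\<close> simple modules
  are permuted cyclically, \<open>S\<^sub>k \<cong> S\<^sub>l\<close> holds iff \<open>d\<close> divides \<open>k - l\<close>, and all of them have the same multiplicity
  in the top of \<open>\<Lambda>\<close>. A map between different members of \<open>M, y M, \<dots>, y\<^bsup>d-1\<^esup> M\<close> vanishes on tops, which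
  identifies the endomorphism ring of their direct sum \<open>T\<close> with \<open>\<Delta>\<^sub>d\<close>. Comparing multiplicities, \<open>\<Lambda>\<^sup>b\<close> and
  \<open>T\<^sup>c\<close> have isomorphic tops for some \<open>b\<close> dividing \<open>r\<close>; the isomorphism lifts to the projective modules
  themselves, and their endomorphism rings are \<open>M\<^sub>b(\<Lambda>)\<close> and \<open>M\<^sub>c(\<Delta>\<^sub>d)\<close>.\<close>

section \<open>Rings on subsets of a type as elements of a type class\<close>

text \<open>A division algebra has no idempotents except 0 and 1, so if idempotents lifted modulo
  the radical of \<Delta>, then \<open>r\<close> would be 1. As \<open>R\<close> need not be
  complete, \<open>r > 1\<close> is possible, and then no direct summand of \<open>M\<close> has a
  simple top. This is why matrices over the two rings are compared, and why isomorphisms of tops are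
  lifted but never idempotents. If each simple module occurs m times in the top of \<Lambda>, the
  tops of the b-th power of \<Lambda> and the c-th power of \<open>T\<close> agree when b m = c r;
  the least solution has b = r / gcd m r, a divisor of r.

  The triangular shape comes from the filtration \<open>H j\<close> = Hom(M, y^j M), with
  \<open>H 0\<close> = \<Delta> and \<open>H 1\<close> = rad \<Delta>. It can drop from
  \<open>H j\<close> to \<open>H (j + 1)\<close> only if M and y^j M have a simple constituent of
  their tops in common, that is, if d divides j. So \<open>H (k - l)\<close> with 0 \<le> k, l < d
  is rad \<Delta> for k > l and \<Delta> otherwise.

  Simple modules are represented by maximal left ideals, and a homomorphism from \<Lambda>/I to
  \<Lambda>/I' by an element a with I a \<subseteq> I'.\<close>

text \<open>The product of all ring structures carried by subsets of a type. Every such ring embeds into it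
  (without preserving the unit), so noncommutative computations can be done in the type class \<open>ring\<close>,
  without carrier side conditions.\<close>

typedef 'a all_rings = "{f :: 'a ring \<Rightarrow> 'a. \<forall>S. if ring S then f S \<in> carrier S else f S = undefined}"
  by (rule exI[of _ "\<lambda>S. if ring S then \<zero>\<^bsub>S\<^esub> else undefined"]) (auto simp: ring.ring_simprules)

setup_lifting type_definition_all_rings

instantiation all_rings :: (type) ring
begin

lift_definition zero_all_rings :: "'a all_rings" is "\<lambda>S. if ring S then \<zero>\<^bsub>S\<^esub> else undefined"
  by (auto simp: ring.ring_simprules)

lift_definition plus_all_rings :: "'a all_rings \<Rightarrow> 'a all_rings \<Rightarrow> 'a all_rings"
  is "\<lambda>f g S. if ring S then f S \<oplus>\<^bsub>S\<^esub> g S else undefined"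
  by (auto simp: ring.ring_simprules split: if_splits)

lift_definition uminus_all_rings :: "'a all_rings \<Rightarrow> 'a all_rings"
  is "\<lambda>f S. if ring S then \<ominus>\<^bsub>S\<^esub> f S else undefined"
  by (auto simp: ring.ring_simprules split: if_splits)

lift_definition minus_all_rings :: "'a all_rings \<Rightarrow> 'a all_rings \<Rightarrow> 'a all_rings"
  is "\<lambda>f g S. if ring S then f S \<ominus>\<^bsub>S\<^esub> g S else undefined"
  by (auto simp: ring.ring_simprules split: if_splits)

lift_definition times_all_rings :: "'a all_rings \<Rightarrow> 'a all_rings \<Rightarrow> 'a all_rings"
  is "\<lambda>f g S. if ring S then f S \<otimes>\<^bsub>S\<^esub> g S else undefined"
  by (auto simp: ring.ring_simprules split: if_splits)

instance
  by standard (transfer; rule ext; fastforce simp: ring.ring_simprules split: if_splits)+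

end

text \<open>Coordinate \<open>A\<close> carries the element and every other coordinate is 0, so sums
  and products in \<open>A\<close> become those of the type class. Elements outside the carrier go
  to 0, hence the carrier premises of the rules below.\<close>

lift_definition emb :: "'a ring \<Rightarrow> 'a \<Rightarrow> 'a all_rings"
  is "\<lambda>A a S. if ring S then (if S = A \<and> a \<in> carrier A then a else \<zero>\<^bsub>S\<^esub>) else undefined"
  by (auto simp: ring.ring_simprules)

locale emb_ring = ring A for A :: "'a ring" (structure)
begin

abbreviation \<iota> where "\<iota> \<equiv> emb A"

lemma emb_add: "a \<in> carrier A \<Longrightarrow> b \<in> carrier A \<Longrightarrow> \<iota> (a \<oplus> b) = \<iota> a + \<iota> b"
  by transfer (rule ext, auto simp: ring.ring_simprules)

lemma emb_mult: "a \<in> carrier A \<Longrightarrow> b \<in> carrier A \<Longrightarrow> \<iota> (a \<otimes> b) = \<iota> a * \<iota> b"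
  by transfer (rule ext, auto simp: ring.ring_simprules)

lemma emb_zero: "\<iota> \<zero> = 0"
  by transfer (rule ext, auto simp: ring.ring_simprules)

lemma emb_uminus: "a \<in> carrier A \<Longrightarrow> \<iota> (\<ominus> a) = - \<iota> a"
  by transfer (rule ext, auto simp: ring.ring_simprules)

lemma emb_minus: "a \<in> carrier A \<Longrightarrow> b \<in> carrier A \<Longrightarrow> \<iota> (a \<ominus> b) = \<iota> a - \<iota> b"
  by (simp add: a_minus_def emb_add emb_uminus)

lemma emb_inj: "a \<in> carrier A \<Longrightarrow> b \<in> carrier A \<Longrightarrow> \<iota> a = \<iota> b \<longleftrightarrow> a = b"
proof
  assume "a \<in> carrier A" "b \<in> carrier A" "\<iota> a = \<iota> b"
  then have "Rep_all_rings (\<iota> a) A = Rep_all_rings (\<iota> b) A" by simp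
  with \<open>a \<in> carrier A\<close> \<open>b \<in> carrier A\<close> show "a = b"
    by (simp add: emb.rep_eq ring_axioms)
qed auto

lemma emb_finsum:
  assumes "f \<in> S \<rightarrow> carrier A"
  shows "\<iota> (finsum A f S) = (\<Sum>x\<in>S. \<iota> (f x))"
  using assms by (induction S rule: infinite_finite_induct) (auto simp: emb_zero emb_add)

end

definition additive :: "'a::ab_group_add set \<Rightarrow> bool" where
  "additive S \<longleftrightarrow> 0 \<in> S \<and> (\<forall>a\<in>S. \<forall>b\<in>S. a - b \<in> S)"

lemma additiveI: "0 \<in> S \<Longrightarrow> (\<And>a b. a \<in> S \<Longrightarrow> b \<in> S \<Longrightarrow> a - b \<in> S) \<Longrightarrow> additive S"
  by (simp add: additive_def)

lemma additive_zero: "additive S \<Longrightarrow> 0 \<in> S"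
  by (simp add: additive_def)

lemma additive_diff: "additive S \<Longrightarrow> a \<in> S \<Longrightarrow> b \<in> S \<Longrightarrow> a - b \<in> S"
  by (simp add: additive_def)

lemma additive_uminus: "additive S \<Longrightarrow> a \<in> S \<Longrightarrow> - a \<in> S"
  using additive_diff[of S 0 a] by (simp add: additive_zero)

lemma additive_add: "additive S \<Longrightarrow> a \<in> S \<Longrightarrow> b \<in> S \<Longrightarrow> a + b \<in> S"
  using additive_diff[of S a "- b"] by (simp add: additive_uminus)

lemma additive_sum: "additive S \<Longrightarrow> (\<And>i. i \<in> I \<Longrightarrow> f i \<in> S) \<Longrightarrow> sum f I \<in> S"
  by (induction I rule: infinite_finite_induct) (auto simp: additive_zero additive_add)

lemmas additive_closed = additive_zero additive_diff additive_uminus additive_add additive_sum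

section \<open>Matrices over additive subgroups\<close>

text \<open>Only the inner dimension is recorded and the outer indices are unbounded. Rectangular
  products need no extra notation, and associativity holds at all indices.\<close>

definition mm :: "nat \<Rightarrow> (nat \<Rightarrow> nat \<Rightarrow> 'a::ring) \<Rightarrow> (nat \<Rightarrow> nat \<Rightarrow> 'a) \<Rightarrow> nat \<Rightarrow> nat \<Rightarrow> 'a" where
  "mm s U Y i j = (\<Sum>k<s. U i k * Y k j)"

text \<open>The class \<open>ring\<close> provides no 1. The diagonal entry is the unit of the
  subring at hand, \<open>p\<close> for \<open>L\<close> or \<open>q\<close> for
  \<open>D\<close>.\<close>

definition unit_mat :: "'a::zero \<Rightarrow> nat \<Rightarrow> nat \<Rightarrow> 'a" where
  "unit_mat a i j = (if i = j then a else 0)"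

lemma mm_assoc: "mm s (mm t U Y) Z i j = mm t U (mm s Y Z) i j"
proof -
  have "mm s (mm t U Y) Z i j = (\<Sum>k<s. \<Sum>l<t. U i l * Y l k * Z k j)"
    by (simp add: mm_def sum_distrib_right)
  also have "\<dots> = (\<Sum>l<t. \<Sum>k<s. U i l * Y l k * Z k j)" by (rule sum.swap)
  also have "\<dots> = mm t U (mm s Y Z) i j" by (simp add: mm_def sum_distrib_left mult.assoc)
  finally show ?thesis .
qed

lemma mm_assoc_fun: "mm s (mm t U V) W = mm t U (mm s V W)"
  by (intro ext mm_assoc)

lemma mm_cong_left: "(\<And>k. k < s \<Longrightarrow> U i k = U' i k) \<Longrightarrow> mm s U Y i j = mm s U' Y i j"
  by (simp add: mm_def)

lemma mm_cong_right: "(\<And>k. k < s \<Longrightarrow> Y k j = Y' k j) \<Longrightarrow> mm s U Y i j = mm s U Y' i j"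
  by (simp add: mm_def)

lemma mm_unit_right: "j < s \<Longrightarrow> mm s U (unit_mat a) i j = U i j * a"
  by (simp add: mm_def unit_mat_def if_distrib[of "\<lambda>a. _ * a"] sum.delta cong: if_cong)

lemma mm_unit_left: "i < s \<Longrightarrow> mm s (unit_mat a) U i j = a * U i j"
  by (simp add: mm_def unit_mat_def if_distrib[of "\<lambda>a. a * _"] sum.delta' cong: if_cong)

lemma mm_diff_right: "mm s U (\<lambda>i j. Y i j - Z i j) i j = mm s U Y i j - mm s U Z i j"
  by (simp add: mm_def right_diff_distrib sum_subtractf)

lemma mm_closed: "additive S \<Longrightarrow> (\<And>k. k < s \<Longrightarrow> U i k * Y k j \<in> S) \<Longrightarrow> mm s U Y i j \<in> S"
  unfolding mm_def by (rule additive_sum) auto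

text \<open>Writing \<open>a = i * n + j\<close> separates the number of a block from the position
  inside it; flattened block matrices are summed this way.\<close>

lemma sum_div_mod:
  fixes h :: "nat \<Rightarrow> nat \<Rightarrow> 'a::comm_monoid_add"
  assumes "0 < n"
  shows "(\<Sum>a<b * n. h (a div n) (a mod n)) = (\<Sum>i<b. \<Sum>j<n. h i j)"
proof (induction b)
  case (Suc b)
  have "(\<Sum>a<Suc b * n. h (a div n) (a mod n)) =
      (\<Sum>a<b * n. h (a div n) (a mod n)) + (\<Sum>a=b * n..<b * n + n. h (a div n) (a mod n))"
    by (simp add: lessThan_atLeast0 sum.atLeastLessThan_concat add.commute)
  also have "(\<Sum>a=b * n..<b * n + n. h (a div n) (a mod n)) =
      (\<Sum>a=0..<n. h ((b * n + a) div n) ((b * n + a) mod n))"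
    using sum.shift_bounds_nat_ivl[of "\<lambda>a. h (a div n) (a mod n)" 0 "b * n" n] by (simp add: add.commute)
  also have "\<dots> = (\<Sum>a<n. h b a)"
    unfolding lessThan_atLeast0 by (rule sum.cong) (use assms in auto)
  finally show ?case using Suc by simp
qed simp

text \<open>A matrix \<open>1 - \<rho>\<close> with \<open>\<rho>\<close> in the radical is left invertible: clear one column of \<open>\<rho>\<close> at a time.\<close>

lemma radical_left_inverse:
  fixes C K :: "nat \<Rightarrow> nat \<Rightarrow> 'a::ring set" and one :: 'a
  assumes C_add: "\<And>i j. additive (C i j)" and K_add: "\<And>i j. additive (K i j)"
    and CC: "\<And>i j k x y. i < s \<Longrightarrow> j < s \<Longrightarrow> k < s \<Longrightarrow> x \<in> C i j \<Longrightarrow> y \<in> C j k \<Longrightarrow> x * y \<in> C i k"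
    and CK: "\<And>i j k x y. i < s \<Longrightarrow> j < s \<Longrightarrow> k < s \<Longrightarrow> x \<in> C i j \<Longrightarrow> y \<in> K j k \<Longrightarrow> x * y \<in> K i k"
    and KC: "\<And>i j. K i j \<subseteq> C i j"
    and one: "\<And>i. i < s \<Longrightarrow> one \<in> C i i" "\<And>i j x. x \<in> C i j \<Longrightarrow> one * x = x" "\<And>i j x. x \<in> C i j \<Longrightarrow> x * one = x"
    and diag: "\<And>i x. i < s \<Longrightarrow> x \<in> K i i \<Longrightarrow> \<exists>y\<in>C i i. y * (one - x) = one"
    and \<rho>: "\<And>i j. i < s \<Longrightarrow> j < s \<Longrightarrow> \<rho> i j \<in> K i j"
  shows "\<exists>W. (\<forall>i<s. \<forall>j<s. W i j \<in> C i j) \<and>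
    (\<forall>i<s. \<forall>j<s. mm s W (\<lambda>i j. unit_mat one i j - \<rho> i j) i j = unit_mat one i j)"
proof -
  have unit_C: "unit_mat one i j \<in> C i j" if "i < s" "j < s" for i j
    using that one(1) additive_zero[OF C_add] by (auto simp: unit_mat_def)
  have "\<exists>W. (\<forall>i<s. \<forall>j<s. W i j \<in> C i j) \<and>
    (\<forall>i<s. \<forall>j<s. mm s W (\<lambda>i j. unit_mat one i j - (if j < n then \<rho> i j else 0)) i j = unit_mat one i j)"
    if "n \<le> s" for n
    using that
  proof (induction n)
    case 0
    then show ?case
      using unit_C one by (intro exI[of _ "unit_mat one"]) (auto simp: mm_unit_left one(2)[OF unit_C])
  next
    case (Suc n)
    from Suc.IH[OF Suc_leD[OF Suc.prems]]
    obtain W where W: "\<And>i j. i < s \<Longrightarrow> j < s \<Longrightarrow> W i j \<in> C i j"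
      "\<And>i j. i < s \<Longrightarrow> j < s \<Longrightarrow>
         mm s W (\<lambda>i j. unit_mat one i j - (if j < n then \<rho> i j else 0)) i j = unit_mat one i j"
      by blast
    have n: "n < s" using Suc by simp
    define \<eta> where "\<eta> i = (\<Sum>k<s. W i k * \<rho> k n)" for i
    have \<eta>: "\<eta> i \<in> K i n" if "i < s" for i
      unfolding \<eta>_def using that n CK[OF that _ n W(1) \<rho>] by (auto intro: additive_sum[OF K_add])
    obtain y where y: "y \<in> C n n" "y * (one - \<eta> n) = one" using diag[OF n \<eta>[OF n]] by blast
    \<comment> \<open>After \<open>W\<close> is applied, column \<open>n\<close> is the unit column
      minus \<open>\<eta>\<close>. The elementary matrix with \<open>\<eta> y\<close> added in
      column \<open>n\<close> clears it, because
      \<open>- \<eta> + \<eta> y (one - \<eta> n) = 0\<close>.\<close>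
    define V where "V i j = unit_mat one i j + (if j = n then \<eta> i * y else 0)" for i j
    have V: "V i j \<in> C i j" if "i < s" "j < s" for i j
      unfolding V_def using that \<eta>[OF that(1)] KC CC[OF that(1) n n _ y(1)] n
      by (auto intro!: additive_add[OF C_add] unit_C simp: additive_zero[OF C_add])
    let ?R = "\<lambda>i j. unit_mat one i j - (if j < Suc n then \<rho> i j else 0)"
    have WR: "mm s W ?R i j = unit_mat one i j - (if j = n then \<eta> i else 0)" if "i < s" "j < s" for i j
    proof (cases "j = n")
      case True
      have "mm s W ?R i j = mm s W (\<lambda>i j. unit_mat one i j - (if j < n then \<rho> i j else 0)) i j - \<eta> i"
        by (simp add: mm_def True \<eta>_def right_diff_distrib sum_subtractf)
      then show ?thesis using W(2)[OF that] True by simp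
    next
      case False
      have "mm s W ?R i j = mm s W (\<lambda>i j. unit_mat one i j - (if j < n then \<rho> i j else 0)) i j"
        unfolding mm_def using False by (intro sum.cong) (auto simp: less_Suc_eq)
      then show ?thesis using W(2)[OF that] False by simp
    qed
    have "mm s (mm s V W) ?R i j = unit_mat one i j" if ij: "i < s" "j < s" for i j
    proof -
      have "mm s (mm s V W) ?R i j = mm s V (\<lambda>i j. unit_mat one i j - (if j = n then \<eta> i else 0)) i j"
        unfolding mm_assoc by (rule mm_cong_right) (use WR ij in auto)
      also have "\<dots> = V i j * one - (if j = n then \<Sum>k<s. V i k * \<eta> k else 0)"
        using mm_unit_right[OF ij(2), of V one i] by (subst mm_diff_right) (simp add: mm_def)
      also have "\<dots> = unit_mat one i j"
      proof (cases "j = n")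
        case True
        have \<eta>C: "\<eta> i \<in> C i n" using \<eta>[OF ij(1)] KC by blast
        have "(\<Sum>k<s. V i k * \<eta> k) = (\<Sum>k<s. unit_mat one i k * \<eta> k) + (\<Sum>k<s. if k = n then \<eta> i * y * \<eta> k else 0)"
          unfolding sum.distrib[symmetric] by (rule sum.cong) (auto simp: V_def distrib_right)
        also have "\<dots> = \<eta> i + \<eta> i * y * \<eta> n"
          using mm_unit_left[OF ij(1), of one "\<lambda>k j. \<eta> k" j] n one(2)[OF \<eta>C]
          by (simp add: mm_def)
        finally have "V i j * one - (\<Sum>k<s. V i k * \<eta> k) = V i n * one - \<eta> i - \<eta> i * y * \<eta> n"
          using True by simp
        also have "\<dots> = unit_mat one i n * one + \<eta> i * (y * (one - \<eta> n)) - \<eta> i"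
          by (simp add: V_def algebra_simps)
        also have "\<dots> = unit_mat one i n"
          using one(3)[OF \<eta>C] one(3)[OF one(1)[OF ij(1)]] by (simp add: y unit_mat_def)
        finally show ?thesis using True by simp
      next
        case False
        then show ?thesis using one(3)[OF one(1)[OF ij(1)]] by (simp add: V_def unit_mat_def)
      qed
      finally show ?thesis .
    qed
    moreover have "mm s V W i j \<in> C i j" if "i < s" "j < s" for i j
      using that CC[OF that(1) _ that(2) V W(1)] by (auto intro: mm_closed C_add)
    ultimately show ?case by blast
  qed
  from this[of s] obtain W where W: "\<forall>i<s. \<forall>j<s. W i j \<in> C i j"
    "\<forall>i<s. \<forall>j<s. mm s W (\<lambda>i j. unit_mat one i j - (if j < s then \<rho> i j else 0)) i j = unit_mat one i j"
    by blast
  have "mm s W (\<lambda>i j. unit_mat one i j - \<rho> i j) i j = unit_mat one i j" if "i < s" "j < s" for i j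
    using W(2) that by (simp add: mm_def)
  then show ?thesis using W(1) by blast
qed

section \<open>Towers of invertible bimodules\<close>

text \<open>A ring \<open>L\<close> with unit \<open>p\<close> and a left \<open>L\<close>-module \<open>M\<close>, all inside one ambient ring. The elements
  \<open>w x\<close>, \<open>v x\<close> form a dual basis, so \<open>M\<close> is projective with dual \<open>N\<close> and endomorphism ring \<open>D\<close>, whose
  unit is the idempotent \<open>q\<close>. Powers of the normalizing generator \<open>t 1\<close> of the radical \<open>J\<close> shift \<open>M\<close>;
  \<open>Mt j\<close> is \<open>t\<^sup>j M = J\<^sup>j M\<close>, \<open>P\<close> is the radical of \<open>D\<close>, and \<open>H j\<close> is \<open>Hom(M, t\<^sup>j M)\<close>.\<close>

locale lattice_tower =
  fixes p q :: "'u::ring" and L M :: "'u set"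
    and nv :: nat and v w :: "nat \<Rightarrow> 'u" and t :: "int \<Rightarrow> 'u"
  assumes L_add: "additive L" and p_L: "p \<in> L"
    and L_mult: "a \<in> L \<Longrightarrow> b \<in> L \<Longrightarrow> a * b \<in> L"
    and p_mult_L: "a \<in> L \<Longrightarrow> p * a = a" and L_mult_p: "a \<in> L \<Longrightarrow> a * p = a"
    and M_add: "additive M"
    and LM: "a \<in> L \<Longrightarrow> m \<in> M \<Longrightarrow> a * m \<in> M"
    and p_mult_M: "m \<in> M \<Longrightarrow> p * m = m" and M_mult_q: "m \<in> M \<Longrightarrow> m * q = m"
    and q_idem: "q * q = q"
    and v_M: "x < nv \<Longrightarrow> v x \<in> M"
    and w_props: "x < nv \<Longrightarrow> q * w x = w x" "x < nv \<Longrightarrow> w x * p = w x"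
      "x < nv \<Longrightarrow> m \<in> M \<Longrightarrow> m * w x \<in> L"
    and dual_basis: "(\<Sum>x<nv. w x * v x) = q"
    and t_zero: "t 0 = p" and t_plus: "t (i + j) = t i * t j"
    and t_conj: "a \<in> L \<Longrightarrow> t i * a * t (- i) \<in> L"
    and radical_eq: "{x\<in>L. \<forall>a\<in>L. \<exists>y\<in>L. y * (p - a * x) = p} = (\<lambda>a. t 1 * a) ` L"
begin

definition J where "J = {x\<in>L. \<forall>a\<in>L. \<exists>y\<in>L. y * (p - a * x) = p}"
definition N where "N = {\<phi>. q * \<phi> = \<phi> \<and> \<phi> * p = \<phi> \<and> (\<forall>m\<in>M. m * \<phi> \<in> L)}"
definition D where "D = {h. q * h = h \<and> h * q = h \<and> (\<forall>m\<in>M. m * h \<in> M)}"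
definition P where "P = {f\<in>D. \<forall>\<delta>\<in>D. \<exists>y\<in>D. y * (q - \<delta> * f) = q}"
definition Mt where "Mt j = (\<lambda>m. t j * m) ` M"
definition H where "H j = {h. q * h = h \<and> h * q = h \<and> (\<forall>m\<in>M. m * h \<in> Mt j)}"

section \<open>Closure rules of the Morita context formed by L, M, N and D\<close>

lemma N_add: "additive N"
  by (rule additiveI)
    (auto simp: N_def right_diff_distrib left_diff_distrib additive_closed[OF L_add])

lemma D_add: "additive D"
  by (rule additiveI)
    (auto simp: D_def right_diff_distrib left_diff_distrib additive_closed[OF M_add])

lemma Mt_add: "additive (Mt j)"
proof (rule additiveI)
  show "0 \<in> Mt j" unfolding Mt_def
    by (rule image_eqI[of _ _ 0]) (auto simp: additive_zero[OF M_add])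
  fix a b assume "a \<in> Mt j" "b \<in> Mt j"
  then show "a - b \<in> Mt j" unfolding Mt_def
    by (auto simp: right_diff_distrib[symmetric] additive_diff[OF M_add])
qed

lemma H_add: "additive (H j)"
  by (rule additiveI)
    (auto simp: H_def right_diff_distrib left_diff_distrib additive_closed[OF Mt_add])

lemma J_alt: "J = (\<lambda>a. t 1 * a) ` L"
  using radical_eq by (simp add: J_def)

lemma J_add: "additive J"
proof (rule additiveI)
  show "0 \<in> J" unfolding J_alt
    by (rule image_eqI[of _ _ 0]) (auto simp: additive_zero[OF L_add])
  fix a b assume "a \<in> J" "b \<in> J"
  then show "a - b \<in> J" unfolding J_alt
    by (auto simp: right_diff_distrib[symmetric] additive_diff[OF L_add])
qed

lemma J_L: "x \<in> J \<Longrightarrow> x \<in> L"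
  by (simp add: J_def)

lemma JL: "x \<in> J \<Longrightarrow> a \<in> L \<Longrightarrow> x * a \<in> J"
  unfolding J_alt using L_mult by (auto simp: mult.assoc)

lemma LJ: "a \<in> L \<Longrightarrow> x \<in> J \<Longrightarrow> a * x \<in> J"
  unfolding J_def by (auto simp: L_mult mult.assoc[symmetric])

lemma MN: "m \<in> M \<Longrightarrow> \<phi> \<in> N \<Longrightarrow> m * \<phi> \<in> L"
  by (simp add: N_def)

lemma MD: "m \<in> M \<Longrightarrow> h \<in> D \<Longrightarrow> m * h \<in> M"
  by (simp add: D_def)

lemma NL: "\<phi> \<in> N \<Longrightarrow> a \<in> L \<Longrightarrow> \<phi> * a \<in> N"
  unfolding N_def by (auto simp: mult.assoc L_mult_p) (simp add: mult.assoc[symmetric] L_mult)+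

lemma NM: "\<phi> \<in> N \<Longrightarrow> m \<in> M \<Longrightarrow> \<phi> * m \<in> D"
  unfolding N_def D_def by (auto simp: mult.assoc M_mult_q) (simp add: mult.assoc[symmetric] LM)+

lemma DN: "\<delta> \<in> D \<Longrightarrow> \<phi> \<in> N \<Longrightarrow> \<delta> * \<phi> \<in> N"
  unfolding N_def D_def by (auto simp: mult.assoc) (simp add: mult.assoc[symmetric])+

lemma DD: "\<delta> \<in> D \<Longrightarrow> f \<in> D \<Longrightarrow> \<delta> * f \<in> D"
  unfolding D_def by (auto simp: mult.assoc) (simp add: mult.assoc[symmetric])+

lemma q_D: "q \<in> D"
  by (simp add: D_def q_idem M_mult_q)

lemma w_N: "x < nv \<Longrightarrow> w x \<in> N"
  by (simp add: N_def w_props)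

lemma q_mult_N: "\<phi> \<in> N \<Longrightarrow> q * \<phi> = \<phi>" and N_mult_p: "\<phi> \<in> N \<Longrightarrow> \<phi> * p = \<phi>"
  by (simp_all add: N_def)

lemma q_mult_D: "\<delta> \<in> D \<Longrightarrow> q * \<delta> = \<delta>" and D_mult_q: "\<delta> \<in> D \<Longrightarrow> \<delta> * q = \<delta>"
  by (simp_all add: D_def)

lemma t_cancel: "t i * t (- i) = p" "t (- i) * t i = p"
  using t_plus[of i "- i"] t_plus[of "- i" i] by (simp_all add: t_zero)

lemma t_mult_p: "t i * p = t i" and p_mult_t: "p * t i = t i"
  using t_plus[of i 0] t_plus[of 0 i] by (simp_all add: t_zero)

lemma t_one_J: "t 1 \<in> J"
  unfolding J_alt by (rule image_eqI[of _ _ p]) (simp_all add: t_mult_p p_L)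

lemma conj_mult: "t i * (a * b) * t (- i) = (t i * a * t (- i)) * (t i * b * t (- i))" if "a \<in> L" "b \<in> L"
proof -
  have "(t i * a * t (- i)) * (t i * b * t (- i)) = t i * a * (t (- i) * t i) * b * t (- i)"
    by (simp only: mult.assoc)
  also have "\<dots> = t i * (a * p) * b * t (- i)" by (simp add: t_cancel mult.assoc)
  finally show ?thesis by (simp add: that L_mult_p mult.assoc)
qed

lemma conj_conj: "t i * (t j * a * t (- j)) * t (- i) = t (i + j) * a * t (- (i + j))"
proof -
  have "t (- (i + j)) = t (- j) * t (- i)" using t_plus[of "- j" "- i"] by (simp add: algebra_simps)
  then show ?thesis by (simp only: t_plus mult.assoc)
qed

lemma conj_inv: "a \<in> L \<Longrightarrow> t i * (t (- i) * a * t i) * t (- i) = a"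
  using conj_conj[of i "- i" a] by (simp add: t_zero p_mult_L L_mult_p)

lemma t_comm_L: "a \<in> L \<Longrightarrow> a * t i = t i * (t (- i) * a * t i)"
  by (simp add: mult.assoc[symmetric] t_cancel p_mult_L)

lemma J_conj: "x \<in> J \<Longrightarrow> t i * x * t (- i) \<in> J"
proof -
  assume "x \<in> J"
  then obtain a where a: "a \<in> L" "x = t 1 * a" by (auto simp: J_alt)
  have "t i * x * t (- i) = t (i + 1) * a * t (- i)" by (simp add: a t_plus mult.assoc)
  also have "\<dots> = t 1 * (t i * a * t (- i))" using t_plus[of 1 i] by (simp add: add.commute mult.assoc)
  finally show ?thesis using t_conj[OF a(1), of i] by (auto simp: J_alt)
qed

lemma L_Mt: "a \<in> L \<Longrightarrow> m \<in> Mt j \<Longrightarrow> a * m \<in> Mt j"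
proof -
  assume a: "a \<in> L" and "m \<in> Mt j"
  then obtain m' where m': "m' \<in> M" "m = t j * m'" by (auto simp: Mt_def)
  have "a * m = t j * (t (- j) * a * t j * m')"
    using t_comm_L[OF a, of j] by (simp add: m' mult.assoc[symmetric])
  moreover have "t (- j) * a * t j \<in> L" using t_conj[OF a, of "- j"] by simp
  ultimately show ?thesis using LM m' by (auto simp: Mt_def)
qed

lemma Mt_D: "m \<in> Mt j \<Longrightarrow> h \<in> D \<Longrightarrow> m * h \<in> Mt j"
  unfolding Mt_def using MD by (auto simp: mult.assoc)

lemma t_one_M: "m \<in> M \<Longrightarrow> t 1 * m \<in> M"
  using LM J_L t_one_J by blast

lemma Mt_Suc: "m \<in> Mt (j + 1) \<Longrightarrow> m \<in> Mt j"
  unfolding Mt_def using t_one_M by (auto simp: t_plus mult.assoc)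

lemma Mt_zero: "Mt 0 = M"
  unfolding Mt_def by (force simp: t_zero p_mult_M)

text \<open>Moving \<open>t j\<close> to the left conjugates \<open>x\<close> by a power of
  \<open>t\<close>, which keeps it in \<open>J = t 1 L\<close>. So the radical lowers the filtration
  \<open>Mt\<close> by one step.\<close>

lemma J_Mt: "x \<in> J \<Longrightarrow> m \<in> Mt j \<Longrightarrow> x * m \<in> Mt (j + 1)"
proof -
  assume x: "x \<in> J" and "m \<in> Mt j"
  then obtain m' where m': "m' \<in> M" "m = t j * m'" by (auto simp: Mt_def)
  have "x * m = t j * (t (- j) * x * t j * m')"
    using t_comm_L[OF J_L[OF x], of j] by (simp add: m' mult.assoc[symmetric])
  moreover obtain a where a: "a \<in> L" "t (- j) * x * t j = t 1 * a"
    using J_conj[OF x, of "- j"] by (auto simp: J_alt)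
  ultimately have "x * m = t j * (t 1 * a * m')" by metis
  then have "x * m = t (j + 1) * (a * m')" by (simp add: t_plus mult.assoc)
  then show ?thesis using LM a m' by (auto simp: Mt_def)
qed

lemma J_M: "x \<in> J \<Longrightarrow> m \<in> M \<Longrightarrow> x * m \<in> Mt 1"
  using J_Mt[of x m 0] by (simp add: Mt_zero)

text \<open>Jacobson's observation that a left inverse \<open>y\<close> of \<open>1 - \<phi> m\<close> yields the left inverse
  \<open>1 + m y \<phi>\<close> of \<open>1 - m \<phi>\<close>, applied across the Morita context in both directions.\<close>

lemma jacobson_D_to_L:
  assumes "m \<in> M" "\<phi> \<in> N" "y \<in> D" "y * (q - \<phi> * m) = q"
  shows "\<exists>y'\<in>L. y' * (p - m * \<phi>) = p"
proof
  show "p + m * (y * \<phi>) \<in> L"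
    by (intro additive_add[OF L_add] p_L MN DN assms)
  have L: "m * \<phi> \<in> L" by (rule MN) fact+
  have "(p + m * (y * \<phi>)) * (p - m * \<phi>) = p - m * \<phi> + m * (y * (q - \<phi> * m)) * \<phi>"
    using assms(1-3) L
    by (simp add: algebra_simps p_mult_L L_mult_p p_L N_mult_p q_mult_N)
  then show "(p + m * (y * \<phi>)) * (p - m * \<phi>) = p"
    by (simp add: assms M_mult_q)
qed

lemma jacobson_L_to_D:
  assumes "m \<in> M" "\<phi> \<in> N" "y \<in> L" "y * (p - m * \<phi>) = p"
  shows "\<exists>y'\<in>D. y' * (q - \<phi> * m) = q"
proof
  show "q + \<phi> * (y * m) \<in> D"
    by (intro additive_add[OF D_add] q_D NM LM assms)
  have D: "\<phi> * m \<in> D" by (rule NM) fact+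
  have "(q + \<phi> * (y * m)) * (q - \<phi> * m) = q - \<phi> * m + \<phi> * (y * (p - m * \<phi>)) * m"
    using assms(1-3) D
    by (simp add: algebra_simps q_mult_D D_mult_q q_D q_idem M_mult_q p_mult_M)
  then show "(q + \<phi> * (y * m)) * (q - \<phi> * m) = q"
    by (simp add: assms N_mult_p)
qed

section \<open>The radical of the endomorphism ring\<close>

lemma M_expand: "m \<in> M \<Longrightarrow> m = (\<Sum>x<nv. m * w x * v x)"
  using M_mult_q[of m] by (simp add: dual_basis[symmetric] sum_distrib_left mult.assoc)

lemma D_expand_left: "q * f = f \<Longrightarrow> f = (\<Sum>x<nv. w x * (v x * f))"
  by (metis (no_types, lifting) dual_basis sum_distrib_right sum.cong mult.assoc)

lemma P_D: "f \<in> P \<Longrightarrow> f \<in> D"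
  by (simp add: P_def)

lemma DP: "\<delta> \<in> D \<Longrightarrow> f \<in> P \<Longrightarrow> \<delta> * f \<in> P"
  unfolding P_def by (auto simp: DD mult.assoc[symmetric])

text \<open>Multiplying \<open>q - \<delta> (f + g)\<close> by the left inverse \<open>y\<close>
  belonging to \<open>f\<close> leaves \<open>q - y \<delta> g\<close>, where the criterion for
  \<open>g\<close> applies with the coefficient \<open>y \<delta>\<close>.\<close>

lemma P_plus: "f \<in> P \<Longrightarrow> g \<in> P \<Longrightarrow> f + g \<in> P"
proof -
  assume f: "f \<in> P" and g: "g \<in> P"
  have "\<exists>y\<in>D. y * (q - \<delta> * (f + g)) = q" if d: "\<delta> \<in> D" for \<delta>
  proof -
    obtain y where y: "y \<in> D" "y * (q - \<delta> * f) = q" using f d by (auto simp: P_def)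
    obtain y2 where y2: "y2 \<in> D" "y2 * (q - y * \<delta> * g) = q"
      using g DD[OF y(1) d] by (auto simp: P_def)
    have "y2 * y * (q - \<delta> * (f + g)) = y2 * (y * (q - \<delta> * f) - y * \<delta> * g)"
      by (simp add: algebra_simps)
    also have "\<dots> = q" by (simp add: y y2)
    finally show ?thesis using DD[OF y2(1) y(1)] by blast
  qed
  then show ?thesis using f g by (simp add: P_def additive_add[OF D_add])
qed

lemma zero_P: "0 \<in> P"
  unfolding P_def using q_D q_idem by (auto simp: additive_zero[OF D_add])

lemma P_sum: "(\<And>i. i \<in> I \<Longrightarrow> f i \<in> P) \<Longrightarrow> sum f I \<in> P"
  by (induction I rule: infinite_finite_induct) (auto simp: zero_P P_plus)

text \<open>For \<open>\<delta>\<close> in \<open>D\<close> the product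
  \<open>x m \<delta> \<phi>\<close> stays in \<open>J\<close>, hence \<open>p\<close> minus it has
  a left inverse in \<open>L\<close>; exchanging the factors carries this inverse over to
  \<open>D\<close>.\<close>

lemma N_J_M_P: "\<phi> \<in> N \<Longrightarrow> x \<in> J \<Longrightarrow> m \<in> M \<Longrightarrow> \<phi> * (x * m) \<in> P"
proof -
  assume \<phi>: "\<phi> \<in> N" and x: "x \<in> J" and m: "m \<in> M"
  have xm: "x * m \<in> M" using LM J_L x m by blast
  have "\<exists>y\<in>D. y * (q - \<delta> * (\<phi> * (x * m))) = q" if d: "\<delta> \<in> D" for \<delta>
  proof -
    have "x * (m * (\<delta> * \<phi>)) \<in> J" by (intro JL x MN m DN d \<phi>)
    then obtain y where "y \<in> L" "y * (p - p * (x * (m * (\<delta> * \<phi>)))) = p" using p_L unfolding J_def by blast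
    then have "y \<in> L" "y * (p - (x * m) * (\<delta> * \<phi>)) = p"
      using J_L[OF \<open>x * (m * (\<delta> * \<phi>)) \<in> J\<close>] by (simp_all add: p_mult_L mult.assoc)
    from jacobson_L_to_D[OF xm DN[OF d \<phi>] this] show ?thesis by (simp add: mult.assoc)
  qed
  then show ?thesis using NM[OF \<phi> xm] by (simp add: P_def)
qed

lemma N_Mt_P: "\<phi> \<in> N \<Longrightarrow> m \<in> Mt 1 \<Longrightarrow> \<phi> * m \<in> P"
  unfolding Mt_def using N_J_M_P t_one_J by auto

text \<open>The reverse passage: a left inverse of \<open>q - \<phi> a m f\<close> in
  \<open>D\<close> is carried over to \<open>p - a m f \<phi>\<close> in \<open>L\<close>. Together
  with the preceding facts this matches the radicals \<open>J\<close> and \<open>P\<close>.\<close>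

lemma M_P_N_J: "m \<in> M \<Longrightarrow> f \<in> P \<Longrightarrow> \<phi> \<in> N \<Longrightarrow> m * f * \<phi> \<in> J"
proof -
  assume m: "m \<in> M" and f: "f \<in> P" and \<phi>: "\<phi> \<in> N"
  have "\<exists>y\<in>L. y * (p - a * (m * f * \<phi>)) = p" if a: "a \<in> L" for a
  proof -
    have am: "a * m \<in> M" by (rule LM) fact+
    obtain y where "y \<in> D" "y * (q - (\<phi> * (a * m)) * f) = q"
      using f NM[OF \<phi> am] unfolding P_def by blast
    then show ?thesis
      using jacobson_D_to_L[OF MD[OF am P_D[OF f]] \<phi>] by (simp add: mult.assoc)
  qed
  then show ?thesis unfolding J_def using MN[OF MD[OF m P_D[OF f]] \<phi>] by blast
qed

text \<open>Inserting the dual basis behind \<open>f\<close> puts the elements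
  \<open>m f w x\<close> of \<open>J\<close> in front of the \<open>v x\<close>, and
  \<open>J M\<close> lies in \<open>t M\<close>.\<close>

lemma M_P_Mt: "m \<in> M \<Longrightarrow> f \<in> P \<Longrightarrow> m * f \<in> Mt 1"
proof -
  assume m: "m \<in> M" and f: "f \<in> P"
  have "m * f = (\<Sum>x<nv. m * f * w x * v x)" using M_expand MD m P_D f by blast
  also have "\<dots> \<in> Mt 1"
    by (intro additive_sum[OF Mt_add] J_M M_P_N_J m f) (auto simp: w_N v_M)
  finally show ?thesis .
qed

text \<open>The known description of the radical of the endomorphism ring of a finitely generated
  projective module: the maps with image in \<open>J M\<close>. To pass from images to
  \<open>P\<close>, \<open>f\<close> is expanded as the sum of the
  \<open>w x * (v x * f)\<close>.\<close>

lemma P_iff: "f \<in> P \<longleftrightarrow> f \<in> D \<and> (\<forall>m\<in>M. m * f \<in> Mt 1)"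
proof (intro iffI conjI ballI)
  assume *: "f \<in> D \<and> (\<forall>m\<in>M. m * f \<in> Mt 1)"
  then have "f = (\<Sum>x<nv. w x * (v x * f))" using D_expand_left q_mult_D by blast
  also have "\<dots> \<in> P" by (intro P_sum N_Mt_P) (use * in \<open>auto simp: w_N v_M\<close>)
  finally show "f \<in> P" .
qed (auto simp: P_D M_P_Mt)

lemma P_add: "additive P"
  by (rule additiveI)
    (auto simp: P_iff right_diff_distrib additive_closed[OF Mt_add] additive_closed[OF D_add])

lemma PD: "f \<in> P \<Longrightarrow> \<delta> \<in> D \<Longrightarrow> f * \<delta> \<in> P"
  unfolding P_iff using Mt_D by (auto simp: mult.assoc[symmetric] DD)

text \<open>The functionals \<open>w x * a\<close> carry left inverses from \<open>D\<close> back to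
  \<open>L\<close>, so all coordinates \<open>m * w x\<close> lie in \<open>J\<close> and the dual
  basis puts \<open>m\<close> into \<open>t M\<close>. Thus functionals modulo \<open>P\<close>
  separate the points of the top of \<open>M\<close>.\<close>

lemma M_separation: "m \<in> M \<Longrightarrow> (\<And>\<phi>. \<phi> \<in> N \<Longrightarrow> \<phi> * m \<in> P) \<Longrightarrow> m \<in> Mt 1"
proof -
  assume m: "m \<in> M" and sep: "\<And>\<phi>. \<phi> \<in> N \<Longrightarrow> \<phi> * m \<in> P"
  have J: "m * w x \<in> J" if x: "x < nv" for x
  proof -
    have "\<exists>y\<in>L. y * (p - a * (m * w x)) = p" if a: "a \<in> L" for a
    proof -
      obtain y where y: "y \<in> D" "y * (q - q * (w x * a * m)) = q"
        using sep[OF NL[OF w_N[OF x] a]] q_D unfolding P_def by blast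
      then have "y * (q - w x * (a * m)) = q"
        using q_mult_N[OF w_N[OF x]] by (simp add: mult.assoc[symmetric])
      from jacobson_D_to_L[OF LM[OF a m] w_N[OF x] y(1) this] show ?thesis by (simp add: mult.assoc)
    qed
    then show ?thesis unfolding J_def using MN[OF m w_N[OF x]] by blast
  qed
  have "m = (\<Sum>x<nv. m * w x * v x)" by (rule M_expand[OF m])
  also have "\<dots> \<in> Mt 1" by (intro additive_sum[OF Mt_add] J_M J) (auto simp: v_M)
  finally show ?thesis .
qed

section \<open>The filtration by Hom groups\<close>

lemma H_zero: "H 0 = D"
  by (simp add: H_def D_def Mt_zero)

lemma H_Suc: "h \<in> H (j + 1) \<Longrightarrow> h \<in> H j"
  unfolding H_def using Mt_Suc by blast

lemma H_one: "H 1 = P"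
  unfolding P_iff set_eq_iff using H_Suc[of _ 0] by (auto simp: H_zero) (auto simp: H_def D_def)

lemma M_H: "m \<in> M \<Longrightarrow> h \<in> H j \<Longrightarrow> m * h \<in> Mt j"
  by (simp add: H_def)

lemma H_mult: "g \<in> H i \<Longrightarrow> h \<in> H j \<Longrightarrow> g * h \<in> H (i + j)"
proof -
  assume g: "g \<in> H i" and h: "h \<in> H j"
  have "m * (g * h) \<in> Mt (i + j)" if m: "m \<in> M" for m
  proof -
    obtain m' where m': "m' \<in> M" "m * g = t i * m'" using M_H[OF m g] by (auto simp: Mt_def)
    obtain m'' where "m'' \<in> M" "m' * h = t j * m''" using M_H[OF m'(1) h] by (auto simp: Mt_def)
    moreover have "m * (g * h) = t i * (m' * h)" by (simp add: mult.assoc[symmetric] m')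
    ultimately show ?thesis by (auto simp: Mt_def t_plus mult.assoc)
  qed
  then show ?thesis using g h by (auto simp: H_def mult.assoc) (simp add: mult.assoc[symmetric])
qed

lemma N_Mt_H: "\<phi> \<in> N \<Longrightarrow> m \<in> Mt j \<Longrightarrow> \<phi> * m \<in> H j"
proof -
  assume \<phi>: "\<phi> \<in> N" and m: "m \<in> Mt j"
  then obtain m' where m': "m' \<in> M" "m = t j * m'" by (auto simp: Mt_def)
  have "x * (\<phi> * m) \<in> Mt j" if "x \<in> M" for x
    using L_Mt[OF MN[OF that \<phi>] m] by (simp add: mult.assoc)
  moreover have "q * (\<phi> * m) = \<phi> * m" by (simp add: mult.assoc[symmetric] q_mult_N \<phi>)
  moreover have "\<phi> * m * q = \<phi> * m" by (simp add: mult.assoc M_mult_q m')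
  ultimately show ?thesis by (simp add: H_def)
qed

text \<open>For trace ideals \<open>MN\<close> and \<open>t j MN t (- j)\<close> orthogonal modulo \<open>J\<close>, the tops of \<open>M\<close> and \<open>t\<^sup>j M\<close> have no common
  simple constituent, so \<open>H j = H (j + 1)\<close>.\<close>

definition disjoint_at where
  "disjoint_at j \<longleftrightarrow> (\<forall>m\<in>M. \<forall>m'\<in>M. \<forall>\<phi>\<in>N. \<forall>\<phi>'\<in>N. m * \<phi> * (t j * m' * \<phi>' * t (- j)) \<in> J)"

text \<open>Two dual basis expansions, one before \<open>h\<close> and one after it, write
  \<open>m h\<close> as a sum of terms \<open>(m w) (t j m' w' t (- j)) (t j v)\<close>. The product
  of the two trace elements is in \<open>J\<close>, and \<open>J\<close> moves \<open>t j v\<close>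
  from \<open>Mt j\<close> into \<open>Mt (j + 1)\<close>.\<close>

lemma H_step:
  assumes "disjoint_at j" "h \<in> H j"
  shows "h \<in> H (j + 1)"
proof -
  have key: "t j * m' = (\<Sum>y<nv. (t j * m' * w y * t (- j)) * (t j * v y))" if "m' \<in> M" for m'
  proof -
    have "(\<Sum>y<nv. (t j * m' * w y * t (- j)) * (t j * v y)) = (\<Sum>y<nv. t j * (m' * w y * v y))"
      by (rule sum.cong) (auto simp: mult.assoc p_mult_M v_M, metis mult.assoc p_mult_M t_cancel(2) v_M)
    also have "\<dots> = t j * m'" by (simp add: sum_distrib_left[symmetric] M_expand[OF that, symmetric])
    finally show ?thesis ..
  qed
  have "m * h \<in> Mt (j + 1)" if m: "m \<in> M" for m
  proof -
    have "m * w x * (v x * h) \<in> Mt (j + 1)" if x: "x < nv" for x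
    proof -
      obtain m' where m': "m' \<in> M" "v x * h = t j * m'"
        using assms(2) v_M[OF x] by (auto simp: H_def Mt_def)
      have "m * w x * (v x * h) = (\<Sum>y<nv. (m * w x * (t j * m' * w y * t (- j))) * (t j * v y))"
        unfolding m'(2) by (subst key[OF m'(1)]) (simp add: sum_distrib_left mult.assoc)
      also have "\<dots> \<in> Mt (j + 1)"
        using assms(1) by (intro additive_sum[OF Mt_add] J_Mt)
          (auto simp: disjoint_at_def m m' w_N x Mt_def v_M)
      finally show ?thesis .
    qed
    moreover have "m * h = (\<Sum>x<nv. m * w x * (v x * h))"
      by (subst M_expand[OF m]) (simp add: sum_distrib_right mult.assoc)
    ultimately show ?thesis by (auto intro!: additive_sum[OF Mt_add])
  qed
  then show ?thesis using assms(2) by (simp add: H_def)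
qed

end

section \<open>Tops of the modules in a normal tower\<close>

text \<open>\<open>e\<close> is a system of matrix units of \<open>D\<close> modulo its radical, \<open>Max\<close> stands for the set of maximal left
  ideals of \<open>L\<close>, and \<open>rep\<close> represents the isomorphism classes of simple modules. By \<open>escape\<close> some power of
  \<open>t 1\<close> lies in \<open>z L\<close> for an invertible central element \<open>z\<close> of the trace ideal \<open>MN\<close>; hence every simple
  module is the top of some \<open>t\<^sup>k M\<close>.\<close>

locale normal_tower = lattice_tower p q L M nv v w t
  for p q :: "'u::ring" and L M :: "'u set" and nv :: nat and v w :: "nat \<Rightarrow> 'u" and t :: "int \<Rightarrow> 'u" +
  fixes r d ng :: nat and e :: "nat \<Rightarrow> nat \<Rightarrow> 'u" and g :: "nat \<Rightarrow> 'u"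
    and Max :: "'u set set" and rep :: "nat \<Rightarrow> 'u set"
  assumes e_D: "i < r \<Longrightarrow> j < r \<Longrightarrow> e i j \<in> D"
    and e_mult: "i < r \<Longrightarrow> j < r \<Longrightarrow> k < r \<Longrightarrow> l < r \<Longrightarrow>
      e i j * e k l - (if j = k then e i l else 0) \<in> P"
    and e_sum: "q - (\<Sum>i<r. e i i) \<in> P"
    and e_simple: "a \<in> D \<Longrightarrow> i < r \<Longrightarrow> a * e i i \<notin> P \<Longrightarrow> \<exists>\<delta>\<in>D. \<delta> * (a * e i i) - e i i \<in> P"
    and q_P: "q \<notin> P"
    and g_M: "k < ng \<Longrightarrow> g k \<in> M"
    and g_gen: "m \<in> M \<Longrightarrow> \<exists>\<delta>. (\<forall>x<ng. \<delta> x \<in> D) \<and> m = (\<Sum>x<ng. g x * \<delta> x)"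
    and Max_add: "I \<in> Max \<Longrightarrow> additive I"
    and Max_left: "I \<in> Max \<Longrightarrow> a \<in> L \<Longrightarrow> x \<in> I \<Longrightarrow> a * x \<in> I"
    and p_Max: "I \<in> Max \<Longrightarrow> p \<notin> I"
    and Max_maximal: "I \<in> Max \<Longrightarrow> x \<in> L \<Longrightarrow> x \<notin> I \<Longrightarrow> \<exists>c\<in>L. p - c * x \<in> I"
    and Max_L: "I \<in> Max \<Longrightarrow> I \<subseteq> L"
    and J_Max: "I \<in> Max \<Longrightarrow> J \<subseteq> I"
    and Max_J: "x \<in> L \<Longrightarrow> x \<notin> J \<Longrightarrow> \<exists>I\<in>Max. x \<notin> I"
    and rep_Max: "i < d \<Longrightarrow> rep i \<in> Max"
    and rep_inj: "i < d \<Longrightarrow> j < d \<Longrightarrow> i \<noteq> j \<Longrightarrow> a \<in> L \<Longrightarrow> (\<And>x. x \<in> rep i \<Longrightarrow> x * a \<in> rep j) \<Longrightarrow> a \<in> rep j"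
    and rep_surj: "I \<in> Max \<Longrightarrow> \<exists>i<d. \<exists>a\<in>L. a \<notin> rep i \<and> (\<forall>x\<in>I. x * a \<in> rep i)"
    and escape: "\<exists>z z' l k nz mz \<phi>z. z' * z = p \<and> (\<forall>a\<in>L. a * z = z * a) \<and> l \<in> L \<and>
      t (int k) = z * l \<and> z = (\<Sum>x<nz. mz x * \<phi>z x) \<and> (\<forall>x<(nz::nat). mz x \<in> M \<and> \<phi>z x \<in> N)"
begin

lemma r_pos: "0 < r"
  using e_sum q_P by (cases r) auto

text \<open>Replacing \<open>e i i\<close> by \<open>e i 0 * e 0 i\<close> reduces questions on all
  of \<open>M\<close> to the column \<open>M * e 0 0\<close>, whose image in the top of
  \<open>M\<close> is one simple module.\<close>

lemma q_decomp: "q - (\<Sum>i<r. e i 0 * e 0 i) \<in> P"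
proof -
  have "q - (\<Sum>i<r. e i 0 * e 0 i) = (q - (\<Sum>i<r. e i i)) - (\<Sum>i<r. e i 0 * e 0 i - e i i)"
    by (simp add: sum_subtractf)
  also have "\<dots> \<in> P"
    using e_mult[of _ 0 0] r_pos by (intro additive_diff[OF P_add e_sum] additive_sum[OF P_add]) auto
  finally show ?thesis .
qed

lemma M_not_Mt: "\<exists>m\<in>M. m \<notin> Mt 1"
  using q_P q_D by (auto simp: P_iff M_mult_q)

text \<open>A Gram-Schmidt process lifts a basis of \<open>(M/t M) e 0 0\<close> over the division ring \<open>e 0 0 (D/P) e 0 0\<close>,
  together with the dual basis.\<close>

definition orthonormal :: "nat \<Rightarrow> (nat \<Rightarrow> 'u) \<Rightarrow> (nat \<Rightarrow> 'u) \<Rightarrow> bool" where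
  "orthonormal n u \<psi> \<longleftrightarrow> (\<forall>i<n. u i \<in> M \<and> u i * e 0 0 - u i \<in> Mt 1 \<and> \<psi> i \<in> N \<and>
     (\<forall>m\<in>M. e 0 0 * (\<psi> i * m) - \<psi> i * m \<in> P) \<and>
     (\<forall>j<n. \<psi> i * u j - (if i = j then e 0 0 else 0) \<in> P))"

text \<open>\<open>S n u \<psi> y\<close> is what remains of \<open>y\<close> after its components
  along the vectors found so far are subtracted. A remainder outside \<open>Mt 1\<close> becomes the
  next vector, and \<open>M_separation\<close> supplies a functional that does not vanish on it
  modulo \<open>P\<close>.\<close>

lemma gram_schmidt_step:
  assumes on: "orthonormal n u \<psi>"
    and x: "x \<in> M" "x * e 0 0 - x \<in> Mt 1"
  defines "S \<equiv> \<lambda>n u \<psi> y. y - (\<Sum>i<n::nat. u i * (\<psi> i * y))"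
  assumes notin: "S n u \<psi> x \<notin> Mt 1"
  shows "\<exists>x' \<psi>'. orthonormal (Suc n) (u(n := x')) (\<psi>(n := \<psi>')) \<and>
    S (Suc n) (u(n := x')) (\<psi>(n := \<psi>')) x \<in> Mt 1 \<and>
    (\<forall>y\<in>M. S n u \<psi> y \<in> Mt 1 \<longrightarrow> S (Suc n) (u(n := x')) (\<psi>(n := \<psi>')) y \<in> Mt 1)"
proof -
  let ?e = "e 0 0"
  have eD: "?e \<in> D" using e_D r_pos by simp
  have u: "u i \<in> M" "u i * ?e - u i \<in> Mt 1" and \<psi>: "\<psi> i \<in> N" if "i < n" for i
    using on that by (auto simp: orthonormal_def)
  have e\<psi>: "?e * (\<psi> i * m) - \<psi> i * m \<in> P" if "i < n" "m \<in> M" for i m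
    using on that by (auto simp: orthonormal_def)
  have \<psi>u: "\<psi> i * u j - (if i = j then ?e else 0) \<in> P" if "i < n" "j < n" for i j
    using on that by (auto simp: orthonormal_def)
  define x' where "x' = S n u \<psi> x"
  have SM: "S n u \<psi> y \<in> M" if "y \<in> M" for y
    unfolding S_def using that by (auto intro!: additive_closed[OF M_add] MD NM u \<psi>)
  have x'M: "x' \<in> M" using SM x by (simp add: x'_def)
  have x'e: "x' * ?e - x' \<in> Mt 1"
  proof -
    have "x' * ?e - x' = (x * ?e - x) - (\<Sum>i<n. (u i * \<psi> i) * (x * ?e - x))"
      by (simp add: x'_def S_def algebra_simps sum_distrib_right sum_subtractf sum_distrib_left)
    also have "\<dots> \<in> Mt 1"
      by (intro additive_closed[OF Mt_add] x L_Mt MN) (auto simp: u \<psi>)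
    finally show ?thesis .
  qed
  obtain \<phi>0 where \<phi>0: "\<phi>0 \<in> N" "\<phi>0 * x' \<notin> P"
    using M_separation[OF x'M] notin by (auto simp: x'_def)
  \<comment> \<open>Right multiplication by \<open>e 0 0\<close> changes \<open>x'\<close> only by
    an element of \<open>Mt 1\<close>, which every functional sends into \<open>P\<close>.\<close>
  have "\<phi>0 * x' * ?e \<notin> P"
  proof
    assume "\<phi>0 * x' * ?e \<in> P"
    moreover have "\<phi>0 * (x' * ?e - x') \<in> P" by (rule N_Mt_P) fact+
    ultimately have "\<phi>0 * x' * ?e - \<phi>0 * (x' * ?e - x') \<in> P" by (rule additive_diff[OF P_add])
    then show False using \<phi>0 by (simp add: algebra_simps)
  qed
  then obtain \<delta> where \<delta>: "\<delta> \<in> D" "\<delta> * (\<phi>0 * x' * ?e) - ?e \<in> P"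
    using e_simple[OF NM[OF \<phi>0(1) x'M], of 0] r_pos by blast
  \<comment> \<open>The factor \<open>\<delta>\<close> scales the value at \<open>x'\<close> to
    \<open>e 0 0\<close>; the factor \<open>e 0 0\<close> on the left makes the functional invariant
    under left multiplication by \<open>e 0 0\<close> modulo \<open>P\<close>.\<close>
  define \<phi> where "\<phi> = ?e * (\<delta> * \<phi>0)"
  have \<delta>\<phi>0: "\<delta> * \<phi>0 \<in> N" by (intro DN \<delta> \<phi>0)
  have \<phi>N: "\<phi> \<in> N" unfolding \<phi>_def by (intro DN eD \<delta>\<phi>0)
  have ee: "?e * ?e - ?e \<in> P" using e_mult[of 0 0 0 0] r_pos by simp
  have \<phi>x': "\<phi> * x' - ?e \<in> P"
  proof -
    have "\<phi> * x' - ?e = ?e * (\<delta> * (\<phi>0 * x' * ?e) - ?e) + (?e * ?e - ?e) - \<phi> * (x' * ?e - x')"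
      by (simp add: \<phi>_def algebra_simps)
    also have "\<dots> \<in> P"
      by (intro additive_closed[OF P_add] DP eD \<delta> ee N_Mt_P \<phi>N x'e)
    finally show ?thesis .
  qed
  \<comment> \<open>Subtracting the values on the earlier vectors makes \<open>\<psi>'\<close>
    vanish on them modulo \<open>P\<close>. The value at \<open>x'\<close> does not change modulo
    \<open>P\<close>, because the earlier functionals vanish on \<open>x'\<close>.\<close>
  define \<psi>' where "\<psi>' = \<phi> - (\<Sum>i<n. \<phi> * u i * \<psi> i)"
  have \<psi>'N: "\<psi>' \<in> N" unfolding \<psi>'_def
    by (intro additive_closed[OF N_add] \<phi>N DN NM) (auto simp: u \<psi>)
  have \<psi>'_eq: "\<psi>' * y = \<phi> * S n u \<psi> y" for y
    by (simp add: \<psi>'_def S_def algebra_simps sum_distrib_left sum_distrib_right)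
  have \<psi>x': "\<psi> i * x' \<in> P" if i: "i < n" for i
  proof -
    have "(\<Sum>j<n. (if i = j then ?e else 0) * (\<psi> j * x)) = ?e * (\<psi> i * x)"
      using i by (simp add: if_distrib[of "\<lambda>a. a * _"] sum.delta' cong: if_cong)
    then have "\<psi> i * x' = - (\<Sum>j<n. (\<psi> i * u j - (if i = j then ?e else 0)) * (\<psi> j * x))
        - (?e * (\<psi> i * x) - \<psi> i * x)"
      by (simp add: x'_def S_def left_diff_distrib right_diff_distrib sum_subtractf sum_distrib_left mult.assoc)
    also have "\<dots> \<in> P"
      by (intro additive_closed[OF P_add] PD \<psi>u e\<psi> i NM x) (auto simp: \<psi>)
    finally show ?thesis .
  qed
  have \<psi>'u: "\<psi>' * u i \<in> P" if i: "i < n" for i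
  proof -
    have "(\<Sum>j<n. \<phi> * u j * (if j = i then ?e else 0)) = \<phi> * u i * ?e"
      using i by (simp add: if_distrib[of "\<lambda>a. _ * a"] sum.delta cong: if_cong)
    then have "\<psi>' * u i = - (\<Sum>j<n. \<phi> * u j * (\<psi> j * u i - (if j = i then ?e else 0)))
        - \<phi> * (u i * ?e - u i)"
      by (simp add: \<psi>'_def left_diff_distrib right_diff_distrib sum_subtractf sum_distrib_right mult.assoc)
    also have "\<dots> \<in> P"
      by (intro additive_closed[OF P_add] DP \<psi>u NM N_Mt_P \<phi>N u i) auto
    finally show ?thesis .
  qed
  have \<psi>'x': "\<psi>' * x' - ?e \<in> P"
  proof -
    have "\<psi>' * x' - ?e = (\<phi> * x' - ?e) - (\<Sum>i<n. \<phi> * u i * (\<psi> i * x'))"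
      by (simp add: \<psi>'_def algebra_simps sum_distrib_right)
    also have "\<dots> \<in> P"
      by (intro additive_closed[OF P_add] \<phi>x' DP NM \<phi>N \<psi>x') (auto simp: u)
    finally show ?thesis .
  qed
  have e\<psi>': "?e * (\<psi>' * m) - \<psi>' * m \<in> P" if m: "m \<in> M" for m
  proof -
    have "?e * (\<psi>' * m) - \<psi>' * m = (?e * ?e - ?e) * (\<delta> * \<phi>0 * S n u \<psi> m)"
      by (simp add: \<psi>'_eq \<phi>_def algebra_simps)
    also have "\<dots> \<in> P" by (intro PD ee NM \<delta>\<phi>0 SM m)
    finally show ?thesis .
  qed
  \<comment> \<open>Evaluating \<open>\<psi>'\<close> at \<open>y\<close> is evaluating
    \<open>\<phi>\<close> at the old remainder of \<open>y\<close>. So the new remainder is the old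
    one minus \<open>x'\<close> times that value, and a remainder already in \<open>Mt 1\<close>
    stays there.\<close>
  have Sn: "S (Suc n) (u(n := x')) (\<psi>(n := \<psi>')) y = S n u \<psi> y - x' * (\<phi> * S n u \<psi> y)" for y
  proof -
    have "(\<Sum>i<n. (u(n := x')) i * ((\<psi>(n := \<psi>')) i * y)) = (\<Sum>i<n. u i * (\<psi> i * y))"
      by (rule sum.cong) auto
    then have "S (Suc n) (u(n := x')) (\<psi>(n := \<psi>')) y = S n u \<psi> y - x' * (\<psi>' * y)"
      by (simp add: S_def algebra_simps)
    then show ?thesis by (simp only: \<psi>'_eq)
  qed
  have 1: "orthonormal (Suc n) (u(n := x')) (\<psi>(n := \<psi>'))"
    unfolding orthonormal_def less_Suc_eq
    using u \<psi> x'M x'e \<psi>'N e\<psi> e\<psi>' \<psi>u \<psi>x' \<psi>'u \<psi>'x' by auto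
  have 2: "S (Suc n) (u(n := x')) (\<psi>(n := \<psi>')) x \<in> Mt 1"
  proof -
    have "S n u \<psi> x - x' * (\<phi> * S n u \<psi> x) = - (x' * (\<phi> * x' - ?e)) - (x' * ?e - x')"
      by (simp add: x'_def[symmetric] algebra_simps)
    also have "\<dots> \<in> Mt 1"
      by (intro additive_closed[OF Mt_add] M_P_Mt x'M \<phi>x' x'e)
    finally show ?thesis by (simp only: Sn)
  qed
  have 3: "S (Suc n) (u(n := x')) (\<psi>(n := \<psi>')) y \<in> Mt 1" if "y \<in> M" "S n u \<psi> y \<in> Mt 1" for y
    unfolding Sn by (intro additive_closed[OF Mt_add] that M_P_Mt x'M N_Mt_P \<phi>N)
  show ?thesis using 1 2 3 by blast
qed

lemma gram_schmidt:
  assumes "set xs \<subseteq> M" "\<And>x. x \<in> set xs \<Longrightarrow> x * e 0 0 - x \<in> Mt 1"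
  shows "\<exists>n u \<psi>. orthonormal n u \<psi> \<and> (\<forall>x\<in>set xs. x - (\<Sum>i<n. u i * (\<psi> i * x)) \<in> Mt 1)"
  using assms
proof (induction xs)
  case Nil
  then show ?case by (auto intro!: exI[of _ 0] simp: orthonormal_def)
next
  case (Cons x xs)
  have "\<exists>n u \<psi>. orthonormal n u \<psi> \<and> (\<forall>x\<in>set xs. x - (\<Sum>i<n. u i * (\<psi> i * x)) \<in> Mt 1)"
    by (rule Cons.IH) (use Cons.prems in auto)
  then obtain n u \<psi> where on: "orthonormal n u \<psi>"
    and *: "\<forall>y\<in>set xs. y - (\<Sum>i<n. u i * (\<psi> i * y)) \<in> Mt 1"
    by blast
  show ?case
  proof (cases "x - (\<Sum>i<n. u i * (\<psi> i * x)) \<in> Mt 1")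
    case True
    then show ?thesis using on *
      by (intro exI[of _ n] exI[of _ u] exI[of _ \<psi>]) auto
  next
    case False
    have x: "x \<in> M" "x * e 0 0 - x \<in> Mt 1" using Cons.prems by auto
    from gram_schmidt_step[OF on x False] obtain x' \<psi>'
      where new: "orthonormal (Suc n) (u(n := x')) (\<psi>(n := \<psi>'))"
      "x - (\<Sum>i<Suc n. (u(n := x')) i * ((\<psi>(n := \<psi>')) i * x)) \<in> Mt 1"
      "\<forall>y\<in>M. y - (\<Sum>i<n. u i * (\<psi> i * y)) \<in> Mt 1 \<longrightarrow>
         y - (\<Sum>i<Suc n. (u(n := x')) i * ((\<psi>(n := \<psi>')) i * y)) \<in> Mt 1" by blast
    show ?thesis
    proof (intro exI conjI ballI)
      show "orthonormal (Suc n) (u(n := x')) (\<psi>(n := \<psi>'))" by (rule new(1))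
      fix y assume "y \<in> set (x # xs)"
      then consider "y = x" | "y \<in> set xs" "y \<in> M" using Cons.prems by auto
      then show "y - (\<Sum>i<Suc n. (u(n := x')) i * ((\<psi>(n := \<psi>')) i * y)) \<in> Mt 1"
        using new(2,3) * by cases blast+
    qed
  qed
qed

text \<open>The elements \<open>g x * e i 0\<close> generate the column \<open>M * e 0 0\<close>
  modulo \<open>t M\<close>. Once the sum of the \<open>u i * \<psi> i\<close> fixes them modulo
  \<open>t M\<close>, \<open>q_decomp\<close> spreads this over all of \<open>M\<close>: the sum is
  an element of \<open>L\<close> acting as the identity on the top of \<open>M\<close>.\<close>

lemma orthonormal_basis:
  obtains n u \<psi> where "0 < n" "orthonormal n u \<psi>"
    "\<And>m. m \<in> M \<Longrightarrow> m - (\<Sum>i<n. u i * \<psi> i) * m \<in> Mt 1"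
proof -
  define xs where "xs = concat (map (\<lambda>x. map (\<lambda>i. g x * e i 0) [0..<r]) [0..<ng])"
  have xs: "set xs = {g x * e i 0 |x i. x < ng \<and> i < r}"
    by (force simp: xs_def)
  have "\<exists>n u \<psi>. orthonormal n u \<psi> \<and> (\<forall>x\<in>set xs. x - (\<Sum>i<n. u i * (\<psi> i * x)) \<in> Mt 1)"
  proof (rule gram_schmidt)
    show "set xs \<subseteq> M" unfolding xs using r_pos by (auto intro!: MD g_M e_D)
    fix y assume "y \<in> set xs"
    then obtain x i where y: "y = g x * e i 0" "x < ng" "i < r" by (auto simp: xs)
    have "y * e 0 0 - y = g x * (e i 0 * e 0 0 - e i 0)"
      by (simp add: y algebra_simps)
    also have "\<dots> \<in> Mt 1"
      using e_mult[of i 0 0 0] r_pos y by (intro M_P_Mt g_M) auto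
    finally show "y * e 0 0 - y \<in> Mt 1" .
  qed
  then obtain n u \<psi> where on: "orthonormal n u \<psi>"
    and *: "\<And>x. x \<in> set xs \<Longrightarrow> x - (\<Sum>i<n. u i * (\<psi> i * x)) \<in> Mt 1" by blast
  define \<epsilon> where "\<epsilon> = (\<Sum>i<n. u i * \<psi> i)"
  have \<epsilon>: "\<epsilon> * y = (\<Sum>i<n. u i * (\<psi> i * y))" for y
    by (simp add: \<epsilon>_def sum_distrib_right mult.assoc)
  have \<epsilon>L: "\<epsilon> \<in> L" unfolding \<epsilon>_def
    using on by (auto intro!: additive_sum[OF L_add] MN simp: orthonormal_def)
  have xs_ok: "g x * e i 0 - \<epsilon> * (g x * e i 0) \<in> Mt 1" if "x < ng" "i < r" for x i
    using *[of "g x * e i 0"] that unfolding \<epsilon> xs by auto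
  have all: "m - \<epsilon> * m \<in> Mt 1" if m: "m \<in> M" for m
  proof -
    obtain \<delta> where \<delta>: "\<And>x. x < ng \<Longrightarrow> \<delta> x \<in> D" "m = (\<Sum>x<ng. g x * \<delta> x)" using g_gen[OF m] by blast
    have *: "g x * \<delta> x - \<epsilon> * (g x * \<delta> x) \<in> Mt 1" if x: "x < ng" for x
    proof -
      let ?f = "q - (\<Sum>i<r. e i 0 * e 0 i)"
      have gx: "g x = (\<Sum>i<r. g x * e i 0 * e 0 i) + g x * ?f"
        using M_mult_q[OF g_M[OF x]] by (simp add: right_diff_distrib sum_distrib_left mult.assoc)
      let ?G = "(\<Sum>i<r. (g x * e i 0 - \<epsilon> * (g x * e i 0)) * e 0 i) + (g x * ?f - \<epsilon> * (g x * ?f))"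
      have "g x - \<epsilon> * g x = ?G"
        by (subst (1 2) gx) (simp add: distrib_left sum_distrib_left left_diff_distrib sum_subtractf mult.assoc)
      moreover have "?G \<in> Mt 1"
        using r_pos by (intro additive_closed[OF Mt_add] Mt_D L_Mt[OF \<epsilon>L] M_P_Mt q_decomp g_M x xs_ok)
          (auto simp: e_D)
      ultimately have "(g x - \<epsilon> * g x) * \<delta> x \<in> Mt 1" using Mt_D \<delta>(1)[OF x] by simp
      then show ?thesis by (simp add: left_diff_distrib mult.assoc)
    qed
    have "m - \<epsilon> * m = (\<Sum>x<ng. g x * \<delta> x - \<epsilon> * (g x * \<delta> x))"
      by (simp add: \<delta>(2) sum_subtractf sum_distrib_left)
    also have "\<dots> \<in> Mt 1" by (intro additive_sum[OF Mt_add] *) simp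
    finally show ?thesis .
  qed
  \<comment> \<open>With no vectors the identity on the top would be 0, that is,
    \<open>M = t M\<close>.\<close>
  have "0 < n"
  proof (rule ccontr)
    assume "\<not> 0 < n"
    then have "\<epsilon> = 0" by (simp add: \<epsilon>_def)
    then show False using all M_not_Mt by auto
  qed
  then show thesis using that on all by (simp add: \<epsilon>_def)
qed

text \<open>A typical element of the trace ideal of \<open>Mt k\<close>; that ideal is the conjugate
  of \<open>M N\<close> by \<open>t k\<close>.\<close>

definition T where "T k m \<phi> = t k * (m * \<phi>) * t (- k)"

text \<open>\<open>I\<close> does not contain the trace ideal of \<open>t\<^sup>k M\<close>: the simple module \<open>L/I\<close> is a quotient of \<open>t\<^sup>k M\<close>. The
  simple modules with this property are all isomorphic, and \<open>cl k\<close> is the index of their class.\<close>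

definition meets where "meets k I \<longleftrightarrow> (\<exists>m\<in>M. \<exists>\<phi>\<in>N. T k m \<phi> \<notin> I)"

lemma T_L: "m \<in> M \<Longrightarrow> \<phi> \<in> N \<Longrightarrow> T k m \<phi> \<in> L"
  unfolding T_def by (intro t_conj MN)

lemma T_J: "m * \<phi> \<in> J \<Longrightarrow> T k m \<phi> \<in> J"
  unfolding T_def by (rule J_conj)

lemma T_left: "a \<in> L \<Longrightarrow> a * T k m \<phi> = T k (t (- k) * a * t k * m) \<phi>"
  unfolding T_def using t_comm_L[of a k] by (simp add: mult.assoc[symmetric])

lemma conj_left: "a \<in> L \<Longrightarrow> t (- k) * a * t k \<in> L"
  using t_conj[of a "- k"] by simp

lemma T_right: "m \<in> M \<Longrightarrow> \<phi> \<in> N \<Longrightarrow> a \<in> L \<Longrightarrow> T k m \<phi> * a = T k m (\<phi> * (t (- k) * a * t k))"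
proof -
  assume a: "m \<in> M" "\<phi> \<in> N" "a \<in> L"
  have "T k m (\<phi> * (t (- k) * a * t k)) = t k * (m * \<phi>) * t (- k) * a * (t k * t (- k))"
    unfolding T_def by (simp only: mult.assoc)
  also have "\<dots> = T k m \<phi> * a" by (simp add: T_def t_cancel mult.assoc L_mult_p a)
  finally show ?thesis ..
qed

lemma T_diff: "T k (m - m') \<phi> = T k m \<phi> - T k m' \<phi>"
  by (simp add: T_def algebra_simps)

text \<open>The map \<open>m \<mapsto> T k m \<phi>\<close> is nonzero modulo \<open>I\<close>.
  Splitting \<open>q\<close> by \<open>q_decomp\<close> yields an \<open>i\<close> for which
  \<open>e 0 i * \<phi>\<close> still gives a nonzero map, and modulo \<open>I\<close> this map sees
  only the column \<open>m * e 0 0\<close>.\<close>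

lemma meets_normalize:
  assumes I: "I \<in> Max" and "meets k I"
  shows "\<exists>\<phi>\<in>N. (\<exists>m\<in>M. T k m \<phi> \<notin> I) \<and> (\<forall>m\<in>M. T k (m * e 0 0 - m) \<phi> \<in> I)"
proof -
  obtain m \<phi> where m: "m \<in> M" and \<phi>: "\<phi> \<in> N" and notin: "T k m \<phi> \<notin> I" using assms by (auto simp: meets_def)
  have "\<exists>i<r. T k (m * e i 0) (e 0 i * \<phi>) \<notin> I"
  proof (rule ccontr)
    assume "\<not> ?thesis"
    then have *: "\<And>i. i < r \<Longrightarrow> T k (m * e i 0) (e 0 i * \<phi>) \<in> I" by blast
    let ?f = "q - (\<Sum>i<r. e i 0 * e 0 i)"
    have "m * \<phi> = m * ?f * \<phi> + (\<Sum>i<r. m * e i 0 * (e 0 i * \<phi>))"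
      by (simp add: left_diff_distrib right_diff_distrib M_mult_q[OF m] sum_distrib_left sum_distrib_right mult.assoc)
    then have "T k m \<phi> = T k (m * ?f) \<phi> + (\<Sum>i<r. T k (m * e i 0) (e 0 i * \<phi>))"
      unfolding T_def by (simp add: distrib_left distrib_right sum_distrib_left sum_distrib_right)
    also have "\<dots> \<in> I"
      using J_Max[OF I] by (intro additive_closed[OF Max_add[OF I]] * subsetD[OF J_Max[OF I]] T_J M_P_N_J m \<phi> q_decomp) auto
    finally show False using notin by simp
  qed
  then obtain i where i: "i < r" "T k (m * e i 0) (e 0 i * \<phi>) \<notin> I" by blast
  have "T k (m' * e 0 0 - m') (e 0 i * \<phi>) \<in> I" if m': "m' \<in> M" for m'
  proof -
    have "(m' * e 0 0 - m') * (e 0 i * \<phi>) = m' * (e 0 0 * e 0 i - e 0 i) * \<phi>"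
      by (simp add: algebra_simps)
    also have "\<dots> \<in> J" using e_mult[of 0 0 0 i] r_pos i by (intro M_P_N_J m' \<phi>) auto
    finally show ?thesis using T_J J_Max[OF I] by blast
  qed
  then show ?thesis using i e_D r_pos m \<phi>
    by (intro bexI[of _ "e 0 i * \<phi>"] conjI bexI[of _ "m * e i 0"]) (auto intro: MD DN)
qed

text \<open>A normalized functional induces a nonzero map on the simple module
  \<open>M * e 0 0\<close> modulo \<open>t M\<close>, which is therefore injective. So the kernel
  depends neither on \<open>I\<close> nor on \<open>\<phi>\<close>, and this makes two such ideals
  comparable.\<close>

lemma meets_kernel:
  assumes I: "I \<in> Max" and \<phi>: "\<phi> \<in> N" and nz: "m0 \<in> M" "T k m0 \<phi> \<notin> I"
    and norm: "\<And>m. m \<in> M \<Longrightarrow> T k (m * e 0 0 - m) \<phi> \<in> I" and m: "m \<in> M"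
  shows "T k m \<phi> \<in> I \<longleftrightarrow> m * e 0 0 \<in> Mt 1"
proof -
  note I_add = additive_closed[OF Max_add[OF I]]
  have eD: "e 0 0 \<in> D" using e_D r_pos by simp
  have shift: "T k (m * e 0 0) \<phi> \<in> I \<longleftrightarrow> T k m \<phi> \<in> I" if "m \<in> M" for m
    using I_add(2)[OF _ norm[OF that], of "T k (m * e 0 0) \<phi>"]
      I_add(4)[OF _ norm[OF that], of "T k m \<phi>"]
    by (auto simp: T_diff)
  have MtI: "T k m \<phi> \<in> I" if m1: "m \<in> Mt 1" for m
  proof -
    obtain m' where m': "m' \<in> M" "m = t 1 * m'" using m1 by (auto simp: Mt_def)
    have "m * \<phi> \<in> J" using JL[OF t_one_J MN[OF m'(1) \<phi>]] by (simp add: m' mult.assoc)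
    then show ?thesis using T_J J_Max[OF I] by blast
  qed
  show ?thesis
  proof
    assume "m * e 0 0 \<in> Mt 1"
    then show "T k m \<phi> \<in> I" using MtI shift[OF m] by blast
  next
    assume Tm: "T k m \<phi> \<in> I"
    show "m * e 0 0 \<in> Mt 1"
    proof (rule ccontr)
      assume "m * e 0 0 \<notin> Mt 1"
      then obtain \<psi> where \<psi>: "\<psi> \<in> N" "\<psi> * (m * e 0 0) \<notin> P"
        using M_separation[OF MD[OF m eD]] by blast
      obtain \<delta> where \<delta>: "\<delta> \<in> D" "\<delta> * (\<psi> * m * e 0 0) - e 0 0 \<in> P"
        using e_simple[OF NM[OF \<psi>(1) m], of 0] \<psi>(2) r_pos by (auto simp: mult.assoc)
      \<comment> \<open>Left multiplication by this element of \<open>L\<close> sends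
        \<open>m * e 0 0\<close> to \<open>m0 * e 0 0\<close> modulo \<open>Mt 1\<close>, so
        vanishing at \<open>m\<close> would force vanishing at \<open>m0\<close>.\<close>
      let ?a = "m0 * (\<delta> * \<psi>)"
      have a: "?a \<in> L" by (intro MN DN nz \<delta> \<psi>)
      have "T k (m0 * (\<delta> * (\<psi> * m * e 0 0) - e 0 0)) \<phi> \<in> I"
        by (intro MtI M_P_Mt nz \<delta>)
      moreover have "T k (?a * (m * e 0 0)) \<phi> \<in> I"
      proof -
        have "t (- k) * (t k * ?a * t (- k)) * t k = ?a"
          using conj_inv[OF a, of "- k"] by simp
        then have "T k (?a * (m * e 0 0)) \<phi> = (t k * ?a * t (- k)) * T k (m * e 0 0) \<phi>"
          using T_left[OF t_conj[OF a], of k k "m * e 0 0" \<phi>] by simp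
        then show ?thesis using Max_left[OF I t_conj[OF a]] shift[OF m] Tm by simp
      qed
      ultimately have "T k (m0 * e 0 0) \<phi> \<in> I"
        using I_add(2) by (force simp: T_diff right_diff_distrib mult.assoc)
      then show False using shift[OF nz(1)] nz(2) by blast
    qed
  qed
qed

text \<open>Both \<open>L/I\<close> and \<open>L/I'\<close> are quotients of \<open>Mt k\<close> by
  the same kernel. \<open>m1\<close> is chosen as a preimage of the class of \<open>p\<close> in
  \<open>L/I\<close>, and its image \<open>T k m1 \<phi>'\<close> in \<open>L/I'\<close> is the
  element \<open>a\<close> whose right multiplication induces the isomorphism.\<close>

lemma meets_equivalent:
  assumes I: "I \<in> Max" "meets k I" and I': "I' \<in> Max" "meets k I'"
  shows "\<exists>a\<in>L. a \<notin> I' \<and> (\<forall>x\<in>I. x * a \<in> I')"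
proof -
  obtain \<phi> m0 where \<phi>: "\<phi> \<in> N" "m0 \<in> M" "T k m0 \<phi> \<notin> I" "\<And>m. m \<in> M \<Longrightarrow> T k (m * e 0 0 - m) \<phi> \<in> I"
    using meets_normalize[OF I] by blast
  obtain \<phi>' m0' where \<phi>': "\<phi>' \<in> N" "m0' \<in> M" "T k m0' \<phi>' \<notin> I'" "\<And>m. m \<in> M \<Longrightarrow> T k (m * e 0 0 - m) \<phi>' \<in> I'"
    using meets_normalize[OF I'] by blast
  note ker = meets_kernel[OF I(1) \<phi>] meets_kernel[OF I'(1) \<phi>']
  obtain c where c: "c \<in> L" "p - c * T k m0 \<phi> \<in> I" using Max_maximal[OF I(1) T_L \<phi>(3)] \<phi> by blast
  define m1 where "m1 = t (- k) * c * t k * m0"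
  have m1: "m1 \<in> M" unfolding m1_def by (intro LM conj_left c \<phi>)
  have Tm1: "p - T k m1 \<phi> \<in> I" using c by (simp add: T_left m1_def)
  have "T k m1 \<phi> \<notin> I"
    using additive_add[OF Max_add[OF I(1)] Tm1, of "T k m1 \<phi>"] p_Max[OF I(1)] by auto
  then have "T k m1 \<phi>' \<notin> I'" using ker m1 by blast
  moreover have "x * T k m1 \<phi>' \<in> I'" if x: "x \<in> I" for x
  proof -
    have xL: "x \<in> L" using x Max_L[OF I(1)] by blast
    have xm1: "t (- k) * x * t k * m1 \<in> M" by (intro LM conj_left xL m1)
    have "x - x * (p - T k m1 \<phi>) \<in> I"
      by (intro additive_diff[OF Max_add[OF I(1)]] x Max_left[OF I(1) xL] Tm1)
    then have "T k (t (- k) * x * t k * m1) \<phi> \<in> I"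
      by (simp add: right_diff_distrib L_mult_p xL T_left)
    then show ?thesis using ker xm1 by (simp add: T_left xL)
  qed
  ultimately show ?thesis using T_L[OF m1 \<phi>'(1)] by blast
qed

text \<open>If the trace ideal lay in \<open>I'\<close>, so would \<open>T k m \<phi> * a\<close>,
  since trace ideals are also closed under right multiplication. But \<open>c * T k m \<phi>\<close>
  is congruent to \<open>p\<close> modulo \<open>I\<close>, and \<open>I a \<subseteq> I'\<close>,
  so \<open>a\<close> itself would lie in \<open>I'\<close>.\<close>

lemma meets_transfer:
  assumes I: "I \<in> Max" "meets k I" and I': "I' \<in> Max"
    and a: "a \<in> L" "a \<notin> I'" "\<And>x. x \<in> I \<Longrightarrow> x * a \<in> I'"
  shows "meets k I'"
proof (rule ccontr)
  assume "\<not> meets k I'"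
  then have *: "T k m \<phi> \<in> I'" if "m \<in> M" "\<phi> \<in> N" for m \<phi> using that by (auto simp: meets_def)
  obtain m \<phi> where m: "m \<in> M" "\<phi> \<in> N" "T k m \<phi> \<notin> I" using I by (auto simp: meets_def)
  obtain c where c: "c \<in> L" "p - c * T k m \<phi> \<in> I" using Max_maximal[OF I(1) T_L m(3)] m by blast
  have "T k m \<phi> * a \<in> I'" unfolding T_right[OF m(1,2) a(1)] by (intro * m NL conj_left a)
  then have "(p - c * T k m \<phi>) * a + c * (T k m \<phi> * a) \<in> I'"
    by (intro additive_add[OF Max_add[OF I']] Max_left[OF I' c(1)] a(3)[OF c(2)])
  then show False using a by (simp add: left_diff_distrib p_mult_L mult.assoc)
qed

text \<open>If all \<open>m * \<phi>\<close> were in \<open>J\<close>, the dual basis would give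
  \<open>M = t M\<close>. So the trace ideal is not inside \<open>J\<close>, and neither is a
  conjugate of it by a power of \<open>t\<close>.\<close>

lemma meets_ex: "\<exists>I\<in>Max. meets k I"
proof -
  have "\<exists>m\<in>M. \<exists>\<phi>\<in>N. m * \<phi> \<notin> J"
  proof (rule ccontr)
    assume "\<not> ?thesis"
    then have *: "m * \<phi> \<in> J" if "m \<in> M" "\<phi> \<in> N" for m \<phi> using that by blast
    have "m \<in> Mt 1" if "m \<in> M" for m
      using that by (subst M_expand[OF that]) (auto intro!: additive_sum[OF Mt_add] J_M * w_N v_M)
    then show False using M_not_Mt by blast
  qed
  then obtain m \<phi> where m: "m \<in> M" "\<phi> \<in> N" "m * \<phi> \<notin> J" by blast
  have "T k m \<phi> \<notin> J"
  proof
    assume "T k m \<phi> \<in> J"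
    then have "t (- k) * T k m \<phi> * t k \<in> J" using J_conj[of _ "- k"] by simp
    then show False using conj_inv[OF MN[OF m(1,2)], of "- k"] m(3) by (simp add: T_def)
  qed
  then obtain I where "I \<in> Max" "T k m \<phi> \<notin> I" using Max_J[OF T_L] m by blast
  then show ?thesis using m by (auto simp: meets_def)
qed

section \<open>Isomorphism classes of the shifted tops\<close>

lemma class_unique:
  assumes "i < d" "meets k (rep i)" "j < d" "meets k (rep j)"
  shows "i = j"
  using meets_equivalent[OF rep_Max[OF assms(1)] assms(2) rep_Max[OF assms(3)] assms(4)]
    rep_inj[OF assms(1,3)] by blast

lemma class_ex1: "\<exists>!i. i < d \<and> meets k (rep i)"
proof -
  obtain I where I: "I \<in> Max" "meets k I" using meets_ex by blast
  then obtain i a where i: "i < d" "a \<in> L" "a \<notin> rep i" "\<forall>x\<in>I. x * a \<in> rep i"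
    using rep_surj by blast
  then have "meets k (rep i)" using meets_transfer[OF I rep_Max[OF i(1)] i(2,3)] by blast
  then show ?thesis using i(1) class_unique by blast
qed

definition cl where "cl k = (THE i. i < d \<and> meets k (rep i))"

lemma cl: "cl k < d" "meets k (rep (cl k))"
  using theI'[OF class_ex1, of k] by (simp_all add: cl_def)

lemma cl_unique: "i < d \<Longrightarrow> meets k (rep i) \<Longrightarrow> i = cl k"
  using class_ex1[of k] cl by blast

lemma cl_eqI:
  assumes "I \<in> Max" "meets k I" "meets l I"
  shows "cl k = cl l"
proof -
  obtain i a where "i < d" "a \<in> L" "a \<notin> rep i" "\<forall>x\<in>I. x * a \<in> rep i" using rep_surj[OF assms(1)] by blast
  then have "meets k (rep i)" "meets l (rep i)"
    using meets_transfer[OF assms(1) _ rep_Max] assms by blast+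
  then show ?thesis using cl_unique \<open>i < d\<close> by metis
qed

definition orth where "orth k l \<longleftrightarrow> (\<forall>m\<in>M. \<forall>m'\<in>M. \<forall>\<phi>\<in>N. \<forall>\<phi>'\<in>N. T k m \<phi> * T l m' \<phi>' \<in> J)"

text \<open>This turns equality of classes into a condition on products of trace elements, which
  conjugation by \<open>t j\<close> visibly preserves. For a common class with ideal
  \<open>I\<close>, some multiple of an element of the second trace ideal is congruent to
  \<open>p\<close> modulo \<open>I\<close>, so orthogonality would put the whole first trace ideal
  into \<open>I\<close>. Conversely, a product outside \<open>J\<close> avoids some maximal
  \<open>I\<close>, and then both trace ideals meet that \<open>I\<close>.\<close>

lemma orth_iff: "orth k l \<longleftrightarrow> cl k \<noteq> cl l"
proof
  assume o: "orth k l"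
  show "cl k \<noteq> cl l"
  proof
    assume eq: "cl k = cl l"
    define I where "I = rep (cl k)"
    have I: "I \<in> Max" "meets k I" "meets l I" using cl[of k] cl[of l] eq rep_Max by (auto simp: I_def)
    obtain m \<phi> where m: "m \<in> M" "\<phi> \<in> N" "T l m \<phi> \<notin> I" using I by (auto simp: meets_def)
    obtain c where c: "c \<in> L" "p - c * T l m \<phi> \<in> I" using Max_maximal[OF I(1) T_L m(3)] m by blast
    have "T k m' \<phi>' \<in> I" if "m' \<in> M" "\<phi>' \<in> N" for m' \<phi>'
    proof -
      have "T k m' \<phi>' * c * T l m \<phi> \<in> I"
        using o that c m J_Max[OF I(1)] T_right[OF that c(1)] NL[OF that(2) conj_left[OF c(1)]]
        by (auto simp: orth_def)
      then have "T k m' \<phi>' * (p - c * T l m \<phi>) + T k m' \<phi>' * c * T l m \<phi> \<in> I"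
        by (intro additive_add[OF Max_add[OF I(1)]] Max_left[OF I(1) _ c(2)] T_L that)
      then show ?thesis by (simp add: right_diff_distrib mult.assoc L_mult_p T_L that)
    qed
    then show False using I(2) by (auto simp: meets_def)
  qed
next
  assume neq: "cl k \<noteq> cl l"
  show "orth k l"
  proof (rule ccontr)
    assume "\<not> orth k l"
    then obtain m \<phi> m' \<phi>' where m: "m \<in> M" "\<phi> \<in> N" "m' \<in> M" "\<phi>' \<in> N" "T k m \<phi> * T l m' \<phi>' \<notin> J"
      by (auto simp: orth_def)
    note T = T_L[OF m(1,2), of k] T_L[OF m(3,4), of l]
    obtain I where I: "I \<in> Max" "T k m \<phi> * T l m' \<phi>' \<notin> I" using Max_J[OF L_mult[OF T] m(5)] by blast
    then have "meets l I" using Max_left[OF I(1) T(1)] m by (auto simp: meets_def)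
    moreover have "meets k I"
      using I(2) unfolding T_right[OF m(1,2) T(2)] meets_def
      using m(1) NL[OF m(2) conj_left[OF T(2)]] by blast
    ultimately show False using cl_eqI[OF I(1)] neq by blast
  qed
qed

lemma orth_shift: "orth k l \<Longrightarrow> orth (k + j) (l + j)"
proof -
  assume o: "orth k l"
  have "T (k + j) m \<phi> * T (l + j) m' \<phi>' \<in> J" if "m \<in> M" "m' \<in> M" "\<phi> \<in> N" "\<phi>' \<in> N" for m \<phi> m' \<phi>'
  proof -
    have "t j * T k m \<phi> * t (- j) = T (k + j) m \<phi>" for k m \<phi>
      unfolding T_def conj_conj by (simp add: add.commute)
    then have "T (k + j) m \<phi> * T (l + j) m' \<phi>' = t j * (T k m \<phi> * T l m' \<phi>') * t (- j)"
      using conj_mult[OF T_L T_L, of m \<phi> m' \<phi>' j k l] that by simp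
    also have "\<dots> \<in> J" using o that by (intro J_conj) (auto simp: orth_def)
    finally show ?thesis .
  qed
  then show ?thesis by (auto simp: orth_def)
qed

lemma cl_shift: "cl k = cl l \<Longrightarrow> cl (k + j) = cl (l + j)"
  using orth_shift[of "k + j" "l + j" "- j"] by (auto simp: orth_iff)

lemma T_sum_left:
  "t k * (\<Sum>i<n. u i * \<psi> i) * t (- k) = (\<Sum>i<n. T k (u i) (\<psi> i))"
  by (simp add: T_def sum_distrib_left sum_distrib_right)

text \<open>Suppose all trace elements were in \<open>I\<close>. A product of factors
  \<open>p - E i\<close>, with \<open>E i\<close> the conjugate of \<open>\<epsilon>\<close> by
  \<open>t i\<close>, is congruent to \<open>p\<close> modulo \<open>I\<close> and pushes
  \<open>M\<close> down the filtration as far as desired. \<open>escape\<close> shows that a long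
  enough product lies in \<open>J\<close>, hence in \<open>I\<close>, and then so does
  \<open>p\<close>.\<close>

lemma Max_meets:
  assumes I: "I \<in> Max"
  shows "\<exists>k. meets k I"
proof (rule ccontr)
  assume "\<not> ?thesis"
  then have T_I: "T k m \<phi> \<in> I" if "m \<in> M" "\<phi> \<in> N" for k m \<phi> using that by (auto simp: meets_def)
  note I_add = Max_add[OF I]
  obtain n u \<psi> where on: "orthonormal n u \<psi>"
    and ker: "\<And>m. m \<in> M \<Longrightarrow> m - (\<Sum>i<n. u i * \<psi> i) * m \<in> Mt 1"
    using orthonormal_basis by metis
  define \<epsilon> where "\<epsilon> = (\<Sum>i<n. u i * \<psi> i)"
  have u: "u i \<in> M" and \<psi>: "\<psi> i \<in> N" if "i < n" for i using on that by (auto simp: orthonormal_def)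
  have \<epsilon>L: "\<epsilon> \<in> L" unfolding \<epsilon>_def by (intro additive_sum[OF L_add] MN u \<psi>) auto
  define E where "E k = t k * \<epsilon> * t (- k)" for k
  have EL: "E k \<in> L" for k unfolding E_def by (intro t_conj \<epsilon>L)
  have EI: "E k * a \<in> I" if a: "a \<in> L" for k a
  proof -
    have "E k * a = (\<Sum>i<n. T k (u i) (\<psi> i) * a)"
      by (simp add: E_def \<epsilon>_def T_sum_left sum_distrib_right)
    also have "\<dots> = (\<Sum>i<n. T k (u i) (\<psi> i * (t (- k) * a * t k)))"
      by (intro sum.cong T_right u \<psi> a refl) auto
    also have "\<dots> \<in> I" by (intro additive_sum[OF I_add] T_I u NL \<psi> conj_left a) auto
    finally show ?thesis .
  qed
  define U where "U = rec_nat p (\<lambda>k x. x - E (int k) * x)"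
  have U0: "U 0 = p" and US: "U (Suc k) = U k - E (int k) * U k" for k by (simp_all add: U_def)
  have U: "U k \<in> L \<and> p - U k \<in> I \<and> (\<forall>m\<in>M. U k * m \<in> Mt (int k))" for k
  proof (induction k)
    case 0
    then show ?case by (simp add: U0 p_L additive_zero[OF I_add] p_mult_M Mt_zero)
  next
    case (Suc k)
    \<comment> \<open>\<open>\<epsilon>\<close> is the identity on the top of \<open>M\<close>, so
      \<open>E k\<close> is the identity on the top of \<open>Mt k\<close>, and the factor
      \<open>p - E k\<close> moves \<open>Mt k\<close> into \<open>Mt (k + 1)\<close>.\<close>
    have 1: "U (Suc k) * m \<in> Mt (int (Suc k))" if m: "m \<in> M" for m
    proof -
      obtain m' where m': "m' \<in> M" "U k * m = t (int k) * m'" using Suc m by (auto simp: Mt_def)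
      obtain m'' where m'': "m'' \<in> M" "m' - \<epsilon> * m' = t 1 * m''" using ker[OF m'(1)] by (auto simp: \<epsilon>_def Mt_def)
      have "U (Suc k) * m = U k * m - E (int k) * (U k * m)" by (simp add: US left_diff_distrib mult.assoc)
      also have "\<dots> = t (int k) * m' - t (int k) * \<epsilon> * (t (- int k) * t (int k)) * m'"
        unfolding m' E_def by (simp only: mult.assoc)
      also have "\<dots> = t (int k) * (m' - \<epsilon> * m')" by (simp add: t_cancel right_diff_distrib mult.assoc p_mult_M m')
      also have "\<dots> = t (int k + 1) * m''" by (simp add: m'' t_plus mult.assoc)
      finally show ?thesis using m'' by (simp add: Mt_def add.commute)
    qed
    have "p - U (Suc k) = (p - U k) + E (int k) * U k" by (simp add: US)
    moreover have "(p - U k) + E (int k) * U k \<in> I" using Suc by (intro additive_add[OF I_add] EI) auto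
    ultimately have "p - U (Suc k) \<in> I" by (simp only:)
    moreover have "U (Suc k) \<in> L" using Suc by (simp add: US additive_diff[OF L_add] L_mult EL)
    ultimately show ?case using 1 by blast
  qed
  from escape obtain z z' l k and nz :: nat and mz \<phi>z where zz: "z' * z = p \<and> (\<forall>a\<in>L. a * z = z * a) \<and>
    l \<in> L \<and> t (int k) = z * l \<and> z = (\<Sum>x<nz. mz x * \<phi>z x) \<and> (\<forall>x<nz. mz x \<in> M \<and> \<phi>z x \<in> N)"
    by (elim exE) (rule that)
  have z: "z' * z = p" "\<And>a. a \<in> L \<Longrightarrow> a * z = z * a" "l \<in> L"
    "t (int k) = z * l" "z = (\<Sum>x<nz. mz x * \<phi>z x)" "\<And>x. x < nz \<Longrightarrow> mz x \<in> M" "\<And>x. x < nz \<Longrightarrow> \<phi>z x \<in> N"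
    using zz by blast+
  \<comment> \<open>One factor more than the exponent in \<open>escape\<close>: when
    \<open>z\<close> is cancelled against \<open>t k = z l\<close>, a factor \<open>t 1\<close> is
    left over, and it places the product in \<open>J\<close>.\<close>
  let ?u = "U (Suc k)"
  \<comment> \<open>Because \<open>z\<close> is a sum of trace elements, the inclusion of
    \<open>?u M\<close> in \<open>Mt (k + 1)\<close> becomes a divisibility of \<open>?u z\<close>
    by \<open>t (k + 1)\<close> inside \<open>L\<close>.\<close>
  have "\<exists>a\<in>L. ?u * z = t (int k + 1) * a"
  proof -
    have "\<exists>a\<in>L. ?u * (mz x * \<phi>z x) = t (int k + 1) * a" if x: "x < nz" for x
    proof -
      obtain m where "m \<in> M" "?u * mz x = t (int k + 1) * m"
        using U[of "Suc k"] z(6)[OF x] by (auto simp: Mt_def add.commute)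
      then show ?thesis using MN[OF _ z(7)[OF x]] by (intro bexI[of _ "m * \<phi>z x"]) (auto simp: mult.assoc[symmetric])
    qed
    then obtain a where a: "\<And>x. x < nz \<Longrightarrow> a x \<in> L \<and> ?u * (mz x * \<phi>z x) = t (int k + 1) * a x" by metis
    have "?u * z = (\<Sum>x<nz. t (int k + 1) * a x)"
      unfolding z(5) sum_distrib_left by (rule sum.cong) (use a in auto)
    then show ?thesis using a
      by (intro bexI[of _ "\<Sum>x<nz. a x"]) (auto simp: sum_distrib_left intro!: additive_sum[OF L_add])
  qed
  then obtain a where a: "a \<in> L" "?u * z = t (int k + 1) * a" by blast
  have uL: "?u \<in> L" using U by blast
  have ta: "t 1 * a \<in> J" by (intro JL t_one_J a)
  have "z * ?u = z * (l * (t 1 * a))"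
    using a(2) z(2)[OF uL] by (simp add: t_plus z(4) mult.assoc)
  then have "z' * z * ?u = z' * z * (l * (t 1 * a))" by (simp add: mult.assoc)
  then have "?u = l * (t 1 * a)" using uL L_mult[OF z(3) J_L[OF ta]] by (simp add: z(1) p_mult_L)
  then have "?u \<in> I" using LJ[OF z(3) ta] J_Max[OF I] by auto
  then show False using U[of "Suc k"] additive_add[OF I_add, of "p - ?u" ?u] p_Max[OF I] by simp
qed

lemma cl_surj: "i < d \<Longrightarrow> \<exists>k. cl k = i"
  using Max_meets[OF rep_Max] cl_unique by metis

text \<open>A period \<open>j\<close> of \<open>cl\<close> would leave at most \<open>j\<close>
  classes, but all \<open>d\<close> of them occur.\<close>

lemma cl_inj:
  assumes "0 < j" "j < d"
  shows "cl k \<noteq> cl (k + int j)"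
proof
  assume eq: "cl k = cl (k + int j)"
  have step: "cl (l + int j) = cl l" for l
    using cl_shift[OF eq, of "l - k"] by (simp add: algebra_simps)
  have steps: "cl (l + int c * int j) = cl l" for l c
  proof (induction c)
    case (Suc c)
    then show ?case using step[of "l + int c * int j"] by (simp add: algebra_simps)
  qed simp
  have mod: "cl l = cl (l mod int j)" for l
  proof (cases "l div int j \<ge> 0")
    case True
    then have "l = l mod int j + int (nat (l div int j)) * int j" by simp
    then show ?thesis using steps by metis
  next
    case False
    then have "l mod int j = l + int (nat (- (l div int j))) * int j"
      by (simp add: minus_mult_div_eq_mod[symmetric] algebra_simps)
    then show ?thesis using steps by metis
  qed
  have "{..<d} \<subseteq> cl ` {0..<int j}"
  proof
    fix i assume "i \<in> {..<d}"
    then obtain l where "cl l = i" using cl_surj by blast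
    then show "i \<in> cl ` {0..<int j}" using mod[of l] assms by (intro image_eqI[of _ _ "l mod int j"]) auto
  qed
  then have "card {..<d} \<le> card {0..<int j}"
    by (meson card_image_le card_mono finite_atLeastLessThan_int finite_imageI le_trans)
  then show False using assms by simp
qed

lemma cl_neq: "k \<noteq> l \<Longrightarrow> \<bar>k - l\<bar> < int d \<Longrightarrow> cl k \<noteq> cl l"
proof (induction k l rule: linorder_wlog)
  case (le k l)
  then show ?case using cl_inj[of "nat (l - k)" k] by (simp add: nat_less_iff)
next
  case (sym k l)
  then show ?case by (metis abs_minus_commute)
qed

lemma T_zero: "m \<in> M \<Longrightarrow> \<phi> \<in> N \<Longrightarrow> T 0 m \<phi> = m * \<phi>"
  by (simp add: T_def t_zero p_mult_L L_mult_p MN)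

lemma disjoint_at: "j \<noteq> 0 \<Longrightarrow> \<bar>j\<bar> < int d \<Longrightarrow> disjoint_at j"
proof -
  assume "j \<noteq> 0" "\<bar>j\<bar> < int d"
  then have "orth 0 j" using cl_neq[of 0 j] by (simp add: orth_iff)
  then show ?thesis unfolding disjoint_at_def orth_def
    using T_zero by (metis T_def mult.assoc)
qed

text \<open>No step between \<open>H 1\<close> and \<open>H d\<close> changes anything, since the
  tops of \<open>M\<close> and \<open>Mt j\<close> share no simple constituent for
  \<open>0 < j < d\<close>. In the same way the groups are constant from \<open>1 - d\<close> up to
  0, so in this range the filtration drops only between \<open>H 0\<close> and
  \<open>H 1\<close>.\<close>

lemma H_P: "c < d \<Longrightarrow> H (1 + int c) = P"
proof (induction c)
  case (Suc c)
  then show ?case using H_step[OF disjoint_at, of "1 + int c"] H_Suc[of _ "1 + int c"]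
    by (auto simp: add.commute add.left_commute)
qed (simp add: H_one)

lemma H_D: "c < d \<Longrightarrow> H (- int c) = D"
proof (induction c)
  case (Suc c)
  then show ?case using H_step[OF disjoint_at, of "- int (Suc c)"] H_Suc[of _ "- int (Suc c)"] by auto
qed (simp add: H_zero)

text \<open>The \<open>d\<close> conjugates of \<open>\<epsilon>\<close> are the identities of the
  \<open>d\<close> simple blocks of \<open>L/J\<close>. This is tested at each maximal left ideal
  \<open>I\<close>: exactly one \<open>k < d\<close> has the class of \<open>I\<close>, the
  conjugates for all other indices lie in \<open>I\<close>, and the one for \<open>k\<close> is
  congruent to \<open>p\<close>.\<close>

lemma idempotent_sum:
  assumes \<epsilon>: "\<epsilon> = (\<Sum>i<n. u i * \<psi> i)" and u: "\<And>i. i < n \<Longrightarrow> u i \<in> M" and \<psi>: "\<And>i. i < n \<Longrightarrow> \<psi> i \<in> N"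
    and ker: "\<And>m. m \<in> M \<Longrightarrow> m - \<epsilon> * m \<in> Mt 1"
  shows "p - (\<Sum>k<d. t (- int k) * \<epsilon> * t (int k)) \<in> J"
proof (rule ccontr)
  assume notin: "p - (\<Sum>k<d. t (- int k) * \<epsilon> * t (int k)) \<notin> J"
  define E where "E k = t (- int k) * \<epsilon> * t (int k)" for k
  have \<epsilon>L: "\<epsilon> \<in> L" unfolding \<epsilon> by (intro additive_sum[OF L_add] MN u \<psi>) auto
  have EL: "E k \<in> L" for k unfolding E_def using t_conj[OF \<epsilon>L, of "- int k"] by simp
  have E: "E k = (\<Sum>i<n. T (- int k) (u i) (\<psi> i))" for k
    unfolding E_def \<epsilon> using T_sum_left[of "- int k"] by simp
  have "p - (\<Sum>k<d. E k) \<in> L" by (intro additive_diff[OF L_add] additive_sum[OF L_add] p_L EL)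
  then obtain I where I: "I \<in> Max" "p - (\<Sum>k<d. E k) \<notin> I" using Max_J notin by (auto simp: E_def)
  note I_add = additive_closed[OF Max_add[OF I(1)]]
  obtain l where l: "meets l I" using Max_meets[OF I(1)] by blast
  \<comment> \<open>\<open>d\<close> distinct classes among \<open>d\<close> exhaust them, so the
    class of \<open>I\<close> is reached by a shift with \<open>k < d\<close>.\<close>
  have inj: "inj_on (\<lambda>k. cl (- int k)) {..<d}"
    by (rule inj_onI, rule ccontr) (use cl_neq in force)
  have "(\<lambda>k. cl (- int k)) ` {..<d} = {..<d}"
    by (rule endo_inj_surj[OF _ _ inj]) (auto simp: cl)
  moreover have "cl l \<in> {..<d}" using cl(1) by simp
  ultimately have "cl l \<in> (\<lambda>k. cl (- int k)) ` {..<d}" by simp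
  then obtain k where k: "k < d" "cl (- int k) = cl l" by auto
  have "meets (- int k) (rep (cl l))" using cl(2)[of "- int k"] k by simp
  then have kI: "meets (- int k) I"
    using meets_equivalent[OF rep_Max[OF cl(1)] cl(2) I(1) l]
      meets_transfer[OF rep_Max[OF cl(1)] _ I(1)] by blast
  have E_I: "E k' \<in> I" if "k' < d" "k' \<noteq> k" for k'
  proof -
    have "\<not> meets (- int k') I" using cl_eqI[OF I(1) kI] inj that k by (auto simp: inj_on_def)
    then show ?thesis unfolding E
      by (intro additive_sum[OF Max_add[OF I(1)]]) (auto simp: meets_def u \<psi>)
  qed
  obtain m \<phi> where m: "m \<in> M" "\<phi> \<in> N" "T (- int k) m \<phi> \<notin> I" using kI by (auto simp: meets_def)
  obtain c where c: "c \<in> L" "p - c * T (- int k) m \<phi> \<in> I" using Max_maximal[OF I(1) T_L m(3)] m by blast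
  \<comment> \<open>\<open>T (- int k) m1 \<phi>\<close> is congruent to \<open>p\<close> modulo
    \<open>I\<close>. The factor \<open>p - E k\<close> sends this element into \<open>I\<close>,
    and the congruence transfers that to \<open>p - E k\<close> itself.\<close>
  define m1 where "m1 = t (int k) * c * t (- int k) * m"
  have m1: "m1 \<in> M" unfolding m1_def by (intro LM t_conj c m)
  have cT: "c * T (- int k) m \<phi> = T (- int k) m1 \<phi>" by (simp add: T_left c m1_def)
  have "T (- int k) (m1 - \<epsilon> * m1) \<phi> \<in> I"
  proof -
    obtain m2 where "m2 \<in> M" "m1 - \<epsilon> * m1 = t 1 * m2" using ker[OF m1] by (auto simp: Mt_def)
    then have "(m1 - \<epsilon> * m1) * \<phi> \<in> J" using JL[OF t_one_J MN[OF _ m(2)]] by (simp add: mult.assoc)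
    then show ?thesis using T_J J_Max[OF I(1)] by blast
  qed
  moreover have "(p - E k) * T (- int k) m1 \<phi> = T (- int k) (m1 - \<epsilon> * m1) \<phi>"
  proof -
    have "E k * T (- int k) m1 \<phi> = t (- int k) * \<epsilon> * (t (int k) * t (- int k)) * m1 * \<phi> * t (int k)"
      unfolding E_def T_def by (simp add: mult.assoc)
    then show ?thesis
      by (simp add: left_diff_distrib p_mult_L T_L m1 m T_diff t_cancel p_mult_M mult.assoc) (simp add: T_def mult.assoc)
  qed
  moreover have "(p - E k) * (p - T (- int k) m1 \<phi>) \<in> I"
    using c(2) unfolding cT by (intro Max_left[OF I(1)] additive_diff[OF L_add] p_L EL)
  ultimately have "(p - E k) * (p - T (- int k) m1 \<phi>) + (p - E k) * T (- int k) m1 \<phi> \<in> I"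
    using I_add(4) by simp
  moreover have "(p - E k) * (p - T (- int k) m1 \<phi>) + (p - E k) * T (- int k) m1 \<phi> = p - E k"
    by (simp add: right_diff_distrib L_mult_p additive_diff[OF L_add] p_L EL)
  ultimately have "p - E k \<in> I" by simp
  then have "(p - E k) - (\<Sum>k'\<in>{..<d} - {k}. E k') \<in> I"
    by (rule I_add(2)) (auto intro!: additive_sum[OF Max_add[OF I(1)]] E_I)
  moreover have "(\<Sum>k<d. E k) = E k + (\<Sum>k'\<in>{..<d} - {k}. E k')"
    by (rule sum.remove) (use k in auto)
  ultimately show False using I(2) by (simp add: algebra_simps)
qed

section \<open>Lifting an isomorphism from the tops\<close>

text \<open>The dual of \<open>Mt (- k)\<close>: the power of \<open>t\<close> moves to the other
  side with the opposite sign.\<close>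

definition Nt where "Nt k = (\<lambda>\<phi>. \<phi> * t k) ` N"

lemma Nt_add: "additive (Nt k)"
proof (rule additiveI)
  show "0 \<in> Nt k" unfolding Nt_def
    by (rule image_eqI[of _ _ 0]) (auto simp: additive_zero[OF N_add])
  fix a b assume "a \<in> Nt k" "b \<in> Nt k"
  then show "a - b \<in> Nt k" unfolding Nt_def
    by (auto simp: left_diff_distrib[symmetric] additive_diff[OF N_add])
qed

lemma Nt_L: "\<phi> \<in> Nt k \<Longrightarrow> a \<in> L \<Longrightarrow> \<phi> * a \<in> Nt k"
proof -
  assume "\<phi> \<in> Nt k" and a: "a \<in> L"
  then obtain \<phi>' where \<phi>': "\<phi>' \<in> N" "\<phi> = \<phi>' * t k" by (auto simp: Nt_def)
  have "\<phi> * a = \<phi>' * (t k * a * (t (- k) * t k))" by (simp add: \<phi>' t_cancel L_mult_p a mult.assoc)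
  also have "\<dots> = \<phi>' * (t k * a * t (- k)) * t k" by (simp only: mult.assoc)
  finally show ?thesis using NL[OF \<phi>'(1) t_conj[OF a]] by (auto simp: Nt_def)
qed

lemma Nt_Mt: "\<phi> \<in> Nt k \<Longrightarrow> m \<in> Mt (- l) \<Longrightarrow> \<phi> * m \<in> H (k - l)"
proof -
  assume "\<phi> \<in> Nt k" "m \<in> Mt (- l)"
  then obtain \<phi>' m' where *: "\<phi>' \<in> N" "\<phi> = \<phi>' * t k" "m' \<in> M" "m = t (- l) * m'" by (auto simp: Nt_def Mt_def)
  have "\<phi> * m = \<phi>' * (t (k - l) * m')" using t_plus[of k "- l"] by (simp add: * mult.assoc)
  then show ?thesis using N_Mt_H[OF *(1), of _ "k - l"] * by (auto simp: Mt_def)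
qed

lemma Mt_Nt: "m \<in> Mt (- k) \<Longrightarrow> \<phi> \<in> Nt k \<Longrightarrow> m * \<phi> \<in> L"
proof -
  assume "m \<in> Mt (- k)" "\<phi> \<in> Nt k"
  then obtain \<phi>' m' where *: "\<phi>' \<in> N" "\<phi> = \<phi>' * t k" "m' \<in> M" "m = t (- k) * m'" by (auto simp: Nt_def Mt_def)
  have "m * \<phi> = t (- k) * (m' * \<phi>') * t k" by (simp add: * mult.assoc)
  then show ?thesis using conj_left[OF MN[OF *(3,1)]] by simp
qed

lemma Mt_H: "m \<in> Mt (- k) \<Longrightarrow> h \<in> H (k - l) \<Longrightarrow> m * h \<in> Mt (- l)"
proof -
  assume "m \<in> Mt (- k)" and h: "h \<in> H (k - l)"
  then obtain m' where m': "m' \<in> M" "m = t (- k) * m'" by (auto simp: Mt_def)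
  obtain m'' where "m'' \<in> M" "m' * h = t (k - l) * m''" using M_H[OF m'(1) h] by (auto simp: Mt_def)
  then have "m * h = t (- l) * m''" using t_plus[of "- k" "k - l"] by (simp add: m' mult.assoc)
  then show ?thesis using \<open>m'' \<in> M\<close> by (auto simp: Mt_def)
qed

lemma d_pos: "0 < d"
  using cl(1)[of 0] by simp

text \<open>Maps from \<open>Mt (- k)\<close> to \<open>Mt (- l)\<close> are right multiplications
  by \<open>H (k - l)\<close>. With negative exponents of \<open>t\<close> the radical appears for
  \<open>l < k\<close>, below the diagonal as in \<open>Delta_d\<close>.\<close>

lemma H_index: "k < d \<Longrightarrow> l < d \<Longrightarrow> H (int k - int l) = (if l < k then P else D)"
  using H_P[of "k - l - 1"] H_D[of "l - k"] by (auto simp: of_nat_diff algebra_simps)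

lemma H_index_neq: "k < d \<Longrightarrow> l < d \<Longrightarrow> k \<noteq> l \<Longrightarrow> h \<in> H (int k - int l) \<Longrightarrow> h \<in> H (int k - int l + 1)"
  by (rule H_step[OF disjoint_at]) auto

lemma H_q: "h \<in> H j \<Longrightarrow> q * h = h" "h \<in> H j \<Longrightarrow> h * q = h"
  by (simp_all add: H_def)

text \<open>The top of \<open>M\<close> is \<open>r\<close> copies of a simple module, which occurs \<open>n\<close> times in \<open>L/J\<close>, so the
  semisimple modules match for \<open>b = r / gcd n r\<close> and \<open>c = n / gcd n r\<close>.\<close>

lemma block_matrices:
  "\<exists>b c F0 G0. b dvd r \<and> 0 < c \<and>
    (\<forall>\<beta> \<gamma>. F0 \<beta> \<gamma> \<in> M \<and> G0 \<gamma> \<beta> \<in> N) \<and>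
    (\<forall>\<beta><b. \<forall>\<beta>'<b. mm (c * d) (\<lambda>\<beta> Q. t (- int (Q mod d)) * F0 \<beta> (Q div d))
       (\<lambda>Q \<beta>. G0 (Q div d) \<beta> * t (int (Q mod d))) \<beta> \<beta>' - unit_mat p \<beta> \<beta>' \<in> J) \<and>
    (\<forall>\<gamma><c. \<forall>\<gamma>'<c. mm b G0 F0 \<gamma> \<gamma>' - unit_mat q \<gamma> \<gamma>' \<in> P)"
proof -
  obtain n u \<psi> where n: "0 < n" and on: "orthonormal n u \<psi>"
    and ker: "\<And>m. m \<in> M \<Longrightarrow> m - (\<Sum>i<n. u i * \<psi> i) * m \<in> Mt 1"
    using orthonormal_basis by metis
  define \<epsilon> where "\<epsilon> = (\<Sum>i<n. u i * \<psi> i)"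
  let ?e = "e 0 0"
  have u: "u i \<in> M" "u i * ?e - u i \<in> Mt 1" and \<psi>: "\<psi> i \<in> N" if "i < n" for i
    using on that by (auto simp: orthonormal_def)
  have \<psi>u: "\<psi> i * u j - (if i = j then ?e else 0) \<in> P" if "i < n" "j < n" for i j
    using on that by (auto simp: orthonormal_def)
  define b where "b = r div gcd n r"
  define c where "c = n div gcd n r"
  have b_r: "b dvd r" unfolding b_def by (metis dvd_div_mult_self dvd_triv_left gcd_dvd2)
  have c_pos: "0 < c" unfolding c_def using n by (simp add: div_greater_zero_iff gcd_le1_nat)
  have bn: "b * n = c * r" unfolding b_def c_def
    by (metis div_mult_swap dvd_div_mult gcd_dvd1 gcd_dvd2 mult.commute)
  \<comment> \<open>An index \<open>a < b * n = c * r\<close> numbers the copies of the simple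
    module in two ways: as vector \<open>a mod n\<close> of block \<open>a div n\<close>, and as
    matrix unit \<open>a mod r\<close> of block \<open>a div r\<close>. \<open>U\<close> and
    \<open>U'\<close> follow the first numbering, \<open>Y\<close> and \<open>Y'\<close> the second,
    so the product of \<open>U\<close> and \<open>Y\<close> matches the two tops.\<close>
  define U where "U \<beta> a = (if a div n = \<beta> then u (a mod n) else 0)" for \<beta> a
  define U' where "U' a \<beta> = (if a div n = \<beta> then \<psi> (a mod n) else 0)" for \<beta> a
  define Y where "Y a \<gamma> = (if a div r = \<gamma> then e 0 (a mod r) else 0)" for a \<gamma>
  define Y' where "Y' \<gamma> a = (if a div r = \<gamma> then e (a mod r) 0 else 0)" for a \<gamma>
  have XM: "U \<beta> a \<in> M" and U'N: "U' a \<beta> \<in> N" and YD: "Y a \<gamma> \<in> D" and Y'D: "Y' \<gamma> a \<in> D" for a \<beta> \<gamma>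
    unfolding U_def U'_def Y_def Y'_def using n r_pos
    by (auto simp: u \<psi> e_D additive_zero[OF M_add] additive_zero[OF N_add] additive_zero[OF D_add])
  define F0 where "F0 = mm (b * n) U Y"
  define G0 where "G0 = mm (b * n) Y' U'"
  have F0: "F0 \<beta> \<gamma> \<in> M" for \<beta> \<gamma> unfolding F0_def by (intro mm_closed M_add MD XM YD)
  have G0: "G0 \<gamma> \<beta> \<in> N" for \<beta> \<gamma> unfolding G0_def by (intro mm_closed N_add DN U'N Y'D)
  \<comment> \<open>Modulo \<open>P\<close>, both \<open>Y Y'\<close> and \<open>U' U\<close> are
    \<open>e 0 0\<close> times the identity matrix, so the inner factors cancel in the products of
    \<open>F0\<close> and \<open>G0\<close> below.\<close>
  have YY': "mm c Y Y' a a' - unit_mat ?e a a' \<in> P" if "a < b * n" "a' < b * n" for a a'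
  proof -
    have ac: "a div r < c" using that bn r_pos by (simp add: less_mult_imp_div_less)
    have "mm c Y Y' a a' = (\<Sum>\<gamma><c. if \<gamma> = a div r then (if a' div r = a div r then e 0 (a mod r) * e (a' mod r) 0 else 0) else 0)"
      unfolding mm_def Y_def Y'_def by (rule sum.cong) auto
    also have "\<dots> = (if a' div r = a div r then e 0 (a mod r) * e (a' mod r) 0 else 0)"
      using ac by simp
    finally have eq: "mm c Y Y' a a' = (if a' div r = a div r then e 0 (a mod r) * e (a' mod r) 0 else 0)" .
    have "a = a' \<longleftrightarrow> a' div r = a div r \<and> a mod r = a' mod r" by (metis div_mult_mod_eq)
    then show ?thesis unfolding eq unit_mat_def
      using e_mult[of 0 "a mod r" "a' mod r" 0] r_pos by (auto simp: additive_zero[OF P_add])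
  qed
  have U'U: "mm b U' U a a' - unit_mat ?e a a' \<in> P" if "a < b * n" "a' < b * n" for a a'
  proof -
    have ac: "a div n < b" using that n by (simp add: less_mult_imp_div_less)
    have "mm b U' U a a' = (\<Sum>\<beta><b. if \<beta> = a div n then (if a' div n = a div n then \<psi> (a mod n) * u (a' mod n) else 0) else 0)"
      unfolding mm_def U_def U'_def by (rule sum.cong) auto
    also have "\<dots> = (if a' div n = a div n then \<psi> (a mod n) * u (a' mod n) else 0)"
      using ac by simp
    finally have eq: "mm b U' U a a' = (if a' div n = a div n then \<psi> (a mod n) * u (a' mod n) else 0)" .
    have "a = a' \<longleftrightarrow> a' div n = a div n \<and> a mod n = a' mod n" by (metis div_mult_mod_eq)
    then show ?thesis unfolding eq unit_mat_def
      using \<psi>u[of "a mod n" "a' mod n"] n by (auto simp: additive_zero[OF P_add])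
  qed
  have FG0: "mm c F0 G0 \<beta> \<beta>' - unit_mat \<epsilon> \<beta> \<beta>' \<in> J" if \<beta>: "\<beta> < b" "\<beta>' < b" for \<beta> \<beta>'
  proof -
    let ?Z = "\<lambda>a a'. mm c Y Y' a a' - unit_mat ?e a a'"
    have "mm c F0 G0 \<beta> \<beta>' = mm (b * n) U (mm (b * n) (mm c Y Y') U') \<beta> \<beta>'"
      unfolding F0_def G0_def mm_assoc by (rule mm_cong_right) (simp add: mm_assoc)
    also have "\<dots> = mm (b * n) U (mm (b * n) ?Z U') \<beta> \<beta>' + mm (b * n) U (mm (b * n) (unit_mat ?e) U') \<beta> \<beta>'"
      by (simp add: mm_def algebra_simps sum.distrib[symmetric] sum_subtractf)
    also have "mm (b * n) U (mm (b * n) (unit_mat ?e) U') \<beta> \<beta>' = (\<Sum>a<b * n. U \<beta> a * (?e * U' a \<beta>'))"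
      unfolding mm_def[of _ U] by (rule sum.cong) (auto simp: mm_unit_left)
    also have "\<dots> = (\<Sum>a<b * n. (\<lambda>i j. if i = \<beta> \<and> \<beta> = \<beta>' then u j * (?e * \<psi> j) else 0) (a div n) (a mod n))"
      by (rule sum.cong) (auto simp: U_def U'_def)
    also have "\<dots> = (\<Sum>i<b. \<Sum>j<n. if i = \<beta> \<and> \<beta> = \<beta>' then u j * (?e * \<psi> j) else 0)"
      by (rule sum_div_mod[OF n])
    also have "\<dots> = (\<Sum>i<b. if i = \<beta> then (if \<beta> = \<beta>' then \<Sum>j<n. u j * (?e * \<psi> j) else 0) else 0)"
      by (rule sum.cong) auto
    also have "\<dots> = (if \<beta> = \<beta>' then \<Sum>j<n. u j * (?e * \<psi> j) else 0)" using \<beta> by simp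
    finally have eq: "mm c F0 G0 \<beta> \<beta>' - unit_mat \<epsilon> \<beta> \<beta>' = mm (b * n) U (mm (b * n) ?Z U') \<beta> \<beta>' +
        (if \<beta> = \<beta>' then \<Sum>j<n. (u j * ?e - u j) * \<psi> j else 0)"
      by (simp add: unit_mat_def \<epsilon>_def left_diff_distrib sum_subtractf mult.assoc)
    have 1: "mm (b * n) U (mm (b * n) ?Z U') \<beta> \<beta>' \<in> J"
      unfolding mm_def[of _ U] mm_def[of _ ?Z] sum_distrib_left mult.assoc[symmetric]
      by (intro additive_sum[OF J_add] M_P_N_J XM U'N YY') auto
    have 2: "(u j * ?e - u j) * \<psi> j \<in> J" if j: "j < n" for j
    proof -
      obtain m where "m \<in> M" "u j * ?e - u j = t 1 * m" using u(2)[OF j] by (auto simp: Mt_def)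
      then show ?thesis using JL[OF t_one_J MN[OF _ \<psi>[OF j]]] by (simp add: mult.assoc)
    qed
    show ?thesis unfolding eq using 2
      by (intro additive_add[OF J_add] 1) (auto intro!: additive_sum[OF J_add] simp: additive_zero[OF J_add])
  qed
  have GF0: "mm b G0 F0 \<gamma> \<gamma>' - unit_mat q \<gamma> \<gamma>' \<in> P" if \<gamma>: "\<gamma> < c" "\<gamma>' < c" for \<gamma> \<gamma>'
  proof -
    let ?Z = "\<lambda>a a'. mm b U' U a a' - unit_mat ?e a a'"
    have "mm b G0 F0 \<gamma> \<gamma>' = mm (b * n) Y' (mm (b * n) (mm b U' U) Y) \<gamma> \<gamma>'"
      unfolding F0_def G0_def mm_assoc by (rule mm_cong_right) (simp add: mm_assoc)
    also have "\<dots> = mm (b * n) Y' (mm (b * n) ?Z Y) \<gamma> \<gamma>' + mm (b * n) Y' (mm (b * n) (unit_mat ?e) Y) \<gamma> \<gamma>'"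
      by (simp add: mm_def algebra_simps sum.distrib[symmetric] sum_subtractf)
    also have "mm (b * n) Y' (mm (b * n) (unit_mat ?e) Y) \<gamma> \<gamma>' = (\<Sum>a<b * n. Y' \<gamma> a * (?e * Y a \<gamma>'))"
      unfolding mm_def[of _ Y'] by (rule sum.cong) (auto simp: mm_unit_left)
    also have "\<dots> = (\<Sum>a<c * r. (\<lambda>i j. if i = \<gamma> \<and> \<gamma> = \<gamma>' then e j 0 * (?e * e 0 j) else 0) (a div r) (a mod r))"
      unfolding bn by (rule sum.cong) (auto simp: Y_def Y'_def)
    also have "\<dots> = (\<Sum>i<c. \<Sum>j<r. if i = \<gamma> \<and> \<gamma> = \<gamma>' then e j 0 * (?e * e 0 j) else 0)"
      by (rule sum_div_mod[OF r_pos])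
    also have "\<dots> = (\<Sum>i<c. if i = \<gamma> then (if \<gamma> = \<gamma>' then \<Sum>j<r. e j 0 * (?e * e 0 j) else 0) else 0)"
      by (rule sum.cong) auto
    also have "\<dots> = (if \<gamma> = \<gamma>' then \<Sum>j<r. e j 0 * (?e * e 0 j) else 0)" using \<gamma> by simp
    finally have eq: "mm b G0 F0 \<gamma> \<gamma>' - unit_mat q \<gamma> \<gamma>' = mm (b * n) Y' (mm (b * n) ?Z Y) \<gamma> \<gamma>' +
        (if \<gamma> = \<gamma>' then (\<Sum>j<r. e j 0 * (?e * e 0 j - e 0 j)) - (q - (\<Sum>j<r. e j 0 * e 0 j)) else 0)"
      by (simp add: unit_mat_def right_diff_distrib sum_subtractf)
    have 1: "mm (b * n) Y' (mm (b * n) ?Z Y) \<gamma> \<gamma>' \<in> P"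
      unfolding mm_def[of _ Y'] mm_def[of _ ?Z] sum_distrib_left
      by (intro additive_sum[OF P_add] DP PD YD Y'D U'U) auto
    have 2: "e j 0 * (?e * e 0 j - e 0 j) \<in> P" if "j < r" for j
      using that e_mult[of 0 0 0 j] r_pos by (intro DP e_D) auto
    show ?thesis unfolding eq using 2 q_decomp
      by (intro additive_add[OF P_add] 1)
        (auto intro!: additive_diff[OF P_add] additive_sum[OF P_add] simp: additive_zero[OF P_add])
  qed
  \<comment> \<open>\<open>FG0\<close> yields \<open>\<epsilon>\<close>, the identity of a single
    block of \<open>L/J\<close>. The remaining factors conjugate it by \<open>d\<close> powers of
    \<open>t\<close>, and \<open>idempotent_sum\<close> adds the results up to
    \<open>p\<close>.\<close>
  have FG: "mm (c * d) (\<lambda>\<beta> Q. t (- int (Q mod d)) * F0 \<beta> (Q div d))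
       (\<lambda>Q \<beta>. G0 (Q div d) \<beta> * t (int (Q mod d))) \<beta> \<beta>' - unit_mat p \<beta> \<beta>' \<in> J"
    if \<beta>: "\<beta> < b" "\<beta>' < b" for \<beta> \<beta>'
  proof -
    have "mm (c * d) (\<lambda>\<beta> Q. t (- int (Q mod d)) * F0 \<beta> (Q div d))
       (\<lambda>Q \<beta>. G0 (Q div d) \<beta> * t (int (Q mod d))) \<beta> \<beta>' =
       (\<Sum>Q<c * d. (\<lambda>\<gamma> k. t (- int k) * (F0 \<beta> \<gamma> * G0 \<gamma> \<beta>') * t (int k)) (Q div d) (Q mod d))"
      by (simp add: mm_def mult.assoc)
    also have "\<dots> = (\<Sum>\<gamma><c. \<Sum>k<d. t (- int k) * (F0 \<beta> \<gamma> * G0 \<gamma> \<beta>') * t (int k))"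
      by (rule sum_div_mod[OF d_pos])
    also have "\<dots> = (\<Sum>k<d. \<Sum>\<gamma><c. t (- int k) * (F0 \<beta> \<gamma> * G0 \<gamma> \<beta>') * t (int k))"
      by (rule sum.swap)
    also have "\<dots> = (\<Sum>k<d. t (- int k) * mm c F0 G0 \<beta> \<beta>' * t (int k))"
      by (simp add: mm_def sum_distrib_left sum_distrib_right)
    also have "\<dots> = (\<Sum>k<d. t (- int k) * (mm c F0 G0 \<beta> \<beta>' - unit_mat \<epsilon> \<beta> \<beta>') * t (int k))
        + (\<Sum>k<d. t (- int k) * unit_mat \<epsilon> \<beta> \<beta>' * t (int k))"
      by (simp add: sum.distrib[symmetric] algebra_simps)
    finally have eq: "mm (c * d) (\<lambda>\<beta> Q. t (- int (Q mod d)) * F0 \<beta> (Q div d))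
       (\<lambda>Q \<beta>. G0 (Q div d) \<beta> * t (int (Q mod d))) \<beta> \<beta>' - unit_mat p \<beta> \<beta>' =
       (\<Sum>k<d. t (- int k) * (mm c F0 G0 \<beta> \<beta>' - unit_mat \<epsilon> \<beta> \<beta>') * t (int k))
        - (if \<beta> = \<beta>' then p - (\<Sum>k<d. t (- int k) * \<epsilon> * t (int k)) else 0)"
      by (simp add: unit_mat_def)
    have "t (- int k) * (mm c F0 G0 \<beta> \<beta>' - unit_mat \<epsilon> \<beta> \<beta>') * t (int k) \<in> J" for k
      using J_conj[OF FG0[OF \<beta>], of "- int k"] by simp
    then show ?thesis unfolding eq
      using idempotent_sum[OF \<epsilon>_def u(1) \<psi>] ker
      by (auto intro!: additive_diff[OF J_add] additive_sum[OF J_add] simp: additive_zero[OF J_add] \<epsilon>_def)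
  qed
  show ?thesis
    by (rule exI[of _ b], rule exI[of _ c], rule exI[of _ F0], rule exI[of _ G0])
      (use b_r c_pos F0 G0 FG GF0 in simp)
qed

text \<open>The matrices from \<open>block_matrices\<close> are inverse to each other on tops. Hence
  \<open>F G\<close> is invertible over \<open>L\<close>, and correcting \<open>G\<close> by its
  inverse \<open>h\<close> gives \<open>F G2 = 1\<close>. Then \<open>G2 F\<close> is idempotent,
  and the left inverse of \<open>G F\<close> forces it to be the identity.\<close>

theorem inverse_matrices:
  "\<exists>b c F G. b dvd r \<and> 0 < c \<and>
    (\<forall>\<beta><b. \<forall>Q<c * d. F \<beta> Q \<in> Mt (- int (Q mod d)) \<and> G Q \<beta> \<in> Nt (int (Q mod d))) \<and>
    (\<forall>\<beta><b. \<forall>\<beta>'<b. mm (c * d) F G \<beta> \<beta>' = unit_mat p \<beta> \<beta>') \<and>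
    (\<forall>Q<c * d. \<forall>Q'<c * d. mm b G F Q Q' = unit_mat q Q Q')"
proof -
  obtain b c F0 G0 where bc: "b dvd r" "0 < c" and F0: "\<And>\<beta> \<gamma>. F0 \<beta> \<gamma> \<in> M" and G0: "\<And>\<beta> \<gamma>. G0 \<gamma> \<beta> \<in> N"
    and FG0: "\<And>\<beta> \<beta>'. \<beta> < b \<Longrightarrow> \<beta>' < b \<Longrightarrow> mm (c * d) (\<lambda>\<beta> Q. t (- int (Q mod d)) * F0 \<beta> (Q div d))
       (\<lambda>Q \<beta>. G0 (Q div d) \<beta> * t (int (Q mod d))) \<beta> \<beta>' - unit_mat p \<beta> \<beta>' \<in> J"
    and GF0: "\<And>\<gamma> \<gamma>'. \<gamma> < c \<Longrightarrow> \<gamma>' < c \<Longrightarrow> mm b G0 F0 \<gamma> \<gamma>' - unit_mat q \<gamma> \<gamma>' \<in> P"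
    using block_matrices by (elim exE conjE) blast
  define F where "F \<beta> Q = t (- int (Q mod d)) * F0 \<beta> (Q div d)" for \<beta> Q
  define G where "G Q \<beta> = G0 (Q div d) \<beta> * t (int (Q mod d))" for \<beta> Q
  let ?s = "c * d"
  have F: "F \<beta> Q \<in> Mt (- int (Q mod d))" and G: "G Q \<beta> \<in> Nt (int (Q mod d))" for \<beta> Q
    unfolding F_def G_def Mt_def Nt_def using F0 G0 by auto
  have cancel: "(\<lambda>i j. unit_mat a i j - (unit_mat a i j - Z i j)) = Z" for a :: 'u and Z :: "nat \<Rightarrow> nat \<Rightarrow> 'u"
    by simp
  have FG_J: "unit_mat p \<beta> \<beta>' - mm ?s F G \<beta> \<beta>' \<in> J" if "\<beta> < b" "\<beta>' < b" for \<beta> \<beta>'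
    using additive_uminus[OF J_add FG0[OF that]] by (simp add: mm_def F_def G_def)
  have J_diag: "\<exists>y\<in>L. y * (p - x) = p" if "x \<in> J" for x
    using that p_L p_mult_L unfolding J_def by fastforce
  note J_inverse = radical_left_inverse[where C = "\<lambda>_ _. L" and K = "\<lambda>_ _. J" and one = p and s = b]
  have "\<exists>W. (\<forall>i<b. \<forall>j<b. W i j \<in> L) \<and>
    (\<forall>i<b. \<forall>j<b. mm b W (\<lambda>i j. unit_mat p i j - (unit_mat p i j - mm ?s F G i j)) i j = unit_mat p i j)"
    by (rule J_inverse) (use FG_J J_diag in \<open>auto simp: L_add J_add L_mult LJ J_L p_L p_mult_L L_mult_p\<close>)
  then obtain h where h: "\<And>i j. i < b \<Longrightarrow> j < b \<Longrightarrow> h i j \<in> L"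
    "\<And>i j. i < b \<Longrightarrow> j < b \<Longrightarrow> mm b h (mm ?s F G) i j = unit_mat p i j"
    unfolding cancel by blast
  \<comment> \<open>\<open>radical_left_inverse\<close> gives left inverses only. As
    \<open>h\<close> is again congruent to the identity, it has a left inverse \<open>h'\<close> of
    its own; then \<open>h' = F G\<close>, and \<open>h\<close> is a two-sided inverse.\<close>
  have h_J: "unit_mat p i j - h i j \<in> J" if ij: "i < b" "j < b" for i j
  proof -
    have "mm b h (\<lambda>i j. unit_mat p i j - mm ?s F G i j) i j = h i j * p - unit_mat p i j"
      by (subst mm_diff_right) (simp add: mm_unit_right ij h)
    moreover have "mm b h (\<lambda>i j. unit_mat p i j - mm ?s F G i j) i j \<in> J"
      using ij by (intro mm_closed J_add LJ h FG_J) auto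
    ultimately have "- (h i j * p - unit_mat p i j) \<in> J" by (simp only: additive_uminus[OF J_add])
    then show ?thesis using L_mult_p[OF h(1)[OF ij]] by simp
  qed
  have "\<exists>W. (\<forall>i<b. \<forall>j<b. W i j \<in> L) \<and>
    (\<forall>i<b. \<forall>j<b. mm b W (\<lambda>i j. unit_mat p i j - (unit_mat p i j - h i j)) i j = unit_mat p i j)"
    by (rule J_inverse) (use h_J J_diag in \<open>auto simp: L_add J_add L_mult LJ J_L p_L p_mult_L L_mult_p\<close>)
  then obtain h' where h': "\<And>i j. i < b \<Longrightarrow> j < b \<Longrightarrow> h' i j \<in> L"
    "\<And>i j. i < b \<Longrightarrow> j < b \<Longrightarrow> mm b h' h i j = unit_mat p i j"
    unfolding cancel by blast
  have FG_L: "mm ?s F G i j \<in> L" for i j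
    by (intro mm_closed L_add Mt_Nt[OF F G])
  have FG_h': "mm ?s F G i j = h' i j" if ij: "i < b" "j < b" for i j
  proof -
    have "mm ?s F G i j = p * mm ?s F G i j" by (rule p_mult_L[OF FG_L, symmetric])
    also have "\<dots> = mm b (unit_mat p) (mm ?s F G) i j" using ij by (simp add: mm_unit_left)
    also have "\<dots> = mm b (mm b h' h) (mm ?s F G) i j" by (rule mm_cong_left) (simp add: h' ij)
    also have "\<dots> = mm b h' (unit_mat p) i j"
      unfolding mm_assoc by (rule mm_cong_right) (simp add: h ij)
    also have "\<dots> = h' i j" using ij by (simp add: mm_unit_right L_mult_p h')
    finally show ?thesis .
  qed
  define G2 where "G2 = mm b G h"
  have G2: "G2 Q \<beta> \<in> Nt (int (Q mod d))" if "\<beta> < b" for Q \<beta>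
    unfolding G2_def using that by (intro mm_closed Nt_add Nt_L G h) auto
  have FG2: "mm ?s F G2 i j = unit_mat p i j" if ij: "i < b" "j < b" for i j
  proof -
    have "mm ?s F G2 i j = mm b (mm ?s F G) h i j" by (simp add: G2_def mm_assoc)
    also have "\<dots> = mm b h' h i j" by (rule mm_cong_left) (simp add: FG_h' ij)
    finally show ?thesis by (simp add: h' ij)
  qed
  have GF_H: "mm b G F Q Q' \<in> H (int (Q mod d) - int (Q' mod d))" for Q Q'
    by (intro mm_closed H_add Nt_Mt[OF G F])
  have GF_rad: "unit_mat q Q Q' - mm b G F Q Q' \<in> H (int (Q mod d) - int (Q' mod d) + 1)"
    if Q: "Q < ?s" "Q' < ?s" for Q Q'
  proof (cases "Q mod d = Q' mod d")
    case True
    have *: "Q div d < c" "Q' div d < c" using Q d_pos by (simp_all add: less_mult_imp_div_less)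
    have "mm b G F Q Q' = mm b G0 F0 (Q div d) (Q' div d)"
      unfolding mm_def
    proof (rule sum.cong)
      fix x
      have "G Q x * F x Q' = G0 (Q div d) x * (t (int (Q mod d)) * t (- int (Q mod d))) * F0 x (Q' div d)"
        using True by (simp add: G_def F_def mult.assoc)
      also have "\<dots> = G0 (Q div d) x * F0 x (Q' div d)"
        by (simp add: t_cancel N_mult_p G0)
      finally show "G Q x * F x Q' = G0 (Q div d) x * F0 x (Q' div d)" .
    qed simp
    moreover have "unit_mat q Q Q' = unit_mat q (Q div d) (Q' div d)"
      using True unfolding unit_mat_def by (metis div_mult_mod_eq)
    ultimately have "unit_mat q Q Q' - mm b G F Q Q' = - (mm b G0 F0 (Q div d) (Q' div d) - unit_mat q (Q div d) (Q' div d))"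
      by simp
    also have "\<dots> \<in> P" by (intro additive_uminus[OF P_add] GF0 *)
    finally show ?thesis using True by (simp add: H_one)
  next
    case False
    then have "unit_mat q Q Q' = 0" by (auto simp: unit_mat_def)
    \<comment> \<open>Between different shifts \<open>H j\<close> equals \<open>H (j + 1)\<close>,
      so nothing has to be known about the entry beyond its membership in
      \<open>H j\<close>.\<close>
    moreover have "mm b G F Q Q' \<in> H (int (Q mod d) - int (Q' mod d) + 1)"
      using False d_pos by (intro H_index_neq GF_H) auto
    ultimately show ?thesis using additive_uminus[OF H_add] by simp
  qed
  have "\<exists>W. (\<forall>i<?s. \<forall>j<?s. W i j \<in> H (int (i mod d) - int (j mod d))) \<and>
    (\<forall>i<?s. \<forall>j<?s. mm ?s W (\<lambda>i j. unit_mat q i j - (unit_mat q i j - mm b G F i j)) i j = unit_mat q i j)"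
  \<comment> \<open>Here the entries are maps between different shifts: position
    \<open>(i, j)\<close> carries \<open>H (i mod d - j mod d)\<close>, and its radical part is the
    next step of the filtration. On the diagonal these groups are \<open>D\<close> and
    \<open>P\<close>.\<close>
  proof (rule radical_left_inverse[where K = "\<lambda>i j. H (int (i mod d) - int (j mod d) + 1)"])
    fix i j k x y
    show "x * y \<in> H (int (i mod d) - int (k mod d))"
      if "x \<in> H (int (i mod d) - int (j mod d))" "y \<in> H (int (j mod d) - int (k mod d))"
      using H_mult[OF that] by simp
    show "x * y \<in> H (int (i mod d) - int (k mod d) + 1)"
      if "x \<in> H (int (i mod d) - int (j mod d))" "y \<in> H (int (j mod d) - int (k mod d) + 1)"
      using H_mult[OF that] by (simp add: algebra_simps)
    show "H (int (i mod d) - int (j mod d) + 1) \<subseteq> H (int (i mod d) - int (j mod d))"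
      using H_Suc by blast
    show "q \<in> H (int (i mod d) - int (i mod d))" by (simp add: H_zero q_D)
    show "\<exists>y\<in>H (int (i mod d) - int (i mod d)). y * (q - x) = q"
      if "x \<in> H (int (i mod d) - int (i mod d) + 1)"
    proof -
      have "x \<in> P" using that by (simp add: H_one)
      then obtain y where "y \<in> D" "y * (q - q * x) = q" using q_D unfolding P_def by blast
      then show ?thesis using q_mult_D[OF P_D[OF \<open>x \<in> P\<close>]] by (auto simp: H_zero)
    qed
  qed (auto simp: H_add H_q GF_rad)
  then obtain w' where w': "\<And>i j. i < ?s \<Longrightarrow> j < ?s \<Longrightarrow> w' i j \<in> H (int (i mod d) - int (j mod d))"
    "\<And>i j. i < ?s \<Longrightarrow> j < ?s \<Longrightarrow> mm ?s w' (mm b G F) i j = unit_mat q i j"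
    unfolding cancel by blast
  have G2F_H: "mm b G2 F Q Q' \<in> H (int (Q mod d) - int (Q' mod d))" for Q Q'
    by (intro mm_closed H_add Nt_Mt[OF G2 F])
  have G2F: "mm b G2 F i j = unit_mat q i j" if ij: "i < ?s" "j < ?s" for i j
  proof -
    have "mm b G2 F i j = mm ?s (unit_mat q) (mm b G2 F) i j"
      using ij by (simp add: mm_unit_left H_q(1)[OF G2F_H])
    also have "\<dots> = mm ?s (mm ?s w' (mm b G F)) (mm b G2 F) i j"
      by (rule mm_cong_left) (simp add: w' ij)
    also have "\<dots> = mm ?s w' (mm b G (mm b (mm ?s F G2) F)) i j"
      unfolding mm_assoc by (intro mm_cong_right) (simp add: mm_assoc)
    also have "\<dots> = mm ?s w' (mm b G (mm b (unit_mat p) F)) i j"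
      by (intro mm_cong_right mm_cong_left) (simp add: FG2)
    also have "\<dots> = mm ?s w' (mm b G F) i j"
    proof -
      have "p * F \<beta> Q = F \<beta> Q" for \<beta> Q by (simp add: F_def mult.assoc[symmetric] p_mult_t)
      then show ?thesis by (intro mm_cong_right) (simp add: mm_unit_left)
    qed
    also have "\<dots> = unit_mat q i j" by (simp add: w' ij)
    finally show ?thesis .
  qed
  show ?thesis
    by (rule exI[of _ b], rule exI[of _ c], rule exI[of _ F], rule exI[of _ G2])
      (simp add: bc F G2 FG2 G2F)
qed

end

section \<open>Subrings and matrix rings\<close>

lemma restr_simps [simp]:
  "carrier (restr A S) = S" "x \<otimes>\<^bsub>restr A S\<^esub> y = x \<otimes>\<^bsub>A\<^esub> y" "\<one>\<^bsub>restr A S\<^esub> = \<one>\<^bsub>A\<^esub>"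
  "\<zero>\<^bsub>restr A S\<^esub> = \<zero>\<^bsub>A\<^esub>" "x \<oplus>\<^bsub>restr A S\<^esub> y = x \<oplus>\<^bsub>A\<^esub> y"
  by (simp_all add: restr_def)

lemma opp_ring_simps [simp]:
  "carrier (opp_ring A) = carrier A" "x \<otimes>\<^bsub>opp_ring A\<^esub> y = y \<otimes>\<^bsub>A\<^esub> x" "\<one>\<^bsub>opp_ring A\<^esub> = \<one>\<^bsub>A\<^esub>"
  "\<zero>\<^bsub>opp_ring A\<^esub> = \<zero>\<^bsub>A\<^esub>" "x \<oplus>\<^bsub>opp_ring A\<^esub> y = x \<oplus>\<^bsub>A\<^esub> y"
  by (simp_all add: opp_ring_def)

lemma ideal_mod_simps [simp]:
  "carrier (ideal_mod A S) = S" "\<zero>\<^bsub>ideal_mod A S\<^esub> = \<zero>\<^bsub>A\<^esub>"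
  "x \<oplus>\<^bsub>ideal_mod A S\<^esub> y = x \<oplus>\<^bsub>A\<^esub> y" "a \<odot>\<^bsub>ideal_mod A S\<^esub> y = a \<otimes>\<^bsub>A\<^esub> y"
  by (simp_all add: ideal_mod_def)

lemma mat_ring_simps:
  "carrier (mat_ring n A) = mat_carrier n A"
  "i < n \<Longrightarrow> j < n \<Longrightarrow> (U \<otimes>\<^bsub>mat_ring n A\<^esub> V) i j = finsum A (\<lambda>k. U i k \<otimes>\<^bsub>A\<^esub> V k j) {..<n}"
  "i < n \<Longrightarrow> j < n \<Longrightarrow> (U \<oplus>\<^bsub>mat_ring n A\<^esub> V) i j = U i j \<oplus>\<^bsub>A\<^esub> V i j"
  "i < n \<Longrightarrow> j < n \<Longrightarrow> monoid.one (mat_ring n A) i j = (if i = j then \<one>\<^bsub>A\<^esub> else \<zero>\<^bsub>A\<^esub>)"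
  "i < n \<Longrightarrow> j < n \<Longrightarrow> ring.zero (mat_ring n A) i j = \<zero>\<^bsub>A\<^esub>"
  by (simp_all add: mat_ring_def)

lemma mat_carrierD: "U \<in> mat_carrier n A \<Longrightarrow> i < n \<Longrightarrow> j < n \<Longrightarrow> U i j \<in> carrier A"
  by (simp add: mat_carrier_def)

lemma mat_eqI:
  assumes "U \<in> mat_carrier n A" "V \<in> mat_carrier n A" "\<And>i j. i < n \<Longrightarrow> j < n \<Longrightarrow> U i j = V i j"
  shows "U = V"
  using assms unfolding mat_carrier_def by (intro ext) (metis (mono_tags, lifting) mem_Collect_eq)

lemma (in ring) mat_ring_closed:
  "U \<in> mat_carrier n R \<Longrightarrow> V \<in> mat_carrier n R \<Longrightarrow> U \<otimes>\<^bsub>mat_ring n R\<^esub> V \<in> mat_carrier n R"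
  "U \<in> mat_carrier n R \<Longrightarrow> V \<in> mat_carrier n R \<Longrightarrow> U \<oplus>\<^bsub>mat_ring n R\<^esub> V \<in> mat_carrier n R"
  "\<one>\<^bsub>mat_ring n R\<^esub> \<in> mat_carrier n R" "\<zero>\<^bsub>mat_ring n R\<^esub> \<in> mat_carrier n R"
  by (auto simp: mat_carrier_def mat_ring_def intro!: finsum_closed)

context emb_ring
begin

lemmas emb_simps = emb_add emb_mult emb_zero emb_uminus emb_minus

lemma emb_mat_mult:
  assumes "U \<in> mat_carrier n A" "V \<in> mat_carrier n A" "i < n" "j < n"
  shows "\<iota> ((U \<otimes>\<^bsub>mat_ring n A\<^esub> V) i j) = mm n (\<lambda>i j. \<iota> (U i j)) (\<lambda>i j. \<iota> (V i j)) i j"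
  using assms mat_carrierD[of U n A] mat_carrierD[of V n A]
  by (simp add: mat_ring_simps emb_finsum mm_def Pi_def emb_mult)

lemma mat_ring_ring: "ring (mat_ring n A)"
proof (rule ringI)
  let ?M = "mat_ring n A"
  note cl = mat_ring_closed
  show "abelian_group ?M"
  proof (rule abelian_groupI; unfold mat_ring_simps(1))
    fix U V W assume UVW: "U \<in> mat_carrier n A" "V \<in> mat_carrier n A" "W \<in> mat_carrier n A"
    show "U \<oplus>\<^bsub>?M\<^esub> V \<oplus>\<^bsub>?M\<^esub> W = U \<oplus>\<^bsub>?M\<^esub> (V \<oplus>\<^bsub>?M\<^esub> W)"
      using UVW by (intro mat_eqI[of _ n A] cl) (auto simp: mat_ring_simps cl a_assoc mat_carrierD)
  next
    fix U V assume UV: "U \<in> mat_carrier n A" "V \<in> mat_carrier n A"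
    show "U \<oplus>\<^bsub>?M\<^esub> V = V \<oplus>\<^bsub>?M\<^esub> U"
      using UV by (intro mat_eqI[of _ n A] cl) (auto simp: mat_ring_simps a_comm mat_carrierD)
  next
    fix U assume U: "U \<in> mat_carrier n A"
    show "\<zero>\<^bsub>?M\<^esub> \<oplus>\<^bsub>?M\<^esub> U = U"
      using U by (intro mat_eqI[of _ n A] cl) (auto simp: mat_ring_simps mat_carrierD)
    show "\<exists>V\<in>mat_carrier n A. V \<oplus>\<^bsub>?M\<^esub> U = \<zero>\<^bsub>?M\<^esub>"
    proof
      let ?V = "\<lambda>i j. if i < n \<and> j < n then \<ominus> U i j else undefined"
      show V: "?V \<in> mat_carrier n A" using U by (auto simp: mat_carrier_def)
      show "?V \<oplus>\<^bsub>?M\<^esub> U = \<zero>\<^bsub>?M\<^esub>"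
        using U V by (intro mat_eqI[of _ n A] cl) (auto simp: mat_ring_simps mat_carrierD l_neg)
    qed
  qed (auto simp: cl)
  have emb_eqI: "U = V" if "U \<in> mat_carrier n A" "V \<in> mat_carrier n A"
    "\<And>i j. i < n \<Longrightarrow> j < n \<Longrightarrow> \<iota> (U i j) = \<iota> (V i j)" for U V
    using that by (intro mat_eqI) (auto simp: mat_carrierD emb_inj)
  show "monoid ?M"
  proof (rule monoidI; unfold mat_ring_simps(1))
    fix U V W assume UVW: "U \<in> mat_carrier n A" "V \<in> mat_carrier n A" "W \<in> mat_carrier n A"
    show "U \<otimes>\<^bsub>?M\<^esub> V \<otimes>\<^bsub>?M\<^esub> W = U \<otimes>\<^bsub>?M\<^esub> (V \<otimes>\<^bsub>?M\<^esub> W)"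
    proof (rule emb_eqI)
      fix i j assume ij: "i < n" "j < n"
      let ?e = "\<lambda>U i j. \<iota> (U i j)"
      have "\<iota> ((U \<otimes>\<^bsub>?M\<^esub> V \<otimes>\<^bsub>?M\<^esub> W) i j) = mm n (mm n (?e U) (?e V)) (?e W) i j"
        using UVW ij by (simp add: emb_mat_mult cl) (rule mm_cong_left, simp add: emb_mat_mult)
      also have "\<dots> = \<iota> ((U \<otimes>\<^bsub>?M\<^esub> (V \<otimes>\<^bsub>?M\<^esub> W)) i j)"
        using UVW ij by (simp add: emb_mat_mult cl mm_assoc) (rule mm_cong_right, simp add: emb_mat_mult)
      finally show "\<iota> ((U \<otimes>\<^bsub>?M\<^esub> V \<otimes>\<^bsub>?M\<^esub> W) i j) = \<iota> ((U \<otimes>\<^bsub>?M\<^esub> (V \<otimes>\<^bsub>?M\<^esub> W)) i j)" .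
    qed (auto simp: cl UVW)
  next
    fix U assume U: "U \<in> mat_carrier n A"
    have one: "mm n (\<lambda>i j. \<iota> (monoid.one ?M i j)) W i j = mm n (unit_mat (\<iota> \<one>)) W i j" if "i < n" for W i j
      using that by (intro mm_cong_left) (simp add: mat_ring_simps unit_mat_def emb_zero)
    have one': "mm n W (\<lambda>i j. \<iota> (monoid.one ?M i j)) i j = mm n W (unit_mat (\<iota> \<one>)) i j" if "j < n" for W i j
      using that by (intro mm_cong_right) (simp add: mat_ring_simps unit_mat_def emb_zero)
    show "\<one>\<^bsub>?M\<^esub> \<otimes>\<^bsub>?M\<^esub> U = U"
      using U by (intro emb_eqI)
        (auto simp: cl emb_mat_mult one mm_unit_left emb_mult[symmetric] mat_carrierD)
    show "U \<otimes>\<^bsub>?M\<^esub> \<one>\<^bsub>?M\<^esub> = U"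
      using U by (intro emb_eqI)
        (auto simp: cl emb_mat_mult one' mm_unit_right emb_mult[symmetric] mat_carrierD)
  qed (auto simp: cl)
  fix U V W assume "U \<in> carrier ?M" "V \<in> carrier ?M" "W \<in> carrier ?M"
  then have UVW: "U \<in> mat_carrier n A" "V \<in> mat_carrier n A" "W \<in> mat_carrier n A"
    by (simp_all add: mat_ring_simps)
  show "(U \<oplus>\<^bsub>?M\<^esub> V) \<otimes>\<^bsub>?M\<^esub> W = U \<otimes>\<^bsub>?M\<^esub> W \<oplus>\<^bsub>?M\<^esub> V \<otimes>\<^bsub>?M\<^esub> W"
    using UVW by (intro emb_eqI)
      (auto simp: cl emb_mat_mult mat_ring_simps(3) mat_carrierD mat_carrierD[OF cl(1)] emb_add mm_def distrib_right sum.distrib)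
  show "W \<otimes>\<^bsub>?M\<^esub> (U \<oplus>\<^bsub>?M\<^esub> V) = W \<otimes>\<^bsub>?M\<^esub> U \<oplus>\<^bsub>?M\<^esub> W \<otimes>\<^bsub>?M\<^esub> V"
    using UVW by (intro emb_eqI)
      (auto simp: cl emb_mat_mult mat_ring_simps(3) mat_carrierD mat_carrierD[OF cl(1)] emb_add mm_def distrib_left sum.distrib)
qed

text \<open>\<open>A\<close> is one factor of the product of all rings, so its image absorbs
  arbitrary elements. Hence an \<open>h\<close> of the ambient ring with \<open>q h = h\<close>, for
  \<open>q\<close> in the image, comes from an element of \<open>A\<close>.\<close>

lemma emb_ideal: "a \<in> carrier A \<Longrightarrow> \<iota> a * x \<in> \<iota> ` carrier A" "a \<in> carrier A \<Longrightarrow> x * \<iota> a \<in> \<iota> ` carrier A"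
proof -
  assume a: "a \<in> carrier A"
  have rep: "ring S \<Longrightarrow> Rep_all_rings x S \<in> carrier S" "\<not> ring S \<Longrightarrow> Rep_all_rings x S = undefined" for S
    using Rep_all_rings[of x] by (auto split: if_splits)
  have x: "Rep_all_rings x A \<in> carrier A" by (rule rep) (rule ring_axioms)
  have "\<iota> a * x = \<iota> (a \<otimes> Rep_all_rings x A)"
    by (rule Rep_all_rings_inject[THEN iffD1], rule ext)
      (use a x in \<open>auto simp: times_all_rings.rep_eq emb.rep_eq ring.ring_simprules rep\<close>)
  then show "\<iota> a * x \<in> \<iota> ` carrier A" using a x by simp
  have "x * \<iota> a = \<iota> (Rep_all_rings x A \<otimes> a)"
    by (rule Rep_all_rings_inject[THEN iffD1], rule ext)
      (use a x in \<open>auto simp: times_all_rings.rep_eq emb.rep_eq ring.ring_simprules rep\<close>)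
  then show "x * \<iota> a \<in> \<iota> ` carrier A" using a x by simp
qed

end

lemma (in ring) restr_ring:
  assumes "subring S R" shows "ring (restr R S)"
proof -
  note S = subringE[OF assms]
  have S1: "x \<in> S \<Longrightarrow> x \<in> carrier R" for x using S(1) by blast
  show ?thesis
  proof (rule ringI)
    show "abelian_group (restr R S)"
    proof (rule abelian_groupI)
      fix x assume "x \<in> carrier (restr R S)"
      then show "\<exists>y\<in>carrier (restr R S). y \<oplus>\<^bsub>restr R S\<^esub> x = \<zero>\<^bsub>restr R S\<^esub>"
        by (intro bexI[of _ "\<ominus> x"]) (auto simp: S S1 l_neg)
    qed (use S S1 in \<open>simp_all add: a_ac\<close>)
    show "monoid (restr R S)"
      by (rule monoidI) (use S S1 in \<open>simp_all add: m_assoc\<close>)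
  qed (use S S1 in \<open>simp_all add: l_distr r_distr\<close>)
qed

lemma (in ring) restr_uminus:
  assumes S: "subring S R" and y: "y \<in> S"
  shows "\<ominus>\<^bsub>restr R S\<^esub> y = \<ominus> y"
proof -
  interpret RS: ring "restr R S" by (rule restr_ring[OF S])
  have "\<ominus>\<^bsub>restr R S\<^esub> y \<in> S" "\<ominus>\<^bsub>restr R S\<^esub> y \<oplus> y = \<zero>" using RS.a_inv_closed[of y] RS.l_neg[of y] y by simp_all
  then show ?thesis using subringE(1)[OF S] y by (intro minus_equality[symmetric]) auto
qed

lemma (in ring) restr_minus:
  "subring S R \<Longrightarrow> x \<in> S \<Longrightarrow> y \<in> S \<Longrightarrow> x \<ominus>\<^bsub>restr R S\<^esub> y = x \<ominus> y"
  by (simp add: a_minus_def restr_uminus)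

lemma (in ring) restr_finsum:
  assumes S: "subring S R" and "f \<in> I \<rightarrow> S"
  shows "finsum (restr R S) f I = finsum R f I"
  using assms(2)
proof (induction I rule: infinite_finite_induct)
  \<comment> \<open>Over an infinite index set both sums take the default value, the common
    zero.\<close>
  case (infinite I)
  then show ?case by (simp add: finsum_def finprod_def)
next
  case empty
  interpret RS: ring "restr R S" by (rule restr_ring[OF S])
  show ?case by simp
next
  case (insert i I)
  interpret RS: ring "restr R S" by (rule restr_ring[OF S])
  have "f \<in> I \<rightarrow> carrier R" "f i \<in> carrier R" using insert subringE(1)[OF S] by auto
  then show ?case using insert by (simp add: Pi_iff)
qed

section \<open>The Jacobson radical\<close>

context emb_ring
begin

lemma left_idealD:
  assumes "left_ideal I A"
  shows "I \<subseteq> carrier A" "\<zero> \<in> I" "x \<in> I \<Longrightarrow> y \<in> I \<Longrightarrow> x \<oplus> y \<in> I" "x \<in> I \<Longrightarrow> \<ominus> x \<in> I"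
    "x \<in> I \<Longrightarrow> y \<in> I \<Longrightarrow> x \<ominus> y \<in> I" "a \<in> carrier A \<Longrightarrow> x \<in> I \<Longrightarrow> a \<otimes> x \<in> I"
proof -
  interpret additive_subgroup I A using assms by (simp add: left_ideal_def)
  show "I \<subseteq> carrier A" "\<zero> \<in> I" "x \<in> I \<Longrightarrow> y \<in> I \<Longrightarrow> x \<oplus> y \<in> I" "x \<in> I \<Longrightarrow> \<ominus> x \<in> I"
    "x \<in> I \<Longrightarrow> y \<in> I \<Longrightarrow> x \<ominus> y \<in> I"
    by (auto simp: a_minus_def a_Hcarr)
  show "a \<in> carrier A \<Longrightarrow> x \<in> I \<Longrightarrow> a \<otimes> x \<in> I" using assms by (simp add: left_ideal_def)
qed

lemma left_idealI:
  assumes "I \<subseteq> carrier A" "\<zero> \<in> I" "\<And>x y. x \<in> I \<Longrightarrow> y \<in> I \<Longrightarrow> x \<oplus> y \<in> I"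
    and "\<And>a x. a \<in> carrier A \<Longrightarrow> x \<in> I \<Longrightarrow> a \<otimes> x \<in> I"
  shows "left_ideal I A"
proof -
  have "\<ominus> x \<in> I" if "x \<in> I" for x
    using assms(4)[of "\<ominus> \<one>" x] assms(1) that by (auto simp: l_minus)
  then have "subgroup I (add_monoid A)"
    using assms by unfold_locales (auto simp: a_inv_def)
  then show ?thesis using assms by (simp add: left_ideal_def additive_subgroup_def)
qed

lemma emb_eqI: "a \<in> carrier A \<Longrightarrow> b \<in> carrier A \<Longrightarrow> \<iota> a = \<iota> b \<Longrightarrow> a = b"
  by (simp add: emb_inj)

lemma emb_one: "a \<in> carrier A \<Longrightarrow> \<iota> \<one> * \<iota> a = \<iota> a" "a \<in> carrier A \<Longrightarrow> \<iota> a * \<iota> \<one> = \<iota> a"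
  by (simp_all add: emb_mult[symmetric])

lemma emb_one': "a \<in> carrier A \<Longrightarrow> \<iota> \<one> * (\<iota> a * z) = \<iota> a * z"
  by (simp add: mult.assoc[symmetric] emb_one)

lemma left_ideal_insert:
  assumes "left_ideal I A" "x \<in> carrier A"
  shows "left_ideal {i \<oplus> a \<otimes> x | i a. i \<in> I \<and> a \<in> carrier A} A"
    and "I \<subseteq> {i \<oplus> a \<otimes> x | i a. i \<in> I \<and> a \<in> carrier A}"
    and "x \<in> {i \<oplus> a \<otimes> x | i a. i \<in> I \<and> a \<in> carrier A}"
proof -
  let ?K = "{i \<oplus> a \<otimes> x | i a. i \<in> I \<and> a \<in> carrier A}"
  note I = left_idealD[OF assms(1)]
  have Ic: "i \<in> I \<Longrightarrow> i \<in> carrier A" for i using I(1) by blast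
  show "left_ideal ?K A"
  proof (rule left_idealI)
    show "?K \<subseteq> carrier A" using assms(2) by (auto simp: Ic)
    show "\<zero> \<in> ?K" using I(2) assms(2) by (force intro: exI[of _ \<zero>])
    show "u \<oplus> v \<in> ?K" if uv: "u \<in> ?K" "v \<in> ?K" for u v
    proof -
      obtain i a j b where *: "i \<in> I" "a \<in> carrier A" "u = i \<oplus> a \<otimes> x" "j \<in> I" "b \<in> carrier A" "v = j \<oplus> b \<otimes> x"
        using uv by blast
      have "u \<oplus> v = (i \<oplus> j) \<oplus> (a \<oplus> b) \<otimes> x"
        by (rule emb_eqI) (use * assms(2) in \<open>simp_all add: Ic emb_simps algebra_simps\<close>)
      then show ?thesis using * I(3) by blast
    qed
    show "c \<otimes> u \<in> ?K" if c: "c \<in> carrier A" and u: "u \<in> ?K" for c u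
    proof -
      obtain i a where *: "i \<in> I" "a \<in> carrier A" "u = i \<oplus> a \<otimes> x" using u by blast
      have "c \<otimes> u = c \<otimes> i \<oplus> (c \<otimes> a) \<otimes> x"
        by (rule emb_eqI) (use * assms(2) c in \<open>simp_all add: Ic emb_simps algebra_simps\<close>)
      then show ?thesis using * I(6)[OF c] c by blast
    qed
  qed
  show "I \<subseteq> ?K"
  proof
    fix i assume "i \<in> I"
    then have "i = i \<oplus> \<zero> \<otimes> x" using assms(2) by (simp add: Ic)
    then show "i \<in> ?K" using \<open>i \<in> I\<close> by blast
  qed
  have "x = \<zero> \<oplus> \<one> \<otimes> x" using assms(2) by simp
  then show "x \<in> ?K" using I(2) by blast
qed

lemma left_ideal_one: "left_ideal I A \<Longrightarrow> \<one> \<in> I \<longleftrightarrow> I = carrier A"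
  by (metis left_idealD(1,6) one_closed r_one subsetI subset_antisym)

lemma exists_maximal_left_ideal:
  assumes "left_ideal I A" "\<one> \<notin> I"
  shows "\<exists>K. maximal_left_ideal K A \<and> I \<subseteq> K"
proof -
  let ?F = "{K. left_ideal K A \<and> I \<subseteq> K \<and> \<one> \<notin> K}"
  have "\<exists>K\<in>?F. \<forall>K'\<in>?F. K \<subseteq> K' \<longrightarrow> K' = K"
  proof (rule subset_Zorn_nonempty)
    show "?F \<noteq> {}" using assms by blast
    fix C assume C: "C \<noteq> {}" "subset.chain ?F C"
    then have CF: "K \<in> C \<Longrightarrow> left_ideal K A \<and> I \<subseteq> K \<and> \<one> \<notin> K" for K
      by (auto simp: subset.chain_def)
    have "left_ideal (\<Union>C) A"
    proof (rule left_idealI)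
      show "\<Union>C \<subseteq> carrier A" using CF left_idealD(1) by (meson Sup_least)
      obtain K where "K \<in> C" using C(1) by blast
      then show "\<zero> \<in> \<Union>C" using CF[OF \<open>K \<in> C\<close>] left_idealD(2)[of K] by blast
      show "x \<oplus> y \<in> \<Union>C" if xy: "x \<in> \<Union>C" "y \<in> \<Union>C" for x y
      proof -
        obtain K1 K2 where K: "K1 \<in> C" "x \<in> K1" "K2 \<in> C" "y \<in> K2" using xy by blast
        then have "K1 \<subseteq> K2 \<or> K2 \<subseteq> K1" using C(2) by (auto simp: subset.chain_def)
        then obtain K' where "K' \<in> C" "x \<in> K'" "y \<in> K'" using K by blast
        then show ?thesis using left_idealD(3)[of K' x y] CF[OF \<open>K' \<in> C\<close>] by blast
      qed
      show "a \<otimes> x \<in> \<Union>C" if a: "a \<in> carrier A" and x: "x \<in> \<Union>C" for a x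
      proof -
        obtain K' where "K' \<in> C" "x \<in> K'" using x by blast
        then show ?thesis using left_idealD(6)[of K' a x] CF[OF \<open>K' \<in> C\<close>] a by blast
      qed
    qed
    then show "\<Union>C \<in> ?F" using C(1) CF by blast
  qed
  then obtain K where K': "K \<in> ?F" "\<forall>K'\<in>?F. K \<subseteq> K' \<longrightarrow> K' = K" by (rule bexE)
  then have K: "left_ideal K A" "I \<subseteq> K" "\<one> \<notin> K" by simp_all
  have max: "K' = K" if "left_ideal K' A" "\<one> \<notin> K'" "K \<subseteq> K'" for K'
    using K'(2)[rule_format, of K'] that K(2) by simp
  have "maximal_left_ideal K A"
    unfolding maximal_left_ideal_def using K max by (auto simp: left_ideal_one)
  then show ?thesis using K by blast
qed

lemma maximal_left_idealD:
  assumes "maximal_left_ideal I A"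
  shows "left_ideal I A" "\<one> \<notin> I" "x \<in> carrier A \<Longrightarrow> x \<notin> I \<Longrightarrow> \<exists>c\<in>carrier A. \<one> \<ominus> c \<otimes> x \<in> I"
proof -
  show I: "left_ideal I A" and "\<one> \<notin> I"
    using assms by (auto simp: maximal_left_ideal_def left_ideal_one)
  assume x: "x \<in> carrier A" "x \<notin> I"
  note K = left_ideal_insert[OF I x(1)]
  have "\<one> \<in> {i \<oplus> a \<otimes> x | i a. i \<in> I \<and> a \<in> carrier A}"
    using assms K x(2) left_ideal_one[OF K(1)] unfolding maximal_left_ideal_def by blast
  then obtain i a where *: "i \<in> I" "a \<in> carrier A" "\<one> = i \<oplus> a \<otimes> x" by blast
  have ic: "i \<in> carrier A" using left_idealD(1)[OF I] * by blast
  have "\<one> \<ominus> a \<otimes> x = i"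
    by (subst *(3), rule emb_eqI) (use ic * x in \<open>simp_all add: emb_simps\<close>)
  then show "\<exists>c\<in>carrier A. \<one> \<ominus> c \<otimes> x \<in> I" using * by (intro bexI[of _ a]) auto
qed

lemma maximal_left_idealI:
  assumes "left_ideal I A" "\<one> \<notin> I" "\<And>x. x \<in> carrier A \<Longrightarrow> x \<notin> I \<Longrightarrow> \<exists>c\<in>carrier A. \<one> \<ominus> c \<otimes> x \<in> I"
  shows "maximal_left_ideal I A"
proof -
  have "K = I" if K: "left_ideal K A" "I \<subseteq> K" "K \<noteq> carrier A" for K
  proof (rule ccontr)
    assume "K \<noteq> I"
    then obtain x where x: "x \<in> K" "x \<notin> I" using K by blast
    have xc: "x \<in> carrier A" using x left_idealD(1)[OF K(1)] by blast
    then obtain c where c: "c \<in> carrier A" "\<one> \<ominus> c \<otimes> x \<in> I" using assms(3) x by blast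
    have "(\<one> \<ominus> c \<otimes> x) \<oplus> c \<otimes> x \<in> K" using K c x by (intro left_idealD(3,6)[OF K(1)]) auto
    moreover have "(\<one> \<ominus> c \<otimes> x) \<oplus> c \<otimes> x = \<one>"
      by (rule emb_eqI) (use c xc in \<open>simp_all add: emb_simps\<close>)
    ultimately show False using left_ideal_one[OF K(1)] K(3) by simp
  qed
  then show ?thesis using assms left_ideal_one by (auto simp: maximal_left_ideal_def)
qed

text \<open>If \<open>one - a x\<close> had no left inverse, it would lie in a maximal left ideal,
  which contains \<open>x\<close> and hence \<open>one\<close>. In this elementwise form the radical
  passes through \<open>emb\<close> and can be compared across the Morita context.\<close>

lemma jrad_iff:
  "x \<in> jrad A \<longleftrightarrow> x \<in> carrier A \<and> (\<forall>a\<in>carrier A. \<exists>y\<in>carrier A. y \<otimes> (\<one> \<ominus> a \<otimes> x) = \<one>)"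
proof (intro iffI conjI ballI)
  assume x: "x \<in> jrad A"
  show xc: "x \<in> carrier A" using x by (simp add: jrad_def)
  fix a assume a: "a \<in> carrier A"
  define z where "z = \<one> \<ominus> a \<otimes> x"
  have z: "z \<in> carrier A" using a xc by (simp add: z_def)
  have zero: "left_ideal {\<zero>} A" by (rule left_idealI) auto
  note K = left_ideal_insert[OF zero z]
  have "\<one> \<in> {i \<oplus> a \<otimes> z | i a. i \<in> {\<zero>} \<and> a \<in> carrier A}"
  proof (rule ccontr)
    assume "\<one> \<notin> {i \<oplus> a \<otimes> z | i a. i \<in> {\<zero>} \<and> a \<in> carrier A}"
    then obtain I where I: "maximal_left_ideal I A" "z \<in> I"
      using exists_maximal_left_ideal[OF K(1)] K(3) by blast
    note I' = maximal_left_idealD[OF I(1)]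
    have "x \<in> I" using x I by (auto simp: jrad_def)
    then have "z \<oplus> a \<otimes> x \<in> I" by (intro left_idealD(3,6)[OF I'(1)] I a)
    moreover have "z \<oplus> a \<otimes> x = \<one>"
      unfolding z_def by (rule emb_eqI) (use a xc in \<open>simp_all add: emb_simps\<close>)
    ultimately show False using I'(2) by simp
  qed
  then obtain y where "y \<in> carrier A" "\<one> = \<zero> \<oplus> y \<otimes> z" by blast
  then show "\<exists>y\<in>carrier A. y \<otimes> (\<one> \<ominus> a \<otimes> x) = \<one>" using z by (auto simp: z_def intro!: bexI[of _ y])
next
  assume x: "x \<in> carrier A \<and> (\<forall>a\<in>carrier A. \<exists>y\<in>carrier A. y \<otimes> (\<one> \<ominus> a \<otimes> x) = \<one>)"
  have "x \<in> I" if I: "maximal_left_ideal I A" for I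
  proof (rule ccontr)
    assume "x \<notin> I"
    then obtain c where c: "c \<in> carrier A" "\<one> \<ominus> c \<otimes> x \<in> I" using maximal_left_idealD(3)[OF I] x by blast
    obtain y where "y \<in> carrier A" "y \<otimes> (\<one> \<ominus> c \<otimes> x) = \<one>" using x c by blast
    then show False using left_idealD(6)[OF maximal_left_idealD(1)[OF I], of y] c maximal_left_idealD(2)[OF I] by metis
  qed
  then show "x \<in> jrad A" using x by (auto simp: jrad_def)
qed

lemma jrad_left_ideal: "left_ideal (jrad A) A"
proof -
  have I: "left_ideal I A" if "maximal_left_ideal I A" for I using maximal_left_idealD[OF that] by blast
  show ?thesis unfolding jrad_def
    by (rule left_idealI) (auto dest: I intro: left_idealD)
qed

lemma jrad_carrier: "x \<in> jrad A \<Longrightarrow> x \<in> carrier A"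
  by (simp add: jrad_iff)

text \<open>If \<open>y\<close> is a left inverse of \<open>one - a b x\<close>, then
  \<open>one + b x y a\<close> is one of \<open>one - b x a\<close>. This makes the radical
  two-sided.\<close>

lemma jrad_right: "x \<in> jrad A \<Longrightarrow> a \<in> carrier A \<Longrightarrow> x \<otimes> a \<in> jrad A"
proof -
  assume x: "x \<in> jrad A" and a: "a \<in> carrier A"
  have xc: "x \<in> carrier A" using x by (rule jrad_carrier)
  have "\<exists>y\<in>carrier A. y \<otimes> (\<one> \<ominus> b \<otimes> (x \<otimes> a)) = \<one>" if b: "b \<in> carrier A" for b
  proof -
    obtain y where y: "y \<in> carrier A" "y \<otimes> (\<one> \<ominus> (a \<otimes> b) \<otimes> x) = \<one>" using x a b unfolding jrad_iff by blast
    have "\<iota> (y \<otimes> (\<one> \<ominus> (a \<otimes> b) \<otimes> x)) = \<iota> y - \<iota> y * (\<iota> a * (\<iota> b * \<iota> x))"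
      using a b xc y(1) by (simp add: emb_simps right_diff_distrib emb_one mult.assoc)
    then have eq: "\<iota> y - \<iota> y * (\<iota> a * (\<iota> b * \<iota> x)) = \<iota> \<one>" by (simp only: y)
    then have "\<iota> b * \<iota> x * (\<iota> y - \<iota> y * (\<iota> a * (\<iota> b * \<iota> x))) * \<iota> a = \<iota> b * \<iota> x * \<iota> \<one> * \<iota> a"
      by (simp only:)
    then have eq2: "\<iota> b * (\<iota> x * (\<iota> y * \<iota> a)) - \<iota> b * (\<iota> x * (\<iota> y * (\<iota> a * (\<iota> b * (\<iota> x * \<iota> a))))) = \<iota> b * (\<iota> x * \<iota> a)"
      using a b xc by (simp add: algebra_simps emb_one)
    have "\<iota> ((\<one> \<oplus> b \<otimes> x \<otimes> y \<otimes> a) \<otimes> (\<one> \<ominus> b \<otimes> (x \<otimes> a))) = \<iota> \<one> - \<iota> b * (\<iota> x * \<iota> a) +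
      (\<iota> b * (\<iota> x * (\<iota> y * \<iota> a)) - \<iota> b * (\<iota> x * (\<iota> y * (\<iota> a * (\<iota> b * (\<iota> x * \<iota> a))))))"
      using a b xc y(1) by (simp add: emb_simps emb_one emb_one' algebra_simps)
    also have "\<dots> = \<iota> \<one>" unfolding eq2 by simp
    finally have "(\<one> \<oplus> b \<otimes> x \<otimes> y \<otimes> a) \<otimes> (\<one> \<ominus> b \<otimes> (x \<otimes> a)) = \<one>"
      by (rule emb_eqI[rotated 2]) (use a b xc y in simp_all)
    then show ?thesis using a b xc y by blast
  qed
  then show ?thesis using xc a unfolding jrad_iff by blast
qed

lemma jrad_ideal: "ideal (jrad A) A"
proof (rule idealI)
  show "subgroup (jrad A) (add_monoid A)"
    using jrad_left_ideal by (simp add: left_ideal_def additive_subgroup_def)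
qed (auto simp: ring_axioms jrad_right left_idealD(6)[OF jrad_left_ideal])

text \<open>The left inverse \<open>y\<close> of \<open>one - x\<close> equals
  \<open>one + y x\<close>, and \<open>y x\<close> is again in the radical. So \<open>y\<close> has
  a left inverse as well, which must then be \<open>one - x\<close>.\<close>

lemma jrad_unit:
  assumes x: "x \<in> jrad A"
  shows "\<exists>y\<in>carrier A. y \<otimes> (\<one> \<ominus> x) = \<one> \<and> (\<one> \<ominus> x) \<otimes> y = \<one>"
proof -
  note xc = jrad_carrier[OF x]
  obtain y where y: "y \<in> carrier A" "y \<otimes> (\<one> \<ominus> \<one> \<otimes> x) = \<one>" using x unfolding jrad_iff by blast
  then have y1: "y \<otimes> (\<one> \<ominus> x) = \<one>" using xc by simp
  have "\<ominus> (y \<otimes> x) \<in> jrad A" by (intro left_idealD(4,6)[OF jrad_left_ideal] x y)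
  then obtain z where z: "z \<in> carrier A" "z \<otimes> (\<one> \<ominus> \<one> \<otimes> (\<ominus> (y \<otimes> x))) = \<one>" unfolding jrad_iff by blast
  have "\<one> \<ominus> \<one> \<otimes> (\<ominus> (y \<otimes> x)) = y \<otimes> (\<one> \<ominus> x) \<oplus> y \<otimes> x"
    unfolding y1 by (rule emb_eqI) (use xc y in \<open>simp_all add: emb_simps emb_one emb_one'\<close>)
  also have "\<dots> = y" by (rule emb_eqI) (use xc y(1) in \<open>simp_all add: emb_simps emb_one algebra_simps\<close>)
  finally have zy: "z \<otimes> y = \<one>" using z by simp
  have "z = z \<otimes> (y \<otimes> (\<one> \<ominus> x))" using z by (simp add: y1)
  also have "\<dots> = z \<otimes> y \<otimes> (\<one> \<ominus> x)" by (rule m_assoc[symmetric]) (use z y xc in auto)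
  also have "\<dots> = \<one> \<ominus> x" using xc by (simp add: zy)
  finally show ?thesis using y1 y zy by auto
qed

lemma opp_ring_ring: "ring (opp_ring A)"
proof (rule ringI)
  show "abelian_group (opp_ring A)"
    by (rule abelian_groupI) (auto simp: a_ac intro!: bexI[of _ "\<ominus> _"] l_neg)
  show "monoid (opp_ring A)" by (rule monoidI) (auto simp: m_assoc)
qed (auto simp: l_distr r_distr)

lemma opp_minus: "x \<ominus>\<^bsub>opp_ring A\<^esub> y = x \<ominus> y"
  by (simp add: a_minus_def a_inv_def opp_ring_def)

text \<open>\<open>one - x a\<close> is invertible on both sides, so the criterion for the radical
  is left-right symmetric. Right modules being left modules over \<open>opp_ring A\<close>, this
  gives the right-handed statements on the radical from the left-handed ones.\<close>

lemma jrad_opp_subset: "jrad A \<subseteq> jrad (opp_ring A)"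
proof
  interpret opp: emb_ring "opp_ring A" by (simp add: emb_ring_def opp_ring_ring)
  fix x assume x: "x \<in> jrad A"
  have "\<exists>y\<in>carrier A. (\<one> \<ominus> x \<otimes> a) \<otimes> y = \<one>" if "a \<in> carrier A" for a
    using jrad_unit[OF jrad_right[OF x that]] by blast
  then show "x \<in> jrad (opp_ring A)"
    using jrad_carrier[OF x] by (simp add: opp.jrad_iff opp_minus)
qed

lemma jrad_opp: "jrad (opp_ring A) = jrad A"
proof
  interpret opp: emb_ring "opp_ring A" by (simp add: emb_ring_def opp_ring_ring)
  have "opp_ring (opp_ring A) = A" by (simp add: opp_ring_def)
  then show "jrad (opp_ring A) \<subseteq> jrad A" using opp.jrad_opp_subset by simp
qed (rule jrad_opp_subset)

text \<open>The preimage \<open>x\<close> of \<open>one\<close> generates, and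
  \<open>f (a \<otimes> x) = a\<close> shows that it is regular.\<close>

lemma free_rank_one_generator:
  assumes "lmod_iso A (ideal_mod A I) (ideal_mod A (carrier A))" "left_ideal I A"
  shows "\<exists>x\<in>I. I = (\<lambda>a. a \<otimes> x) ` carrier A \<and> (\<forall>a\<in>carrier A. a \<otimes> x = \<zero> \<longrightarrow> a = \<zero>)"
proof -
  obtain f where f: "f \<in> lhom A (ideal_mod A I) (ideal_mod A (carrier A))" "bij_betw f I (carrier A)"
    using assms(1) by (auto simp: lmod_iso_def)
  note I = left_idealD[OF assms(2)]
  have hom: "f (a \<otimes> x) = a \<otimes> f x" if "a \<in> carrier A" "x \<in> I" for a x
    using f that by (simp add: lhom_def)
  obtain x where x: "x \<in> I" "f x = \<one>" using f(2) by (metis bij_betw_iff_bijections one_closed)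
  have fax: "f (a \<otimes> x) = a" if "a \<in> carrier A" for a using hom[OF that x(1)] x that by simp
  have "j \<in> (\<lambda>a. a \<otimes> x) ` carrier A" if j: "j \<in> I" for j
  proof -
    have fj: "f j \<in> carrier A" using f(2) j by (auto simp: bij_betw_def)
    have "f (f j \<otimes> x) = f j" by (rule fax[OF fj])
    then have "f j \<otimes> x = j" using f(2) j I(6)[OF fj x(1)] by (auto simp: bij_betw_def inj_on_def)
    then show ?thesis using fj by force
  qed
  moreover have "a = \<zero>" if "a \<in> carrier A" "a \<otimes> x = \<zero>" for a
  proof -
    have "\<zero> \<otimes> x = \<zero>" using x I by auto
    then show ?thesis using fax[OF that(1)] fax[of \<zero>] that by simp
  qed
  ultimately show ?thesis using x I by (intro bexI[of _ x]) auto
qed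

text \<open>Freeness on the two sides gives two generators with no relation between them yet;
  \<open>radical_generator\<close> derives from both that the second one normalizes the
  order.\<close>

lemma normal_generators:
  assumes "normal_ring A"
  shows "\<exists>x\<in>jrad A. jrad A = (\<lambda>a. a \<otimes> x) ` carrier A \<and> (\<forall>a\<in>carrier A. a \<otimes> x = \<zero> \<longrightarrow> a = \<zero>)"
    and "\<exists>y\<in>jrad A. jrad A = (\<lambda>a. y \<otimes> a) ` carrier A \<and> (\<forall>a\<in>carrier A. y \<otimes> a = \<zero> \<longrightarrow> a = \<zero>)"
proof -
  show "\<exists>x\<in>jrad A. jrad A = (\<lambda>a. a \<otimes> x) ` carrier A \<and> (\<forall>a\<in>carrier A. a \<otimes> x = \<zero> \<longrightarrow> a = \<zero>)"
    using free_rank_one_generator[OF _ jrad_left_ideal] assms by (auto simp: normal_ring_def)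
  interpret opp: emb_ring "opp_ring A" by (simp add: emb_ring_def opp_ring_ring)
  show "\<exists>y\<in>jrad A. jrad A = (\<lambda>a. y \<otimes> a) ` carrier A \<and> (\<forall>a\<in>carrier A. y \<otimes> a = \<zero> \<longrightarrow> a = \<zero>)"
    using opp.free_rank_one_generator[OF _ opp.jrad_left_ideal] assms
    by (simp add: normal_ring_def jrad_opp)
qed

end

section \<open>Simple modules and maximal left ideals\<close>

lemma minus_eq_zero_iff:
  assumes "abelian_group M" "x \<in> carrier M" "y \<in> carrier M"
  shows "x \<ominus>\<^bsub>M\<^esub> y = \<zero>\<^bsub>M\<^esub> \<longleftrightarrow> x = y"
proof -
  interpret M: abelian_group M by fact
  have "x \<ominus>\<^bsub>M\<^esub> y \<oplus>\<^bsub>M\<^esub> y = x" using assms by (simp add: a_minus_def M.a_assoc M.l_neg)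
  then show ?thesis using assms by (auto simp: a_minus_def M.r_neg)
qed

context emb_ring
begin

lemma lmodD:
  assumes "lmod A M"
  shows "abelian_group M"
    "a \<in> carrier A \<Longrightarrow> x \<in> carrier M \<Longrightarrow> a \<odot>\<^bsub>M\<^esub> x \<in> carrier M"
    "a \<in> carrier A \<Longrightarrow> b \<in> carrier A \<Longrightarrow> x \<in> carrier M \<Longrightarrow> (a \<oplus> b) \<odot>\<^bsub>M\<^esub> x = a \<odot>\<^bsub>M\<^esub> x \<oplus>\<^bsub>M\<^esub> b \<odot>\<^bsub>M\<^esub> x"
    "a \<in> carrier A \<Longrightarrow> x \<in> carrier M \<Longrightarrow> y \<in> carrier M \<Longrightarrow> a \<odot>\<^bsub>M\<^esub> (x \<oplus>\<^bsub>M\<^esub> y) = a \<odot>\<^bsub>M\<^esub> x \<oplus>\<^bsub>M\<^esub> a \<odot>\<^bsub>M\<^esub> y"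
    "a \<in> carrier A \<Longrightarrow> b \<in> carrier A \<Longrightarrow> x \<in> carrier M \<Longrightarrow> (a \<otimes> b) \<odot>\<^bsub>M\<^esub> x = a \<odot>\<^bsub>M\<^esub> (b \<odot>\<^bsub>M\<^esub> x)"
    "x \<in> carrier M \<Longrightarrow> \<one> \<odot>\<^bsub>M\<^esub> x = x"
  using assms by (simp_all add: lmod_def)

lemma lmod_zero:
  assumes "lmod A M"
  shows "x \<in> carrier M \<Longrightarrow> \<zero> \<odot>\<^bsub>M\<^esub> x = \<zero>\<^bsub>M\<^esub>" "a \<in> carrier A \<Longrightarrow> a \<odot>\<^bsub>M\<^esub> \<zero>\<^bsub>M\<^esub> = \<zero>\<^bsub>M\<^esub>"
    "a \<in> carrier A \<Longrightarrow> x \<in> carrier M \<Longrightarrow> (\<ominus> a) \<odot>\<^bsub>M\<^esub> x = \<ominus>\<^bsub>M\<^esub> (a \<odot>\<^bsub>M\<^esub> x)"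
proof -
  note M = lmodD[OF assms]
  interpret M: abelian_group M by (rule M)
  have cancel: "u = \<zero>\<^bsub>M\<^esub>" if "u \<in> carrier M" "u = u \<oplus>\<^bsub>M\<^esub> u" for u
    using that M.add.l_cancel_one' by metis
  show z: "\<zero> \<odot>\<^bsub>M\<^esub> x = \<zero>\<^bsub>M\<^esub>" if "x \<in> carrier M" for x
    using M(3)[of \<zero> \<zero> x] M(2)[of \<zero> x] that by (intro cancel) auto
  show "a \<odot>\<^bsub>M\<^esub> \<zero>\<^bsub>M\<^esub> = \<zero>\<^bsub>M\<^esub>" if "a \<in> carrier A"
    using M(4)[of a "\<zero>\<^bsub>M\<^esub>" "\<zero>\<^bsub>M\<^esub>"] M(2)[of a "\<zero>\<^bsub>M\<^esub>"] that by (intro cancel) auto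
  show "(\<ominus> a) \<odot>\<^bsub>M\<^esub> x = \<ominus>\<^bsub>M\<^esub> (a \<odot>\<^bsub>M\<^esub> x)" if "a \<in> carrier A" "x \<in> carrier M"
    using M(3)[of "\<ominus> a" a x] M(2)[of a x] M(2)[of "\<ominus> a" x] z[of x] that
    by (intro M.minus_equality[symmetric]) (auto simp: l_neg)
qed

definition ann where "ann M x = {a \<in> carrier A. a \<odot>\<^bsub>M\<^esub> x = \<zero>\<^bsub>M\<^esub>}"

lemma simple_cyclic:
  assumes "simple_lmod A M" "x \<in> carrier M" "x \<noteq> \<zero>\<^bsub>M\<^esub>" "y \<in> carrier M"
  shows "\<exists>a\<in>carrier A. a \<odot>\<^bsub>M\<^esub> x = y"
proof -
  have L: "lmod A M" using assms(1) by (simp add: simple_lmod_def)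
  note M = lmodD[OF L] and Z = lmod_zero[OF L]
  interpret M: abelian_group M by (rule M)
  let ?S = "(\<lambda>a. a \<odot>\<^bsub>M\<^esub> x) ` carrier A"
  have inv: "\<ominus>\<^bsub>M\<^esub> (a \<odot>\<^bsub>M\<^esub> x) \<in> ?S" if "a \<in> carrier A" for a
    using that Z(3)[OF that assms(2), symmetric] by simp
  have add: "(a \<odot>\<^bsub>M\<^esub> x) \<oplus>\<^bsub>M\<^esub> (b \<odot>\<^bsub>M\<^esub> x) \<in> ?S" if "a \<in> carrier A" "b \<in> carrier A" for a b
    using that M(3)[OF that assms(2), symmetric] by simp
  have zero: "\<zero>\<^bsub>M\<^esub> \<in> ?S" using Z(1)[OF assms(2)] by (intro image_eqI[of _ _ \<zero>]) auto
  have "subgroup ?S (add_monoid M)"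
    by (rule subgroup.intro) (use inv add zero M(2) assms(2) in \<open>auto simp: a_inv_def\<close>)
  then have "submodule A M ?S"
    using M(5)[OF _ _ assms(2), symmetric] by (auto simp: submodule_def additive_subgroup_def)
  moreover have "x \<in> ?S" using M(6)[OF assms(2)] by (intro image_eqI[of _ _ \<one>]) auto
  ultimately have "?S = carrier M" using assms(1,3) unfolding simple_lmod_def by blast
  then have "y \<in> ?S" using assms(4) by (simp only:)
  then show ?thesis by blast
qed

lemma ann_maximal:
  assumes "simple_lmod A M" "x \<in> carrier M" "x \<noteq> \<zero>\<^bsub>M\<^esub>"
  shows "maximal_left_ideal (ann M x) A"
proof -
  have L: "lmod A M" using assms(1) by (simp add: simple_lmod_def)
  note M = lmodD[OF L] and Z = lmod_zero[OF L]
  interpret M: abelian_group M by (rule M)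
  show ?thesis
  proof (rule maximal_left_idealI)
    show "left_ideal (ann M x) A"
      by (rule left_idealI) (auto simp: ann_def M Z assms)
    show "\<one> \<notin> ann M x" using assms by (simp add: ann_def M)
    fix a assume a: "a \<in> carrier A" "a \<notin> ann M x"
    then obtain c where c: "c \<in> carrier A" "c \<odot>\<^bsub>M\<^esub> (a \<odot>\<^bsub>M\<^esub> x) = x"
      using simple_cyclic[OF assms(1), of "a \<odot>\<^bsub>M\<^esub> x" x] M(2) assms(2) by (auto simp: ann_def)
    have "(\<one> \<oplus> \<ominus> (c \<otimes> a)) \<odot>\<^bsub>M\<^esub> x = \<zero>\<^bsub>M\<^esub>"
      using a c assms(2) by (subst M(3)) (auto simp: Z M(5,6) M.r_neg)
    then show "\<exists>c\<in>carrier A. \<one> \<ominus> c \<otimes> a \<in> ann M x"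
      using a c by (intro bexI[of _ c]) (auto simp: ann_def a_minus_def)
  qed
qed

text \<open>Sending \<open>a x\<close> to \<open>a x'\<close> is well defined by the inclusion of
  the annihilators. Both are maximal left ideals, so the inclusion is an equality and the map is
  injective.\<close>

lemma lmod_iso_of_ann:
  assumes M: "simple_lmod A M" "x \<in> carrier M" "x \<noteq> \<zero>\<^bsub>M\<^esub>"
    and M': "simple_lmod A M'" "x' \<in> carrier M'" "x' \<noteq> \<zero>\<^bsub>M'\<^esub>"
    and sub: "ann M x \<subseteq> ann M' x'"
  shows "lmod_iso A M M'"
proof -
  have L: "lmod A M" "lmod A M'" using M M' by (simp_all add: simple_lmod_def)
  note LM = lmodD[OF L(1)] lmod_zero[OF L(1)] and LM' = lmodD[OF L(2)] lmod_zero[OF L(2)]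
  interpret M: abelian_group M by (rule LM)
  interpret M': abelian_group M' by (rule LM')
  have eq: "ann M x = ann M' x'"
    using ann_maximal[OF M] ann_maximal[OF M'] sub unfolding maximal_left_ideal_def by blast
  have eq_iff: "a \<odot>\<^bsub>M\<^esub> x = b \<odot>\<^bsub>M\<^esub> x \<longleftrightarrow> a \<odot>\<^bsub>M'\<^esub> x' = b \<odot>\<^bsub>M'\<^esub> x'" if ab: "a \<in> carrier A" "b \<in> carrier A" for a b
  proof -
    have 1: "(a \<oplus> \<ominus> b) \<odot>\<^bsub>M\<^esub> x = a \<odot>\<^bsub>M\<^esub> x \<ominus>\<^bsub>M\<^esub> b \<odot>\<^bsub>M\<^esub> x"
      using ab M(2) by (simp add: LM a_minus_def)
    have 2: "(a \<oplus> \<ominus> b) \<odot>\<^bsub>M'\<^esub> x' = a \<odot>\<^bsub>M'\<^esub> x' \<ominus>\<^bsub>M'\<^esub> b \<odot>\<^bsub>M'\<^esub> x'"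
      using ab M'(2) by (simp add: LM' a_minus_def)
    have "(a \<oplus> \<ominus> b) \<in> ann M x \<longleftrightarrow> (a \<oplus> \<ominus> b) \<in> ann M' x'" by (simp add: eq)
    then have "a \<odot>\<^bsub>M\<^esub> x \<ominus>\<^bsub>M\<^esub> b \<odot>\<^bsub>M\<^esub> x = \<zero>\<^bsub>M\<^esub> \<longleftrightarrow> a \<odot>\<^bsub>M'\<^esub> x' \<ominus>\<^bsub>M'\<^esub> b \<odot>\<^bsub>M'\<^esub> x' = \<zero>\<^bsub>M'\<^esub>"
      using ab by (simp add: ann_def 1 2)
    then show ?thesis
      using minus_eq_zero_iff[OF LM(1)] minus_eq_zero_iff[OF LM'(1)] LM(2)[OF _ M(2)] LM'(2)[OF _ M'(2)] ab by simp
  qed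
  define c where "c y = (SOME a. a \<in> carrier A \<and> a \<odot>\<^bsub>M\<^esub> x = y)" for y
  have c: "c y \<in> carrier A" "c y \<odot>\<^bsub>M\<^esub> x = y" if "y \<in> carrier M" for y
    using someI_ex[of "\<lambda>a. a \<in> carrier A \<and> a \<odot>\<^bsub>M\<^esub> x = y"] simple_cyclic[OF M that]
    unfolding c_def by blast+
  define f where "f y = c y \<odot>\<^bsub>M'\<^esub> x'" for y
  have f: "f (a \<odot>\<^bsub>M\<^esub> x) = a \<odot>\<^bsub>M'\<^esub> x'" if "a \<in> carrier A" for a
    using eq_iff[OF c(1)[OF LM(2)[OF that M(2)]] that] c(2)[OF LM(2)[OF that M(2)]] by (simp add: f_def)
  have f_add: "f (y \<oplus>\<^bsub>M\<^esub> z) = f y \<oplus>\<^bsub>M'\<^esub> f z" if "y \<in> carrier M" "z \<in> carrier M" for y z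
    using f[of "c y \<oplus> c z"] c[OF that(1)] c[OF that(2)] M(2) M'(2) by (simp add: LM(3) LM'(3) f_def)
  have f_smult: "f (a \<odot>\<^bsub>M\<^esub> y) = a \<odot>\<^bsub>M'\<^esub> f y" if "a \<in> carrier A" "y \<in> carrier M" for a y
    using f[of "a \<otimes> c y"] c[OF that(2)] M(2) M'(2) that by (simp add: LM(5) LM'(5) f_def)
  have f_inj: "inj_on f (carrier M)"
    by (rule inj_onI) (metis c eq_iff f_def)
  have "f ` carrier M = carrier M'"
  proof
    show "f ` carrier M \<subseteq> carrier M'" using c M'(2) LM'(2) by (auto simp: f_def)
    show "carrier M' \<subseteq> f ` carrier M"
    proof
      fix y assume "y \<in> carrier M'"
      then obtain a where "a \<in> carrier A" "a \<odot>\<^bsub>M'\<^esub> x' = y" using simple_cyclic[OF M'] by blast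
      then show "y \<in> f ` carrier M" using f LM(2)[OF _ M(2)] by (metis image_eqI)
    qed
  qed
  then have "f \<in> lhom A M M'" "bij_betw f (carrier M) (carrier M')"
    using f_inj f_add f_smult by (auto simp: lhom_def bij_betw_def)
  then show ?thesis by (auto simp: lmod_iso_def)
qed

definition coset_of where "coset_of I x = {z \<in> carrier A. z \<ominus> x \<in> I}"

text \<open>\<open>num_simple_classes\<close> quantifies over modules whose elements are sets, so
  the quotient by \<open>I\<close> has cosets as elements. The operations go through chosen
  representatives, which is harmless for a left ideal.\<close>

definition quot_mod :: "'a set \<Rightarrow> ('a, 'a set) module" where
  "quot_mod I = \<lparr>carrier = coset_of I ` carrier A, monoid.mult = undefined, monoid.one = undefined,
     ring.zero = coset_of I \<zero>, ring.add = (\<lambda>U V. coset_of I ((SOME x. x \<in> U) \<oplus> (SOME y. y \<in> V))),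
     module.smult = (\<lambda>a U. coset_of I (a \<otimes> (SOME x. x \<in> U)))\<rparr>"

context
  fixes I
  assumes I: "left_ideal I A"
begin

lemma coset_of_eq_iff:
  assumes "x \<in> carrier A" "y \<in> carrier A"
  shows "coset_of I x = coset_of I y \<longleftrightarrow> x \<ominus> y \<in> I"
proof
  note ID = left_idealD[OF I]
  show "x \<ominus> y \<in> I" if "coset_of I x = coset_of I y"
  proof -
    have "x \<in> coset_of I x" using assms ID(2) by (simp add: coset_of_def a_minus_def r_neg)
    then have "x \<in> coset_of I y" using that by simp
    then show ?thesis by (simp add: coset_of_def)
  qed
  assume xy: "x \<ominus> y \<in> I"
  have "z \<ominus> x \<in> I \<longleftrightarrow> z \<ominus> y \<in> I" if "z \<in> carrier A" for z
  proof -
    have "z \<ominus> y = (z \<ominus> x) \<oplus> (x \<ominus> y)" "z \<ominus> x = (z \<ominus> y) \<ominus> (x \<ominus> y)"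
      by (rule emb_eqI, use assms that in \<open>simp_all add: emb_simps\<close>)+
    then show ?thesis using ID(3,5) xy by metis
  qed
  then show "coset_of I x = coset_of I y" by (auto simp: coset_of_def)
qed

lemma coset_of_some:
  assumes "x \<in> carrier A"
  shows "(SOME z. z \<in> coset_of I x) \<in> carrier A" "(SOME z. z \<in> coset_of I x) \<ominus> x \<in> I"
proof -
  have "x \<in> coset_of I x" using assms left_idealD(2)[OF I] by (simp add: coset_of_def a_minus_def r_neg)
  then have "(SOME z. z \<in> coset_of I x) \<in> coset_of I x" by (rule someI)
  then show "(SOME z. z \<in> coset_of I x) \<in> carrier A" "(SOME z. z \<in> coset_of I x) \<ominus> x \<in> I"
    by (simp_all add: coset_of_def)
qed

lemma quot_mod_simps:
  "carrier (quot_mod I) = coset_of I ` carrier A" "\<zero>\<^bsub>quot_mod I\<^esub> = coset_of I \<zero>"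
  "x \<in> carrier A \<Longrightarrow> y \<in> carrier A \<Longrightarrow> coset_of I x \<oplus>\<^bsub>quot_mod I\<^esub> coset_of I y = coset_of I (x \<oplus> y)"
  "a \<in> carrier A \<Longrightarrow> x \<in> carrier A \<Longrightarrow> a \<odot>\<^bsub>quot_mod I\<^esub> coset_of I x = coset_of I (a \<otimes> x)"
proof -
  note ID = left_idealD[OF I]
  show "carrier (quot_mod I) = coset_of I ` carrier A" "\<zero>\<^bsub>quot_mod I\<^esub> = coset_of I \<zero>"
    by (simp_all add: quot_mod_def)
  show "coset_of I x \<oplus>\<^bsub>quot_mod I\<^esub> coset_of I y = coset_of I (x \<oplus> y)" if xy: "x \<in> carrier A" "y \<in> carrier A"
  proof -
    define x' y' where "x' = (SOME z. z \<in> coset_of I x)" and "y' = (SOME z. z \<in> coset_of I y)"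
    note s = coset_of_some[OF xy(1), folded x'_def] coset_of_some[OF xy(2), folded y'_def]
    have "(x' \<oplus> y') \<ominus> (x \<oplus> y) = (x' \<ominus> x) \<oplus> (y' \<ominus> y)"
      by (rule emb_eqI) (use s xy in \<open>simp_all add: emb_simps\<close>)
    then have "(x' \<oplus> y') \<ominus> (x \<oplus> y) \<in> I" using ID(3) s by simp
    then show ?thesis using xy s by (simp add: quot_mod_def x'_def[symmetric] y'_def[symmetric] coset_of_eq_iff)
  qed
  show "a \<odot>\<^bsub>quot_mod I\<^esub> coset_of I x = coset_of I (a \<otimes> x)" if ax: "a \<in> carrier A" "x \<in> carrier A"
  proof -
    define x' where "x' = (SOME z. z \<in> coset_of I x)"
    note s = coset_of_some[OF ax(2), folded x'_def]
    have "a \<otimes> x' \<ominus> a \<otimes> x = a \<otimes> (x' \<ominus> x)"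
      by (rule emb_eqI) (use s ax in \<open>simp_all add: emb_simps right_diff_distrib\<close>)
    then have "a \<otimes> x' \<ominus> a \<otimes> x \<in> I" using ID(6) s ax by simp
    then show ?thesis using ax s by (simp add: quot_mod_def x'_def[symmetric] coset_of_eq_iff)
  qed
qed

lemma quot_mod_lmod: "lmod A (quot_mod I)"
proof -
  have "abelian_group (quot_mod I)"
  proof (rule abelian_groupI)
    fix U assume "U \<in> carrier (quot_mod I)"
    then obtain x where "x \<in> carrier A" "U = coset_of I x" by (auto simp: quot_mod_simps)
    then show "\<exists>V\<in>carrier (quot_mod I). V \<oplus>\<^bsub>quot_mod I\<^esub> U = \<zero>\<^bsub>quot_mod I\<^esub>"
      by (intro bexI[of _ "coset_of I (\<ominus> x)"]) (auto simp: quot_mod_simps l_neg)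
  qed (auto simp: quot_mod_simps a_ac)
  then show ?thesis
    unfolding lmod_def using ring_axioms by (auto simp: quot_mod_simps l_distr r_distr m_assoc)
qed

end

lemma quot_mod_simple:
  assumes "maximal_left_ideal I A"
  shows "simple_lmod A (quot_mod I)"
proof -
  note I = maximal_left_idealD[OF assms]
  note ID = left_idealD[OF I(1)] and Q = quot_mod_simps[OF I(1)] and E = coset_of_eq_iff[OF I(1)]
  have nz: "carrier (quot_mod I) \<noteq> {\<zero>\<^bsub>quot_mod I\<^esub>}"
  proof
    assume "carrier (quot_mod I) = {\<zero>\<^bsub>quot_mod I\<^esub>}"
    then have "coset_of I \<one> = coset_of I \<zero>" by (auto simp: Q)
    then show False using I(2) by (simp add: E a_minus_def)
  qed
  have "S = {\<zero>\<^bsub>quot_mod I\<^esub>} \<or> S = carrier (quot_mod I)" if S: "submodule A (quot_mod I) S" for S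
  proof (cases "S \<subseteq> {\<zero>\<^bsub>quot_mod I\<^esub>}")
    case True
    have "\<zero>\<^bsub>quot_mod I\<^esub> \<in> S" using S additive_subgroup.zero_closed by (auto simp: submodule_def)
    then show ?thesis using True by blast
  next
    case False
    have Sc: "S \<subseteq> carrier (quot_mod I)"
      using S subgroup.subset[of S "add_monoid (quot_mod I)"] by (simp add: submodule_def additive_subgroup_def)
    obtain U where U: "U \<in> S" "U \<noteq> coset_of I \<zero>" using False unfolding Q(2) by blast
    then obtain x where x: "x \<in> carrier A" "coset_of I x \<in> S" "coset_of I x \<noteq> coset_of I \<zero>"
      using Sc unfolding Q(1) by blast
    then have "x \<notin> I" by (simp add: E a_minus_def)
    then obtain c where c: "c \<in> carrier A" "\<one> \<ominus> c \<otimes> x \<in> I" using I(3) x by blast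
    have "coset_of I y \<in> S" if y: "y \<in> carrier A" for y
    proof -
      have "y \<ominus> (y \<otimes> c) \<otimes> x = y \<otimes> (\<one> \<ominus> c \<otimes> x)"
        by (rule emb_eqI) (use c x y in \<open>simp_all add: emb_simps emb_one algebra_simps\<close>)
      then have "y \<ominus> (y \<otimes> c) \<otimes> x \<in> I" using ID(6)[OF y c(2)] by simp
      then have "coset_of I y = (y \<otimes> c) \<odot>\<^bsub>quot_mod I\<^esub> coset_of I x" using c x y by (simp add: Q E)
      then show ?thesis using S x c y by (simp add: submodule_def)
    qed
    then show ?thesis using Sc by (auto simp: Q)
  qed
  then show ?thesis using quot_mod_lmod[OF I(1)] nz by (simp add: simple_lmod_def)
qed

text \<open>Each simple module is replaced by the annihilator of a nonzero vector. A homomorphism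
  between quotients by left ideals is the right multiplication by an element representing the image
  of the class of \<open>one\<close>, so isomorphism of simple modules becomes a statement on
  ideals.\<close>

lemma num_simple_classes_representatives:
  assumes "num_simple_classes A d"
  shows "\<exists>rep. (\<forall>i<d. maximal_left_ideal (rep i) A) \<and>
    (\<forall>i<d. \<forall>j<d. \<forall>a\<in>carrier A. i \<noteq> j \<longrightarrow> (\<forall>x\<in>rep i. x \<otimes> a \<in> rep j) \<longrightarrow> a \<in> rep j) \<and>
    (\<forall>I. maximal_left_ideal I A \<longrightarrow> (\<exists>i<d. \<exists>a\<in>carrier A. a \<notin> rep i \<and> (\<forall>x\<in>I. x \<otimes> a \<in> rep i)))"
proof -
  obtain S :: "nat \<Rightarrow> ('a, 'a set) module" where S: "\<And>i. i < d \<Longrightarrow> simple_lmod A (S i)"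
    "\<And>i j. i < d \<Longrightarrow> j < d \<Longrightarrow> i \<noteq> j \<Longrightarrow> \<not> lmod_iso A (S i) (S j)"
    "\<And>M :: ('a, 'a set) module. simple_lmod A M \<Longrightarrow> \<exists>i<d. lmod_iso A M (S i)"
    using assms unfolding num_simple_classes_def by (elim exE conjE) blast
  have SL: "lmod A (S i)" if "i < d" for i using S(1)[OF that] by (simp add: simple_lmod_def)
  have "\<exists>x\<in>carrier (S i). x \<noteq> \<zero>\<^bsub>S i\<^esub>" if "i < d" for i
  proof -
    interpret S: abelian_group "S i" by (rule lmodD[OF SL[OF that]])
    show ?thesis using S(1)[OF that] S.zero_closed unfolding simple_lmod_def by blast
  qed
  then obtain \<xi> where \<xi>: "\<And>i. i < d \<Longrightarrow> \<xi> i \<in> carrier (S i)" "\<And>i. i < d \<Longrightarrow> \<xi> i \<noteq> \<zero>\<^bsub>S i\<^esub>" by metis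
  have 1: "maximal_left_ideal (ann (S i) (\<xi> i)) A" if "i < d" for i
    by (rule ann_maximal) (use that S \<xi> in auto)
  have 2: "a \<in> ann (S j) (\<xi> j)" if ij: "i < d" "j < d" "i \<noteq> j" and a: "a \<in> carrier A"
    and sub: "\<forall>x\<in>ann (S i) (\<xi> i). x \<otimes> a \<in> ann (S j) (\<xi> j)" for i j a
  proof (rule ccontr)
    assume "a \<notin> ann (S j) (\<xi> j)"
    then have nz: "a \<odot>\<^bsub>S j\<^esub> \<xi> j \<noteq> \<zero>\<^bsub>S j\<^esub>" using a by (simp add: ann_def)
    note LS = lmodD[OF SL[OF ij(2)]]
    have "ann (S i) (\<xi> i) \<subseteq> ann (S j) (a \<odot>\<^bsub>S j\<^esub> \<xi> j)"
      using sub a LS(5) \<xi>(1)[OF ij(2)] by (auto simp: ann_def)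
    then have "lmod_iso A (S i) (S j)"
      using S(1) \<xi> ij nz LS(2) a by (intro lmod_iso_of_ann[where x = "\<xi> i"]) auto
    then show False using S(2) ij by blast
  qed
  have 3: "\<exists>i<d. \<exists>a\<in>carrier A. a \<notin> ann (S i) (\<xi> i) \<and> (\<forall>x\<in>I. x \<otimes> a \<in> ann (S i) (\<xi> i))"
    if I: "maximal_left_ideal I A" for I
  proof -
    note I' = maximal_left_idealD[OF I]
    note Q = quot_mod_simps[OF I'(1)] and E = coset_of_eq_iff[OF I'(1)]
    obtain i f where i: "i < d" and f: "f \<in> lhom A (quot_mod I) (S i)" "bij_betw f (carrier (quot_mod I)) (carrier (S i))"
      using S(3)[OF quot_mod_simple[OF I]] by (auto simp: lmod_iso_def)
    note LS = lmodD[OF SL[OF i]] lmod_zero[OF SL[OF i]]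
    define \<eta> where "\<eta> = f (coset_of I \<one>)"
    have \<eta>: "\<eta> \<in> carrier (S i)" using f(2) by (auto simp: bij_betw_def Q \<eta>_def)
    have fx: "f (coset_of I x) = x \<odot>\<^bsub>S i\<^esub> \<eta>" if "x \<in> carrier A" for x
    proof -
      have "f (x \<odot>\<^bsub>quot_mod I\<^esub> coset_of I \<one>) = x \<odot>\<^bsub>S i\<^esub> \<eta>"
        using f(1) that unfolding lhom_def \<eta>_def by (blast intro: image_eqI one_closed Q(1)[THEN equalityD2, THEN subsetD])
      then show ?thesis using that by (simp add: Q)
    qed
    \<comment> \<open>\<open>a\<close> expresses the image of the class of \<open>one\<close>
      through the chosen vector \<open>\<xi> i\<close>, so right multiplication by \<open>a\<close>
      realizes the isomorphism.\<close>
    obtain a where a: "a \<in> carrier A" "a \<odot>\<^bsub>S i\<^esub> \<xi> i = \<eta>"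
      using simple_cyclic[OF S(1)[OF i] \<xi>(1)[OF i] \<xi>(2)[OF i] \<eta>] by blast
    have f0: "f (coset_of I \<zero>) = \<zero>\<^bsub>S i\<^esub>" using fx[of \<zero>] LS(7)[OF \<eta>] by simp
    have "coset_of I \<one> \<noteq> coset_of I \<zero>" using I'(2) by (simp add: E a_minus_def)
    then have "\<eta> \<noteq> \<zero>\<^bsub>S i\<^esub>"
      using f(2) f0[symmetric] unfolding bij_betw_def \<eta>_def by (auto simp: Q inj_on_def)
    then have "a \<notin> ann (S i) (\<xi> i)" using a by (simp add: ann_def)
    moreover have "x \<otimes> a \<in> ann (S i) (\<xi> i)" if x: "x \<in> I" for x
    proof -
      have xc: "x \<in> carrier A" using x left_idealD(1)[OF I'(1)] by blast
      have "coset_of I x = coset_of I \<zero>" using x xc by (simp add: E a_minus_def)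
      then have "x \<odot>\<^bsub>S i\<^esub> \<eta> = \<zero>\<^bsub>S i\<^esub>" using fx[OF xc] f0 by simp
      then show ?thesis using xc a LS(5)[OF xc a(1) \<xi>(1)[OF i]] by (simp add: ann_def)
    qed
    ultimately show ?thesis using i a by blast
  qed
  show ?thesis by (rule exI[of _ "\<lambda>i. ann (S i) (\<xi> i)"]) (use 1 2 3 in blast)
qed

end

section \<open>Orders over a discrete valuation ring\<close>

text \<open>\<open>Z\<close> stands for the central copy of the valuation ring, with unit
  \<open>p\<close> and uniformizer \<open>\<pi>\<close>. The valuation enters through two
  consequences: \<open>p - \<pi> z\<close> is always a unit, and every element of \<open>Z\<close>
  is a unit or a multiple of \<open>\<pi>\<close>.\<close>

locale local_order =
  fixes p \<pi> :: "'u::ring" and L Z B :: "'u set"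
  assumes L_add: "additive L" and p_L: "p \<in> L"
    and L_mult: "a \<in> L \<Longrightarrow> b \<in> L \<Longrightarrow> a * b \<in> L"
    and p_mult_L: "a \<in> L \<Longrightarrow> p * a = a" and L_mult_p: "a \<in> L \<Longrightarrow> a * p = a"
    and Z_L: "Z \<subseteq> L" and Z_add: "additive Z" and p_Z: "p \<in> Z"
    and Z_mult: "a \<in> Z \<Longrightarrow> b \<in> Z \<Longrightarrow> a * b \<in> Z"
    and Z_central: "z \<in> Z \<Longrightarrow> a \<in> L \<Longrightarrow> a * z = z * a"
    and pi_Z: "\<pi> \<in> Z"
    and local_ring: "z \<in> Z \<Longrightarrow> \<exists>s\<in>Z. s * (p - \<pi> * z) = p"
    and pi_dvd_or_unit: "z \<in> Z \<Longrightarrow> (\<exists>z'\<in>Z. z = \<pi> * z') \<or> (\<exists>z'\<in>Z. z' * z = p)"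
    and finite_B: "finite B" and B_L: "B \<subseteq> L"
    and L_span: "a \<in> L \<Longrightarrow> \<exists>c. (\<forall>b\<in>B. c b \<in> Z) \<and> a = (\<Sum>b\<in>B. c b * b)"
begin

lemma ZL: "z \<in> Z \<Longrightarrow> z \<in> L"
  using Z_L by blast

text \<open>Nakayama's lemma: the left ideal \<open>?I\<close> generated by
  \<open>p - a \<pi>\<close> satisfies \<open>L = ?I + \<pi> L\<close>, and the generators of
  \<open>L\<close> modulo \<open>?I\<close> are eliminated one at a time until
  \<open>?I = L\<close>.\<close>

lemma pi_in_radical:
  assumes a: "a \<in> L"
  shows "\<exists>y\<in>L. y * (p - a * \<pi>) = p"
proof -
  let ?I = "{y * (p - a * \<pi>) | y. y \<in> L}"
  have I_add: "additive ?I"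
  proof (rule additiveI)
    show "0 \<in> ?I" using additive_zero[OF L_add] by (intro CollectI exI[of _ 0]) simp
    fix x y assume "x \<in> ?I" "y \<in> ?I"
    then obtain x' y' where "x' \<in> L" "y' \<in> L" "x = x' * (p - a * \<pi>)" "y = y' * (p - a * \<pi>)" by blast
    then show "x - y \<in> ?I" using additive_diff[OF L_add]
      by (intro CollectI exI[of _ "x' - y'"]) (simp add: left_diff_distrib)
  qed
  have ZI: "z * x \<in> ?I" if zx: "z \<in> Z" "x \<in> ?I" for z x
  proof -
    obtain y where "y \<in> L" "x = y * (p - a * \<pi>)" using zx by blast
    then show ?thesis using zx L_mult ZL by (intro CollectI exI[of _ "z * y"]) (simp add: mult.assoc)
  qed
  have "L \<subseteq> ?I" if "finite C" "C \<subseteq> L"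
    "\<And>x. x \<in> L \<Longrightarrow> \<exists>i\<in>?I. \<exists>c. (\<forall>b\<in>C. c b \<in> Z) \<and> x = i + (\<Sum>b\<in>C. c b * b)" for C
    using that
  proof (induction C)
    case empty
    then show ?case by fastforce
  next
    case (insert b C)
    have bL: "b \<in> L" using insert by simp
    obtain i c where i: "i \<in> ?I" and c: "\<forall>b'\<in>insert b C. c b' \<in> Z"
      and eq: "b * a = i + (\<Sum>b'\<in>insert b C. c b' * b')"
      using insert.prems(2)[OF L_mult[OF bL a]] by blast
    obtain s where s: "s \<in> Z" "s * (p - \<pi> * c b) = p" using local_ring c by blast
    \<comment> \<open>Multiplying the expansion of \<open>b a\<close> by \<open>\<pi>\<close>
      expresses \<open>b\<close> through \<open>?I\<close> and multiples of \<open>\<pi>\<close>.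
      Its own coefficient \<open>\<pi> c b\<close> on the right is absorbed because
      \<open>p - \<pi> c b\<close> is a unit.\<close>
    define i' where "i' = b * (p - a * \<pi>) + \<pi> * i"
    have i': "i' \<in> ?I" unfolding i'_def using bL by (intro additive_add[OF I_add _ ZI[OF pi_Z i]]) blast
    have "b = b * (p - a * \<pi>) + \<pi> * (b * a)"
      using Z_central[OF pi_Z L_mult[OF bL a]] by (simp add: right_diff_distrib L_mult_p bL mult.assoc)
    also have "\<dots> = i' + (\<Sum>b'\<in>C. \<pi> * c b' * b') + \<pi> * c b * b"
      using insert by (simp add: eq i'_def distrib_left sum_distrib_left mult.assoc add_ac)
    finally have "(p - \<pi> * c b) * b = i' + (\<Sum>b'\<in>C. \<pi> * c b' * b')"
      by (simp add: left_diff_distrib p_mult_L bL) (metis add_diff_cancel_right')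
    then have "s * ((p - \<pi> * c b) * b) = s * (i' + (\<Sum>b'\<in>C. \<pi> * c b' * b'))" by simp
    moreover have "s * ((p - \<pi> * c b) * b) = b"
      by (simp add: mult.assoc[symmetric] s p_mult_L bL)
    ultimately have b_eq: "b = s * i' + (\<Sum>b'\<in>C. s * \<pi> * c b' * b')"
      by (simp add: distrib_left sum_distrib_left mult.assoc)
    show ?case
    proof (rule insert.IH)
      show "C \<subseteq> L" using insert by simp
      fix x assume x: "x \<in> L"
      obtain j e where j: "j \<in> ?I" and e: "\<forall>b'\<in>insert b C. e b' \<in> Z"
        and xeq: "x = j + (\<Sum>b'\<in>insert b C. e b' * b')"
        using insert.prems(2)[OF x] by blast
      have "e b * b = e b * (s * i') + (\<Sum>b'\<in>C. e b * (s * \<pi> * c b' * b'))"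
        by (subst b_eq) (simp add: distrib_left sum_distrib_left)
      then have "x = (j + e b * (s * i')) + (\<Sum>b'\<in>C. (e b * (s * \<pi> * c b') + e b') * b')"
        using xeq insert by (simp add: distrib_right sum.distrib mult.assoc add_ac)
      moreover have "j + e b * (s * i') \<in> ?I" using e s by (intro additive_add[OF I_add] j ZI i') auto
      moreover have "\<forall>b'\<in>C. e b * (s * \<pi> * c b') + e b' \<in> Z"
        using e s c pi_Z by (auto intro!: additive_add[OF Z_add] Z_mult)
      ultimately show "\<exists>i\<in>?I. \<exists>c. (\<forall>b\<in>C. c b \<in> Z) \<and> x = i + (\<Sum>b\<in>C. c b * b)"
        by (intro bexI[of _ "j + e b * (s * i')"] exI[of _ "\<lambda>b'. e b * (s * \<pi> * c b') + e b'"]) auto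
    qed
  qed
  moreover have "\<exists>i\<in>?I. \<exists>c. (\<forall>b\<in>B. c b \<in> Z) \<and> x = i + (\<Sum>b\<in>B. c b * b)" if "x \<in> L" for x
    using L_span[OF that] additive_zero[OF I_add] by force
  ultimately have "p \<in> ?I" using finite_B B_L p_L by blast
  then show ?thesis by force
qed

text \<open>Gaussian elimination over the residue field: more elements than generators are
  dependent. To avoid quotients, dependence means that some coefficient is not divisible by
  \<open>\<pi>\<close> while the combination is a multiple of \<open>\<pi>\<close>.\<close>

lemma dependent_mod_pi:
  assumes "p \<notin> (*) \<pi> ` Z"
    and "finite C" "C \<subseteq> L" "finite I" "card C < card I"
    and "\<And>i. i \<in> I \<Longrightarrow> \<exists>c. \<exists>l\<in>L. (\<forall>b\<in>C. c b \<in> Z) \<and> f i = (\<Sum>b\<in>C. c b * b) + \<pi> * l"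
    and "\<And>i. i \<in> I \<Longrightarrow> f i \<in> L"
  shows "\<exists>a. (\<forall>i\<in>I. a i \<in> Z) \<and> (\<exists>i\<in>I. a i \<notin> (*) \<pi> ` Z) \<and> (\<exists>l\<in>L. (\<Sum>i\<in>I. a i * f i) = \<pi> * l)"
  using assms(2-)
proof (induction C arbitrary: I f)
  case empty
  then obtain i0 where i0: "i0 \<in> I" by fastforce
  obtain l where l: "l \<in> L" "f i0 = \<pi> * l" using empty(4)[OF i0] by auto
  have "(\<Sum>i\<in>I. (if i = i0 then p else 0) * f i) = (\<Sum>i\<in>I. if i = i0 then p * f i else 0)"
    by (rule sum.cong) auto
  also have "\<dots> = \<pi> * l" using i0 empty(2) l p_mult_L[OF empty(5)[OF i0]] by simp
  finally show ?case
    using assms(1) i0 p_Z l additive_zero[OF Z_add] by (intro exI[of _ "\<lambda>i. if i = i0 then p else 0"]) auto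
next
  case (insert b C)
  obtain c l where cl: "\<And>i. i \<in> I \<Longrightarrow> l i \<in> L" "\<And>i b'. i \<in> I \<Longrightarrow> b' \<in> insert b C \<Longrightarrow> c i b' \<in> Z"
    "\<And>i. i \<in> I \<Longrightarrow> f i = (\<Sum>b'\<in>insert b C. c i b' * b') + \<pi> * l i"
    using insert.prems(4) by metis
  have f_eq: "f i = (\<Sum>b'\<in>C. c i b' * b') + c i b * b + \<pi> * l i" if "i \<in> I" for i
    using cl(3)[OF that] insert by (simp add: add_ac)
  have bL: "b \<in> L" and CL: "C \<subseteq> L" using insert by auto
  show ?case
  proof (cases "\<forall>i\<in>I. c i b \<in> (*) \<pi> ` Z")
    case True
    show ?thesis
    proof (rule insert.IH)
      fix i assume i: "i \<in> I"
      then obtain z where z: "z \<in> Z" "c i b = \<pi> * z" using True by auto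
      have "f i = (\<Sum>b'\<in>C. c i b' * b') + \<pi> * (z * b + l i)"
        using f_eq[OF i] by (simp add: z distrib_left mult.assoc)
      moreover have "z * b + l i \<in> L" using ZL[OF z(1)] by (intro additive_add[OF L_add] L_mult bL cl i)
      ultimately show "\<exists>c. \<exists>l\<in>L. (\<forall>b\<in>C. c b \<in> Z) \<and> f i = (\<Sum>b\<in>C. c b * b) + \<pi> * l"
        using cl(2)[OF i] by blast
    qed (use insert CL in auto)
  next
    case False
    then obtain j where j: "j \<in> I" "c j b \<notin> (*) \<pi> ` Z" by blast
    then obtain z where z: "z \<in> Z" "z * c j b = p" using pi_dvd_or_unit[OF cl(2)[of j b]] by blast
    let ?I = "I - {j}"
    \<comment> \<open>\<open>j\<close> serves as pivot: its coefficient at \<open>b\<close> is a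
      unit with inverse \<open>z\<close>, and subtracting multiples of \<open>f j\<close> removes
      \<open>b\<close> from the other elements.\<close>
    define f' where "f' i = f i - c i b * z * f j" for i
    have "\<exists>a. (\<forall>i\<in>?I. a i \<in> Z) \<and> (\<exists>i\<in>?I. a i \<notin> (*) \<pi> ` Z) \<and> (\<exists>l\<in>L. (\<Sum>i\<in>?I. a i * f' i) = \<pi> * l)"
    proof (rule insert.IH)
      show "card C < card ?I" using insert j by simp
      fix i assume i: "i \<in> ?I"
      have ci: "c i b \<in> Z" using cl(2) i by simp
      have "c i b * z * (c j b * b) = c i b * (z * c j b) * b" by (simp only: mult.assoc)
      also have "\<dots> = c i b * b" by (simp add: z L_mult_p ZL ci)
      finally have cz: "c i b * z * (c j b * b) = c i b * b" .
      have pi_comm: "c i b * z * (\<pi> * l j) = \<pi> * (c i b * z * l j)"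
        using Z_central[OF pi_Z L_mult[OF ZL[OF ci] ZL[OF z(1)]]] by (simp add: mult.assoc[symmetric])
      have "f' i = (\<Sum>b'\<in>C. c i b' * b') + \<pi> * l i - (c i b * z * (\<Sum>b'\<in>C. c j b' * b') + c i b * z * (\<pi> * l j))"
        unfolding f'_def using f_eq[of i] f_eq[OF j(1)] i by (simp add: distrib_left cz)
      also have "\<dots> = (\<Sum>b'\<in>C. (c i b' - c i b * z * c j b') * b') + \<pi> * (l i - c i b * z * l j)"
        unfolding pi_comm by (simp add: left_diff_distrib right_diff_distrib sum_subtractf sum_distrib_left mult.assoc)
      finally have "f' i = (\<Sum>b'\<in>C. (c i b' - c i b * z * c j b') * b') + \<pi> * (l i - c i b * z * l j)" .
      moreover have "l i - c i b * z * l j \<in> L"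
        using i j ZL z ci by (intro additive_diff[OF L_add] L_mult cl) auto
      moreover have "\<forall>b'\<in>C. c i b' - c i b * z * c j b' \<in> Z"
        using i j z ci cl(2) by (auto intro!: additive_diff[OF Z_add] Z_mult)
      ultimately show "\<exists>c. \<exists>l\<in>L. (\<forall>b\<in>C. c b \<in> Z) \<and> f' i = (\<Sum>b\<in>C. c b * b) + \<pi> * l"
        by (intro exI[of _ "\<lambda>b'. c i b' - c i b * z * c j b'"] bexI[of _ "l i - c i b * z * l j"]) auto
      show "f' i \<in> L" unfolding f'_def
        using i j insert.prems(5) ZL z ci by (intro additive_diff[OF L_add] L_mult) auto
    qed (use insert CL in auto)
    then obtain a where a0: "(\<forall>i\<in>?I. a i \<in> Z) \<and> (\<exists>i\<in>?I. a i \<notin> (*) \<pi> ` Z) \<and> (\<exists>l\<in>L. (\<Sum>i\<in>?I. a i * f' i) = \<pi> * l)"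
      by (rule exE)
    then obtain l' where a: "\<forall>i\<in>?I. a i \<in> Z" "\<exists>i\<in>?I. a i \<notin> (*) \<pi> ` Z" "l' \<in> L" "(\<Sum>i\<in>?I. a i * f' i) = \<pi> * l'"
      by (elim conjE bexE) (rule that; assumption?; blast)
    \<comment> \<open>The coefficient at the pivot collects the multiples of \<open>f j\<close>
      subtracted in \<open>f'\<close>.\<close>
    define a' where "a' i = (if i = j then - (\<Sum>i\<in>?I. a i * c i b * z) else a i)" for i
    have "(\<Sum>i\<in>I. a' i * f i) = a' j * f j + (\<Sum>i\<in>?I. a' i * f i)"
      using insert.prems(2) j(1) by (rule sum.remove)
    also have "(\<Sum>i\<in>?I. a' i * f i) = (\<Sum>i\<in>?I. a i * f i)" by (rule sum.cong) (auto simp: a'_def)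
    also have "a' j * f j + (\<Sum>i\<in>?I. a i * f i) = (\<Sum>i\<in>?I. a i * f' i)"
      by (simp add: a'_def f'_def right_diff_distrib sum_subtractf sum_distrib_right mult.assoc)
    finally have "(\<Sum>i\<in>I. a' i * f i) = \<pi> * l'" using a by simp
    moreover have "\<forall>i\<in>I. a' i \<in> Z"
      unfolding a'_def using a(1) cl(2) z
      by (auto intro!: additive_uminus[OF Z_add] additive_sum[OF Z_add] Z_mult)
    moreover have "\<exists>i\<in>I. a' i \<notin> (*) \<pi> ` Z" using a(2) by (auto simp: a'_def)
    ultimately show ?thesis using a(3) by blast
  qed
qed

text \<open>A linear dependence modulo \<open>\<pi>\<close> among the powers of \<open>t\<close> exhibits some power of \<open>t\<close>, times an element
  of \<open>1 + tL\<close>, as a multiple of \<open>\<pi>\<close>.\<close>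

lemma radical_power:
  assumes pi: "p \<notin> (*) \<pi> ` Z" and t: "t \<in> L"
    and unit: "\<And>a. a \<in> L \<Longrightarrow> \<exists>s\<in>L. (p + t * a) * s = p"
    and T: "T 0 = p" "\<And>i. T (Suc i) = t * T i"
  shows "\<exists>j. \<exists>l\<in>L. T j = \<pi> * l"
proof -
  have TL: "T i \<in> L" for i by (induction i) (auto simp: T p_L L_mult t)
  have T_add: "T (i + j) = T i * T j" for i j
    by (induction i) (simp_all add: T p_mult_L TL mult.assoc)
  let ?s = "card B"
  have "\<exists>a. (\<forall>i\<in>{..?s}. a i \<in> Z) \<and> (\<exists>i\<in>{..?s}. a i \<notin> (*) \<pi> ` Z) \<and> (\<exists>l\<in>L. (\<Sum>i\<in>{..?s}. a i * T i) = \<pi> * l)"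
  proof (rule dependent_mod_pi[OF pi finite_B B_L])
    fix i
    obtain c where "\<forall>b\<in>B. c b \<in> Z" "T i = (\<Sum>b\<in>B. c b * b)" using L_span[OF TL] by blast
    then show "\<exists>c. \<exists>l\<in>L. (\<forall>b\<in>B. c b \<in> Z) \<and> T i = (\<Sum>b\<in>B. c b * b) + \<pi> * l"
      using additive_zero[OF L_add] by (intro exI[of _ c] bexI[of _ 0]) auto
  qed (auto simp: TL)
  then obtain a l where a: "\<And>i. i \<le> ?s \<Longrightarrow> a i \<in> Z" "\<exists>i\<le>?s. a i \<notin> (*) \<pi> ` Z" "l \<in> L"
    "(\<Sum>i\<le>?s. a i * T i) = \<pi> * l" by auto
  \<comment> \<open>At the first coefficient that is a unit, all earlier terms are multiples of
    \<open>\<pi>\<close> and all later ones contain the factor \<open>T j * t\<close>. So the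
    relation reads: \<open>T j * (a j + t * w)\<close> is a multiple of
    \<open>\<pi>\<close>.\<close>
  define j where "j = (LEAST i. i \<le> ?s \<and> a i \<notin> (*) \<pi> ` Z)"
  have j: "j \<le> ?s" "a j \<notin> (*) \<pi> ` Z" using LeastI_ex[of "\<lambda>i. i \<le> ?s \<and> a i \<notin> (*) \<pi> ` Z"] a(2) by (auto simp: j_def)
  have low: "a i \<in> (*) \<pi> ` Z" if "i < j" for i
    using not_less_Least[of i "\<lambda>i. i \<le> ?s \<and> a i \<notin> (*) \<pi> ` Z"] that j(1) by (auto simp: j_def)
  then have "\<forall>i. \<exists>z. i < j \<longrightarrow> z \<in> Z \<and> a i = \<pi> * z" by blast
  then have "\<exists>z. \<forall>i. i < j \<longrightarrow> z i \<in> Z \<and> a i = \<pi> * z i" by (rule choice)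
  then obtain z where z: "\<And>i. i < j \<Longrightarrow> z i \<in> Z \<and> a i = \<pi> * z i" by blast
  obtain u where u: "u \<in> Z" "u * a j = p" using pi_dvd_or_unit[OF a(1)[OF j(1)]] j(2) by blast
  define w where "w = (\<Sum>i\<in>{j<..?s}. a i * T (i - j - 1))"
  have wL: "w \<in> L" unfolding w_def using a(1) by (intro additive_sum[OF L_add] L_mult[OF ZL TL]) auto
  have comm: "z * T i = T i * z" if "z \<in> Z" for z i using Z_central[OF that TL] by simp
  have "(\<Sum>i\<le>?s. a i * T i) = (\<Sum>i<j. a i * T i) + a j * T j + (\<Sum>i\<in>{j<..?s}. a i * T i)"
  proof -
    have "{..?s} = {..<j} \<union> {j} \<union> {j<..?s}" using j(1) by auto
    moreover have "(\<Sum>i\<in>{..<j} \<union> {j} \<union> {j<..?s}. a i * T i) = (\<Sum>i<j. a i * T i) + a j * T j + (\<Sum>i\<in>{j<..?s}. a i * T i)"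
      by (subst sum.union_disjoint; (subst sum.union_disjoint)?) auto
    ultimately show ?thesis by simp
  qed
  moreover have "(\<Sum>i<j. a i * T i) = \<pi> * (\<Sum>i<j. z i * T i)"
    unfolding sum_distrib_left by (rule sum.cong) (use z in \<open>auto simp: mult.assoc\<close>)
  moreover have "(\<Sum>i\<in>{j<..?s}. a i * T i) = T j * (t * w)"
    unfolding w_def sum_distrib_left
  proof (rule sum.cong)
    fix i assume i: "i \<in> {j<..?s}"
    then have "T i = T j * (t * T (i - j - 1))"
      using T_add[of j "Suc (i - j - 1)"] by (simp add: T)
    moreover have "a i * (T j * (t * T (i - j - 1))) = T j * (t * (a i * T (i - j - 1)))"
      using Z_central[OF a(1)[of i] L_mult[OF TL[of j] t]] i by (simp add: mult.assoc[symmetric])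
    ultimately show "a i * T i = T j * (t * (a i * T (i - j - 1)))" by simp
  qed simp
  ultimately have sum_eq: "\<pi> * (\<Sum>i<j. z i * T i) + a j * T j + T j * (t * w) = \<pi> * l"
    using a(4) by simp
  have "T j * (a j + t * w) = a j * T j + T j * (t * w)"
    using comm[OF a(1)[OF j(1)], of j] by (simp add: distrib_left)
  also have "\<dots> = \<pi> * l - \<pi> * (\<Sum>i<j. z i * T i)" by (simp add: sum_eq[symmetric] add.assoc)
  finally have eq: "T j * (a j + t * w) = \<pi> * (l - (\<Sum>i<j. z i * T i))"
    by (simp only: right_diff_distrib)
  define l' where "l' = l - (\<Sum>i<j. z i * T i)"
  have l'L: "l' \<in> L" unfolding l'_def using z a(3)
    by (intro additive_diff[OF L_add] additive_sum[OF L_add] L_mult[OF ZL TL]) auto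
  obtain s where s: "s \<in> L" "(p + t * (u * w)) * s = p" using unit[OF L_mult[OF ZL[OF u(1)] wL]] by blast
  have "u * (a j + t * w) = p + t * (u * w)"
    using Z_central[OF u(1) t] by (simp add: distrib_left u mult.assoc[symmetric])
  then have "T j * (p + t * (u * w)) = T j * u * (a j + t * w)" by (simp add: mult.assoc)
  also have "\<dots> = u * (T j * (a j + t * w))" by (simp only: comm[OF u(1), symmetric] mult.assoc)
  also have "\<dots> = u * (\<pi> * l')" by (simp only: eq l'_def)
  also have "\<dots> = \<pi> * (u * l')" using Z_central[OF pi_Z ZL[OF u(1)]] by (simp add: mult.assoc[symmetric])
  finally have "T j * (p + t * (u * w)) * s = \<pi> * (u * l') * s" by simp
  then have "T j = \<pi> * (u * l' * s)" using L_mult_p[OF TL[of j]] by (simp add: mult.assoc s)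
  then show ?thesis using L_mult ZL u l'L s by blast
qed

end

section \<open>Orders in a matrix algebra\<close>

definition single :: "nat \<Rightarrow> ('a, 'c) ring_scheme \<Rightarrow> nat \<Rightarrow> nat \<Rightarrow> 'a \<Rightarrow> (nat \<Rightarrow> nat \<Rightarrow> 'a)" where
  "single n A i j a = (\<lambda>k l. if k < n \<and> l < n then (if k = i \<and> l = j then a else \<zero>\<^bsub>A\<^esub>) else undefined)"

context emb_ring
begin

lemma single_closed: "a \<in> carrier A \<Longrightarrow> single n A i j a \<in> mat_carrier n A"
  by (auto simp: single_def mat_carrier_def)

lemma scal_closed: "a \<in> carrier A \<Longrightarrow> scal n A a \<in> mat_carrier n A"
  by (auto simp: scal_def mat_carrier_def)

lemma single_entry: "k < n \<Longrightarrow> l < n \<Longrightarrow> single n A i j a k l = (if k = i \<and> l = j then a else \<zero>)"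
  by (simp add: single_def)

lemma scal_entry: "k < n \<Longrightarrow> l < n \<Longrightarrow> scal n A a k l = (if k = l then a else \<zero>)"
  by (simp add: scal_def)

lemma mat_mult_entries:
  assumes "U \<in> mat_carrier n A" "a \<in> carrier A" "k < n" "l < n"
  shows "j < n \<Longrightarrow> (single n A i j a \<otimes>\<^bsub>mat_ring n A\<^esub> U) k l = (if k = i then a \<otimes> U j l else \<zero>)"
    and "i < n \<Longrightarrow> (U \<otimes>\<^bsub>mat_ring n A\<^esub> single n A i j a) k l = (if l = j then U k i \<otimes> a else \<zero>)"
    and "(scal n A a \<otimes>\<^bsub>mat_ring n A\<^esub> U) k l = a \<otimes> U k l"
    and "(U \<otimes>\<^bsub>mat_ring n A\<^esub> scal n A a) k l = U k l \<otimes> a"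
proof -
  note U = mat_carrierD[OF assms(1)]
  have cl: "\<And>V W. V \<in> mat_carrier n A \<Longrightarrow> W \<in> mat_carrier n A \<Longrightarrow> (V \<otimes>\<^bsub>mat_ring n A\<^esub> W) k l \<in> carrier A"
    using mat_carrierD mat_ring_closed(1) assms(3,4) by blast
  have if_emb: "\<iota> (if P then x else y) = (if P then \<iota> x else \<iota> y)" for P x y by simp
  show "(single n A i j a \<otimes>\<^bsub>mat_ring n A\<^esub> U) k l = (if k = i then a \<otimes> U j l else \<zero>)" if j: "j < n"
  proof (rule emb_eqI)
    have "\<iota> ((single n A i j a \<otimes>\<^bsub>mat_ring n A\<^esub> U) k l) =
        (\<Sum>m<n. if m = j then (if k = i then \<iota> a * \<iota> (U m l) else 0) else 0)"
      unfolding emb_mat_mult[OF single_closed[OF assms(2)] assms(1,3,4)] mm_def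
      using assms by (intro sum.cong) (auto simp: single_entry emb_zero)
    then show "\<iota> ((single n A i j a \<otimes>\<^bsub>mat_ring n A\<^esub> U) k l) = \<iota> (if k = i then a \<otimes> U j l else \<zero>)"
      using j U assms by (simp add: emb_simps)
  qed (use j U assms cl single_closed in auto)
  show "(U \<otimes>\<^bsub>mat_ring n A\<^esub> single n A i j a) k l = (if l = j then U k i \<otimes> a else \<zero>)" if i: "i < n"
  proof (rule emb_eqI)
    have "\<iota> ((U \<otimes>\<^bsub>mat_ring n A\<^esub> single n A i j a) k l) =
        (\<Sum>m<n. if m = i then (if l = j then \<iota> (U k m) * \<iota> a else 0) else 0)"
      unfolding emb_mat_mult[OF assms(1) single_closed[OF assms(2)] assms(3,4)] mm_def
      using assms by (intro sum.cong) (auto simp: single_entry emb_zero)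
    then show "\<iota> ((U \<otimes>\<^bsub>mat_ring n A\<^esub> single n A i j a) k l) = \<iota> (if l = j then U k i \<otimes> a else \<zero>)"
      using i U assms by (simp add: emb_simps)
  qed (use i U assms cl single_closed in auto)
  show "(scal n A a \<otimes>\<^bsub>mat_ring n A\<^esub> U) k l = a \<otimes> U k l"
  proof (rule emb_eqI)
    have "\<iota> ((scal n A a \<otimes>\<^bsub>mat_ring n A\<^esub> U) k l) = (\<Sum>m<n. if m = k then \<iota> a * \<iota> (U m l) else 0)"
      unfolding emb_mat_mult[OF scal_closed[OF assms(2)] assms(1,3,4)] mm_def
      using assms by (intro sum.cong) (auto simp: scal_entry emb_zero)
    then show "\<iota> ((scal n A a \<otimes>\<^bsub>mat_ring n A\<^esub> U) k l) = \<iota> (a \<otimes> U k l)"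
      using U assms by (simp add: emb_simps)
  qed (use U assms cl scal_closed in auto)
  show "(U \<otimes>\<^bsub>mat_ring n A\<^esub> scal n A a) k l = U k l \<otimes> a"
  proof (rule emb_eqI)
    have "\<iota> ((U \<otimes>\<^bsub>mat_ring n A\<^esub> scal n A a) k l) = (\<Sum>m<n. if m = l then \<iota> (U k m) * \<iota> a else 0)"
      unfolding emb_mat_mult[OF assms(1) scal_closed[OF assms(2)] assms(3,4)] mm_def
      using assms by (intro sum.cong) (auto simp: scal_entry emb_zero)
    then show "\<iota> ((U \<otimes>\<^bsub>mat_ring n A\<^esub> scal n A a) k l) = \<iota> (U k l \<otimes> a)"
      using U assms by (simp add: emb_simps)
  qed (use U assms cl scal_closed in auto)
qed

end

locale order_setup =
  fixes E :: "'e ring" and R K Dl :: "'e set" and L :: "(nat \<Rightarrow> nat \<Rightarrow> 'e) set" and n :: nat and \<pi> :: 'e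
  assumes KDelta: "central_division_algebra E K"
    and R_subring: "subring R E"
    and pi_R: "\<pi> \<in> R" and pi_nonzero: "\<pi> \<noteq> \<zero>\<^bsub>E\<^esub>" and pi_nonunit: "\<pi> \<notin> Units (restr E R)"
    and uniformizer: "x \<in> R \<Longrightarrow> x \<noteq> \<zero>\<^bsub>E\<^esub> \<Longrightarrow> \<exists>u k. u \<in> Units (restr E R) \<and> x = u \<otimes>\<^bsub>E\<^esub> (\<pi> [^]\<^bsub>E\<^esub> (k::nat))"
    and K_frac: "fraction_field E R K"
    and Dl_order: "order E R K Dl"
    and n_pos: "0 < n"
    and L_sub: "L \<subseteq> mat_carrier n (restr E Dl)"
    and L_order: "order (mat_ring n E) (scal n E ` R) (scal n E ` K) L"
    and L_normal: "normal_ring (restr (mat_ring n E) L)"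
    and L_hered: "hereditary (restr (mat_ring n E) L)"
begin

lemma E_ring: "ring E"
  using KDelta by (simp add: central_division_algebra_def division_ring_def)

sublocale E: emb_ring E
  by (simp add: emb_ring_def E_ring)

abbreviation A where "A \<equiv> mat_ring n E"

sublocale A: emb_ring A
  by (simp add: emb_ring_def E.mat_ring_ring)

abbreviation S where "S \<equiv> restr A L"

lemma L_subring: "subring L A"
  using L_order by (simp add: order_def)

lemma S_ring: "ring S"
  using A.restr_ring[OF L_subring] .

sublocale S: emb_ring S
  by (simp add: emb_ring_def S_ring)

lemma Dl_subring: "subring Dl E"
  using Dl_order by (simp add: order_def)

lemmas L_props = subringE[OF L_subring] and R_props = subringE[OF R_subring]
  and Dl_props = subringE[OF Dl_subring]

lemma LA: "a \<in> L \<Longrightarrow> a \<in> carrier A"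
  using L_props(1) by blast

lemma RE: "x \<in> R \<Longrightarrow> x \<in> carrier E"
  using R_props(1) by blast

lemma DlE: "x \<in> Dl \<Longrightarrow> x \<in> carrier E"
  using Dl_props(1) by blast

lemma carrier_A: "carrier A = mat_carrier n E"
  by (simp add: mat_ring_simps)

lemma K_central: "z \<in> K \<Longrightarrow> x \<in> carrier E \<Longrightarrow> z \<otimes>\<^bsub>E\<^esub> x = x \<otimes>\<^bsub>E\<^esub> z"
  using KDelta by (auto simp: central_division_algebra_def center_def)

lemma KE: "z \<in> K \<Longrightarrow> z \<in> carrier E"
  using KDelta by (auto simp: central_division_algebra_def center_def)

lemma RK: "z \<in> R \<Longrightarrow> z \<in> K"
  using K_frac by (auto simp: fraction_field_def)

lemma R_central: "z \<in> R \<Longrightarrow> x \<in> carrier E \<Longrightarrow> z \<otimes>\<^bsub>E\<^esub> x = x \<otimes>\<^bsub>E\<^esub> z"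
  using K_central RK by blast

lemma E_unit: "x \<in> carrier E \<Longrightarrow> x \<noteq> \<zero>\<^bsub>E\<^esub> \<Longrightarrow> x \<in> Units E"
  using KDelta by (simp add: central_division_algebra_def division_ring_def)

lemma R_unitsD: "u \<in> Units (restr E R) \<Longrightarrow> u \<in> R \<and> (\<exists>v\<in>R. v \<otimes>\<^bsub>E\<^esub> u = \<one>\<^bsub>E\<^esub>)"
  by (auto simp: Units_def)

lemma pi_pow_R: "\<pi> [^]\<^bsub>E\<^esub> (k::nat) \<in> R"
  by (induction k) (auto simp: R_props pi_R)

lemma pi_dvd_or_unit:
  assumes "x \<in> R"
  shows "(\<exists>y\<in>R. x = \<pi> \<otimes>\<^bsub>E\<^esub> y) \<or> (\<exists>y\<in>R. y \<otimes>\<^bsub>E\<^esub> x = \<one>\<^bsub>E\<^esub>)"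
proof (cases "x = \<zero>\<^bsub>E\<^esub>")
  case True
  then show ?thesis using R_props(2) RE[OF pi_R] by (intro disjI1 bexI[of _ "\<zero>\<^bsub>E\<^esub>"]) auto
next
  case False
  then obtain u k where u: "u \<in> Units (restr E R)" "x = u \<otimes>\<^bsub>E\<^esub> (\<pi> [^]\<^bsub>E\<^esub> (k::nat))"
    using uniformizer assms by blast
  note u' = R_unitsD[OF u(1)]
  show ?thesis
  proof (cases k)
    case 0
    then show ?thesis using u u' RE by auto
  next
    case (Suc l)
    have "x = \<pi> \<otimes>\<^bsub>E\<^esub> (u \<otimes>\<^bsub>E\<^esub> \<pi> [^]\<^bsub>E\<^esub> l)"
      using u(2) Suc R_central[OF pi_R, of "u \<otimes>\<^bsub>E\<^esub> \<pi> [^]\<^bsub>E\<^esub> l"] u' RE pi_R pi_pow_R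
      by (simp add: E.m_assoc)
    then show ?thesis using u' pi_pow_R R_props(6)[of u "\<pi> [^]\<^bsub>E\<^esub> l"] by auto
  qed
qed

lemma pi_not_dvd_one: "y \<in> R \<Longrightarrow> \<one>\<^bsub>E\<^esub> \<noteq> \<pi> \<otimes>\<^bsub>E\<^esub> y"
  using pi_nonunit pi_R R_central[of \<pi> y] RE by (auto simp: Units_def)

lemma R_local:
  assumes "x \<in> R"
  shows "\<exists>s\<in>R. s \<otimes>\<^bsub>E\<^esub> (\<one>\<^bsub>E\<^esub> \<ominus>\<^bsub>E\<^esub> \<pi> \<otimes>\<^bsub>E\<^esub> x) = \<one>\<^bsub>E\<^esub>"
proof -
  have *: "\<one>\<^bsub>E\<^esub> \<ominus>\<^bsub>E\<^esub> \<pi> \<otimes>\<^bsub>E\<^esub> x \<in> R" unfolding a_minus_def using assms pi_R R_props by auto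
  have False if y: "y \<in> R" and eq: "\<one>\<^bsub>E\<^esub> \<ominus>\<^bsub>E\<^esub> \<pi> \<otimes>\<^bsub>E\<^esub> x = \<pi> \<otimes>\<^bsub>E\<^esub> y" for y
  proof -
    have "\<one>\<^bsub>E\<^esub> = (\<one>\<^bsub>E\<^esub> \<ominus>\<^bsub>E\<^esub> \<pi> \<otimes>\<^bsub>E\<^esub> x) \<oplus>\<^bsub>E\<^esub> \<pi> \<otimes>\<^bsub>E\<^esub> x"
      by (rule E.emb_eqI) (use assms pi_R RE in \<open>simp_all add: E.emb_simps\<close>)
    also have "\<dots> = \<pi> \<otimes>\<^bsub>E\<^esub> (y \<oplus>\<^bsub>E\<^esub> x)" using y assms pi_R RE by (simp add: eq E.r_distr)
    finally show False using pi_not_dvd_one[OF R_props(7)[OF y assms]] by blast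
  qed
  then show ?thesis using pi_dvd_or_unit[OF *] by blast
qed

text \<open>The denominator is a unit of \<open>R\<close> times a power of \<open>\<pi>\<close>, and
  that power clears it.\<close>

lemma K_denominator:
  assumes "x \<in> K"
  shows "\<exists>s::nat. \<pi> [^]\<^bsub>E\<^esub> s \<otimes>\<^bsub>E\<^esub> x \<in> R"
proof -
  obtain a b where ab: "a \<in> R" "b \<in> R" "b \<noteq> \<zero>\<^bsub>E\<^esub>" "x = a \<otimes>\<^bsub>E\<^esub> inv\<^bsub>E\<^esub> b"
    using K_frac assms unfolding fraction_field_def by blast
  obtain u k where u: "u \<in> Units (restr E R)" "b = u \<otimes>\<^bsub>E\<^esub> (\<pi> [^]\<^bsub>E\<^esub> (k::nat))" using uniformizer ab by blast
  obtain v where v: "v \<in> R" "v \<otimes>\<^bsub>E\<^esub> u = \<one>\<^bsub>E\<^esub>" using R_unitsD[OF u(1)] by blast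
  have uR: "u \<in> R" using R_unitsD[OF u(1)] by blast
  have bU: "b \<in> Units E" using E_unit RE ab by blast
  have bi: "inv\<^bsub>E\<^esub> b \<in> carrier E" "b \<otimes>\<^bsub>E\<^esub> inv\<^bsub>E\<^esub> b = \<one>\<^bsub>E\<^esub>" using bU by auto
  note c = RE[OF v(1)] RE[OF uR] RE[OF pi_pow_R[of k]] RE[OF ab(1)] RE[OF ab(2)]
  have vb: "v \<otimes>\<^bsub>E\<^esub> b = \<pi> [^]\<^bsub>E\<^esub> k" using v c by (simp add: u(2) E.m_assoc[symmetric])
  have "\<pi> [^]\<^bsub>E\<^esub> k \<otimes>\<^bsub>E\<^esub> x = a \<otimes>\<^bsub>E\<^esub> \<pi> [^]\<^bsub>E\<^esub> k \<otimes>\<^bsub>E\<^esub> inv\<^bsub>E\<^esub> b"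
    using R_central[OF pi_pow_R c(4), of k] c bi by (simp add: ab(4) E.m_assoc[symmetric])
  also have "\<dots> = a \<otimes>\<^bsub>E\<^esub> v \<otimes>\<^bsub>E\<^esub> (b \<otimes>\<^bsub>E\<^esub> inv\<^bsub>E\<^esub> b)"
    unfolding vb[symmetric] using c bi(1) by (simp add: E.m_assoc)
  also have "\<dots> = a \<otimes>\<^bsub>E\<^esub> v" using c bi by simp
  finally show ?thesis using ab v R_props by metis
qed

abbreviation scalar where "scalar \<equiv> scal n E"
abbreviation elt where "elt \<equiv> single n E"

lemma scalar_closed: "a \<in> carrier E \<Longrightarrow> scalar a \<in> carrier A"
  by (simp add: carrier_A E.scal_closed)

lemma elt_closed: "a \<in> carrier E \<Longrightarrow> elt i j a \<in> carrier A"
  by (simp add: carrier_A E.single_closed)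

lemma A_eqI: "U \<in> carrier A \<Longrightarrow> V \<in> carrier A \<Longrightarrow> (\<And>i j. i < n \<Longrightarrow> j < n \<Longrightarrow> U i j = V i j) \<Longrightarrow> U = V"
  unfolding carrier_A by (rule mat_eqI)

lemma A_entry: "U \<in> carrier A \<Longrightarrow> i < n \<Longrightarrow> j < n \<Longrightarrow> U i j \<in> carrier E"
  unfolding carrier_A by (rule mat_carrierD)

lemmas A_mult_entries = E.mat_mult_entries[where n = n, folded carrier_A]

lemma scalar_mult: "a \<in> carrier E \<Longrightarrow> b \<in> carrier E \<Longrightarrow> scalar a \<otimes>\<^bsub>A\<^esub> scalar b = scalar (a \<otimes>\<^bsub>E\<^esub> b)"
  by (rule A_eqI) (auto simp: scalar_closed A_mult_entries E.scal_entry)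

lemma scalar_add: "a \<in> carrier E \<Longrightarrow> b \<in> carrier E \<Longrightarrow> scalar a \<oplus>\<^bsub>A\<^esub> scalar b = scalar (a \<oplus>\<^bsub>E\<^esub> b)"
  by (rule A_eqI) (auto simp: scalar_closed mat_ring_simps(3) E.scal_entry)

lemma scalar_one: "scalar \<one>\<^bsub>E\<^esub> = \<one>\<^bsub>A\<^esub>"
  by (rule A_eqI) (auto simp: scalar_closed mat_ring_simps(4) E.scal_entry)

lemma scalar_zero: "scalar \<zero>\<^bsub>E\<^esub> = \<zero>\<^bsub>A\<^esub>"
  by (rule A_eqI) (auto simp: scalar_closed mat_ring_simps(5) E.scal_entry)

lemma scalar_central: "z \<in> K \<Longrightarrow> U \<in> carrier A \<Longrightarrow> scalar z \<otimes>\<^bsub>A\<^esub> U = U \<otimes>\<^bsub>A\<^esub> scalar z"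
  by (rule A_eqI) (auto simp: scalar_closed KE A_mult_entries A_entry intro: K_central)

lemma elt_mult:
  "i < n \<Longrightarrow> j < n \<Longrightarrow> k < n \<Longrightarrow> l < n \<Longrightarrow> a \<in> carrier E \<Longrightarrow> b \<in> carrier E \<Longrightarrow>
    elt i j a \<otimes>\<^bsub>A\<^esub> elt k l b = (if j = k then elt i l (a \<otimes>\<^bsub>E\<^esub> b) else \<zero>\<^bsub>A\<^esub>)"
  by (rule A_eqI) (auto simp: elt_closed A_mult_entries E.single_entry mat_ring_simps(5))

lemma scalar_elt: "i < n \<Longrightarrow> j < n \<Longrightarrow> a \<in> carrier E \<Longrightarrow> b \<in> carrier E \<Longrightarrow> scalar a \<otimes>\<^bsub>A\<^esub> elt i j b = elt i j (a \<otimes>\<^bsub>E\<^esub> b)"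
  by (rule A_eqI) (auto simp: elt_closed scalar_closed A_mult_entries E.single_entry E.scal_entry)

lemma elt_add: "a \<in> carrier E \<Longrightarrow> b \<in> carrier E \<Longrightarrow> elt i j a \<oplus>\<^bsub>A\<^esub> elt i j b = elt i j (a \<oplus>\<^bsub>E\<^esub> b)"
  by (rule A_eqI) (auto simp: elt_closed mat_ring_simps(3) E.single_entry)

lemma elt_zero: "elt i j \<zero>\<^bsub>E\<^esub> = \<zero>\<^bsub>A\<^esub>"
  by (rule A_eqI) (auto simp: elt_closed mat_ring_simps(5) E.single_entry)

lemma elt_minus:
  assumes "a \<in> carrier E" "b \<in> carrier E"
  shows "elt i j a \<ominus>\<^bsub>A\<^esub> elt i j b = elt i j (a \<ominus>\<^bsub>E\<^esub> b)"
proof -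
  have "elt i j a = elt i j (a \<ominus>\<^bsub>E\<^esub> b) \<oplus>\<^bsub>A\<^esub> elt i j b"
    using assms by (simp add: elt_add a_minus_def E.a_assoc E.l_neg)
  then show ?thesis
    using assms by (simp add: a_minus_def A.a_assoc A.r_neg elt_closed)
qed

lemma elt_inj: "i < n \<Longrightarrow> j < n \<Longrightarrow> elt i j a = elt i j b \<Longrightarrow> a = b"
  by (metis E.single_entry)

lemma corner: "U \<in> carrier A \<Longrightarrow> elt 0 0 \<one>\<^bsub>E\<^esub> \<otimes>\<^bsub>A\<^esub> U \<otimes>\<^bsub>A\<^esub> elt 0 0 \<one>\<^bsub>E\<^esub> = elt 0 0 (U 0 0)"
  by (rule A_eqI) (auto simp: elt_closed A_mult_entries E.single_entry A_entry n_pos)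

end

context emb_ring
begin

lemma finsum_mem:
  assumes "finite I" "\<And>i. i \<in> I \<Longrightarrow> f i \<in> T" "T \<subseteq> carrier A" "\<zero> \<in> T" "\<And>x y. x \<in> T \<Longrightarrow> y \<in> T \<Longrightarrow> x \<oplus> y \<in> T"
  shows "finsum A f I \<in> T"
  using assms(1,2)
proof (induction I)
  case (insert i I)
  then have "f \<in> I \<rightarrow> carrier A" "f i \<in> carrier A" using assms(3) by auto
  then show ?case using insert assms(5) by simp
qed (simp add: assms)

lemma lin_comb_subset:
  assumes "T \<subseteq> carrier A" "\<zero> \<in> T" "\<And>x y. x \<in> T \<Longrightarrow> y \<in> T \<Longrightarrow> x \<oplus> y \<in> T"
    and "\<And>c v. c \<in> C \<Longrightarrow> v \<in> V \<Longrightarrow> c \<otimes> v \<in> T"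
  shows "lin_comb A C V \<subseteq> T"
  unfolding lin_comb_def using assms by (auto intro!: finsum_mem)

lemma emb_additive:
  assumes "T \<subseteq> carrier A" "\<zero> \<in> T" "\<And>x. x \<in> T \<Longrightarrow> \<ominus> x \<in> T" "\<And>x y. x \<in> T \<Longrightarrow> y \<in> T \<Longrightarrow> x \<oplus> y \<in> T"
  shows "additive (\<iota> ` T)"
proof (rule additiveI)
  show "0 \<in> \<iota> ` T" using assms(2) emb_zero by force
  fix a b assume "a \<in> \<iota> ` T" "b \<in> \<iota> ` T"
  then obtain x y where xy: "x \<in> T" "y \<in> T" "a = \<iota> x" "b = \<iota> y" by blast
  have "a - b = \<iota> (x \<oplus> \<ominus> y)" using xy assms(1) by (simp add: emb_simps subset_iff)
  then show "a - b \<in> \<iota> ` T" using xy assms(3,4) by blast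
qed

text \<open>\<open>lin_comb\<close> allows vectors to repeat and fixes no length; collecting the
  coefficients of equal vectors leaves one coefficient per element of \<open>B\<close>.\<close>

lemma lin_comb_span:
  assumes "y \<in> lin_comb A C B" "finite B" "C \<subseteq> carrier A" "B \<subseteq> carrier A" "additive (\<iota> ` C)"
  shows "\<exists>c. (\<forall>b\<in>\<iota> ` B. c b \<in> \<iota> ` C) \<and> \<iota> y = (\<Sum>b\<in>\<iota> ` B. c b * b)"
proof -
  obtain m :: nat and c v where y: "\<And>i. i < m \<Longrightarrow> c i \<in> C \<and> v i \<in> B" "y = finsum A (\<lambda>i. c i \<otimes> v i) {..<m}"
    using assms(1) by (auto simp: lin_comb_def)
  define c' where "c' b = (\<Sum>i\<in>{i \<in> {..<m}. \<iota> (v i) = b}. \<iota> (c i))" for b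
  have "\<iota> y = (\<Sum>i<m. \<iota> (c i) * \<iota> (v i))"
    unfolding y(2) using y(1) assms(3,4)
    by (subst emb_finsum) (auto simp: emb_mult subset_iff intro!: sum.cong)
  also have "\<dots> = (\<Sum>b\<in>\<iota> ` B. \<Sum>i\<in>{i \<in> {..<m}. \<iota> (v i) = b}. \<iota> (c i) * \<iota> (v i))"
    by (rule sum.group[symmetric]) (use y(1) assms(2) in auto)
  also have "\<dots> = (\<Sum>b\<in>\<iota> ` B. c' b * b)"
    unfolding c'_def sum_distrib_right by (intro sum.cong) auto
  finally have "\<iota> y = (\<Sum>b\<in>\<iota> ` B. c' b * b)" .
  moreover have "c' b \<in> \<iota> ` C" for b
    unfolding c'_def using y(1) by (intro additive_sum[OF assms(5)]) auto
  ultimately show ?thesis by blast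
qed

lemma mat_finsum_entry:
  assumes "finite I" "f \<in> I \<rightarrow> mat_carrier n A" "k < n" "l < n"
  shows "finsum (mat_ring n A) f I k l = finsum A (\<lambda>x. f x k l) I"
  using assms(1,2)
proof (induction I)
  case empty
  interpret M: ring "mat_ring n A" by (rule mat_ring_ring)
  show ?case using assms by (simp add: mat_ring_simps)
next
  case (insert i I)
  interpret M: ring "mat_ring n A" by (rule mat_ring_ring)
  have "f \<in> I \<rightarrow> carrier (mat_ring n A)" "f i \<in> carrier (mat_ring n A)"
    "(\<lambda>x. f x k l) \<in> I \<rightarrow> carrier A" "f i k l \<in> carrier A"
    using insert assms(3,4) by (auto simp: mat_ring_simps mat_carrierD Pi_iff)
  then show ?case using insert assms(3,4) by (simp add: mat_ring_simps)
qed

end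

section \<open>The normal order as an algebra over the valuation ring\<close>

context order_setup
begin

abbreviation \<kappa> where "\<kappa> \<equiv> emb A"

lemmas S_minus = A.restr_minus[OF L_subring] and S_uminus = A.restr_uminus[OF L_subring]

lemma jrad_S_L: "x \<in> jrad S \<Longrightarrow> x \<in> L"
  using S.jrad_carrier by simp

lemma jrad_S_iff:
  "x \<in> jrad S \<longleftrightarrow> x \<in> L \<and> (\<forall>a\<in>L. \<exists>y\<in>L. \<kappa> y * (\<kappa> \<one>\<^bsub>A\<^esub> - \<kappa> a * \<kappa> x) = \<kappa> \<one>\<^bsub>A\<^esub>)"
proof -
  have "y \<otimes>\<^bsub>S\<^esub> (\<one>\<^bsub>S\<^esub> \<ominus>\<^bsub>S\<^esub> a \<otimes>\<^bsub>S\<^esub> x) = \<one>\<^bsub>S\<^esub> \<longleftrightarrow> \<kappa> y * (\<kappa> \<one>\<^bsub>A\<^esub> - \<kappa> a * \<kappa> x) = \<kappa> \<one>\<^bsub>A\<^esub>"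
    if "x \<in> L" "a \<in> L" "y \<in> L" for a y
    using that LA L_props by (subst A.emb_inj[symmetric]) (auto simp: S_minus A.emb_simps)
  then show ?thesis unfolding S.jrad_iff by auto
qed

lemma kappa_L_add: "additive (\<kappa> ` L)"
  using L_props by (intro A.emb_additive) auto

lemma kappa_one: "a \<in> carrier A \<Longrightarrow> \<kappa> \<one>\<^bsub>A\<^esub> * \<kappa> a = \<kappa> a" "a \<in> carrier A \<Longrightarrow> \<kappa> a * \<kappa> \<one>\<^bsub>A\<^esub> = \<kappa> a"
  by (rule A.emb_one, assumption)+

lemma scalar_L: "r \<in> R \<Longrightarrow> scalar r \<in> L"
  using L_order by (auto simp: order_def)

lemma kappa_scalar_R_add: "additive (\<kappa> ` scalar ` R)"
proof (rule A.emb_additive)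
  fix x assume "x \<in> scalar ` R"
  then obtain r where r: "r \<in> R" "x = scalar r" by blast
  have "scalar (\<ominus>\<^bsub>E\<^esub> r) \<oplus>\<^bsub>A\<^esub> x = \<zero>\<^bsub>A\<^esub>" using r RE by (simp add: scalar_add E.l_neg scalar_zero)
  then have "\<ominus>\<^bsub>A\<^esub> x = scalar (\<ominus>\<^bsub>E\<^esub> r)" using r RE by (intro A.minus_equality) (auto simp: scalar_closed)
  then show "\<ominus>\<^bsub>A\<^esub> x \<in> scalar ` R" using r R_props(5) by auto
next
  fix x y assume "x \<in> scalar ` R" "y \<in> scalar ` R"
  then obtain a b where "a \<in> R" "b \<in> R" "x = scalar a" "y = scalar b" by blast
  then show "x \<oplus>\<^bsub>A\<^esub> y \<in> scalar ` R" using RE R_props(7) by (auto simp: scalar_add)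
next
  show "scalar ` R \<subseteq> carrier A" using RE scalar_closed by blast
  show "\<zero>\<^bsub>A\<^esub> \<in> scalar ` R" using R_props(2) by (metis imageI scalar_zero)
qed

lemma local_order: "\<exists>B. local_order (\<kappa> \<one>\<^bsub>A\<^esub>) (\<kappa> (scalar \<pi>)) (\<kappa> ` L) (\<kappa> ` scalar ` R) B"
proof -
  obtain B where B: "finite B" "B \<subseteq> L" "L = lin_comb A (scalar ` R) B"
    using L_order unfolding order_def by blast
  have sc: "scalar r \<in> carrier A" if "r \<in> R" for r using that RE scalar_closed by blast
  have "local_order (\<kappa> \<one>\<^bsub>A\<^esub>) (\<kappa> (scalar \<pi>)) (\<kappa> ` L) (\<kappa> ` scalar ` R) (\<kappa> ` B)"
  proof
    fix a b assume "a \<in> \<kappa> ` L" "b \<in> \<kappa> ` L"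
    then show "a * b \<in> \<kappa> ` L" using L_props(6) LA by (auto simp: A.emb_mult[symmetric])
  next
    fix a b assume "a \<in> \<kappa> ` scalar ` R" "b \<in> \<kappa> ` scalar ` R"
    then obtain x y where "x \<in> R" "y \<in> R" "a = \<kappa> (scalar x)" "b = \<kappa> (scalar y)" by blast
    moreover from this have "a * b = \<kappa> (scalar (x \<otimes>\<^bsub>E\<^esub> y))"
      using RE by (simp add: A.emb_mult[symmetric] sc scalar_mult)
    ultimately show "a * b \<in> \<kappa> ` scalar ` R" using R_props(6) by auto
  next
    fix z a assume "z \<in> \<kappa> ` scalar ` R" "a \<in> \<kappa> ` L"
    then show "a * z = z * a"
      using scalar_central[OF RK] LA by (auto simp: A.emb_mult[symmetric] sc)
  next
    fix z assume "z \<in> \<kappa> ` scalar ` R"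
    then obtain x where x: "x \<in> R" "z = \<kappa> (scalar x)" by blast
    note xE = RE[OF x(1)] RE[OF pi_R]
    obtain s where s: "s \<in> R" "s \<otimes>\<^bsub>E\<^esub> (\<one>\<^bsub>E\<^esub> \<ominus>\<^bsub>E\<^esub> \<pi> \<otimes>\<^bsub>E\<^esub> x) = \<one>\<^bsub>E\<^esub>" using R_local[OF x(1)] by blast
    have "\<one>\<^bsub>E\<^esub> \<ominus>\<^bsub>E\<^esub> \<pi> \<otimes>\<^bsub>E\<^esub> x \<oplus>\<^bsub>E\<^esub> \<pi> \<otimes>\<^bsub>E\<^esub> x = \<one>\<^bsub>E\<^esub>"
      using xE by (simp add: a_minus_def E.a_assoc E.l_neg)
    then have "\<kappa> (scalar (\<one>\<^bsub>E\<^esub> \<ominus>\<^bsub>E\<^esub> \<pi> \<otimes>\<^bsub>E\<^esub> x)) + \<kappa> (scalar (\<pi> \<otimes>\<^bsub>E\<^esub> x)) = \<kappa> (scalar \<one>\<^bsub>E\<^esub>)"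
      using xE by (simp add: A.emb_add[symmetric] scalar_closed scalar_add)
    then have *: "\<kappa> (scalar (\<one>\<^bsub>E\<^esub> \<ominus>\<^bsub>E\<^esub> \<pi> \<otimes>\<^bsub>E\<^esub> x)) = \<kappa> \<one>\<^bsub>A\<^esub> - \<kappa> (scalar \<pi>) * z"
      using xE by (simp add: x(2) A.emb_mult[symmetric] scalar_closed scalar_mult scalar_one algebra_simps)
    have "\<kappa> (scalar s) * \<kappa> (scalar (\<one>\<^bsub>E\<^esub> \<ominus>\<^bsub>E\<^esub> \<pi> \<otimes>\<^bsub>E\<^esub> x)) = \<kappa> \<one>\<^bsub>A\<^esub>"
      using xE RE[OF s(1)] by (simp add: A.emb_mult[symmetric] scalar_closed scalar_mult s(2) scalar_one)
    then show "\<exists>s\<in>\<kappa> ` scalar ` R. s * (\<kappa> \<one>\<^bsub>A\<^esub> - \<kappa> (scalar \<pi>) * z) = \<kappa> \<one>\<^bsub>A\<^esub>"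
      unfolding * using s(1) by blast
    show "(\<exists>z'\<in>\<kappa> ` scalar ` R. z = \<kappa> (scalar \<pi>) * z') \<or> (\<exists>z'\<in>\<kappa> ` scalar ` R. z' * z = \<kappa> \<one>\<^bsub>A\<^esub>)"
      using pi_dvd_or_unit[OF x(1)]
    proof
      assume "\<exists>y\<in>R. x = \<pi> \<otimes>\<^bsub>E\<^esub> y"
      then obtain y where "y \<in> R" "x = \<pi> \<otimes>\<^bsub>E\<^esub> y" by blast
      then show ?thesis using RE pi_R
        by (intro disjI1 bexI[of _ "\<kappa> (scalar y)"]) (auto simp: x(2) A.emb_mult[symmetric] scalar_closed scalar_mult)
    next
      assume "\<exists>y\<in>R. y \<otimes>\<^bsub>E\<^esub> x = \<one>\<^bsub>E\<^esub>"
      then obtain y where "y \<in> R" "y \<otimes>\<^bsub>E\<^esub> x = \<one>\<^bsub>E\<^esub>" by blast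
      then show ?thesis using RE xE
        by (intro disjI2 bexI[of _ "\<kappa> (scalar y)"]) (auto simp: x(2) A.emb_mult[symmetric] scalar_closed scalar_mult scalar_one)
    qed
  next
    fix a assume "a \<in> \<kappa> ` L"
    then obtain x where x: "x \<in> lin_comb A (scalar ` R) B" "a = \<kappa> x" using B(3) by blast
    show "\<exists>c. (\<forall>b\<in>\<kappa> ` B. c b \<in> \<kappa> ` scalar ` R) \<and> a = (\<Sum>b\<in>\<kappa> ` B. c b * b)"
      unfolding x(2) by (rule A.lin_comb_span[OF x(1) B(1)]) (use sc B LA kappa_scalar_R_add in auto)
  next
    show "\<kappa> \<one>\<^bsub>A\<^esub> \<in> \<kappa> ` L" using L_props(3) by blast
    show "\<kappa> \<one>\<^bsub>A\<^esub> \<in> \<kappa> ` scalar ` R" using R_props(3) by (metis imageI scalar_one)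
    show "\<kappa> ` scalar ` R \<subseteq> \<kappa> ` L" using scalar_L by blast
    show "\<kappa> (scalar \<pi>) \<in> \<kappa> ` scalar ` R" using pi_R by blast
    show "finite (\<kappa> ` B)" "\<kappa> ` B \<subseteq> \<kappa> ` L" using B by blast+
  qed (use LA kappa_L_add kappa_scalar_R_add kappa_one in auto)
  then show ?thesis by blast
qed

lemma scalar_pi_jrad: "scalar \<pi> \<in> jrad S"
proof -
  obtain B where "local_order (\<kappa> \<one>\<^bsub>A\<^esub>) (\<kappa> (scalar \<pi>)) (\<kappa> ` L) (\<kappa> ` scalar ` R) B" using local_order by blast
  then interpret LO: local_order "\<kappa> \<one>\<^bsub>A\<^esub>" "\<kappa> (scalar \<pi>)" "\<kappa> ` L" "\<kappa> ` scalar ` R" B .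
  show ?thesis unfolding jrad_S_iff using LO.pi_in_radical scalar_L[OF pi_R] by force
qed

definition pi_inv where "pi_inv = inv\<^bsub>E\<^esub> \<pi>"

lemma pi_inv: "pi_inv \<in> carrier E" "\<pi> \<otimes>\<^bsub>E\<^esub> pi_inv = \<one>\<^bsub>E\<^esub>" "pi_inv \<otimes>\<^bsub>E\<^esub> \<pi> = \<one>\<^bsub>E\<^esub>"
  using E_unit[OF RE[OF pi_R] pi_nonzero] by (simp_all add: pi_inv_def)

lemma pi_inv_central: "x \<in> carrier E \<Longrightarrow> pi_inv \<otimes>\<^bsub>E\<^esub> x = x \<otimes>\<^bsub>E\<^esub> pi_inv"
proof -
  assume x: "x \<in> carrier E"
  have "pi_inv \<otimes>\<^bsub>E\<^esub> x = pi_inv \<otimes>\<^bsub>E\<^esub> (x \<otimes>\<^bsub>E\<^esub> \<pi>) \<otimes>\<^bsub>E\<^esub> pi_inv"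
    using x pi_inv RE[OF pi_R] by (simp add: E.m_assoc)
  also have "\<dots> = (pi_inv \<otimes>\<^bsub>E\<^esub> \<pi>) \<otimes>\<^bsub>E\<^esub> x \<otimes>\<^bsub>E\<^esub> pi_inv"
    using x pi_inv(1) RE[OF pi_R] by (simp add: R_central[OF pi_R x, symmetric] E.m_assoc)
  finally show ?thesis using x pi_inv by simp
qed

lemma scalar_pi_inv:
  "\<kappa> (scalar \<pi>) * \<kappa> (scalar pi_inv) = \<kappa> \<one>\<^bsub>A\<^esub>" "\<kappa> (scalar pi_inv) * \<kappa> (scalar \<pi>) = \<kappa> \<one>\<^bsub>A\<^esub>"
  using pi_inv RE[OF pi_R] by (simp_all add: A.emb_mult[symmetric] scalar_closed scalar_mult scalar_one)

lemma scalar_pi_central: "U \<in> carrier A \<Longrightarrow> \<kappa> (scalar \<pi>) * \<kappa> U = \<kappa> U * \<kappa> (scalar \<pi>)"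
  "U \<in> carrier A \<Longrightarrow> \<kappa> (scalar pi_inv) * \<kappa> U = \<kappa> U * \<kappa> (scalar pi_inv)"
proof -
  assume U: "U \<in> carrier A"
  show "\<kappa> (scalar \<pi>) * \<kappa> U = \<kappa> U * \<kappa> (scalar \<pi>)"
    using scalar_central[OF RK[OF pi_R] U] U RE[OF pi_R] by (simp add: A.emb_mult[symmetric] scalar_closed)
  have "scalar pi_inv \<otimes>\<^bsub>A\<^esub> U = U \<otimes>\<^bsub>A\<^esub> scalar pi_inv"
    using U pi_inv by (intro A_eqI) (auto simp: scalar_closed A_mult_entries A_entry intro: pi_inv_central)
  then show "\<kappa> (scalar pi_inv) * \<kappa> U = \<kappa> U * \<kappa> (scalar pi_inv)"
    using U pi_inv by (simp add: A.emb_mult[symmetric] scalar_closed)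
qed

text \<open>\<open>\<pi>\<close> lies in the radical, so \<open>\<pi> = y l\<close> with
  \<open>l\<close> in \<open>L\<close>; regularity of \<open>y\<close> on \<open>L\<close> turns
  \<open>y (l y - \<pi>) = 0\<close> into \<open>l y = \<pi>\<close>, and \<open>y\<close> is
  invertible in \<open>A\<close>. The radical is a left ideal, which gives
  \<open>L y \<subseteq> y L\<close>. The reverse inclusion uses the other generator
  \<open>x\<close>.\<close>

lemma radical_generator:
  "\<exists>y y'. y \<in> jrad S \<and> y' \<in> carrier A \<and> y \<otimes>\<^bsub>A\<^esub> y' = \<one>\<^bsub>A\<^esub> \<and> y' \<otimes>\<^bsub>A\<^esub> y = \<one>\<^bsub>A\<^esub> \<and>
    jrad S = (\<lambda>a. y \<otimes>\<^bsub>A\<^esub> a) ` L \<and>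
    (\<forall>a\<in>L. y \<otimes>\<^bsub>A\<^esub> a \<otimes>\<^bsub>A\<^esub> y' \<in> L \<and> y' \<otimes>\<^bsub>A\<^esub> a \<otimes>\<^bsub>A\<^esub> y \<in> L)"
proof -
  obtain x where x: "x \<in> jrad S" "jrad S = (\<lambda>a. a \<otimes>\<^bsub>A\<^esub> x) ` L" "\<And>a. a \<in> L \<Longrightarrow> a \<otimes>\<^bsub>A\<^esub> x = \<zero>\<^bsub>A\<^esub> \<Longrightarrow> a = \<zero>\<^bsub>A\<^esub>"
    using S.normal_generators(1)[OF L_normal] by auto
  obtain y where y: "y \<in> jrad S" "jrad S = (\<lambda>a. y \<otimes>\<^bsub>A\<^esub> a) ` L" "\<And>a. a \<in> L \<Longrightarrow> y \<otimes>\<^bsub>A\<^esub> a = \<zero>\<^bsub>A\<^esub> \<Longrightarrow> a = \<zero>\<^bsub>A\<^esub>"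
    using S.normal_generators(2)[OF L_normal] by auto
  note J_left = S.left_idealD(6)[OF S.jrad_left_ideal]
  have xL: "x \<in> L" and yL: "y \<in> L" using jrad_S_L[OF x(1)] jrad_S_L[OF y(1)] by simp_all
  obtain l where l: "l \<in> L" "scalar \<pi> = y \<otimes>\<^bsub>A\<^esub> l" using scalar_pi_jrad unfolding y(2) by blast
  note c = LA[OF xL] LA[OF yL] LA[OF l(1)] scalar_closed[OF RE[OF pi_R]] scalar_closed[OF pi_inv(1)]
  let ?p = "\<kappa> (scalar \<pi>)" and ?p' = "\<kappa> (scalar pi_inv)" and ?one = "\<kappa> \<one>\<^bsub>A\<^esub>"
  have Yl: "\<kappa> y * \<kappa> l = ?p" using c by (simp add: l(2) A.emb_mult)
  have lY: "\<kappa> l * \<kappa> y = ?p"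
  proof -
    have "y \<otimes>\<^bsub>A\<^esub> (l \<otimes>\<^bsub>A\<^esub> y \<ominus>\<^bsub>A\<^esub> scalar \<pi>) = \<zero>\<^bsub>A\<^esub>"
    proof (rule A.emb_eqI)
      have "\<kappa> (y \<otimes>\<^bsub>A\<^esub> (l \<otimes>\<^bsub>A\<^esub> y \<ominus>\<^bsub>A\<^esub> scalar \<pi>)) = (\<kappa> y * \<kappa> l) * \<kappa> y - \<kappa> y * ?p"
        using c by (simp add: A.emb_simps right_diff_distrib mult.assoc)
      also have "\<dots> = 0" unfolding Yl using scalar_pi_central(1)[OF c(2)] by simp
      finally show "\<kappa> (y \<otimes>\<^bsub>A\<^esub> (l \<otimes>\<^bsub>A\<^esub> y \<ominus>\<^bsub>A\<^esub> scalar \<pi>)) = \<kappa> \<zero>\<^bsub>A\<^esub>" by (simp add: A.emb_zero)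
    qed (use c in auto)
    then have "l \<otimes>\<^bsub>A\<^esub> y \<ominus>\<^bsub>A\<^esub> scalar \<pi> = \<zero>\<^bsub>A\<^esub>"
      using y(3) l(1) yL scalar_L[OF pi_R] L_props by (simp add: a_minus_def)
    then have "\<kappa> (l \<otimes>\<^bsub>A\<^esub> y \<ominus>\<^bsub>A\<^esub> scalar \<pi>) = 0" by (simp add: A.emb_zero)
    then show ?thesis using c by (simp add: A.emb_simps)
  qed
  define y' where "y' = l \<otimes>\<^bsub>A\<^esub> scalar pi_inv"
  have y'A: "y' \<in> carrier A" using c by (simp add: y'_def)
  have \<kappa>y': "\<kappa> y' = \<kappa> l * ?p'" using c by (simp add: y'_def A.emb_mult)
  have YY': "\<kappa> y * \<kappa> y' = ?one" using Yl by (simp add: \<kappa>y' mult.assoc[symmetric] scalar_pi_inv)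
  have Y'Y: "\<kappa> y' * \<kappa> y = ?one"
  proof -
    have "\<kappa> y' * \<kappa> y = \<kappa> l * (?p' * \<kappa> y)" by (simp add: \<kappa>y' mult.assoc)
    also have "\<dots> = (\<kappa> l * \<kappa> y) * ?p'" by (simp add: scalar_pi_central(2)[OF c(2)] mult.assoc)
    finally show ?thesis by (simp add: lY scalar_pi_inv)
  qed
  have inverse: "y \<otimes>\<^bsub>A\<^esub> y' = \<one>\<^bsub>A\<^esub>" "y' \<otimes>\<^bsub>A\<^esub> y = \<one>\<^bsub>A\<^esub>"
    by (rule A.emb_eqI; use c y'A YY' Y'Y in \<open>simp add: A.emb_mult\<close>)+
  have conj2: "y' \<otimes>\<^bsub>A\<^esub> a \<otimes>\<^bsub>A\<^esub> y \<in> L" if a: "a \<in> L" for a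
  proof -
    have "a \<otimes>\<^bsub>A\<^esub> y \<in> jrad S" using J_left[of a y] a y(1) by simp
    then obtain b where b: "b \<in> L" "a \<otimes>\<^bsub>A\<^esub> y = y \<otimes>\<^bsub>A\<^esub> b" unfolding y(2) by blast
    have "y' \<otimes>\<^bsub>A\<^esub> a \<otimes>\<^bsub>A\<^esub> y = (y' \<otimes>\<^bsub>A\<^esub> y) \<otimes>\<^bsub>A\<^esub> b"
      using b y'A LA[OF a] LA[OF b(1)] c by (simp add: A.m_assoc)
    then show ?thesis using b LA[OF b(1)] by (simp add: inverse)
  qed
  obtain u where u: "u \<in> L" "x = y \<otimes>\<^bsub>A\<^esub> u" using x(1) unfolding y(2) by blast
  have conj1: "y \<otimes>\<^bsub>A\<^esub> a \<otimes>\<^bsub>A\<^esub> y' \<in> L" if a: "a \<in> L" for a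
  proof -
    have "y \<otimes>\<^bsub>A\<^esub> (a \<otimes>\<^bsub>A\<^esub> u) \<in> jrad S" unfolding y(2) using L_props(6)[OF a u(1)] by blast
    then obtain b where b: "b \<in> L" "y \<otimes>\<^bsub>A\<^esub> (a \<otimes>\<^bsub>A\<^esub> u) = b \<otimes>\<^bsub>A\<^esub> x" unfolding x(2) by blast
    note ac = LA[OF a] LA[OF b(1)] LA[OF u(1)]
    have eq: "\<kappa> y * (\<kappa> a * \<kappa> u) = \<kappa> b * (\<kappa> y * \<kappa> u)"
      using arg_cong[OF b(2), of \<kappa>] ac c by (simp add: u(2) A.emb_mult)
    have u_eq: "\<kappa> y' * \<kappa> x = \<kappa> u"
      using ac c by (simp add: u(2) A.emb_mult mult.assoc[symmetric] Y'Y kappa_one)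
    \<comment> \<open>The relation \<open>y a u = b y u\<close> says \<open>w u = 0\<close>. To use
      the regularity of \<open>x = y u\<close>, \<open>w\<close> is first multiplied by
      \<open>l\<close>, because \<open>l x = l y u = \<pi> u\<close>.\<close>
    define w where "w = y \<otimes>\<^bsub>A\<^esub> a \<ominus>\<^bsub>A\<^esub> b \<otimes>\<^bsub>A\<^esub> y"
    have wA: "w \<in> carrier A" using ac c by (simp add: w_def)
    have \<kappa>w: "\<kappa> w = \<kappa> y * \<kappa> a - \<kappa> b * \<kappa> y" using ac c by (simp add: w_def A.emb_simps)
    have wl: "w \<otimes>\<^bsub>A\<^esub> l \<in> L"
      unfolding w_def a_minus_def using a b yL l L_props by simp
    have "w \<otimes>\<^bsub>A\<^esub> l \<otimes>\<^bsub>A\<^esub> x = \<zero>\<^bsub>A\<^esub>"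
    proof (rule A.emb_eqI)
      have "\<kappa> l = ?p * \<kappa> y'"
        using c by (simp add: \<kappa>y' mult.assoc[symmetric] scalar_pi_central(1))
          (simp add: mult.assoc scalar_pi_inv kappa_one)
      then have "\<kappa> (w \<otimes>\<^bsub>A\<^esub> l \<otimes>\<^bsub>A\<^esub> x) = \<kappa> w * (?p * (\<kappa> y' * \<kappa> x))"
        using wA c by (simp add: A.emb_mult mult.assoc)
      also have "\<dots> = ?p * (\<kappa> w * \<kappa> u)"
        using scalar_pi_central(1)[OF wA] by (simp add: u_eq mult.assoc[symmetric])
      also have "\<dots> = 0" by (simp add: \<kappa>w left_diff_distrib mult.assoc eq)
      finally show "\<kappa> (w \<otimes>\<^bsub>A\<^esub> l \<otimes>\<^bsub>A\<^esub> x) = \<kappa> \<zero>\<^bsub>A\<^esub>" by (simp add: A.emb_zero)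
    qed (use wA c in auto)
    then have "w \<otimes>\<^bsub>A\<^esub> l = \<zero>\<^bsub>A\<^esub>" using x(3) wl by blast
    then have "\<kappa> w * \<kappa> l = 0" using wA c by (simp add: A.emb_mult[symmetric] A.emb_zero)
    then have "\<kappa> w * \<kappa> l * \<kappa> y * ?p' = 0" by simp
    then have "\<kappa> w = 0" using wA by (simp add: mult.assoc lY) (simp add: mult.assoc[symmetric] lY scalar_pi_inv kappa_one mult.assoc)
    then have "\<kappa> y * \<kappa> a = \<kappa> b * \<kappa> y" by (simp add: \<kappa>w)
    then have "\<kappa> (y \<otimes>\<^bsub>A\<^esub> a \<otimes>\<^bsub>A\<^esub> y') = \<kappa> b"
      using ac c y'A by (simp add: A.emb_mult mult.assoc YY' kappa_one)
    then have "y \<otimes>\<^bsub>A\<^esub> a \<otimes>\<^bsub>A\<^esub> y' = b" using ac c y'A by (intro A.emb_eqI) auto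
    then show ?thesis using b by simp
  qed
  show ?thesis
    by (rule exI[of _ y], rule exI[of _ y'], intro conjI ballI y(1,2) y'A inverse conj1 conj2)
qed

lemma jrad_one_plus_unit:
  assumes "x \<in> jrad S"
  shows "\<exists>s\<in>L. (\<kappa> \<one>\<^bsub>A\<^esub> + \<kappa> x) * \<kappa> s = \<kappa> \<one>\<^bsub>A\<^esub>"
proof -
  have xL: "x \<in> L" using jrad_S_L[OF assms] .
  have "\<ominus>\<^bsub>S\<^esub> x \<in> jrad S" by (rule S.left_idealD(4)[OF S.jrad_left_ideal assms])
  from S.jrad_unit[OF this] obtain s where s: "s \<in> L" "(\<one>\<^bsub>A\<^esub> \<ominus>\<^bsub>S\<^esub> (\<ominus>\<^bsub>S\<^esub> x)) \<otimes>\<^bsub>A\<^esub> s = \<one>\<^bsub>A\<^esub>" by auto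
  have m: "\<ominus>\<^bsub>A\<^esub> x \<in> L" using L_props(5)[OF xL] .
  have "\<kappa> ((\<one>\<^bsub>A\<^esub> \<ominus>\<^bsub>S\<^esub> (\<ominus>\<^bsub>S\<^esub> x)) \<otimes>\<^bsub>A\<^esub> s) = (\<kappa> \<one>\<^bsub>A\<^esub> + \<kappa> x) * \<kappa> s"
    using LA[OF xL] LA[OF s(1)] S_minus[OF L_props(3) m] by (simp add: S_uminus[OF xL] A.emb_simps)
  then have "(\<kappa> \<one>\<^bsub>A\<^esub> + \<kappa> x) * \<kappa> s = \<kappa> \<one>\<^bsub>A\<^esub>" by (simp only: s)
  then show ?thesis using s(1) by blast
qed

text \<open>For \<open>s = 1\<close> this is \<open>radical_power\<close>, applicable since
  \<open>one + y a\<close> is invertible when \<open>y a\<close> is in the radical. Larger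
  \<open>s\<close> follow by multiplying, as scalars from \<open>R\<close> are central.\<close>

lemma generator_power:
  assumes y: "y \<in> jrad S" "jrad S = (\<lambda>a. y \<otimes>\<^bsub>A\<^esub> a) ` L"
  shows "\<exists>j::nat. \<exists>l\<in>L. y [^]\<^bsub>A\<^esub> j = scalar (\<pi> [^]\<^bsub>E\<^esub> (s::nat)) \<otimes>\<^bsub>A\<^esub> l"
proof -
  have yL: "y \<in> L" using jrad_S_L y(1) by blast
  have yA: "y \<in> carrier A" using LA yL by blast
  have pow_L: "y [^]\<^bsub>A\<^esub> i \<in> L" for i :: nat by (induction i) (auto simp: L_props yL)
  obtain B where "local_order (\<kappa> \<one>\<^bsub>A\<^esub>) (\<kappa> (scalar \<pi>)) (\<kappa> ` L) (\<kappa> ` scalar ` R) B" using local_order by blast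
  then interpret LO: local_order "\<kappa> \<one>\<^bsub>A\<^esub>" "\<kappa> (scalar \<pi>)" "\<kappa> ` L" "\<kappa> ` scalar ` R" B .
  have "\<exists>j. \<exists>l\<in>\<kappa> ` L. \<kappa> (y [^]\<^bsub>A\<^esub> (j::nat)) = \<kappa> (scalar \<pi>) * l"
  proof (rule LO.radical_power)
    show "\<kappa> \<one>\<^bsub>A\<^esub> \<notin> (*) (\<kappa> (scalar \<pi>)) ` \<kappa> ` scalar ` R"
    proof
      assume "\<kappa> \<one>\<^bsub>A\<^esub> \<in> (*) (\<kappa> (scalar \<pi>)) ` \<kappa> ` scalar ` R"
      then obtain r where r: "r \<in> R" "\<kappa> \<one>\<^bsub>A\<^esub> = \<kappa> (scalar \<pi>) * \<kappa> (scalar r)" by blast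
      note c = RE[OF r(1)] RE[OF pi_R]
      have "\<kappa> (scalar \<one>\<^bsub>E\<^esub>) = \<kappa> (scalar (\<pi> \<otimes>\<^bsub>E\<^esub> r))"
        using r c by (simp add: A.emb_mult[symmetric] scalar_closed scalar_mult scalar_one)
      then have "scalar \<one>\<^bsub>E\<^esub> = scalar (\<pi> \<otimes>\<^bsub>E\<^esub> r)" using c by (intro A.emb_eqI) (auto intro: scalar_closed)
      then have "\<one>\<^bsub>E\<^esub> = \<pi> \<otimes>\<^bsub>E\<^esub> r" using E.scal_entry[OF n_pos n_pos] by (metis (full_types))
      then show False using pi_not_dvd_one[OF r(1)] by simp
    qed
    show "\<kappa> y \<in> \<kappa> ` L" using yL by blast
    show "\<exists>s\<in>\<kappa> ` L. (\<kappa> \<one>\<^bsub>A\<^esub> + \<kappa> y * a) * s = \<kappa> \<one>\<^bsub>A\<^esub>" if a: "a \<in> \<kappa> ` L" for a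
    proof -
      obtain b where b: "b \<in> L" "a = \<kappa> b" using a by blast
      have "y \<otimes>\<^bsub>A\<^esub> b \<in> jrad S" unfolding y(2) using b by blast
      then show ?thesis using jrad_one_plus_unit[of "y \<otimes>\<^bsub>A\<^esub> b"] yA LA[OF b(1)] by (auto simp: b(2) A.emb_mult)
    qed
    show "\<kappa> (y [^]\<^bsub>A\<^esub> Suc i) = \<kappa> y * \<kappa> (y [^]\<^bsub>A\<^esub> i)" for i :: nat
      unfolding A.nat_pow_Suc2[OF yA] using yA LA[OF pow_L] by (rule A.emb_mult)
  qed simp
  then obtain j :: nat and l where jl: "l \<in> L" "\<kappa> (y [^]\<^bsub>A\<^esub> j) = \<kappa> (scalar \<pi>) * \<kappa> l" by blast
  note sc = scalar_closed[OF RE[OF pi_R]]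
  have j: "y [^]\<^bsub>A\<^esub> j = scalar \<pi> \<otimes>\<^bsub>A\<^esub> l"
    using jl sc LA[OF jl(1)] LA[OF pow_L] by (intro A.emb_eqI) (auto simp: A.emb_mult)
  show ?thesis
  proof (induction s)
    case 0
    show ?case by (intro exI[of _ "0::nat"] bexI[of _ "\<one>\<^bsub>A\<^esub>"]) (auto simp: scalar_one L_props)
  next
    case (Suc s)
    then obtain i :: nat and l' where i: "l' \<in> L" "y [^]\<^bsub>A\<^esub> i = scalar (\<pi> [^]\<^bsub>E\<^esub> s) \<otimes>\<^bsub>A\<^esub> l'" by blast
    note c = scalar_closed[OF RE[OF pi_pow_R[of s]]] LA[OF i(1)] LA[OF jl(1)] sc
    have "y [^]\<^bsub>A\<^esub> (i + j) = scalar (\<pi> [^]\<^bsub>E\<^esub> s) \<otimes>\<^bsub>A\<^esub> l' \<otimes>\<^bsub>A\<^esub> (scalar \<pi> \<otimes>\<^bsub>A\<^esub> l)"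
      using A.nat_pow_mult[OF yA, of i j] by (simp add: i j)
    also have "\<dots> = scalar (\<pi> [^]\<^bsub>E\<^esub> s) \<otimes>\<^bsub>A\<^esub> (l' \<otimes>\<^bsub>A\<^esub> scalar \<pi>) \<otimes>\<^bsub>A\<^esub> l" using c by (simp add: A.m_assoc)
    also have "\<dots> = scalar (\<pi> [^]\<^bsub>E\<^esub> Suc s) \<otimes>\<^bsub>A\<^esub> (l' \<otimes>\<^bsub>A\<^esub> l)"
      using c RE[OF pi_pow_R[of s]] RE[OF pi_R]
      by (simp add: scalar_central[OF RK[OF pi_R] c(2), symmetric] A.m_assoc scalar_mult[symmetric])
    finally show ?case using L_props(6)[OF i(1) jl(1)] by blast
  qed
qed

section \<open>Clearing denominators\<close>

lemma scalar_pow_mono: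
  assumes "U \<in> carrier A" "scalar (\<pi> [^]\<^bsub>E\<^esub> s) \<otimes>\<^bsub>A\<^esub> U \<in> L" "s \<le> (s' :: nat)"
  shows "scalar (\<pi> [^]\<^bsub>E\<^esub> s') \<otimes>\<^bsub>A\<^esub> U \<in> L"
proof -
  have "\<pi> [^]\<^bsub>E\<^esub> s' = \<pi> [^]\<^bsub>E\<^esub> (s' - s) \<otimes>\<^bsub>E\<^esub> \<pi> [^]\<^bsub>E\<^esub> s"
    using assms(3) RE[OF pi_R] by (simp add: E.nat_pow_mult)
  then have "scalar (\<pi> [^]\<^bsub>E\<^esub> s') \<otimes>\<^bsub>A\<^esub> U = scalar (\<pi> [^]\<^bsub>E\<^esub> (s' - s)) \<otimes>\<^bsub>A\<^esub> (scalar (\<pi> [^]\<^bsub>E\<^esub> s) \<otimes>\<^bsub>A\<^esub> U)"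
    using assms(1) RE[OF pi_R] by (simp add: scalar_mult[symmetric] A.m_assoc scalar_closed)
  then show ?thesis using assms(2) scalar_L[OF pi_pow_R] L_props(6) by simp
qed

lemma denominator:
  assumes "U \<in> carrier A"
  shows "\<exists>s::nat. scalar (\<pi> [^]\<^bsub>E\<^esub> s) \<otimes>\<^bsub>A\<^esub> U \<in> L"
proof -
  let ?T = "{U \<in> carrier A. \<exists>s::nat. scalar (\<pi> [^]\<^bsub>E\<^esub> s) \<otimes>\<^bsub>A\<^esub> U \<in> L}"
  have "lin_comb A (scalar ` K) L \<subseteq> ?T"
  proof (rule A.lin_comb_subset)
    show "\<zero>\<^bsub>A\<^esub> \<in> ?T" using L_props(2) scalar_closed[OF RE[OF pi_pow_R]] by auto
    fix x y assume "x \<in> ?T" "y \<in> ?T"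
    then obtain s s' :: nat where s: "x \<in> carrier A" "y \<in> carrier A"
      "scalar (\<pi> [^]\<^bsub>E\<^esub> s) \<otimes>\<^bsub>A\<^esub> x \<in> L" "scalar (\<pi> [^]\<^bsub>E\<^esub> s') \<otimes>\<^bsub>A\<^esub> y \<in> L" by blast
    then have "scalar (\<pi> [^]\<^bsub>E\<^esub> (max s s')) \<otimes>\<^bsub>A\<^esub> x \<in> L" "scalar (\<pi> [^]\<^bsub>E\<^esub> (max s s')) \<otimes>\<^bsub>A\<^esub> y \<in> L"
      using scalar_pow_mono by auto
    then have "scalar (\<pi> [^]\<^bsub>E\<^esub> (max s s')) \<otimes>\<^bsub>A\<^esub> (x \<oplus>\<^bsub>A\<^esub> y) \<in> L"
      using s(1,2) L_props(7) scalar_closed[OF RE[OF pi_pow_R[of "max s s'"]]] by (simp add: A.r_distr)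
    then show "x \<oplus>\<^bsub>A\<^esub> y \<in> ?T" using s by blast
  next
    fix c l assume c: "c \<in> scalar ` K" and l: "l \<in> L"
    then obtain k where k: "k \<in> K" "c = scalar k" by blast
    obtain s :: nat where s: "\<pi> [^]\<^bsub>E\<^esub> s \<otimes>\<^bsub>E\<^esub> k \<in> R" using K_denominator[OF k(1)] by blast
    have "scalar (\<pi> [^]\<^bsub>E\<^esub> s) \<otimes>\<^bsub>A\<^esub> (c \<otimes>\<^bsub>A\<^esub> l) = scalar (\<pi> [^]\<^bsub>E\<^esub> s \<otimes>\<^bsub>E\<^esub> k) \<otimes>\<^bsub>A\<^esub> l"
      using KE[OF k(1)] RE[OF pi_pow_R[of s]] LA[OF l]
      by (simp add: k(2) scalar_mult[symmetric] scalar_closed A.m_assoc)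
    also have "\<dots> \<in> L" using L_props(6) scalar_L[OF s] l by blast
    finally show "c \<otimes>\<^bsub>A\<^esub> l \<in> ?T" using k KE LA[OF l] scalar_closed by blast
  qed auto
  then show ?thesis using assms L_order by (auto simp: order_def)
qed

lemma denominator_finite:
  assumes "finite F" "F \<subseteq> carrier A"
  shows "\<exists>s::nat. \<forall>U\<in>F. scalar (\<pi> [^]\<^bsub>E\<^esub> s) \<otimes>\<^bsub>A\<^esub> U \<in> L"
  using assms
proof (induction F)
  case (insert U F)
  then obtain s s' :: nat where s: "\<forall>U\<in>F. scalar (\<pi> [^]\<^bsub>E\<^esub> s) \<otimes>\<^bsub>A\<^esub> U \<in> L" "scalar (\<pi> [^]\<^bsub>E\<^esub> s') \<otimes>\<^bsub>A\<^esub> U \<in> L"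
    using denominator[of U] by auto
  then have "\<forall>U\<in>insert U F. scalar (\<pi> [^]\<^bsub>E\<^esub> (max s s')) \<otimes>\<^bsub>A\<^esub> U \<in> L"
    using insert.prems scalar_pow_mono[of _ s "max s s'"] scalar_pow_mono[of _ s' "max s s'"] by auto
  then show ?case by blast
qed auto

lemma Dl_generators: "\<exists>B. finite B \<and> B \<subseteq> Dl \<and> Dl = lin_comb E R B"
  using Dl_order by (auto simp: order_def)

text \<open>\<open>Dl\<close> is finitely generated over \<open>R\<close>, so one power of
  \<open>\<pi>\<close> serves all matrix positions and all elements of \<open>Dl\<close>. This power
  is the factor \<open>c\<close> of the column lattice below.\<close>

lemma denominator_elt:
  "\<exists>s::nat. \<forall>i<n. \<forall>j<n. \<forall>w\<in>Dl. elt i j (\<pi> [^]\<^bsub>E\<^esub> s \<otimes>\<^bsub>E\<^esub> w) \<in> L"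
proof -
  obtain B where B: "finite B" "B \<subseteq> Dl" "Dl = lin_comb E R B" using Dl_generators by blast
  have BE: "b \<in> carrier E" if "b \<in> B" for b using that B(2) DlE by blast
  have fin: "finite ((\<lambda>(i, j, b). elt i j b) ` ({..<n} \<times> {..<n} \<times> B))" using B(1) by simp
  obtain s :: nat where s: "\<And>i j b. i < n \<Longrightarrow> j < n \<Longrightarrow> b \<in> B \<Longrightarrow> scalar (\<pi> [^]\<^bsub>E\<^esub> s) \<otimes>\<^bsub>A\<^esub> elt i j b \<in> L"
  proof -
    have "(\<lambda>(i, j, b). elt i j b) ` ({..<n} \<times> {..<n} \<times> B) \<subseteq> carrier A" using BE elt_closed by auto
    from denominator_finite[OF fin this] obtain s :: nat
      where "\<forall>U\<in>(\<lambda>(i, j, b). elt i j b) ` ({..<n} \<times> {..<n} \<times> B). scalar (\<pi> [^]\<^bsub>E\<^esub> s) \<otimes>\<^bsub>A\<^esub> U \<in> L" by blast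
    then show thesis using that[of s] by auto
  qed
  have ps: "\<pi> [^]\<^bsub>E\<^esub> s \<in> carrier E" using RE pi_pow_R by blast
  have "elt i j (\<pi> [^]\<^bsub>E\<^esub> s \<otimes>\<^bsub>E\<^esub> w) \<in> L" if ij: "i < n" "j < n" and w: "w \<in> Dl" for i j w
  proof -
    let ?T = "{w \<in> carrier E. elt i j (\<pi> [^]\<^bsub>E\<^esub> s \<otimes>\<^bsub>E\<^esub> w) \<in> L}"
    have "lin_comb E R B \<subseteq> ?T"
    proof (rule E.lin_comb_subset)
      show "\<zero>\<^bsub>E\<^esub> \<in> ?T" using ps by (simp add: elt_zero L_props(2))
      fix x y assume "x \<in> ?T" "y \<in> ?T"
      then show "x \<oplus>\<^bsub>E\<^esub> y \<in> ?T" using ps L_props(7) by (auto simp: E.r_distr elt_add[symmetric])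
    next
      fix c b assume c: "c \<in> R" and b: "b \<in> B"
      have "\<pi> [^]\<^bsub>E\<^esub> s \<otimes>\<^bsub>E\<^esub> (c \<otimes>\<^bsub>E\<^esub> b) = c \<otimes>\<^bsub>E\<^esub> (\<pi> [^]\<^bsub>E\<^esub> s \<otimes>\<^bsub>E\<^esub> b)"
        using R_central[OF c ps] RE[OF c] BE[OF b] ps by (simp add: E.m_assoc[symmetric])
      then have "elt i j (\<pi> [^]\<^bsub>E\<^esub> s \<otimes>\<^bsub>E\<^esub> (c \<otimes>\<^bsub>E\<^esub> b)) = scalar c \<otimes>\<^bsub>A\<^esub> (scalar (\<pi> [^]\<^bsub>E\<^esub> s) \<otimes>\<^bsub>A\<^esub> elt i j b)"
        using RE[OF c] BE[OF b] ps ij by (simp add: scalar_elt)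
      then show "c \<otimes>\<^bsub>E\<^esub> b \<in> ?T"
        using s[OF ij b] L_props(6)[OF scalar_L[OF c]] RE[OF c] BE[OF b] by simp
    qed auto
    then show ?thesis using w B(3) by blast
  qed
  then show ?thesis by blast
qed

end

locale order_denominator = order_setup E R K Dl L n \<pi>
  for E :: "'e ring" and R K Dl :: "'e set" and L :: "(nat \<Rightarrow> nat \<Rightarrow> 'e) set" and n :: nat and \<pi> :: 'e +
  fixes s :: nat
  assumes s: "i < n \<Longrightarrow> j < n \<Longrightarrow> w \<in> Dl \<Longrightarrow> elt i j (\<pi> [^]\<^bsub>E\<^esub> s \<otimes>\<^bsub>E\<^esub> w) \<in> L"
begin

abbreviation c where "c \<equiv> \<pi> [^]\<^bsub>E\<^esub> s"

lemma c_E: "c \<in> carrier E"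
  using RE pi_pow_R by blast

lemma c_central: "x \<in> carrier E \<Longrightarrow> c \<otimes>\<^bsub>E\<^esub> x = x \<otimes>\<^bsub>E\<^esub> c"
  using R_central pi_pow_R by blast

definition c_inv where "c_inv = pi_inv [^]\<^bsub>E\<^esub> s"

lemma c_inv_E: "c_inv \<in> carrier E"
  by (simp add: c_inv_def pi_inv)

lemma pi_inv_pow_central: "x \<in> carrier E \<Longrightarrow> pi_inv [^]\<^bsub>E\<^esub> (k::nat) \<otimes>\<^bsub>E\<^esub> x = x \<otimes>\<^bsub>E\<^esub> pi_inv [^]\<^bsub>E\<^esub> k"
proof (induction k)
  case (Suc k)
  have "pi_inv [^]\<^bsub>E\<^esub> Suc k \<otimes>\<^bsub>E\<^esub> x = pi_inv [^]\<^bsub>E\<^esub> k \<otimes>\<^bsub>E\<^esub> x \<otimes>\<^bsub>E\<^esub> pi_inv"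
    using Suc.prems pi_inv(1) by (simp add: E.m_assoc pi_inv_central)
  then show ?case using Suc pi_inv(1) by (simp add: E.m_assoc)
qed simp

lemma c_inv_central: "x \<in> carrier E \<Longrightarrow> c_inv \<otimes>\<^bsub>E\<^esub> x = x \<otimes>\<^bsub>E\<^esub> c_inv"
  unfolding c_inv_def by (rule pi_inv_pow_central)

lemma c_c_inv: "c \<otimes>\<^bsub>E\<^esub> c_inv = \<one>\<^bsub>E\<^esub>"
proof -
  have "\<pi> [^]\<^bsub>E\<^esub> k \<otimes>\<^bsub>E\<^esub> pi_inv [^]\<^bsub>E\<^esub> k = \<one>\<^bsub>E\<^esub>" for k :: nat
  proof (induction k)
    case (Suc k)
    note p = RE[OF pi_R] pi_inv(1) RE[OF pi_pow_R[of k]]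
    have "\<pi> [^]\<^bsub>E\<^esub> Suc k \<otimes>\<^bsub>E\<^esub> pi_inv [^]\<^bsub>E\<^esub> Suc k = \<pi> [^]\<^bsub>E\<^esub> k \<otimes>\<^bsub>E\<^esub> (\<pi> \<otimes>\<^bsub>E\<^esub> (pi_inv [^]\<^bsub>E\<^esub> k \<otimes>\<^bsub>E\<^esub> pi_inv))"
      using p by (simp add: E.m_assoc)
    also have "\<dots> = \<pi> [^]\<^bsub>E\<^esub> k \<otimes>\<^bsub>E\<^esub> pi_inv [^]\<^bsub>E\<^esub> k \<otimes>\<^bsub>E\<^esub> (\<pi> \<otimes>\<^bsub>E\<^esub> pi_inv)"
      using p R_central[OF pi_R, of "pi_inv [^]\<^bsub>E\<^esub> k"]
        E.m_assoc[of \<pi> "pi_inv [^]\<^bsub>E\<^esub> k" pi_inv] E.m_assoc[of "pi_inv [^]\<^bsub>E\<^esub> k" \<pi> pi_inv]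
        E.m_assoc[of "\<pi> [^]\<^bsub>E\<^esub> k" "pi_inv [^]\<^bsub>E\<^esub> k" "\<pi> \<otimes>\<^bsub>E\<^esub> pi_inv"] by simp
    finally show ?case using Suc pi_inv by simp
  qed simp
  then show ?thesis by (simp add: c_inv_def)
qed

lemma c_inv_c: "c_inv \<otimes>\<^bsub>E\<^esub> c = \<one>\<^bsub>E\<^esub>"
  using c_c_inv c_central[OF c_inv_E] by simp

text \<open>The column lattice \<open>c \<Delta>\<^sup>n\<close>, embedded in the first column. The factor \<open>c\<close> puts it inside \<open>L\<close>, where it is
  a left ideal and hence projective.\<close>

definition M0 where
  "M0 = {W \<in> carrier A. (\<forall>i<n. \<exists>w\<in>Dl. W i 0 = c \<otimes>\<^bsub>E\<^esub> w) \<and> (\<forall>i<n. \<forall>j<n. j \<noteq> 0 \<longrightarrow> W i j = \<zero>\<^bsub>E\<^esub>)}"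

lemma M0_A: "W \<in> M0 \<Longrightarrow> W \<in> carrier A"
  by (simp add: M0_def)

lemma cDl_closed:
  "\<zero>\<^bsub>E\<^esub> \<in> (\<lambda>w. c \<otimes>\<^bsub>E\<^esub> w) ` Dl" "(\<lambda>w. c \<otimes>\<^bsub>E\<^esub> w) ` Dl \<subseteq> carrier E"
  "x \<in> (\<lambda>w. c \<otimes>\<^bsub>E\<^esub> w) ` Dl \<Longrightarrow> y \<in> (\<lambda>w. c \<otimes>\<^bsub>E\<^esub> w) ` Dl \<Longrightarrow> x \<oplus>\<^bsub>E\<^esub> y \<in> (\<lambda>w. c \<otimes>\<^bsub>E\<^esub> w) ` Dl"
  "a \<in> Dl \<Longrightarrow> x \<in> (\<lambda>w. c \<otimes>\<^bsub>E\<^esub> w) ` Dl \<Longrightarrow> a \<otimes>\<^bsub>E\<^esub> x \<in> (\<lambda>w. c \<otimes>\<^bsub>E\<^esub> w) ` Dl"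
proof -
  show "\<zero>\<^bsub>E\<^esub> \<in> (\<lambda>w. c \<otimes>\<^bsub>E\<^esub> w) ` Dl" using Dl_props(2) c_E by (intro image_eqI[of _ _ "\<zero>\<^bsub>E\<^esub>"]) auto
  show "(\<lambda>w. c \<otimes>\<^bsub>E\<^esub> w) ` Dl \<subseteq> carrier E" using DlE c_E by auto
  assume "x \<in> (\<lambda>w. c \<otimes>\<^bsub>E\<^esub> w) ` Dl"
  then obtain x' where x: "x' \<in> Dl" "x = c \<otimes>\<^bsub>E\<^esub> x'" by blast
  show "x \<oplus>\<^bsub>E\<^esub> y \<in> (\<lambda>w. c \<otimes>\<^bsub>E\<^esub> w) ` Dl" if yD: "y \<in> (\<lambda>w. c \<otimes>\<^bsub>E\<^esub> w) ` Dl"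
  proof -
    obtain y' where y: "y' \<in> Dl" "y = c \<otimes>\<^bsub>E\<^esub> y'" using yD by blast
    then show ?thesis using x Dl_props(7)[OF x(1) y(1)] DlE c_E
      by (intro image_eqI[of _ _ "x' \<oplus>\<^bsub>E\<^esub> y'"]) (auto simp: E.r_distr)
  qed
  show "a \<otimes>\<^bsub>E\<^esub> x \<in> (\<lambda>w. c \<otimes>\<^bsub>E\<^esub> w) ` Dl" if a: "a \<in> Dl"
    using x Dl_props(6)[OF a x(1)] DlE[OF a] DlE[OF x(1)] c_E c_central[OF DlE[OF a]]
    by (intro image_eqI[of _ _ "a \<otimes>\<^bsub>E\<^esub> x'"]) (auto simp: E.m_assoc[symmetric])
qed

lemma M0_iff: "W \<in> M0 \<longleftrightarrow> W \<in> carrier A \<and> (\<forall>i<n. W i 0 \<in> (\<lambda>w. c \<otimes>\<^bsub>E\<^esub> w) ` Dl) \<and>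
    (\<forall>i<n. \<forall>j<n. j \<noteq> 0 \<longrightarrow> W i j = \<zero>\<^bsub>E\<^esub>)"
  by (auto simp: M0_def)

lemma M0_zero: "\<zero>\<^bsub>A\<^esub> \<in> M0"
  using cDl_closed(1) A.zero_closed unfolding M0_iff by (simp add: mat_ring_simps(5) n_pos)

lemma M0_add: "U \<in> M0 \<Longrightarrow> V \<in> M0 \<Longrightarrow> U \<oplus>\<^bsub>A\<^esub> V \<in> M0"
  using cDl_closed(3) by (auto simp: M0_iff mat_ring_simps(3) n_pos)

lemma L_entry: "a \<in> L \<Longrightarrow> i < n \<Longrightarrow> j < n \<Longrightarrow> a i j \<in> Dl"
  using L_sub by (auto simp: mat_carrier_def)

lemma L_M0: "a \<in> L \<Longrightarrow> W \<in> M0 \<Longrightarrow> a \<otimes>\<^bsub>A\<^esub> W \<in> M0"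
proof -
  assume a: "a \<in> L" and W: "W \<in> M0"
  note aA = LA[OF a]
  have "(a \<otimes>\<^bsub>A\<^esub> W) i 0 \<in> (\<lambda>w. c \<otimes>\<^bsub>E\<^esub> w) ` Dl" if "i < n" for i
  proof -
    have "(a \<otimes>\<^bsub>A\<^esub> W) i 0 = finsum E (\<lambda>k. a i k \<otimes>\<^bsub>E\<^esub> W k 0) {..<n}" using that n_pos by (simp add: mat_ring_simps)
    also have "\<dots> \<in> (\<lambda>w. c \<otimes>\<^bsub>E\<^esub> w) ` Dl"
      using W L_entry[OF a that] by (intro E.finsum_mem cDl_closed) (auto simp: M0_iff)
    finally show ?thesis .
  qed
  moreover have "(a \<otimes>\<^bsub>A\<^esub> W) i j = \<zero>\<^bsub>E\<^esub>" if "i < n" "j < n" "j \<noteq> 0" for i j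
  proof -
    have "(a \<otimes>\<^bsub>A\<^esub> W) i j = finsum E (\<lambda>k. a i k \<otimes>\<^bsub>E\<^esub> W k j) {..<n}" using that by (simp add: mat_ring_simps)
    also have "\<dots> = finsum E (\<lambda>k. \<zero>\<^bsub>E\<^esub>) {..<n}"
      using that W DlE L_entry[OF a] by (intro E.finsum_cong') (auto simp: M0_iff)
    finally show ?thesis by simp
  qed
  ultimately show ?thesis using aA M0_A[OF W] by (auto simp: M0_iff)
qed

lemma elt_M0: "i < n \<Longrightarrow> w \<in> Dl \<Longrightarrow> elt i 0 (c \<otimes>\<^bsub>E\<^esub> w) \<in> M0"
  using cDl_closed(1) c_E DlE by (auto simp: M0_iff elt_closed E.single_entry n_pos)

lemma M0_decomp: "W \<in> M0 \<Longrightarrow> W = finsum A (\<lambda>i. elt i 0 (W i 0)) {..<n}"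
proof (rule A_eqI)
  assume W: "W \<in> M0"
  have WE: "W i 0 \<in> carrier E" if "i < n" for i using A_entry[OF M0_A[OF W] that n_pos] .
  then have elts: "(\<lambda>i. elt i 0 (W i 0)) \<in> {..<n} \<rightarrow> carrier A" using elt_closed by auto
  show "W \<in> carrier A" by (rule M0_A) fact
  show "finsum A (\<lambda>i. elt i 0 (W i 0)) {..<n} \<in> carrier A" using elts by (rule A.finsum_closed)
  fix k l assume kl: "k < n" "l < n"
  have "finsum A (\<lambda>i. elt i 0 (W i 0)) {..<n} k l = finsum E (\<lambda>i. elt i 0 (W i 0) k l) {..<n}"
    using elts kl by (intro E.mat_finsum_entry) (auto simp: carrier_A)
  also have "\<dots> = finsum E (\<lambda>i. if k = i then (if l = 0 then W i 0 else \<zero>\<^bsub>E\<^esub>) else \<zero>\<^bsub>E\<^esub>) {..<n}"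
    using kl WE by (intro E.finsum_cong') (auto simp: E.single_entry)
  also have "\<dots> = (if l = 0 then W k 0 else \<zero>\<^bsub>E\<^esub>)"
    using kl WE by (intro E.finsum_singleton) auto
  also have "\<dots> = W k l" using W kl by (auto simp: M0_iff)
  finally show "W k l = finsum A (\<lambda>i. elt i 0 (W i 0)) {..<n} k l" ..
qed

lemma M0_L: "W \<in> M0 \<Longrightarrow> W \<in> L"
proof -
  assume W: "W \<in> M0"
  have "finsum A (\<lambda>i. elt i 0 (W i 0)) {..<n} \<in> L"
    using W s n_pos L_props by (intro A.finsum_mem) (auto simp: M0_iff)
  then show ?thesis using M0_decomp[OF W] by simp
qed

lemma M0_left_ideal: "left_ideal M0 S"
  by (rule S.left_idealI) (auto simp: M0_L M0_zero M0_add L_M0)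

text \<open>The generators are columns with a single entry \<open>c b\<close>, for \<open>b\<close>
  in a finite generating set of \<open>Dl\<close>. Coefficients are functions vanishing off
  \<open>G\<close>, the shape of the elements of \<open>free_mod\<close> below.\<close>

lemma M0_generators:
  "\<exists>G. finite G \<and> G \<subseteq> M0 \<and> (\<forall>W\<in>M0. \<exists>f. (\<forall>x\<in>G. f x \<in> L) \<and> (\<forall>x. x \<notin> G \<longrightarrow> f x = \<zero>\<^bsub>A\<^esub>) \<and>
     W = finsum A (\<lambda>x. f x \<otimes>\<^bsub>A\<^esub> x) G)"
proof -
  obtain B where B: "finite B" "B \<subseteq> Dl" "Dl = lin_comb E R B" using Dl_generators by blast
  define G where "G = (\<lambda>(i, b). elt i 0 (c \<otimes>\<^bsub>E\<^esub> b)) ` ({..<n} \<times> B)"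
  have G: "finite G" "G \<subseteq> M0" using B elt_M0 by (auto simp: G_def)
  have GA: "x \<in> carrier A" if "x \<in> G" for x using that G M0_A by blast
  define T where "T = {W \<in> carrier A. \<exists>f. (\<forall>x\<in>G. f x \<in> L) \<and> (\<forall>x. x \<notin> G \<longrightarrow> f x = \<zero>\<^bsub>A\<^esub>) \<and> W = finsum A (\<lambda>x. f x \<otimes>\<^bsub>A\<^esub> x) G}"
  have T_zero: "\<zero>\<^bsub>A\<^esub> \<in> T"
  proof -
    have "finsum A (\<lambda>x. \<zero>\<^bsub>A\<^esub> \<otimes>\<^bsub>A\<^esub> x) G = finsum A (\<lambda>x. \<zero>\<^bsub>A\<^esub>) G" using GA by (intro A.finsum_cong') auto
    then show ?thesis unfolding T_def using L_props(2) by (intro CollectI conjI exI[of _ "\<lambda>_. \<zero>\<^bsub>A\<^esub>"]) auto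
  qed
  have T_add: "U \<oplus>\<^bsub>A\<^esub> V \<in> T" if U: "U \<in> T" and V: "V \<in> T" for U V
  proof -
    obtain f where f: "\<forall>x\<in>G. f x \<in> L" "\<forall>x. x \<notin> G \<longrightarrow> f x = \<zero>\<^bsub>A\<^esub>" "U = finsum A (\<lambda>x. f x \<otimes>\<^bsub>A\<^esub> x) G"
      using U unfolding T_def by blast
    obtain g where g: "\<forall>x\<in>G. g x \<in> L" "\<forall>x. x \<notin> G \<longrightarrow> g x = \<zero>\<^bsub>A\<^esub>" "V = finsum A (\<lambda>x. g x \<otimes>\<^bsub>A\<^esub> x) G"
      using V unfolding T_def by blast
    have "U \<oplus>\<^bsub>A\<^esub> V = finsum A (\<lambda>x. f x \<otimes>\<^bsub>A\<^esub> x \<oplus>\<^bsub>A\<^esub> g x \<otimes>\<^bsub>A\<^esub> x) G"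
      unfolding f(3) g(3) using f(1) g(1) LA GA by (intro A.finsum_addf[symmetric]) auto
    also have "\<dots> = finsum A (\<lambda>x. (f x \<oplus>\<^bsub>A\<^esub> g x) \<otimes>\<^bsub>A\<^esub> x) G"
      using f(1) g(1) LA GA by (intro A.finsum_cong') (auto simp: A.l_distr)
    finally have eq: "U \<oplus>\<^bsub>A\<^esub> V = finsum A (\<lambda>x. (f x \<oplus>\<^bsub>A\<^esub> g x) \<otimes>\<^bsub>A\<^esub> x) G" .
    have "U \<oplus>\<^bsub>A\<^esub> V \<in> carrier A" using U V by (simp add: T_def)
    moreover have "(\<forall>x\<in>G. f x \<oplus>\<^bsub>A\<^esub> g x \<in> L) \<and> (\<forall>x. x \<notin> G \<longrightarrow> f x \<oplus>\<^bsub>A\<^esub> g x = \<zero>\<^bsub>A\<^esub>)"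
      using f(1,2) g(1,2) L_props(7) by simp
    ultimately show ?thesis unfolding T_def using eq
      by (intro CollectI conjI exI[of _ "\<lambda>x. f x \<oplus>\<^bsub>A\<^esub> g x"]) simp_all
  qed
  have T_gen: "scalar a \<otimes>\<^bsub>A\<^esub> x \<in> T" if a: "a \<in> R" and x: "x \<in> G" for a x
  proof -
    have "finsum A (\<lambda>y. (if x = y then scalar a else \<zero>\<^bsub>A\<^esub>) \<otimes>\<^bsub>A\<^esub> y) G = finsum A (\<lambda>y. if x = y then scalar a \<otimes>\<^bsub>A\<^esub> y else \<zero>\<^bsub>A\<^esub>) G"
      using GA LA[OF scalar_L[OF a]] by (intro A.finsum_cong') auto
    also have "\<dots> = scalar a \<otimes>\<^bsub>A\<^esub> x"
      using x G(1) GA LA[OF scalar_L[OF a]] by (intro A.finsum_singleton) auto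
    finally show ?thesis unfolding T_def using x a scalar_L L_props(2) LA[OF scalar_L[OF a]] GA
      by (intro CollectI conjI exI[of _ "\<lambda>y. if x = y then scalar a else \<zero>\<^bsub>A\<^esub>"]) auto
  qed
  have elt_T: "elt i 0 (c \<otimes>\<^bsub>E\<^esub> w) \<in> T" if i: "i < n" and w: "w \<in> Dl" for i w
  proof -
    let ?T = "{w \<in> carrier E. elt i 0 (c \<otimes>\<^bsub>E\<^esub> w) \<in> T}"
    have "lin_comb E R B \<subseteq> ?T"
    proof (rule E.lin_comb_subset)
      show "\<zero>\<^bsub>E\<^esub> \<in> ?T" using c_E by (simp add: elt_zero T_zero)
      fix x y assume "x \<in> ?T" "y \<in> ?T"
      then show "x \<oplus>\<^bsub>E\<^esub> y \<in> ?T" using c_E T_add by (auto simp: E.r_distr elt_add[symmetric])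
    next
      fix a b assume a: "a \<in> R" and b: "b \<in> B"
      have bE: "b \<in> carrier E" using b B(2) DlE by blast
      have "c \<otimes>\<^bsub>E\<^esub> (a \<otimes>\<^bsub>E\<^esub> b) = a \<otimes>\<^bsub>E\<^esub> (c \<otimes>\<^bsub>E\<^esub> b)"
        using c_central[OF RE[OF a]] RE[OF a] bE c_E by (simp add: E.m_assoc[symmetric])
      then have "elt i 0 (c \<otimes>\<^bsub>E\<^esub> (a \<otimes>\<^bsub>E\<^esub> b)) = scalar a \<otimes>\<^bsub>A\<^esub> elt i 0 (c \<otimes>\<^bsub>E\<^esub> b)"
        using RE[OF a] bE c_E i n_pos by (simp add: scalar_elt)
      moreover have "elt i 0 (c \<otimes>\<^bsub>E\<^esub> b) \<in> G"
        unfolding G_def using i b by (intro image_eqI[of _ _ "(i, b)"]) auto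
      ultimately show "a \<otimes>\<^bsub>E\<^esub> b \<in> ?T" using T_gen[OF a] RE[OF a] bE by simp
    qed auto
    then show ?thesis using w B(3) by blast
  qed
  have "W \<in> T" if W: "W \<in> M0" for W
  proof -
    have "finsum A (\<lambda>i. elt i 0 (W i 0)) {..<n} \<in> T"
      using W elt_T T_zero T_add by (intro A.finsum_mem) (auto simp: M0_iff T_def)
    then show ?thesis using M0_decomp[OF W] by simp
  qed
  then show ?thesis using G by (intro exI[of _ G]) (auto simp: T_def)
qed

text \<open>The hypothesis \<open>projective_lmod\<close> only lifts along modules of functions on the given module, so the
  free module is taken on a generating subset of \<open>M0\<close>.\<close>

definition free_mod :: "(nat \<Rightarrow> nat \<Rightarrow> 'e) set \<Rightarrow> (nat \<Rightarrow> nat \<Rightarrow> 'e, (nat \<Rightarrow> nat \<Rightarrow> 'e) \<Rightarrow> nat \<Rightarrow> nat \<Rightarrow> 'e) module" where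
  "free_mod G = \<lparr>carrier = {f. (\<forall>x\<in>G. f x \<in> L) \<and> (\<forall>x. x \<notin> G \<longrightarrow> f x = \<zero>\<^bsub>A\<^esub>)}, monoid.mult = undefined, monoid.one = undefined,
    ring.zero = (\<lambda>x. \<zero>\<^bsub>A\<^esub>), ring.add = (\<lambda>f g x. f x \<oplus>\<^bsub>A\<^esub> g x), module.smult = (\<lambda>a f x. a \<otimes>\<^bsub>A\<^esub> f x)\<rparr>"

lemma free_mod_mem: "f \<in> carrier (free_mod G) \<longleftrightarrow> (\<forall>x\<in>G. f x \<in> L) \<and> (\<forall>x. x \<notin> G \<longrightarrow> f x = \<zero>\<^bsub>A\<^esub>)"
  by (simp add: free_mod_def)

lemma free_mod_L: "f \<in> carrier (free_mod G) \<Longrightarrow> f x \<in> L"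
  using L_props(2) by (cases "x \<in> G") (auto simp: free_mod_mem)

lemma free_mod_ops:
  "\<zero>\<^bsub>free_mod G\<^esub> = (\<lambda>x. \<zero>\<^bsub>A\<^esub>)" "f \<oplus>\<^bsub>free_mod G\<^esub> g = (\<lambda>x. f x \<oplus>\<^bsub>A\<^esub> g x)" "a \<odot>\<^bsub>free_mod G\<^esub> f = (\<lambda>x. a \<otimes>\<^bsub>A\<^esub> f x)"
  by (simp_all add: free_mod_def)

lemma free_mod_lmod: "lmod S (free_mod G)"
proof -
  have "abelian_group (free_mod G)"
  proof (rule abelian_groupI)
    fix f assume f: "f \<in> carrier (free_mod G)"
    then show "\<exists>g\<in>carrier (free_mod G). g \<oplus>\<^bsub>free_mod G\<^esub> f = \<zero>\<^bsub>free_mod G\<^esub>"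
      using L_props(5) LA[OF free_mod_L[OF f]]
      by (intro bexI[of _ "\<lambda>x. \<ominus>\<^bsub>A\<^esub> f x"]) (auto simp: free_mod_ops free_mod_mem A.l_neg)
  next
    fix f g assume "f \<in> carrier (free_mod G)" "g \<in> carrier (free_mod G)"
    then show "f \<oplus>\<^bsub>free_mod G\<^esub> g \<in> carrier (free_mod G)" "f \<oplus>\<^bsub>free_mod G\<^esub> g = g \<oplus>\<^bsub>free_mod G\<^esub> f"
      using L_props(7) LA free_mod_L by (auto simp: free_mod_ops free_mod_mem intro!: A.a_comm)
  next
    fix f g h assume "f \<in> carrier (free_mod G)" "g \<in> carrier (free_mod G)" "h \<in> carrier (free_mod G)"
    then show "f \<oplus>\<^bsub>free_mod G\<^esub> g \<oplus>\<^bsub>free_mod G\<^esub> h = f \<oplus>\<^bsub>free_mod G\<^esub> (g \<oplus>\<^bsub>free_mod G\<^esub> h)"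
      using LA free_mod_L by (auto simp: free_mod_ops intro!: A.a_assoc)
  next
    fix f assume "f \<in> carrier (free_mod G)"
    then show "\<zero>\<^bsub>free_mod G\<^esub> \<oplus>\<^bsub>free_mod G\<^esub> f = f" using LA[OF free_mod_L] by (simp add: free_mod_ops)
  qed (use L_props(2) in \<open>simp add: free_mod_ops free_mod_mem\<close>)
  moreover have "a \<odot>\<^bsub>free_mod G\<^esub> f \<in> carrier (free_mod G)" if "a \<in> L" "f \<in> carrier (free_mod G)" for a f
    using that L_props(6) LA by (auto simp: free_mod_ops free_mod_mem)
  ultimately show ?thesis unfolding lmod_def using S_ring LA free_mod_L
    by (auto simp: free_mod_ops A.l_distr A.r_distr A.m_assoc)
qed

abbreviation q0 where "q0 \<equiv> elt 0 0 \<one>\<^bsub>E\<^esub>"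

text \<open>Projectivity splits the surjection from the free module, and the coordinates of the
  splitting \<open>h\<close> are linear maps from \<open>M0\<close> to \<open>L\<close>. Each is
  right multiplication by a matrix, which is read off from the value of \<open>h\<close> at a single
  element.\<close>

lemma dual_basis:
  "\<exists>nv v w. (\<forall>x<(nv::nat). v x \<in> M0 \<and> w x \<in> carrier A \<and> q0 \<otimes>\<^bsub>A\<^esub> w x = w x \<and> (\<forall>W\<in>M0. W \<otimes>\<^bsub>A\<^esub> w x \<in> L)) \<and>
    (\<Sum>x<nv. \<kappa> (w x) * \<kappa> (v x)) = \<kappa> q0"
proof -
  obtain G where G: "finite G" "G \<subseteq> M0" "\<And>W. W \<in> M0 \<Longrightarrow> \<exists>f. (\<forall>x\<in>G. f x \<in> L) \<and> (\<forall>x. x \<notin> G \<longrightarrow> f x = \<zero>\<^bsub>A\<^esub>) \<and>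
     W = finsum A (\<lambda>x. f x \<otimes>\<^bsub>A\<^esub> x) G" using M0_generators by blast
  have GA: "x \<in> carrier A" if "x \<in> G" for x using that G M0_A by blast
  let ?P = "ideal_mod S M0"
  define g where "g f = finsum A (\<lambda>x. f x \<otimes>\<^bsub>A\<^esub> x) G" for f
  have proj: "projective_lmod S ?P" using L_hered M0_left_ideal by (simp add: hereditary_def)
  have g_hom: "g \<in> lhom S (free_mod G) ?P"
    unfolding lhom_def
  proof (intro CollectI conjI ballI Pi_I)
    fix f assume f: "f \<in> carrier (free_mod G)"
    show "g f \<in> carrier ?P" unfolding g_def ideal_mod_simps
      using f G(1,2) M0_zero M0_add M0_A L_M0 by (intro A.finsum_mem) (auto simp: free_mod_mem)
    show "g (f \<oplus>\<^bsub>free_mod G\<^esub> h) = g f \<oplus>\<^bsub>?P\<^esub> g h" if h: "h \<in> carrier (free_mod G)" for h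
    proof -
      have "g (f \<oplus>\<^bsub>free_mod G\<^esub> h) = finsum A (\<lambda>x. f x \<otimes>\<^bsub>A\<^esub> x \<oplus>\<^bsub>A\<^esub> h x \<otimes>\<^bsub>A\<^esub> x) G"
        unfolding g_def free_mod_ops using f h LA free_mod_L GA by (intro A.finsum_cong') (auto simp: A.l_distr)
      also have "\<dots> = g f \<oplus>\<^bsub>A\<^esub> g h"
        unfolding g_def using f h LA free_mod_L GA by (intro A.finsum_addf) auto
      finally show ?thesis by simp
    qed
  next
    fix a f assume a: "a \<in> carrier S" and f: "f \<in> carrier (free_mod G)"
    have aA: "a \<in> carrier A" using a LA by simp
    have "g (a \<odot>\<^bsub>free_mod G\<^esub> f) = finsum A (\<lambda>x. a \<otimes>\<^bsub>A\<^esub> (f x \<otimes>\<^bsub>A\<^esub> x)) G"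
      unfolding g_def free_mod_ops using f aA LA[OF free_mod_L[OF f]] GA by (intro A.finsum_cong') (auto simp: A.m_assoc)
    also have "\<dots> = a \<otimes>\<^bsub>A\<^esub> g f"
      unfolding g_def using f aA LA[OF free_mod_L[OF f]] GA G(1) by (intro A.finsum_rdistr[symmetric]) auto
    finally show "g (a \<odot>\<^bsub>free_mod G\<^esub> f) = a \<odot>\<^bsub>?P\<^esub> g f" by simp
  qed
  have g_onto: "g ` carrier (free_mod G) = carrier ?P"
  proof
    show "g ` carrier (free_mod G) \<subseteq> carrier ?P" using g_hom by (auto simp: lhom_def)
    show "carrier ?P \<subseteq> g ` carrier (free_mod G)"
    proof
      fix W assume "W \<in> carrier ?P"
      then obtain f where "(\<forall>x\<in>G. f x \<in> L) \<and> (\<forall>x. x \<notin> G \<longrightarrow> f x = \<zero>\<^bsub>A\<^esub>)" "W = g f"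
        using G(3)[of W] by (auto simp: g_def)
      then show "W \<in> g ` carrier (free_mod G)" using free_mod_mem by blast
    qed
  qed
  have "(\<lambda>x. x) \<in> lhom S ?P ?P" by (simp add: lhom_def)
  then obtain h where h: "h \<in> lhom S ?P (free_mod G)" "\<And>x. x \<in> M0 \<Longrightarrow> g (h x) = x"
    using proj[unfolded projective_lmod_def, THEN conjunct2, rule_format, of "free_mod G" ?P g "\<lambda>x. x"]
      free_mod_lmod g_hom g_onto proj[unfolded projective_lmod_def, THEN conjunct1] by auto
  have hL: "h W x \<in> L" if "W \<in> M0" for W x using h(1) that free_mod_L by (auto simp: lhom_def)
  have h_smult: "h (a \<otimes>\<^bsub>A\<^esub> W) x = a \<otimes>\<^bsub>A\<^esub> h W x" if "a \<in> L" "W \<in> M0" for a W x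
    using h(1) that by (simp add: lhom_def free_mod_ops)
  \<comment> \<open>For \<open>W\<close> in \<open>M0\<close> the product \<open>W y0\<close> is
    \<open>c W\<close>, so linearity gives \<open>W * h y0 x = c * h W x\<close>. The value at
    \<open>y0\<close> therefore determines \<open>h\<close>, and \<open>\<phi> x\<close> is this
    value with \<open>c\<close> divided out.\<close>
  define y0 where "y0 = elt 0 0 c"
  have y0: "y0 \<in> M0" using elt_M0[OF n_pos Dl_props(3)] c_E by (simp add: y0_def)
  define \<phi> where "\<phi> x = elt 0 0 c_inv \<otimes>\<^bsub>A\<^esub> h y0 x" for x
  have ei: "elt 0 0 c_inv \<in> carrier A" "q0 \<in> carrier A" using c_inv_E elt_closed by auto
  have \<phi>A: "\<phi> x \<in> carrier A" for x unfolding \<phi>_def using ei LA[OF hL[OF y0]] by simp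
  have q0\<phi>: "q0 \<otimes>\<^bsub>A\<^esub> \<phi> x = \<phi> x" for x
    unfolding \<phi>_def using ei LA[OF hL[OF y0]] c_inv_E n_pos by (simp add: A.m_assoc[symmetric] elt_mult)
  have W\<phi>: "W \<otimes>\<^bsub>A\<^esub> \<phi> x \<in> L" if W: "W \<in> M0" for W x
  proof -
    note WA = M0_A[OF W] and WL = M0_L[OF W] and hA = LA[OF hL[OF y0]] LA[OF hL[OF W]]
    have sc: "scalar c \<in> L" "scalar c \<in> carrier A" "scalar c_inv \<in> carrier A"
      using scalar_L[OF pi_pow_R] c_E c_inv_E scalar_closed by auto
    have 1: "W \<otimes>\<^bsub>A\<^esub> y0 = scalar c \<otimes>\<^bsub>A\<^esub> W"
      using WA c_E W unfolding y0_def
      by (intro A_eqI) (auto simp: elt_closed scalar_closed A_mult_entries A_entry n_pos M0_iff c_central[OF A_entry[OF WA _ n_pos]])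
    have 2: "W \<otimes>\<^bsub>A\<^esub> elt 0 0 c_inv = scalar c_inv \<otimes>\<^bsub>A\<^esub> W"
      using WA c_inv_E W
      by (intro A_eqI) (auto simp: elt_closed scalar_closed A_mult_entries A_entry n_pos M0_iff c_inv_central[OF A_entry[OF WA _ n_pos]])
    have "W \<otimes>\<^bsub>A\<^esub> h y0 x = scalar c \<otimes>\<^bsub>A\<^esub> h W x"
      using h_smult[OF WL y0, of x] h_smult[OF sc(1) W, of x] by (simp add: 1)
    then have "W \<otimes>\<^bsub>A\<^esub> \<phi> x = (scalar c_inv \<otimes>\<^bsub>A\<^esub> scalar c) \<otimes>\<^bsub>A\<^esub> h W x"
      unfolding \<phi>_def using WA ei hA sc by (simp add: A.m_assoc[symmetric] 2) (simp add: A.m_assoc)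
    also have "\<dots> = h W x" using hA c_E c_inv_E by (simp add: scalar_mult c_inv_c scalar_one)
    finally show ?thesis using hL[OF W] by simp
  qed
  have sum: "(\<Sum>x\<in>G. \<kappa> (\<phi> x) * \<kappa> x) = \<kappa> q0"
  proof -
    have "(\<Sum>x\<in>G. \<kappa> (\<phi> x) * \<kappa> x) = \<kappa> (elt 0 0 c_inv) * (\<Sum>x\<in>G. \<kappa> (h y0 x \<otimes>\<^bsub>A\<^esub> x))"
      unfolding sum_distrib_left \<phi>_def using ei LA[OF hL[OF y0]] GA
      by (intro sum.cong) (auto simp: A.emb_mult mult.assoc)
    also have "(\<Sum>x\<in>G. \<kappa> (h y0 x \<otimes>\<^bsub>A\<^esub> x)) = \<kappa> (g (h y0))"
      unfolding g_def using LA[OF hL[OF y0]] GA by (intro A.emb_finsum[symmetric]) auto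
    also have "\<kappa> (elt 0 0 c_inv) * \<kappa> (g (h y0)) = \<kappa> q0"
      unfolding h(2)[OF y0] unfolding y0_def using ei c_E c_inv_E n_pos by (simp add: A.emb_mult[symmetric] elt_closed elt_mult c_inv_c)
    finally show ?thesis .
  qed
  obtain e where e: "bij_betw e {0..<card G} G" using ex_bij_betw_nat_finite[OF G(1)] by blast
  then have eG: "x < card G \<Longrightarrow> e x \<in> G" for x by (auto simp: bij_betw_def)
  have "(\<Sum>x<card G. \<kappa> (\<phi> (e x)) * \<kappa> (e x)) = \<kappa> q0"
    unfolding sum[symmetric] using e by (intro sum.reindex_bij_betw) (simp add: lessThan_atLeast0)
  then show ?thesis
    using eG G(2) \<phi>A q0\<phi> W\<phi> by (intro exI[of _ "card G"] exI[of _ e] exI[of _ "\<lambda>x. \<phi> (e x)"]) auto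
qed

end

section \<open>The tower of a normal hereditary order\<close>

context emb_ring
begin

lemma single_mult:
  assumes "i < n" "j < n" "k < n" "l < n" "a \<in> carrier A" "b \<in> carrier A"
  shows "single n A i j a \<otimes>\<^bsub>mat_ring n A\<^esub> single n A k l b = (if j = k then single n A i l (a \<otimes> b) else \<zero>\<^bsub>mat_ring n A\<^esub>)"
  by (rule mat_eqI[of _ n A])
    (use assms in \<open>auto simp: mat_ring_closed single_closed mat_mult_entries single_entry mat_ring_simps(5)\<close>)

lemma single_sum_one: "finsum (mat_ring n A) (\<lambda>i. single n A i i \<one>) {..<n} = \<one>\<^bsub>mat_ring n A\<^esub>"
proof -
  interpret M: ring "mat_ring n A" by (rule mat_ring_ring)
  have c: "(\<lambda>i. single n A i i \<one>) \<in> {..<n} \<rightarrow> mat_carrier n A" using single_closed by auto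
  show ?thesis
  proof (rule mat_eqI[of _ n A])
    show "finsum (mat_ring n A) (\<lambda>i. single n A i i \<one>) {..<n} \<in> mat_carrier n A"
      using M.finsum_closed[of "\<lambda>i. single n A i i \<one>" "{..<n}"] c by (simp add: mat_ring_simps)
    fix k l assume kl: "k < n" "l < n"
    have "finsum (mat_ring n A) (\<lambda>i. single n A i i \<one>) {..<n} k l = finsum A (\<lambda>i. single n A i i \<one> k l) {..<n}"
      using c kl by (intro mat_finsum_entry) auto
    also have "\<dots> = finsum A (\<lambda>i. if k = i then (if k = l then \<one> else \<zero>) else \<zero>) {..<n}"
      using kl by (intro finsum_cong') (auto simp: single_entry)
    also have "\<dots> = (if k = l then \<one> else \<zero>)" using kl by (intro finsum_singleton) auto
    finally show "finsum (mat_ring n A) (\<lambda>i. single n A i i \<one>) {..<n} k l = monoid.one (mat_ring n A) k l"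
      using kl by (simp add: mat_ring_simps)
  qed (rule mat_ring_closed)
qed

text \<open>Elementary matrices over \<open>D\<close> have these properties exactly, and they are
  pulled back along the surjection to the quotient by the radical. The last one expresses that a
  column of the matrix ring is simple.\<close>

lemma matrix_units_mod_radical:
  fixes D :: "'d ring"
  assumes D: "division_ring D" and iso: "A Quot (jrad A) \<simeq> mat_ring r D"
  shows "\<exists>e. (\<forall>i<r. \<forall>j<r. e i j \<in> carrier A) \<and>
    (\<forall>i<r. \<forall>j<r. \<forall>k<r. \<forall>l<r. e i j \<otimes> e k l \<ominus> (if j = k then e i l else \<zero>) \<in> jrad A) \<and>
    \<one> \<ominus> finsum A (\<lambda>i. e i i) {..<r} \<in> jrad A \<and>
    (\<forall>a\<in>carrier A. \<forall>i<r. a \<otimes> e i i \<notin> jrad A \<longrightarrow> (\<exists>\<delta>\<in>carrier A. \<delta> \<otimes> (a \<otimes> e i i) \<ominus> e i i \<in> jrad A))"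
proof -
  let ?M = "mat_ring r D"
  interpret D: emb_ring D using D by (simp add: emb_ring_def division_ring_def)
  interpret J: ideal "jrad A" A by (rule jrad_ideal)
  obtain h where h: "h \<in> ring_hom (A Quot (jrad A)) ?M" "bij_betw h (carrier (A Quot (jrad A))) (carrier ?M)"
    using iso by (auto simp: is_ring_iso_def ring_iso_def)
  define \<rho> where "\<rho> a = h (jrad A +> a)" for a
  have "h \<circ> (+>) (jrad A) \<in> ring_hom A ?M" by (rule ring_hom_trans[OF J.rcos_ring_hom h(1)])
  then have "\<rho> \<in> ring_hom A ?M" by (simp add: \<rho>_def[abs_def] comp_def)
  then interpret \<rho>: ring_hom_ring A ?M \<rho>
    by (intro ring_hom_ringI2 ring_axioms D.mat_ring_ring)
  have Qc: "carrier (A Quot (jrad A)) = (\<lambda>a. jrad A +> a) ` carrier A"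
    by (auto simp: FactRing_def A_RCOSETS_def')
  have ker: "x \<in> jrad A" if "x \<in> carrier A" "\<rho> x = \<zero>\<^bsub>?M\<^esub>" for x
  proof -
    have "h (jrad A +> x) = h (jrad A +> \<zero>)" using that \<rho>.hom_zero by (simp add: \<rho>_def)
    then have "jrad A +> x = jrad A +> \<zero>"
      using h(2) that(1) by (auto simp: bij_betw_def inj_on_def Qc)
    moreover have "jrad A +> \<zero> = jrad A" using J.a_rcos_const J.zero_closed by blast
    ultimately have "jrad A +> x = jrad A" by (rule trans)
    then show ?thesis by (rule a_coset_join1[OF _ that(1) J.a_subgroup])
  qed
  have minus: "x \<ominus> y \<in> jrad A" if "x \<in> carrier A" "y \<in> carrier A" "\<rho> x = \<rho> y" for x y
    using that by (intro ker) (auto simp: a_minus_def \<rho>.S.r_neg)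
  have surj: "\<exists>x\<in>carrier A. \<rho> x = U" if "U \<in> mat_carrier r D" for U
  proof -
    have "h ` carrier (A Quot (jrad A)) = mat_carrier r D" using h(2) by (simp add: bij_betw_def mat_ring_simps)
    then have "U \<in> h ` carrier (A Quot (jrad A))" using that by (simp only:)
    then show ?thesis unfolding Qc \<rho>_def by blast
  qed
  have "\<exists>x\<in>carrier A. \<rho> x = single r D i j \<one>\<^bsub>D\<^esub>" for i j by (rule surj) (simp add: D.single_closed)
  then obtain e where e: "\<And>i j. e i j \<in> carrier A" "\<And>i j. \<rho> (e i j) = single r D i j \<one>\<^bsub>D\<^esub>" by metis
  have e_mult: "e i j \<otimes> e k l \<ominus> (if j = k then e i l else \<zero>) \<in> jrad A" if "i < r" "j < r" "k < r" "l < r" for i j k l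
    using that by (intro minus) (auto simp: e D.single_mult)
  have e_sum: "\<one> \<ominus> finsum A (\<lambda>i. e i i) {..<r} \<in> jrad A"
    by (intro minus) (auto simp: e comp_def D.single_sum_one \<rho>.hom_one)
  have "\<exists>\<delta>\<in>carrier A. \<delta> \<otimes> (a \<otimes> e i i) \<ominus> e i i \<in> jrad A"
    if a: "a \<in> carrier A" and i: "i < r" and notin: "a \<otimes> e i i \<notin> jrad A" for a i
  proof -
    have \<rho>a: "\<rho> a \<in> mat_carrier r D" using \<rho>.hom_closed[OF a] by (simp add: mat_ring_simps)
    have entry: "(\<rho> a \<otimes>\<^bsub>?M\<^esub> single r D i i \<one>\<^bsub>D\<^esub>) k l = (if l = i then \<rho> a k i else \<zero>\<^bsub>D\<^esub>)" if "k < r" "l < r" for k l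
      using that i \<rho>a mat_carrierD[OF \<rho>a that(1) i] by (simp add: D.mat_mult_entries)
    have "\<exists>k<r. \<rho> a k i \<noteq> \<zero>\<^bsub>D\<^esub>"
    proof (rule ccontr)
      assume "\<not> ?thesis"
      then have "\<rho> a \<otimes>\<^bsub>?M\<^esub> single r D i i \<one>\<^bsub>D\<^esub> = \<zero>\<^bsub>?M\<^esub>"
        using \<rho>a by (intro mat_eqI[of _ r D]) (auto simp: D.mat_ring_closed D.single_closed entry mat_ring_simps(5))
      then show False using notin ker[of "a \<otimes> e i i"] a by (simp add: e)
    qed
    then obtain k where k: "k < r" "\<rho> a k i \<noteq> \<zero>\<^bsub>D\<^esub>" by blast
    have "\<rho> a k i \<in> Units D"
      using D k mat_carrierD[OF \<rho>a k(1) i] by (simp add: division_ring_def)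
    then obtain b where b: "b \<in> carrier D" "b \<otimes>\<^bsub>D\<^esub> \<rho> a k i = \<one>\<^bsub>D\<^esub>" by (auto simp: Units_def)
    \<comment> \<open>The matrix with \<open>b\<close> at position \<open>(i, k)\<close> moves the
      nonzero entry of column \<open>i\<close> from row \<open>k\<close> to row \<open>i\<close> and
      scales it to 1.\<close>
    obtain \<delta> where \<delta>: "\<delta> \<in> carrier A" "\<rho> \<delta> = single r D i k b"
      using surj[OF D.single_closed[OF b(1)]] by blast
    have "single r D i k b \<otimes>\<^bsub>?M\<^esub> (\<rho> a \<otimes>\<^bsub>?M\<^esub> single r D i i \<one>\<^bsub>D\<^esub>) = single r D i i \<one>\<^bsub>D\<^esub>"
    proof (rule mat_eqI[of _ r D])
      fix x y assume xy: "x < r" "y < r"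
      have "(single r D i k b \<otimes>\<^bsub>?M\<^esub> (\<rho> a \<otimes>\<^bsub>?M\<^esub> single r D i i \<one>\<^bsub>D\<^esub>)) x y =
          (if x = i then b \<otimes>\<^bsub>D\<^esub> (\<rho> a \<otimes>\<^bsub>?M\<^esub> single r D i i \<one>\<^bsub>D\<^esub>) k y else \<zero>\<^bsub>D\<^esub>)"
        using xy k(1) b(1) \<rho>a by (intro D.mat_mult_entries(1)) (auto simp: D.mat_ring_closed D.single_closed)
      then show "(single r D i k b \<otimes>\<^bsub>?M\<^esub> (\<rho> a \<otimes>\<^bsub>?M\<^esub> single r D i i \<one>\<^bsub>D\<^esub>)) x y = single r D i i \<one>\<^bsub>D\<^esub> x y"
        using xy k(1) b by (simp add: entry D.single_entry)
    qed (use \<rho>a b in \<open>auto simp: D.mat_ring_closed D.single_closed\<close>)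
    then have "\<delta> \<otimes> (a \<otimes> e i i) \<ominus> e i i \<in> jrad A"
      using a \<delta> by (intro minus) (auto simp: e)
    then show ?thesis using \<delta> by blast
  qed
  then show ?thesis using e(1) e_mult e_sum by (intro exI[of _ e]) blast
qed

end

locale tower_setup = order_denominator E R K Dl L n \<pi> s
  for E :: "'e ring" and R K Dl :: "'e set" and L :: "(nat \<Rightarrow> nat \<Rightarrow> 'e) set" and n :: nat and \<pi> :: 'e and s :: nat +
  fixes D :: "'d ring" and r d :: nat and y y' :: "nat \<Rightarrow> nat \<Rightarrow> 'e"
  assumes D_div: "division_ring D"
    and Delta_mod_rad: "restr E Dl Quot jrad (restr E Dl) \<simeq> mat_ring r D"
    and L_simples: "num_simple_classes (restr (mat_ring n E) L) d"
    and y_jrad: "y \<in> jrad S" and y'_A: "y' \<in> carrier A"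
    and y_y': "y \<otimes>\<^bsub>A\<^esub> y' = \<one>\<^bsub>A\<^esub>" "y' \<otimes>\<^bsub>A\<^esub> y = \<one>\<^bsub>A\<^esub>"
    and jrad_y: "jrad S = (\<lambda>a. y \<otimes>\<^bsub>A\<^esub> a) ` L"
    and y_conj: "a \<in> L \<Longrightarrow> y \<otimes>\<^bsub>A\<^esub> a \<otimes>\<^bsub>A\<^esub> y' \<in> L" "a \<in> L \<Longrightarrow> y' \<otimes>\<^bsub>A\<^esub> a \<otimes>\<^bsub>A\<^esub> y \<in> L"
begin

abbreviation Q where "Q \<equiv> restr E Dl"

lemma Q_ring: "ring Q"
  using E.restr_ring[OF Dl_subring] .

sublocale Q: emb_ring Q
  by (simp add: emb_ring_def Q_ring)

lemma y_A: "y \<in> carrier A"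
  using y_jrad jrad_S_L LA by blast

text \<open>Powers are taken in the unit group of \<open>A\<close>, where negative exponents
  exist.\<close>

definition t :: "int \<Rightarrow> (nat \<Rightarrow> nat \<Rightarrow> 'e) all_rings" where
  "t k = \<kappa> (y [^]\<^bsub>units_of A\<^esub> k)"

lemma y_unit: "y \<in> Units A"
  using y_A y'_A y_y' by (auto simp: Units_def)

lemma t_simps: "t 0 = \<kappa> \<one>\<^bsub>A\<^esub>" "t (i + j) = t i * t j" "t (int k) = \<kappa> (y [^]\<^bsub>A\<^esub> k)" "t 1 = \<kappa> y" "t (- 1) = \<kappa> y'"
  "t i \<in> \<kappa> ` carrier A"
proof -
  interpret U: group "units_of A" by (rule A.units_group)
  have yU: "y \<in> carrier (units_of A)" using y_unit by (simp add: units_of_carrier)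
  have UA: "x \<in> carrier (units_of A) \<Longrightarrow> x \<in> carrier A" for x by (simp add: units_of_carrier A.Units_closed)
  show "t 0 = \<kappa> \<one>\<^bsub>A\<^esub>" by (simp add: t_def units_of_one)
  show tp: "t (i + j) = t i * t j" for i j
    using U.int_pow_closed[OF yU] UA yU
    by (simp add: t_def U.int_pow_mult A.emb_mult[symmetric] units_of_mult)
  show t_nat: "t (int k) = \<kappa> (y [^]\<^bsub>A\<^esub> k)" for k
  proof -
    have "y [^]\<^bsub>units_of A\<^esub> k = y [^]\<^bsub>A\<^esub> k"
      by (induction k) (simp_all add: units_of_one units_of_mult)
    then show ?thesis by (simp add: t_def int_pow_int)
  qed
  show "t 1 = \<kappa> y" using t_nat[of 1] y_A by simp
  then have eq: "\<kappa> y * t (- 1) = \<kappa> \<one>\<^bsub>A\<^esub>" using tp[of 1 "- 1"] by (simp add: t_def units_of_one)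
  show tA: "t i \<in> \<kappa> ` carrier A" for i using U.int_pow_closed[OF yU] UA by (auto simp: t_def)
  obtain x where x: "x \<in> carrier A" "t (- 1) = \<kappa> x" using tA by blast
  have "\<kappa> y' = \<kappa> y' * (\<kappa> y * t (- 1))" using y'_A by (simp add: eq kappa_one)
  also have "\<dots> = t (- 1)"
    using y'_A y_A x by (simp add: mult.assoc[symmetric] A.emb_mult[symmetric] y_y' A.m_assoc[symmetric])
  finally show "t (- 1) = \<kappa> y'" ..
qed

lemma t_conj_L: "a \<in> \<kappa> ` L \<Longrightarrow> t i * a * t (- i) \<in> \<kappa> ` L"
proof (induction i arbitrary: a rule: int_induct[where k = 0])
  case base
  then show ?case using kappa_one LA by (auto simp: t_simps(1))
next
  case (step1 i)
  obtain x where x: "x \<in> L" "a = \<kappa> x" using step1 by blast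
  have "t 1 * a * t (- 1) = \<kappa> (y \<otimes>\<^bsub>A\<^esub> x \<otimes>\<^bsub>A\<^esub> y')" using y_A y'_A LA[OF x(1)] by (simp add: t_simps x A.emb_mult)
  then have "t i * (t 1 * a * t (- 1)) * t (- i) \<in> \<kappa> ` L" using step1 y_conj(1)[OF x(1)] by simp
  moreover have "- (i + 1) = - 1 + - i" by simp
  then have "t (- (i + 1)) = t (- 1) * t (- i)" by (simp only: t_simps(2))
  ultimately show ?case by (simp only: t_simps(2) mult.assoc)
next
  case (step2 i)
  obtain x where x: "x \<in> L" "a = \<kappa> x" using step2 by blast
  have "t (- 1) * a * t 1 = \<kappa> (y' \<otimes>\<^bsub>A\<^esub> x \<otimes>\<^bsub>A\<^esub> y)" using y_A y'_A LA[OF x(1)] by (simp add: t_simps x A.emb_mult)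
  then have "t i * (t (- 1) * a * t 1) * t (- i) \<in> \<kappa> ` L" using step2 y_conj(2)[OF x(1)] by simp
  moreover have "i - 1 = i + - 1" "- (i - 1) = 1 + - i" by simp_all
  then have "t (i - 1) = t i * t (- 1)" "t (- (i - 1)) = t 1 * t (- i)" by (simp_all only: t_simps(2))
  ultimately show ?case by (simp only: mult.assoc)
qed

lemma M0_additive: "additive (\<kappa> ` M0)"
proof (rule A.emb_additive)
  fix W assume W: "W \<in> M0"
  have m: "\<ominus>\<^bsub>A\<^esub> \<one>\<^bsub>A\<^esub> \<in> L" using L_props(3,5) by blast
  have "\<ominus>\<^bsub>A\<^esub> W = \<ominus>\<^bsub>A\<^esub> \<one>\<^bsub>A\<^esub> \<otimes>\<^bsub>A\<^esub> W" using M0_A[OF W] by (simp add: A.l_minus)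
  then show "\<ominus>\<^bsub>A\<^esub> W \<in> M0" using L_M0[OF m W] by simp
qed (use M0_A M0_zero M0_add in auto)

text \<open>\<open>M0\<close> sits in the first column, so its endomorphisms are matrices at
  position \<open>(0, 0)\<close> acting from the right.\<close>

definition \<eta> where "\<eta> a = \<kappa> (elt 0 0 a)"

lemma eta_mult: "a \<in> carrier E \<Longrightarrow> b \<in> carrier E \<Longrightarrow> \<eta> a * \<eta> b = \<eta> (a \<otimes>\<^bsub>E\<^esub> b)"
  unfolding \<eta>_def using n_pos by (simp add: A.emb_mult[symmetric] elt_closed elt_mult)

lemma eta_add: "a \<in> carrier E \<Longrightarrow> b \<in> carrier E \<Longrightarrow> \<eta> a + \<eta> b = \<eta> (a \<oplus>\<^bsub>E\<^esub> b)"
  unfolding \<eta>_def by (simp add: A.emb_add[symmetric] elt_closed elt_add)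

lemma eta_zero: "\<eta> \<zero>\<^bsub>E\<^esub> = 0"
  unfolding \<eta>_def by (simp add: elt_zero A.emb_zero)

lemma eta_minus: "a \<in> carrier E \<Longrightarrow> b \<in> carrier E \<Longrightarrow> \<eta> a - \<eta> b = \<eta> (a \<ominus>\<^bsub>E\<^esub> b)"
  unfolding \<eta>_def by (simp add: A.emb_minus[symmetric] elt_closed elt_minus)

lemma eta_inj: "a \<in> carrier E \<Longrightarrow> b \<in> carrier E \<Longrightarrow> \<eta> a = \<eta> b \<longleftrightarrow> a = b"
  unfolding \<eta>_def using elt_inj[OF n_pos n_pos] by (auto simp: A.emb_inj elt_closed)

lemma kappa_M0_sum: "W \<in> M0 \<Longrightarrow> \<kappa> W = (\<Sum>i<n. \<kappa> (elt i 0 (W i 0)))"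
proof -
  assume W: "W \<in> M0"
  have "(\<lambda>i. elt i 0 (W i 0)) \<in> {..<n} \<rightarrow> carrier A" using A_entry[OF M0_A[OF W] _ n_pos] elt_closed by auto
  from A.emb_finsum[OF this] show ?thesis using M0_decomp[OF W] by simp
qed

lemma lattice_tower_exists:
  "\<exists>nv v w. lattice_tower (\<kappa> \<one>\<^bsub>A\<^esub>) (\<eta> \<one>\<^bsub>E\<^esub>) (\<kappa> ` L) (\<kappa> ` M0) nv v w t"
proof -
  obtain nv v w where dual: "\<forall>x<(nv::nat). v x \<in> M0 \<and> w x \<in> carrier A \<and> q0 \<otimes>\<^bsub>A\<^esub> w x = w x \<and> (\<forall>W\<in>M0. W \<otimes>\<^bsub>A\<^esub> w x \<in> L)"
    "(\<Sum>x<nv. \<kappa> (w x) * \<kappa> (v x)) = \<kappa> q0" using dual_basis by blast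
  have q0A: "q0 \<in> carrier A" by (simp add: elt_closed)
  have "lattice_tower (\<kappa> \<one>\<^bsub>A\<^esub>) (\<eta> \<one>\<^bsub>E\<^esub>) (\<kappa> ` L) (\<kappa> ` M0) nv (\<lambda>x. \<kappa> (v x)) (\<lambda>x. \<kappa> (w x)) t"
  proof
    show "additive (\<kappa> ` L)" by (rule kappa_L_add)
    show "additive (\<kappa> ` M0)" by (rule M0_additive)
    show "\<kappa> \<one>\<^bsub>A\<^esub> \<in> \<kappa> ` L" using L_props(3) by blast
    show "a * b \<in> \<kappa> ` L" if "a \<in> \<kappa> ` L" "b \<in> \<kappa> ` L" for a b
      using that L_props(6) LA by (auto simp: A.emb_mult[symmetric])
    show "\<kappa> \<one>\<^bsub>A\<^esub> * a = a" "a * \<kappa> \<one>\<^bsub>A\<^esub> = a" if "a \<in> \<kappa> ` L" for a using that kappa_one LA by auto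
    show "a * m \<in> \<kappa> ` M0" if "a \<in> \<kappa> ` L" "m \<in> \<kappa> ` M0" for a m
      using that L_M0 LA M0_A by (auto simp: A.emb_mult[symmetric])
    show "\<kappa> \<one>\<^bsub>A\<^esub> * m = m" if "m \<in> \<kappa> ` M0" for m using that kappa_one M0_A by auto
    show "m * \<eta> \<one>\<^bsub>E\<^esub> = m" if m: "m \<in> \<kappa> ` M0" for m
    proof -
      obtain W where W: "W \<in> M0" "m = \<kappa> W" using m by blast
      have "W \<otimes>\<^bsub>A\<^esub> q0 = W"
        using M0_A[OF W(1)] W(1) by (intro A_eqI) (auto simp: elt_closed A_mult_entries A_entry n_pos M0_iff)
      then show ?thesis using M0_A[OF W(1)] q0A by (simp add: W \<eta>_def A.emb_mult[symmetric])
    qed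
    show "\<eta> \<one>\<^bsub>E\<^esub> * \<eta> \<one>\<^bsub>E\<^esub> = \<eta> \<one>\<^bsub>E\<^esub>" by (simp add: eta_mult)
    show "\<kappa> (v x) \<in> \<kappa> ` M0" if "x < nv" for x using dual that by blast
    show "\<eta> \<one>\<^bsub>E\<^esub> * \<kappa> (w x) = \<kappa> (w x)" "\<kappa> (w x) * \<kappa> \<one>\<^bsub>A\<^esub> = \<kappa> (w x)" if "x < nv" for x
      using dual(1) that q0A by (auto simp: \<eta>_def A.emb_mult[symmetric])
    show "m * \<kappa> (w x) \<in> \<kappa> ` L" if "x < nv" "m \<in> \<kappa> ` M0" for x m
      using dual(1) that M0_A by (auto simp: A.emb_mult[symmetric])
    show "(\<Sum>x<nv. \<kappa> (w x) * \<kappa> (v x)) = \<eta> \<one>\<^bsub>E\<^esub>" using dual(2) by (simp add: \<eta>_def)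
    show "t 0 = \<kappa> \<one>\<^bsub>A\<^esub>" "t (i + j) = t i * t j" for i j by (rule t_simps)+
    show "t i * a * t (- i) \<in> \<kappa> ` L" if "a \<in> \<kappa> ` L" for a i using that by (rule t_conj_L)
    have "{x \<in> \<kappa> ` L. \<forall>a\<in>\<kappa> ` L. \<exists>y\<in>\<kappa> ` L. y * (\<kappa> \<one>\<^bsub>A\<^esub> - a * x) = \<kappa> \<one>\<^bsub>A\<^esub>} = \<kappa> ` jrad S"
      by (auto simp: jrad_S_iff)
    also have "\<dots> = (\<lambda>a. t 1 * a) ` \<kappa> ` L"
      unfolding jrad_y image_image using y_A LA by (intro image_cong) (auto simp: t_simps A.emb_mult)
    finally show "{x \<in> \<kappa> ` L. \<forall>a\<in>\<kappa> ` L. \<exists>y\<in>\<kappa> ` L. y * (\<kappa> \<one>\<^bsub>A\<^esub> - a * x) = \<kappa> \<one>\<^bsub>A\<^esub>} = (\<lambda>a. t 1 * a) ` \<kappa> ` L" .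
  qed
  then show ?thesis by blast
qed

lemma jrad_Q_iff:
  "a \<in> jrad Q \<longleftrightarrow> a \<in> Dl \<and> (\<forall>b\<in>Dl. \<exists>x\<in>Dl. \<eta> x * (\<eta> \<one>\<^bsub>E\<^esub> - \<eta> b * \<eta> a) = \<eta> \<one>\<^bsub>E\<^esub>)"
proof -
  have "x \<otimes>\<^bsub>E\<^esub> (\<one>\<^bsub>E\<^esub> \<ominus>\<^bsub>Q\<^esub> b \<otimes>\<^bsub>E\<^esub> a) = \<one>\<^bsub>E\<^esub> \<longleftrightarrow> \<eta> x * (\<eta> \<one>\<^bsub>E\<^esub> - \<eta> b * \<eta> a) = \<eta> \<one>\<^bsub>E\<^esub>"
    if "a \<in> Dl" "b \<in> Dl" "x \<in> Dl" for b x
    using that DlE Dl_props E.restr_minus[OF Dl_subring, of "\<one>\<^bsub>E\<^esub>" "b \<otimes>\<^bsub>E\<^esub> a"]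
    by (simp add: eta_mult eta_minus eta_inj)
  then show ?thesis unfolding Q.jrad_iff by auto
qed

lemma elt_mult_M0: "W \<in> M0 \<Longrightarrow> w \<in> Dl \<Longrightarrow> W \<otimes>\<^bsub>A\<^esub> elt 0 0 w \<in> M0"
proof -
  assume W: "W \<in> M0" and w: "w \<in> Dl"
  note WA = M0_A[OF W] and wE = DlE[OF w]
  have "W i 0 \<otimes>\<^bsub>E\<^esub> w \<in> (\<lambda>w. c \<otimes>\<^bsub>E\<^esub> w) ` Dl" if i: "i < n" for i
  proof -
    obtain v where v: "v \<in> Dl" "W i 0 = c \<otimes>\<^bsub>E\<^esub> v" using W i by (auto simp: M0_iff)
    then have "W i 0 \<otimes>\<^bsub>E\<^esub> w = c \<otimes>\<^bsub>E\<^esub> (v \<otimes>\<^bsub>E\<^esub> w)" using wE DlE c_E by (simp add: E.m_assoc)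
    then show ?thesis using Dl_props(6)[OF v(1) w] by blast
  qed
  then show ?thesis
    using WA wE W by (auto simp: M0_iff elt_closed A_mult_entries n_pos)
qed

text \<open>Moving the first column of \<open>W\<close> to position \<open>j\<close> keeps the
  factor \<open>c\<close> that brings it into \<open>L\<close>. So this row lies in the dual of
  \<open>M0\<close>, and together with the columns \<open>elt j 0 c\<close> such rows put the scalar
  \<open>c\<close> into the trace ideal.\<close>

lemma elt_row_dual:
  assumes "W \<in> M0" "j < n"
  shows "W \<otimes>\<^bsub>A\<^esub> elt 0 j \<one>\<^bsub>E\<^esub> \<in> L"
proof -
  have WE: "W i 0 \<in> carrier E" if "i < n" for i using A_entry[OF M0_A[OF assms(1)] that n_pos] .
  have "\<kappa> W * \<kappa> (elt 0 j \<one>\<^bsub>E\<^esub>) = (\<Sum>i<n. \<kappa> (elt i j (W i 0)))"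
    unfolding kappa_M0_sum[OF assms(1)] sum_distrib_right
    using WE n_pos assms(2) by (intro sum.cong) (auto simp: A.emb_mult[symmetric] elt_closed elt_mult)
  also have "\<dots> \<in> \<kappa> ` L"
  proof (rule additive_sum[OF kappa_L_add])
    fix i assume "i \<in> {..<n}"
    then obtain w where "w \<in> Dl" "W i 0 = c \<otimes>\<^bsub>E\<^esub> w" using assms(1) by (auto simp: M0_iff)
    then show "\<kappa> (elt i j (W i 0)) \<in> \<kappa> ` L" using s[of i j w] assms(2) \<open>i \<in> {..<n}\<close> by auto
  qed
  finally obtain x where "x \<in> L" "\<kappa> W * \<kappa> (elt 0 j \<one>\<^bsub>E\<^esub>) = \<kappa> x" by blast
  moreover from this have "W \<otimes>\<^bsub>A\<^esub> elt 0 j \<one>\<^bsub>E\<^esub> = x"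
    using M0_A[OF assms(1)] LA by (intro A.emb_eqI) (auto simp: elt_closed A.emb_mult)
  ultimately show ?thesis by simp
qed

lemma normal_tower_exists:
  "\<exists>nv v w e g Max rep. normal_tower (\<kappa> \<one>\<^bsub>A\<^esub>) (\<eta> \<one>\<^bsub>E\<^esub>) (\<kappa> ` L) (\<kappa> ` M0) nv v w t r d n e g Max rep \<and>
    lattice_tower.D (\<eta> \<one>\<^bsub>E\<^esub>) (\<kappa> ` M0) = \<eta> ` Dl \<and> lattice_tower.P (\<eta> \<one>\<^bsub>E\<^esub>) (\<kappa> ` M0) = \<eta> ` jrad Q"
proof -
  obtain nv v w where "lattice_tower (\<kappa> \<one>\<^bsub>A\<^esub>) (\<eta> \<one>\<^bsub>E\<^esub>) (\<kappa> ` L) (\<kappa> ` M0) nv v w t"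
    using lattice_tower_exists by blast
  then interpret T: lattice_tower "\<kappa> \<one>\<^bsub>A\<^esub>" "\<eta> \<one>\<^bsub>E\<^esub>" "\<kappa> ` L" "\<kappa> ` M0" nv v w t .
  have q: "\<eta> \<one>\<^bsub>E\<^esub> = \<kappa> q0" by (simp add: \<eta>_def)
  have q0A: "q0 \<in> carrier A" by (simp add: elt_closed)
  have y0: "elt 0 0 c \<in> M0" using elt_M0[OF n_pos Dl_props(3)] c_E by simp
  have TD: "T.D = \<eta> ` Dl"
  proof (intro equalityI subsetI)
    fix h assume h: "h \<in> T.D"
    \<comment> \<open>By \<open>emb_ideal\<close> the product \<open>q h\<close> comes from a
      matrix; compressing it to the corner shows that \<open>h\<close> is a single element
      \<open>b\<close> of \<open>E\<close>. Applying \<open>h\<close> to \<open>elt 0 0 c\<close> in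
      \<open>M0\<close> and cancelling \<open>c\<close> places \<open>b\<close> in
      \<open>Dl\<close>.\<close>
    obtain U where U: "U \<in> carrier A" "\<kappa> q0 * h = \<kappa> U" using A.emb_ideal(1)[OF q0A, of h] by blast
    define b where "b = U 0 0"
    have bE: "b \<in> carrier E" using A_entry[OF U(1) n_pos n_pos] by (simp add: b_def)
    have "\<eta> \<one>\<^bsub>E\<^esub> * h = h" "h * \<eta> \<one>\<^bsub>E\<^esub> = h" using h by (simp_all add: T.D_def)
    then have "h = \<kappa> q0 * (\<kappa> q0 * h) * \<kappa> q0" by (simp add: q)
    also have "\<dots> = \<eta> b" using U q0A by (simp add: A.emb_mult[symmetric] corner b_def \<eta>_def)
    finally have hb: "h = \<eta> b" .
    have "\<kappa> (elt 0 0 c) * h \<in> \<kappa> ` M0" using h y0 by (simp add: T.D_def)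
    then obtain W where W: "W \<in> M0" "\<kappa> (elt 0 0 c) * h = \<kappa> W" by blast
    have "\<kappa> W = \<kappa> (elt 0 0 (c \<otimes>\<^bsub>E\<^esub> b))"
      unfolding W(2)[symmetric] hb \<eta>_def using c_E bE n_pos by (simp add: A.emb_mult[symmetric] elt_closed elt_mult)
    then have "W = elt 0 0 (c \<otimes>\<^bsub>E\<^esub> b)" using M0_A[OF W(1)] c_E bE by (intro A.emb_eqI) (auto intro: elt_closed)
    then have "W 0 0 = c \<otimes>\<^bsub>E\<^esub> b" by (simp add: E.single_entry n_pos)
    then obtain b' where b': "b' \<in> Dl" "c \<otimes>\<^bsub>E\<^esub> b = c \<otimes>\<^bsub>E\<^esub> b'" using W(1) n_pos by (auto simp: M0_iff)
    then have "c_inv \<otimes>\<^bsub>E\<^esub> (c \<otimes>\<^bsub>E\<^esub> b) = c_inv \<otimes>\<^bsub>E\<^esub> (c \<otimes>\<^bsub>E\<^esub> b')" by simp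
    then have "b = b'" using bE DlE[OF b'(1)] c_E c_inv_E by (simp add: E.m_assoc[symmetric] c_inv_c)
    then show "h \<in> \<eta> ` Dl" using hb b' by blast
  next
    fix h assume "h \<in> \<eta> ` Dl"
    then obtain b where b: "b \<in> Dl" "h = \<eta> b" by blast
    have "W * h \<in> \<kappa> ` M0" if "W \<in> \<kappa> ` M0" for W
      using that elt_mult_M0[OF _ b(1)] M0_A DlE[OF b(1)]
      by (auto simp: b(2) \<eta>_def A.emb_mult[symmetric] elt_closed)
    then show "h \<in> T.D" using DlE[OF b(1)] by (simp add: T.D_def b(2) eta_mult)
  qed
  have TP: "T.P = \<eta> ` jrad Q"
    unfolding T.P_def TD by (auto simp: jrad_Q_iff)
  have TJ: "T.J = \<kappa> ` jrad S"
    unfolding T.J_def by (auto simp: jrad_S_iff)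
  obtain e where e_facts: "\<forall>i<r. \<forall>j<r. e i j \<in> Dl"
    "\<forall>i<r. \<forall>j<r. \<forall>k<r. \<forall>l<r. e i j \<otimes>\<^bsub>E\<^esub> e k l \<ominus>\<^bsub>Q\<^esub> (if j = k then e i l else \<zero>\<^bsub>E\<^esub>) \<in> jrad Q"
    "\<one>\<^bsub>E\<^esub> \<ominus>\<^bsub>Q\<^esub> finsum Q (\<lambda>i. e i i) {..<r} \<in> jrad Q"
    "\<forall>a\<in>Dl. \<forall>i<r. a \<otimes>\<^bsub>E\<^esub> e i i \<notin> jrad Q \<longrightarrow> (\<exists>\<delta>\<in>Dl. \<delta> \<otimes>\<^bsub>E\<^esub> (a \<otimes>\<^bsub>E\<^esub> e i i) \<ominus>\<^bsub>Q\<^esub> e i i \<in> jrad Q)"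
    using Q.matrix_units_mod_radical[OF D_div Delta_mod_rad] unfolding restr_simps
    by (elim exE conjE) (rule that)
  note e = e_facts(1)[rule_format] e_facts(2)[rule_format] e_facts(3) e_facts(4)[rule_format]
  have eta_in_P: "\<eta> a \<in> T.P \<longleftrightarrow> a \<in> jrad Q" if "a \<in> Dl" for a
    unfolding TP using that DlE Q.jrad_carrier by (auto simp: eta_inj)
  have eta_minus_Q: "\<eta> a - \<eta> b = \<eta> (a \<ominus>\<^bsub>Q\<^esub> b)" if "a \<in> Dl" "b \<in> Dl" for a b
    using that DlE by (simp add: E.restr_minus[OF Dl_subring] eta_minus)
  obtain rep0 where rep_facts: "\<forall>i<d. maximal_left_ideal (rep0 i) S"
    "\<forall>i<d. \<forall>j<d. \<forall>a\<in>L. i \<noteq> j \<longrightarrow> (\<forall>x\<in>rep0 i. x \<otimes>\<^bsub>A\<^esub> a \<in> rep0 j) \<longrightarrow> a \<in> rep0 j"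
    "\<forall>I. maximal_left_ideal I S \<longrightarrow> (\<exists>i<d. \<exists>a\<in>L. a \<notin> rep0 i \<and> (\<forall>x\<in>I. x \<otimes>\<^bsub>A\<^esub> a \<in> rep0 i))"
    using S.num_simple_classes_representatives[OF L_simples] unfolding restr_simps
    by (elim exE conjE) (rule that)
  note rep0 = rep_facts(1)[rule_format] rep_facts(2)[rule_format] rep_facts(3)[rule_format]
  have max_L: "I \<subseteq> L" if "maximal_left_ideal I S" for I
    using S.left_idealD(1)[OF S.maximal_left_idealD(1)[OF that]] by simp
  have kappa_mem: "\<kappa> x \<in> \<kappa> ` I \<longleftrightarrow> x \<in> I" if "x \<in> carrier A" "I \<subseteq> carrier A" for x I
    using that A.emb_inj by blast
  have kappa_memL: "\<kappa> x \<in> \<kappa> ` I \<longleftrightarrow> x \<in> I" if "x \<in> L" "maximal_left_ideal I S" for x I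
    using that max_L LA by (intro kappa_mem) blast+
  let ?Max = "(\<lambda>I. \<kappa> ` I) ` {I. maximal_left_ideal I S}"
  have "normal_tower (\<kappa> \<one>\<^bsub>A\<^esub>) (\<eta> \<one>\<^bsub>E\<^esub>) (\<kappa> ` L) (\<kappa> ` M0) nv v w t r d n (\<lambda>i j. \<eta> (e i j))
    (\<lambda>i. \<kappa> (elt i 0 c)) ?Max (\<lambda>i. \<kappa> ` rep0 i)"
  proof
    fix i j k l assume "i < r" "j < r"
    then show "\<eta> (e i j) \<in> T.D" using e(1) by (auto simp: TD)
    assume "k < r" "l < r"
    then have "\<eta> (e i j) * \<eta> (e k l) - \<eta> (if j = k then e i l else \<zero>\<^bsub>E\<^esub>) = \<eta> (e i j \<otimes>\<^bsub>E\<^esub> e k l \<ominus>\<^bsub>Q\<^esub> (if j = k then e i l else \<zero>\<^bsub>E\<^esub>))"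
      using \<open>i < r\<close> \<open>j < r\<close> e(1) DlE Dl_props(2,6) by (subst eta_minus_Q[symmetric]) (auto simp: eta_mult)
    then show "\<eta> (e i j) * \<eta> (e k l) - (if j = k then \<eta> (e i l) else 0) \<in> T.P"
      using e(2)[OF \<open>i < r\<close> \<open>j < r\<close> \<open>k < r\<close> \<open>l < r\<close>] by (auto simp: TP eta_zero)
  next
    have eQ: "(\<lambda>i. e i i) \<in> {..<r} \<rightarrow> Dl" using e(1) by auto
    have "(\<Sum>i<r. \<eta> (e i i)) = \<eta> (finsum E (\<lambda>i. e i i) {..<r})"
    proof -
      have "(\<Sum>i\<in>I. \<eta> (f i)) = \<eta> (finsum E f I)" if "finite I" "f \<in> I \<rightarrow> carrier E" for f and I :: "nat set"
        using that by (induction I) (auto simp: eta_zero eta_add)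
      then show ?thesis using eQ DlE by (auto simp: Pi_iff)
    qed
    also have "finsum E (\<lambda>i. e i i) {..<r} = finsum Q (\<lambda>i. e i i) {..<r}"
      by (rule E.restr_finsum[OF Dl_subring eQ, symmetric])
    finally have "(\<Sum>i<r. \<eta> (e i i)) = \<eta> (finsum Q (\<lambda>i. e i i) {..<r})" .
    moreover have "finsum Q (\<lambda>i. e i i) {..<r} \<in> Dl" using Q.finsum_closed[of "\<lambda>i. e i i" "{..<r}"] eQ by simp
    ultimately show "\<eta> \<one>\<^bsub>E\<^esub> - (\<Sum>i<r. \<eta> (e i i)) \<in> T.P"
      using e(3) Dl_props(3) by (simp add: eta_minus_Q TP)
  next
    fix a i assume a: "a \<in> T.D" and i: "i < r" and notin: "a * \<eta> (e i i) \<notin> T.P"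
    obtain b where b: "b \<in> Dl" "a = \<eta> b" using a TD by blast
    note bE = DlE[OF b(1)] DlE[OF e(1)[OF i i]] and be = Dl_props(6)[OF b(1) e(1)[OF i i]]
    have "b \<otimes>\<^bsub>E\<^esub> e i i \<notin> jrad Q" using notin bE be by (simp add: b(2) eta_mult eta_in_P)
    then obtain \<delta> where \<delta>: "\<delta> \<in> Dl" "\<delta> \<otimes>\<^bsub>E\<^esub> (b \<otimes>\<^bsub>E\<^esub> e i i) \<ominus>\<^bsub>Q\<^esub> e i i \<in> jrad Q" using e(4)[OF b(1) i] by blast
    have "\<eta> \<delta> * (a * \<eta> (e i i)) - \<eta> (e i i) = \<eta> (\<delta> \<otimes>\<^bsub>E\<^esub> (b \<otimes>\<^bsub>E\<^esub> e i i) \<ominus>\<^bsub>Q\<^esub> e i i)"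
      using \<delta>(1) DlE bE be e(1)[OF i i] Dl_props(6) by (subst eta_minus_Q[symmetric]) (auto simp: b(2) eta_mult)
    then show "\<exists>\<delta>\<in>T.D. \<delta> * (a * \<eta> (e i i)) - \<eta> (e i i) \<in> T.P" using \<delta> by (auto simp: TD TP)
  next
    show "\<eta> \<one>\<^bsub>E\<^esub> \<notin> T.P"
    proof
      assume "\<eta> \<one>\<^bsub>E\<^esub> \<in> T.P"
      then obtain x where x: "x \<in> T.D" "x * (\<eta> \<one>\<^bsub>E\<^esub> - \<eta> \<one>\<^bsub>E\<^esub> * \<eta> \<one>\<^bsub>E\<^esub>) = \<eta> \<one>\<^bsub>E\<^esub>"
        using T.q_D unfolding T.P_def by blast
      then have "\<eta> \<one>\<^bsub>E\<^esub> = \<eta> \<zero>\<^bsub>E\<^esub>" by (simp add: T.q_idem eta_zero)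
      then show False using KDelta eta_inj by (auto simp: central_division_algebra_def division_ring_def)
    qed
  next
    fix i assume "i < n"
    then show "\<kappa> (elt i 0 c) \<in> \<kappa> ` M0" using elt_M0[OF _ Dl_props(3)] c_E by force
  next
    fix m assume "m \<in> \<kappa> ` M0"
    then obtain W where W: "W \<in> M0" "m = \<kappa> W" by blast
    have "\<forall>i. \<exists>b. i < n \<longrightarrow> b \<in> Dl \<and> W i 0 = c \<otimes>\<^bsub>E\<^esub> b" using W(1) by (auto simp: M0_iff)
    then obtain b where b: "\<And>i. i < n \<Longrightarrow> b i \<in> Dl \<and> W i 0 = c \<otimes>\<^bsub>E\<^esub> b i" by metis
    have "m = (\<Sum>i<n. \<kappa> (elt i 0 c) * \<eta> (b i))"
      unfolding W(2) kappa_M0_sum[OF W(1)] \<eta>_def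
      using b DlE c_E n_pos by (intro sum.cong) (auto simp: A.emb_mult[symmetric] elt_closed elt_mult)
    then show "\<exists>\<delta>. (\<forall>i<n. \<delta> i \<in> T.D) \<and> m = (\<Sum>i<n. \<kappa> (elt i 0 c) * \<delta> i)"
      using b by (intro exI[of _ "\<lambda>i. \<eta> (b i)"]) (auto simp: TD)
  next
    fix I assume "I \<in> ?Max"
    then obtain I0 where I0: "maximal_left_ideal I0 S" "I = \<kappa> ` I0" by blast
    note mx = S.maximal_left_idealD[OF I0(1)] and sub = max_L[OF I0(1)]
    note id = S.left_idealD[OF mx(1)]
    have neg: "\<ominus>\<^bsub>A\<^esub> x \<in> I0" if "x \<in> I0" for x
      using id(4)[OF that] that sub S_uminus by auto
    show "additive I" unfolding I0(2) using sub LA id(2,3) neg by (intro A.emb_additive) auto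
    show "I \<subseteq> \<kappa> ` L" using sub I0(2) by blast
    show "T.J \<subseteq> I" unfolding TJ I0(2) using I0(1) by (auto simp: jrad_def)
    show "\<kappa> \<one>\<^bsub>A\<^esub> \<notin> I" unfolding I0(2) using kappa_memL[OF L_props(3) I0(1)] mx(2) by simp
    show "a * x \<in> I" if "a \<in> \<kappa> ` L" "x \<in> I" for a x
      using that id(6) sub LA unfolding I0(2) by (auto simp: A.emb_mult[symmetric] subset_iff)
    show "\<exists>c\<in>\<kappa> ` L. \<kappa> \<one>\<^bsub>A\<^esub> - c * x \<in> I" if x: "x \<in> \<kappa> ` L" "x \<notin> I" for x
    proof -
      obtain z where z: "z \<in> L" "x = \<kappa> z" using x by blast
      then have "z \<notin> I0" using x I0(2) by blast
      then obtain b where b: "b \<in> L" "\<one>\<^bsub>A\<^esub> \<ominus>\<^bsub>S\<^esub> b \<otimes>\<^bsub>A\<^esub> z \<in> I0" using mx(3)[of z] z by auto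
      have "\<kappa> \<one>\<^bsub>A\<^esub> - \<kappa> b * x = \<kappa> (\<one>\<^bsub>A\<^esub> \<ominus>\<^bsub>S\<^esub> b \<otimes>\<^bsub>A\<^esub> z)"
        using z b LA L_props(3,6) by (simp add: S_minus A.emb_simps)
      then show ?thesis using b I0(2) by blast
    qed
    show "\<exists>i<d. \<exists>a\<in>\<kappa> ` L. a \<notin> \<kappa> ` rep0 i \<and> (\<forall>x\<in>I. x * a \<in> \<kappa> ` rep0 i)"
    proof -
      obtain i a where i: "i < d" "a \<in> L" "a \<notin> rep0 i" "\<forall>x\<in>I0. x \<otimes>\<^bsub>A\<^esub> a \<in> rep0 i" using rep0(3)[OF I0(1)] by blast
      have "x * \<kappa> a \<in> \<kappa> ` rep0 i" if "x \<in> I" for x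
        using that i sub LA unfolding I0(2) by (auto simp: A.emb_mult[symmetric] subset_iff)
      then show ?thesis using i kappa_memL[OF i(2) rep0(1)[OF i(1)]] by blast
    qed
  next
    fix x assume x: "x \<in> \<kappa> ` L" "x \<notin> T.J"
    then obtain z where z: "z \<in> L" "x = \<kappa> z" "z \<notin> jrad S" unfolding TJ by blast
    then obtain I where "maximal_left_ideal I S" "z \<notin> I" by (auto simp: jrad_def)
    then show "\<exists>I\<in>?Max. x \<notin> I" using kappa_memL z by blast
  next
    fix i assume "i < d"
    then show "\<kappa> ` rep0 i \<in> ?Max" using rep0(1) by blast
  next
    fix i j a assume ij: "i < d" "j < d" "i \<noteq> j" and a: "a \<in> \<kappa> ` L"
      and *: "\<And>x. x \<in> \<kappa> ` rep0 i \<Longrightarrow> x * a \<in> \<kappa> ` rep0 j"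
    obtain b where b: "b \<in> L" "a = \<kappa> b" using a by blast
    have "x \<otimes>\<^bsub>A\<^esub> b \<in> rep0 j" if x: "x \<in> rep0 i" for x
    proof -
      have xL: "x \<in> L" using x max_L[OF rep0(1)[OF ij(1)]] by blast
      have "\<kappa> (x \<otimes>\<^bsub>A\<^esub> b) \<in> \<kappa> ` rep0 j" using *[of "\<kappa> x"] x b LA xL by (simp add: A.emb_mult)
      then show ?thesis using kappa_memL[OF L_props(6)[OF xL b(1)] rep0(1)[OF ij(2)]] by simp
    qed
    from rep0(2)[OF ij(1,2) b(1) ij(3) this] show "a \<in> \<kappa> ` rep0 j" unfolding b(2) by (rule imageI)
  next
    \<comment> \<open>Witnesses for \<open>escape\<close>: \<open>z\<close> is the scalar
      \<open>c\<close>, which is central and invertible, divides a power of \<open>y\<close>, and is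
      a sum of products of columns from \<open>M0\<close> with rows from its dual.\<close>
    obtain k :: nat and l where kl: "l \<in> L" "y [^]\<^bsub>A\<^esub> k = scalar c \<otimes>\<^bsub>A\<^esub> l"
      using generator_power[OF y_jrad jrad_y, of s] by blast
    note sc = scalar_closed[OF c_E] scalar_closed[OF c_inv_E]
    have 1: "\<kappa> (scalar c_inv) * \<kappa> (scalar c) = \<kappa> \<one>\<^bsub>A\<^esub>"
      using sc c_E c_inv_E by (simp add: A.emb_mult[symmetric] scalar_mult c_inv_c scalar_one)
    have 2: "a * \<kappa> (scalar c) = \<kappa> (scalar c) * a" if "a \<in> \<kappa> ` L" for a
      using that sc LA scalar_central[OF RK[OF pi_pow_R]] by (auto simp: A.emb_mult[symmetric])
    have 3: "t (int k) = \<kappa> (scalar c) * \<kappa> l"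
      using kl sc LA by (simp add: t_simps A.emb_mult)
    have 4: "\<kappa> (scalar c) = (\<Sum>x<n. \<kappa> (elt x 0 c) * \<kappa> (elt 0 x \<one>\<^bsub>E\<^esub>))"
    proof -
      have elts: "(\<lambda>x. elt x x \<one>\<^bsub>E\<^esub>) \<in> {..<n} \<rightarrow> carrier A" by (simp add: elt_closed)
      have "\<kappa> (scalar c) = \<kappa> (scalar c) * \<kappa> (finsum A (\<lambda>x. elt x x \<one>\<^bsub>E\<^esub>) {..<n})"
        using sc by (simp add: E.single_sum_one kappa_one)
      also have "\<dots> = (\<Sum>x<n. \<kappa> (scalar c) * \<kappa> (elt x x \<one>\<^bsub>E\<^esub>))"
        by (simp add: A.emb_finsum[OF elts] sum_distrib_left)
      also have "\<dots> = (\<Sum>x<n. \<kappa> (elt x 0 c) * \<kappa> (elt 0 x \<one>\<^bsub>E\<^esub>))"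
        using sc c_E n_pos by (intro sum.cong) (auto simp: A.emb_mult[symmetric] elt_closed elt_mult scalar_elt)
      finally show ?thesis .
    qed
    have 5: "\<kappa> (elt x 0 c) \<in> \<kappa> ` M0 \<and> \<kappa> (elt 0 x \<one>\<^bsub>E\<^esub>) \<in> T.N" if x: "x < n" for x
    proof
      show "\<kappa> (elt x 0 c) \<in> \<kappa> ` M0" using elt_M0[OF x Dl_props(3)] c_E by force
      have "\<kappa> q0 * \<kappa> (elt 0 x \<one>\<^bsub>E\<^esub>) = \<kappa> (elt 0 x \<one>\<^bsub>E\<^esub>)"
        using x n_pos by (simp add: A.emb_mult[symmetric] elt_closed elt_mult)
      moreover have "m * \<kappa> (elt 0 x \<one>\<^bsub>E\<^esub>) \<in> \<kappa> ` L" if "m \<in> \<kappa> ` M0" for m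
        using that elt_row_dual[OF _ x] M0_A by (auto simp: A.emb_mult[symmetric] elt_closed)
      moreover have "\<kappa> (elt 0 x \<one>\<^bsub>E\<^esub>) * \<kappa> \<one>\<^bsub>A\<^esub> = \<kappa> (elt 0 x \<one>\<^bsub>E\<^esub>)"
        using kappa_one(2) elt_closed by simp
      ultimately show "\<kappa> (elt 0 x \<one>\<^bsub>E\<^esub>) \<in> T.N"
        unfolding T.N_def using q by simp
    qed
    show "\<exists>z z' l k nz mz \<phi>z. z' * z = \<kappa> \<one>\<^bsub>A\<^esub> \<and> (\<forall>a\<in>\<kappa> ` L. a * z = z * a) \<and> l \<in> \<kappa> ` L \<and>
      t (int k) = z * l \<and> z = (\<Sum>x<nz. mz x * \<phi>z x) \<and> (\<forall>x<(nz::nat). mz x \<in> \<kappa> ` M0 \<and> \<phi>z x \<in> T.N)"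
      by (rule exI[of _ "\<kappa> (scalar c)"], rule exI[of _ "\<kappa> (scalar c_inv)"], rule exI[of _ "\<kappa> l"], rule exI[of _ k],
          rule exI[of _ n], rule exI[of _ "\<lambda>x. \<kappa> (elt x 0 c)"], rule exI[of _ "\<lambda>x. \<kappa> (elt 0 x \<one>\<^bsub>E\<^esub>)"])
        (use 1 2 3 4 5 kl(1) in blast)
  qed
  then show ?thesis using TD TP by blast
qed

end

section \<open>The matrix ring isomorphism\<close>

context emb_ring
begin

text \<open>In the entry \<open>(i, j)\<close> with \<open>j < i\<close> every summation index
  \<open>k\<close> satisfies \<open>k < i\<close> or \<open>j < k\<close>, so each term has a factor
  in the radical.\<close>

lemma upper_triangular_subring:
  "subring {U \<in> mat_carrier n A. \<forall>i j. j < i \<and> i < n \<longrightarrow> U i j \<in> jrad A} (mat_ring n A)" (is "subring ?H _")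
proof -
  interpret M: ring "mat_ring n A" by (rule mat_ring_ring)
  note J = left_idealD[OF jrad_left_ideal]
  show ?thesis
  proof (rule M.subringI)
    show "?H \<subseteq> carrier (mat_ring n A)" by (auto simp: mat_ring_simps)
    show "\<one>\<^bsub>mat_ring n A\<^esub> \<in> ?H" using J(2) by (auto simp: mat_ring_closed mat_ring_simps)
    show "\<ominus>\<^bsub>mat_ring n A\<^esub> U \<in> ?H" if U: "U \<in> ?H" for U
    proof -
      let ?V = "\<lambda>i j. if i < n \<and> j < n then \<ominus> U i j else undefined"
      have V: "?V \<in> mat_carrier n A" using U by (auto simp: mat_carrier_def)
      have "?V \<oplus>\<^bsub>mat_ring n A\<^esub> U = \<zero>\<^bsub>mat_ring n A\<^esub>"
        using U V by (intro mat_eqI[of _ n A]) (auto simp: mat_ring_closed mat_ring_simps mat_carrierD l_neg)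
      then have "\<ominus>\<^bsub>mat_ring n A\<^esub> U = ?V" using U V by (intro M.minus_equality) (auto simp: mat_ring_simps)
      then show ?thesis using U V J(4) by auto
    qed
    show "U \<otimes>\<^bsub>mat_ring n A\<^esub> V \<in> ?H" if UV: "U \<in> ?H" "V \<in> ?H" for U V
    proof -
      have "(U \<otimes>\<^bsub>mat_ring n A\<^esub> V) i j \<in> jrad A" if ij: "j < i" "i < n" for i j
      proof -
        have "U i k \<otimes> V k j \<in> jrad A" if "k < n" for k
        proof (cases "k < i")
          case True
          then have "U i k \<in> jrad A" "V k j \<in> carrier A" using UV ij mat_carrierD[of V n A k j] by auto
          then show ?thesis by (rule jrad_right)
        next
          case False
          then have "V k j \<in> jrad A" "U i k \<in> carrier A" using UV ij that mat_carrierD[of U n A i k] by auto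
          then show ?thesis using J(6) by blast
        qed
        then show ?thesis using ij J(1-3) by (simp add: mat_ring_simps) (rule finsum_mem, auto)
      qed
      then show ?thesis using UV by (auto simp: mat_ring_closed)
    qed
    show "U \<oplus>\<^bsub>mat_ring n A\<^esub> V \<in> ?H" if "U \<in> ?H" "V \<in> ?H" for U V
      using that J(3) by (auto simp: mat_ring_closed mat_ring_simps(3))
  qed
qed

end

context tower_setup
begin

abbreviation De where "De \<equiv> Delta_d d Q"

lemma De_eq: "De = restr (mat_ring d Q) {U \<in> mat_carrier d Q. \<forall>i j. j < i \<and> i < d \<longrightarrow> U i j \<in> jrad Q}"
  by (simp add: Delta_d_def restr_def mat_ring_def)

lemma De_ring: "ring De"
proof -
  interpret M: ring "mat_ring d Q" by (rule Q.mat_ring_ring)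
  show ?thesis unfolding De_eq by (rule M.restr_ring[OF Q.upper_triangular_subring])
qed

lemma De_carrier: "U \<in> carrier De \<longleftrightarrow> U \<in> mat_carrier d Q \<and> (\<forall>i j. j < i \<and> i < d \<longrightarrow> U i j \<in> jrad Q)"
  by (simp add: De_eq)

lemma De_finsum_entry:
  assumes "finite I" "f \<in> I \<rightarrow> carrier De" "k < d" "l < d"
  shows "finsum De f I k l = finsum Q (\<lambda>x. f x k l) I"
proof -
  interpret M: ring "mat_ring d Q" by (rule Q.mat_ring_ring)
  have "finsum De f I = finsum (mat_ring d Q) f I"
    unfolding De_eq by (rule M.restr_finsum[OF Q.upper_triangular_subring]) (use assms in \<open>auto simp: De_eq\<close>)
  then show ?thesis using Q.mat_finsum_entry[of I f d k l] assms by (auto simp: De_carrier Pi_iff)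
qed

lemma eta_finsum: "finite I \<Longrightarrow> f \<in> I \<rightarrow> Dl \<Longrightarrow> \<eta> (finsum Q f I) = (\<Sum>i\<in>I. \<eta> (f i))"
proof (induction I rule: finite_induct)
  case (insert i I)
  then have "finsum Q f I \<in> Dl" "f i \<in> Dl" using Q.finsum_closed[of f I] by auto
  then show ?case using insert DlE by (simp add: eta_add[symmetric])
qed (simp add: eta_zero)

text \<open>Matrices over \<open>Delta_d\<close> flattened to matrices of size \<open>cc * d\<close> over the ambient ring.\<close>

definition hat :: "(nat \<Rightarrow> nat \<Rightarrow> nat \<Rightarrow> nat \<Rightarrow> 'e) \<Rightarrow> nat \<Rightarrow> nat \<Rightarrow> (nat \<Rightarrow> nat \<Rightarrow> 'e) all_rings" where
  "hat V i j = \<eta> (V (i div d) (j div d) (i mod d) (j mod d))"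

text \<open>The groups \<open>H (k - l)\<close> of the tower, for \<open>k\<close> and
  \<open>l\<close> below \<open>d\<close>, in terms of \<Delta>.\<close>

definition entry_set where "entry_set k l = \<eta> ` (if l < k then jrad Q else Dl)"

lemma block_index:
  assumes "0 < d" "i < cc * d"
  shows "i div d < cc" "i mod d < d"
  using assms by (simp_all add: less_mult_imp_div_less)

lemma block_index':
  assumes "g < cc" "k < d"
  shows "g * d + k < cc * d" "(g * d + k) div d = g" "(g * d + k) mod d = k"
proof -
  have "g * d + k < Suc g * d" using assms by simp
  also have "\<dots> \<le> cc * d" using assms by (intro mult_right_mono) auto
  finally show "g * d + k < cc * d" .
qed (use assms in auto)

lemma carrier_entry:
  assumes "V \<in> mat_carrier cc De" "g < cc" "g' < cc" "k < d" "l < d"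
  shows "V g g' k l \<in> (if l < k then jrad Q else Dl)"
proof -
  have "V g g' \<in> carrier De" using mat_carrierD[OF assms(1)] assms by blast
  then show ?thesis using assms mat_carrierD[of "V g g'" d Q k l] by (auto simp: De_carrier)
qed

lemma entry_Dl: "x \<in> (if l < k then jrad Q else Dl) \<Longrightarrow> x \<in> Dl"
  using Q.jrad_carrier by (auto split: if_splits)

lemma hat_mem: "0 < d \<Longrightarrow> V \<in> mat_carrier cc De \<Longrightarrow> i < cc * d \<Longrightarrow> j < cc * d \<Longrightarrow> hat V i j \<in> entry_set (i mod d) (j mod d)"
  unfolding hat_def entry_set_def by (intro imageI carrier_entry) (auto simp: block_index)

lemma hat_inj:
  assumes "V \<in> mat_carrier cc De" "V' \<in> mat_carrier cc De" "\<And>i j. i < cc * d \<Longrightarrow> j < cc * d \<Longrightarrow> hat V i j = hat V' i j"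
  shows "V = V'"
proof (rule mat_eqI[OF assms(1,2)])
  fix g g' assume g: "g < cc" "g' < cc"
  show "V g g' = V' g g'"
  proof (rule mat_eqI[of _ d Q])
    show "V g g' \<in> mat_carrier d Q" "V' g g' \<in> mat_carrier d Q"
      using mat_carrierD[OF assms(1) g] mat_carrierD[OF assms(2) g] by (auto simp: De_carrier)
    fix k l assume kl: "k < d" "l < d"
    have "\<eta> (V g g' k l) = \<eta> (V' g g' k l)"
      using assms(3)[OF block_index'(1)[OF g(1) kl(1)] block_index'(1)[OF g(2) kl(2)]]
      unfolding hat_def block_index'(2,3)[OF g(1) kl(1)] block_index'(2,3)[OF g(2) kl(2)] .
    then show "V g g' k l = V' g g' k l"
      using carrier_entry[OF assms(1) g kl] carrier_entry[OF assms(2) g kl] DlE[OF entry_Dl] eta_inj by meson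
  qed
qed

lemma hat_mult:
  assumes d: "0 < d" and V: "V \<in> mat_carrier cc De" "V' \<in> mat_carrier cc De" and ij: "i < cc * d" "j < cc * d"
  shows "hat (V \<otimes>\<^bsub>mat_ring cc De\<^esub> V') i j = mm (cc * d) (hat V) (hat V') i j"
proof -
  interpret De: ring De by (rule De_ring)
  note bi = block_index[OF d ij(1)] and bj = block_index[OF d ij(2)]
  have entry: "x g g' k l \<in> Dl" if "x \<in> mat_carrier cc De" "g < cc" "g' < cc" "k < d" "l < d" for x g g' k l
    using carrier_entry[OF that] by (rule entry_Dl)
  let ?f = "\<lambda>g. V (i div d) g \<otimes>\<^bsub>De\<^esub> V' g (j div d)"
  have f: "?f \<in> {..<cc} \<rightarrow> carrier De"
    using mat_carrierD[OF V(1) bi(1)] mat_carrierD[OF V(2) _ bj(1)] by auto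
  have "(V \<otimes>\<^bsub>mat_ring cc De\<^esub> V') (i div d) (j div d) (i mod d) (j mod d) =
      finsum Q (\<lambda>g. ?f g (i mod d) (j mod d)) {..<cc}"
    using bi bj f by (simp add: mat_ring_simps De_finsum_entry)
  also have "\<dots> = finsum Q (\<lambda>g. finsum Q (\<lambda>k. V (i div d) g (i mod d) k \<otimes>\<^bsub>E\<^esub> V' g (j div d) k (j mod d)) {..<d}) {..<cc}"
    using bi bj entry[OF V(1)] entry[OF V(2)] Dl_props(6)
    by (intro Q.finsum_cong') (auto simp: De_eq mat_ring_simps intro!: Q.finsum_closed[simplified])
  finally have "hat (V \<otimes>\<^bsub>mat_ring cc De\<^esub> V') i j =
      \<eta> (finsum Q (\<lambda>g. finsum Q (\<lambda>k. V (i div d) g (i mod d) k \<otimes>\<^bsub>E\<^esub> V' g (j div d) k (j mod d)) {..<d}) {..<cc})"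
    by (simp add: hat_def)
  also have "\<dots> = (\<Sum>g<cc. \<eta> (finsum Q (\<lambda>k. V (i div d) g (i mod d) k \<otimes>\<^bsub>E\<^esub> V' g (j div d) k (j mod d)) {..<d}))"
    using bi bj entry[OF V(1)] entry[OF V(2)] Dl_props(6)
    by (intro eta_finsum) (auto intro!: Q.finsum_closed[simplified])
  also have "\<dots> = (\<Sum>g<cc. \<Sum>k<d. \<eta> (V (i div d) g (i mod d) k) * \<eta> (V' g (j div d) k (j mod d)))"
    using bi bj entry[OF V(1)] entry[OF V(2)] Dl_props(6) DlE
    by (intro sum.cong refl) (subst eta_finsum, auto simp: eta_mult intro!: sum.cong)
  also have "\<dots> = mm (cc * d) (hat V) (hat V') i j"
    unfolding mm_def hat_def by (rule sum_div_mod[OF d, symmetric])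
  finally show ?thesis .
qed

text \<open>\<open>F\<close> and \<open>G\<close> are inverse to each other, so
  \<open>U \<mapsto> G U F\<close> and \<open>V \<mapsto> F V G\<close> are inverse ring
  isomorphisms. The first two membership premises keep the entries inside the groups that form
  \<open>Delta_d\<close> and inside \<open>L\<close>.\<close>

lemma matrix_ring_iso:
  fixes F G :: "nat \<Rightarrow> nat \<Rightarrow> (nat \<Rightarrow> nat \<Rightarrow> 'e) all_rings"
  assumes d: "0 < d"
    and GLF: "\<And>\<beta> \<beta>' i j a. \<beta> < b \<Longrightarrow> \<beta>' < b \<Longrightarrow> i < cc * d \<Longrightarrow> j < cc * d \<Longrightarrow> a \<in> \<kappa> ` L \<Longrightarrow>
      G i \<beta> * a * F \<beta>' j \<in> entry_set (i mod d) (j mod d)"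
    and FCG: "\<And>\<beta> \<beta>' i j x. \<beta> < b \<Longrightarrow> \<beta>' < b \<Longrightarrow> i < cc * d \<Longrightarrow> j < cc * d \<Longrightarrow> x \<in> entry_set (i mod d) (j mod d) \<Longrightarrow>
      F \<beta> i * x * G j \<beta>' \<in> \<kappa> ` L"
    and FG: "\<And>\<beta> \<beta>'. \<beta> < b \<Longrightarrow> \<beta>' < b \<Longrightarrow> mm (cc * d) F G \<beta> \<beta>' = unit_mat (\<kappa> \<one>\<^bsub>A\<^esub>) \<beta> \<beta>'"
    and GF: "\<And>i j. i < cc * d \<Longrightarrow> j < cc * d \<Longrightarrow> mm b G F i j = unit_mat (\<eta> \<one>\<^bsub>E\<^esub>) i j"
    and pF: "\<And>\<beta> i. \<beta> < b \<Longrightarrow> i < cc * d \<Longrightarrow> \<kappa> \<one>\<^bsub>A\<^esub> * F \<beta> i = F \<beta> i"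
  shows "mat_ring b S \<simeq> mat_ring cc De"
proof -
  let ?s = "cc * d" and ?T = "mat_ring cc De" and ?B = "mat_ring b S"
  interpret De: ring De by (rule De_ring)
  define ka where "ka U \<beta> \<beta>' = \<kappa> (U \<beta> \<beta>')" for U :: "nat \<Rightarrow> nat \<Rightarrow> nat \<Rightarrow> nat \<Rightarrow> 'e" and \<beta> \<beta>'
  define W where "W U = mm b (mm b G (ka U)) F" for U
  have UL: "U \<beta> \<beta>' \<in> L" if "U \<in> mat_carrier b S" "\<beta> < b" "\<beta>' < b" for U \<beta> \<beta>'
    using mat_carrierD[OF that] by simp
  have eta_add_set: "additive (entry_set k l)" for k l
  proof -
    have "additive (\<eta> ` I)" if "left_ideal I Q" for I
    proof (rule additiveI)
      note I = Q.left_idealD[OF that]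
      have IE: "x \<in> I \<Longrightarrow> x \<in> carrier E \<and> x \<in> Dl" for x using I(1) DlE by auto
      show "0 \<in> \<eta> ` I" using I(2) eta_zero by force
      fix a b assume "a \<in> \<eta> ` I" "b \<in> \<eta> ` I"
      then obtain x z where xz: "x \<in> I" "z \<in> I" "a = \<eta> x" "b = \<eta> z" by blast
      then have "a - b = \<eta> (x \<ominus>\<^bsub>Q\<^esub> z)" using IE by (simp add: eta_minus E.restr_minus[OF Dl_subring])
      then show "a - b \<in> \<eta> ` I" using I(5) xz by blast
    qed
    moreover have "left_ideal Dl Q"
      by (rule Q.left_idealI) (use Dl_props in auto)
    ultimately show ?thesis using Q.jrad_left_ideal by (simp add: entry_set_def)
  qed
  have W_mem: "W U i j \<in> entry_set (i mod d) (j mod d)" if U: "U \<in> mat_carrier b S" and ij: "i < ?s" "j < ?s" for U i j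
  proof -
    have "W U i j = (\<Sum>k<b. \<Sum>l<b. G i l * ka U l k * F k j)"
      by (simp add: W_def mm_def sum_distrib_right)
    also have "\<dots> \<in> entry_set (i mod d) (j mod d)"
      using U ij UL by (intro additive_sum[OF eta_add_set] GLF) (auto simp: ka_def)
    finally show ?thesis .
  qed
  \<comment> \<open>\<open>\<eta>\<close> is injective on \<open>E\<close>, so the choice merely
    inverts it. Outside the index range the value is \<open>undefined\<close>, as
    \<open>mat_carrier\<close> demands at both levels of nesting.\<close>
  define \<Phi> where "\<Phi> U g g' = (if g < cc \<and> g' < cc then (\<lambda>k l. if k < d \<and> l < d
      then (SOME x. x \<in> (if l < k then jrad Q else Dl) \<and> \<eta> x = W U (g * d + k) (g' * d + l)) else undefined) else undefined)" for U g g'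
  have \<Phi>_entry: "\<Phi> U g g' k l \<in> (if l < k then jrad Q else Dl) \<and> \<eta> (\<Phi> U g g' k l) = W U (g * d + k) (g' * d + l)"
    if U: "U \<in> mat_carrier b S" and g: "g < cc" "g' < cc" and kl: "k < d" "l < d" for U g g' k l
  proof -
    have "\<exists>x. x \<in> (if l < k then jrad Q else Dl) \<and> \<eta> x = W U (g * d + k) (g' * d + l)"
      using W_mem[OF U block_index'(1)[OF g(1) kl(1)] block_index'(1)[OF g(2) kl(2)]]
      unfolding block_index'(3)[OF g(1) kl(1)] block_index'(3)[OF g(2) kl(2)] entry_set_def by force
    from someI_ex[OF this] show ?thesis using g kl by (simp add: \<Phi>_def)
  qed
  have \<Phi>_closed: "\<Phi> U \<in> mat_carrier cc De" if U: "U \<in> mat_carrier b S" for U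
  proof -
    have "\<Phi> U g g' \<in> carrier De" if g: "g < cc" "g' < cc" for g g'
    proof -
      have "\<Phi> U g g' k l \<in> carrier Q" if "k < d" "l < d" for k l
        using entry_Dl \<Phi>_entry[OF U g that] by fastforce
      moreover have "\<Phi> U g g' k l = undefined" if "\<not> (k < d \<and> l < d)" for k l
        using that g by (auto simp: \<Phi>_def)
      moreover have "\<Phi> U g g' k l \<in> jrad Q" if "l < k" "k < d" for k l
        using \<Phi>_entry[OF U g that(2), of l] that by simp
      ultimately show ?thesis unfolding De_carrier mat_carrier_def by blast
    qed
    then show ?thesis by (auto simp: mat_carrier_def \<Phi>_def)
  qed
  have hat_\<Phi>: "hat (\<Phi> U) i j = W U i j" if U: "U \<in> mat_carrier b S" and ij: "i < ?s" "j < ?s" for U i j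
    using \<Phi>_entry[OF U block_index(1)[OF d ij(1)] block_index(1)[OF d ij(2)] block_index(2)[OF d ij(1)] block_index(2)[OF d ij(2)]]
    by (simp add: hat_def)
  have ka_mult: "ka (U \<otimes>\<^bsub>?B\<^esub> V) \<beta> \<beta>' = mm b (ka U) (ka V) \<beta> \<beta>'"
    if U: "U \<in> mat_carrier b S" and V: "V \<in> mat_carrier b S" and \<beta>: "\<beta> < b" "\<beta>' < b" for U V \<beta> \<beta>'
  proof -
    have f: "(\<lambda>k. U \<beta> k \<otimes>\<^bsub>A\<^esub> V k \<beta>') \<in> {..<b} \<rightarrow> L" using UL[OF U] UL[OF V] \<beta> L_props(6) by auto
    have "(U \<otimes>\<^bsub>?B\<^esub> V) \<beta> \<beta>' = finsum A (\<lambda>k. U \<beta> k \<otimes>\<^bsub>A\<^esub> V k \<beta>') {..<b}"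
      using \<beta> by (simp add: mat_ring_simps A.restr_finsum[OF L_subring f])
    then show ?thesis using f LA UL[OF U] UL[OF V] \<beta>
      by (simp add: ka_def mm_def A.emb_finsum Pi_iff A.emb_mult)
  qed
  have ka_unit: "mm b (mm b (unit_mat (\<kappa> \<one>\<^bsub>A\<^esub>)) (ka U)) (unit_mat (\<kappa> \<one>\<^bsub>A\<^esub>)) \<beta> \<beta>' = ka U \<beta> \<beta>'"
    if U: "U \<in> mat_carrier b S" and \<beta>: "\<beta> < b" "\<beta>' < b" for U \<beta> \<beta>'
    using \<beta> LA[OF UL[OF U \<beta>]] by (simp add: mm_unit_left mm_unit_right ka_def kappa_one)
  have W_back: "mm ?s (mm ?s F (W U)) G \<beta> \<beta>' = ka U \<beta> \<beta>'" if U: "U \<in> mat_carrier b S" and \<beta>: "\<beta> < b" "\<beta>' < b" for U \<beta> \<beta>'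
  proof -
    have "mm ?s (mm ?s F (W U)) G \<beta> \<beta>' = mm b (mm b (mm ?s F G) (ka U)) (mm ?s F G) \<beta> \<beta>'"
    proof -
      have "mm ?s (mm ?s F (W U)) G \<beta> \<beta>' = mm ?s F (mm b G (mm b (ka U) (mm ?s F G))) \<beta> \<beta>'"
        by (simp add: W_def mm_assoc_fun)
      also have "\<dots> = mm b (mm b (mm ?s F G) (ka U)) (mm ?s F G) \<beta> \<beta>'" by (simp add: mm_assoc_fun)
      finally show ?thesis .
    qed
    also have "\<dots> = mm b (mm b (unit_mat (\<kappa> \<one>\<^bsub>A\<^esub>)) (ka U)) (unit_mat (\<kappa> \<one>\<^bsub>A\<^esub>)) \<beta> \<beta>'"
      using \<beta> by (simp add: mm_def FG[unfolded mm_def])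
    finally show ?thesis using ka_unit[OF U \<beta>] by simp
  qed
  have hom_mult: "\<Phi> (U \<otimes>\<^bsub>?B\<^esub> V) = \<Phi> U \<otimes>\<^bsub>?T\<^esub> \<Phi> V" if U: "U \<in> mat_carrier b S" and V: "V \<in> mat_carrier b S" for U V
  proof (rule hat_inj)
    have UV: "U \<otimes>\<^bsub>?B\<^esub> V \<in> mat_carrier b S" by (rule S.mat_ring_closed(1)[OF U V])
    show "\<Phi> (U \<otimes>\<^bsub>?B\<^esub> V) \<in> mat_carrier cc De" by (rule \<Phi>_closed[OF UV])
    show "\<Phi> U \<otimes>\<^bsub>?T\<^esub> \<Phi> V \<in> mat_carrier cc De" by (intro De.mat_ring_closed \<Phi>_closed U V)
    fix i j assume ij: "i < ?s" "j < ?s"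
    have "hat (\<Phi> U \<otimes>\<^bsub>?T\<^esub> \<Phi> V) i j = mm ?s (hat (\<Phi> U)) (hat (\<Phi> V)) i j"
      by (intro hat_mult d \<Phi>_closed U V ij)
    also have "\<dots> = mm ?s (W U) (W V) i j" unfolding mm_def using hat_\<Phi> U V ij by (intro sum.cong) auto
    also have "\<dots> = mm b (mm b G (ka U)) (mm b (mm ?s F G) (mm b (ka V) F)) i j"
      by (simp add: W_def mm_assoc_fun)
    also have "\<dots> = mm b (mm b G (ka U)) (mm b (unit_mat (\<kappa> \<one>\<^bsub>A\<^esub>)) (mm b (ka V) F)) i j"
      by (intro mm_cong_right mm_cong_left) (simp add: FG)
    also have "\<dots> = mm b (mm b G (ka U)) (mm b (ka V) F) i j"
    proof (rule mm_cong_right)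
      fix k assume k: "k < b"
      show "mm b (unit_mat (\<kappa> \<one>\<^bsub>A\<^esub>)) (mm b (ka V) F) k j = mm b (ka V) F k j"
        using k LA[OF UL[OF V k]] unfolding mm_unit_left[OF k]
        by (simp add: mm_def sum_distrib_left mult.assoc[symmetric] ka_def kappa_one)
    qed
    also have "\<dots> = mm b G (mm b (mm b (ka U) (ka V)) F) i j"
      by (simp add: mm_assoc_fun)
    also have "\<dots> = mm b G (mm b (ka (U \<otimes>\<^bsub>?B\<^esub> V)) F) i j"
      by (intro mm_cong_right mm_cong_left) (simp add: ka_mult U V)
    also have "\<dots> = W (U \<otimes>\<^bsub>?B\<^esub> V) i j" by (simp add: W_def mm_assoc_fun)
    finally show "hat (\<Phi> (U \<otimes>\<^bsub>?B\<^esub> V)) i j = hat (\<Phi> U \<otimes>\<^bsub>?T\<^esub> \<Phi> V) i j" using hat_\<Phi>[OF UV ij] by simp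
  qed
  have hom_add: "\<Phi> (U \<oplus>\<^bsub>?B\<^esub> V) = \<Phi> U \<oplus>\<^bsub>?T\<^esub> \<Phi> V" if U: "U \<in> mat_carrier b S" and V: "V \<in> mat_carrier b S" for U V
  proof (rule hat_inj)
    have UV: "U \<oplus>\<^bsub>?B\<^esub> V \<in> mat_carrier b S" by (rule S.mat_ring_closed(2)[OF U V])
    show "\<Phi> (U \<oplus>\<^bsub>?B\<^esub> V) \<in> mat_carrier cc De" by (rule \<Phi>_closed[OF UV])
    show "\<Phi> U \<oplus>\<^bsub>?T\<^esub> \<Phi> V \<in> mat_carrier cc De" by (intro De.mat_ring_closed \<Phi>_closed U V)
    fix i j assume ij: "i < ?s" "j < ?s"
    note bi = block_index[OF d ij(1)] and bj = block_index[OF d ij(2)]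
    have "hat (\<Phi> U \<oplus>\<^bsub>?T\<^esub> \<Phi> V) i j = hat (\<Phi> U) i j + hat (\<Phi> V) i j"
      unfolding hat_def
      using bi bj DlE[OF entry_Dl[OF carrier_entry[OF \<Phi>_closed[OF U] bi(1) bj(1) bi(2) bj(2)]]]
        DlE[OF entry_Dl[OF carrier_entry[OF \<Phi>_closed[OF V] bi(1) bj(1) bi(2) bj(2)]]]
      by (simp add: mat_ring_simps(3) De_eq eta_add)
    also have "\<dots> = W U i j + W V i j" by (simp add: hat_\<Phi> U V ij)
    also have "\<dots> = W (U \<oplus>\<^bsub>?B\<^esub> V) i j"
    proof -
      have "ka (U \<oplus>\<^bsub>?B\<^esub> V) k l = ka U k l + ka V k l" if "k < b" "l < b" for k l
        using that LA[OF UL[OF U that]] LA[OF UL[OF V that]] by (simp add: ka_def mat_ring_simps(3) A.emb_add)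
      then show ?thesis
        by (simp add: W_def mm_def sum.distrib distrib_left distrib_right)
    qed
    finally show "hat (\<Phi> (U \<oplus>\<^bsub>?B\<^esub> V)) i j = hat (\<Phi> U \<oplus>\<^bsub>?T\<^esub> \<Phi> V) i j" using hat_\<Phi>[OF UV ij] by simp
  qed
  have hom_one: "\<Phi> \<one>\<^bsub>?B\<^esub> = \<one>\<^bsub>?T\<^esub>"
  proof (rule hat_inj)
    have one: "\<one>\<^bsub>?B\<^esub> \<in> mat_carrier b S" by (rule S.mat_ring_closed(3))
    show "\<Phi> \<one>\<^bsub>?B\<^esub> \<in> mat_carrier cc De" by (rule \<Phi>_closed[OF one])
    show "\<one>\<^bsub>?T\<^esub> \<in> mat_carrier cc De" by (rule De.mat_ring_closed(3))
    fix i j assume ij: "i < ?s" "j < ?s"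
    note bi = block_index[OF d ij(1)] and bj = block_index[OF d ij(2)]
    have ij_eq: "i = j \<longleftrightarrow> i div d = j div d \<and> i mod d = j mod d" by (metis div_mult_mod_eq)
    have "W \<one>\<^bsub>?B\<^esub> i j = mm b G (mm b (ka \<one>\<^bsub>?B\<^esub>) F) i j" by (simp add: W_def mm_assoc_fun)
    also have "\<dots> = mm b G (mm b (unit_mat (\<kappa> \<one>\<^bsub>A\<^esub>)) F) i j"
      by (intro mm_cong_right mm_cong_left) (simp add: ka_def mat_ring_simps(4) unit_mat_def A.emb_zero)
    also have "\<dots> = mm b G F i j" by (intro mm_cong_right) (simp add: mm_unit_left pF ij)
    also have "\<dots> = hat \<one>\<^bsub>?T\<^esub> i j"
      using bi bj ij_eq by (auto simp: GF ij unit_mat_def hat_def mat_ring_simps De_eq eta_zero)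
    finally show "hat (\<Phi> \<one>\<^bsub>?B\<^esub>) i j = hat \<one>\<^bsub>?T\<^esub> i j" using hat_\<Phi>[OF one ij] by simp
  qed
  have inj: "inj_on \<Phi> (mat_carrier b S)"
  proof (rule inj_onI)
    fix U V assume U: "U \<in> mat_carrier b S" and V: "V \<in> mat_carrier b S" and eq: "\<Phi> U = \<Phi> V"
    have W_eq: "W U i j = W V i j" if "i < ?s" "j < ?s" for i j
      using hat_\<Phi>[OF U that] hat_\<Phi>[OF V that] eq by simp
    show "U = V"
    proof (rule mat_eqI[OF U V])
      fix \<beta> \<beta>' assume \<beta>: "\<beta> < b" "\<beta>' < b"
      have "ka U \<beta> \<beta>' = ka V \<beta> \<beta>'"
        unfolding W_back[OF U \<beta>, symmetric] W_back[OF V \<beta>, symmetric] mm_def by (simp add: W_eq)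
      then show "U \<beta> \<beta>' = V \<beta> \<beta>'"
        using LA[OF UL[OF U \<beta>]] LA[OF UL[OF V \<beta>]] by (simp add: ka_def A.emb_inj)
    qed
  qed
  have surj: "V \<in> \<Phi> ` mat_carrier b S" if V: "V \<in> mat_carrier cc De" for V
  proof -
    \<comment> \<open>The candidate for the preimage of \<open>V\<close>, obtained from the inverse
      conjugation; its entries still have to be pulled back from the ambient ring to
      \<open>L\<close>.\<close>
    let ?Z = "mm ?s (mm ?s F (hat V)) G"
    have Z: "?Z \<beta> \<beta>' \<in> \<kappa> ` L" if \<beta>: "\<beta> < b" "\<beta>' < b" for \<beta> \<beta>'
    proof -
      have "?Z \<beta> \<beta>' = (\<Sum>k<?s. \<Sum>l<?s. F \<beta> l * hat V l k * G k \<beta>')"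
        by (simp add: mm_def sum_distrib_right)
      also have "\<dots> \<in> \<kappa> ` L"
        using \<beta> hat_mem[OF d V] by (intro additive_sum[OF kappa_L_add] FCG) auto
      finally show ?thesis .
    qed
    define U where "U \<beta> \<beta>' = (if \<beta> < b \<and> \<beta>' < b then (SOME x. x \<in> L \<and> \<kappa> x = ?Z \<beta> \<beta>') else undefined)" for \<beta> \<beta>'
    have U: "U \<beta> \<beta>' \<in> L \<and> ka U \<beta> \<beta>' = ?Z \<beta> \<beta>'" if \<beta>: "\<beta> < b" "\<beta>' < b" for \<beta> \<beta>'
    proof -
      have "\<exists>x. x \<in> L \<and> \<kappa> x = ?Z \<beta> \<beta>'" using Z[OF \<beta>] by force
      from someI_ex[OF this] show ?thesis using \<beta> by (simp add: U_def ka_def)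
    qed
    have Uc: "U \<in> mat_carrier b S" using U by (auto simp: mat_carrier_def U_def)
    have "W U i j = hat V i j" if ij: "i < ?s" "j < ?s" for i j
    proof -
      have "W U i j = mm b (mm b G ?Z) F i j"
        unfolding W_def mm_def[of b] using U by (simp add: mm_def[of b])
      also have "\<dots> = mm ?s (mm ?s (mm b G F) (hat V)) (mm b G F) i j"
      proof -
        have "mm b (mm b G ?Z) F i j = mm b G (mm ?s F (mm ?s (hat V) (mm b G F))) i j"
          by (simp add: mm_assoc_fun)
        also have "\<dots> = mm ?s (mm ?s (mm b G F) (hat V)) (mm b G F) i j" by (simp add: mm_assoc_fun)
        finally show ?thesis .
      qed
      also have "\<dots> = mm ?s (mm ?s (unit_mat (\<eta> \<one>\<^bsub>E\<^esub>)) (hat V)) (unit_mat (\<eta> \<one>\<^bsub>E\<^esub>)) i j"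
        using ij by (simp add: mm_def GF[unfolded mm_def])
      also have "\<dots> = \<eta> \<one>\<^bsub>E\<^esub> * hat V i j * \<eta> \<one>\<^bsub>E\<^esub>" using ij by (simp add: mm_unit_left mm_unit_right)
      also have "\<dots> = hat V i j"
      proof -
        obtain x where "x \<in> Dl" "hat V i j = \<eta> x" using hat_mem[OF d V ij] entry_Dl unfolding entry_set_def by blast
        then show ?thesis using DlE by (simp add: eta_mult)
      qed
      finally show ?thesis .
    qed
    then have "V = \<Phi> U" using hat_\<Phi>[OF Uc] by (intro hat_inj[OF V \<Phi>_closed[OF Uc]]) simp
    then show ?thesis using Uc by blast
  qed
  have "\<Phi> \<in> ring_hom ?B ?T"
    by (rule ring_hom_memI) (auto simp: mat_ring_simps(1) \<Phi>_closed hom_mult hom_add hom_one)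
  moreover have "bij_betw \<Phi> (carrier ?B) (carrier ?T)"
    unfolding bij_betw_def mat_ring_simps(1) using inj surj \<Phi>_closed by blast
  ultimately show ?thesis by (auto simp: is_ring_iso_def ring_iso_def)
qed

text \<open>The premises of \<open>matrix_ring_iso\<close> are the composition rules between
  \<open>L\<close>, the shifts \<open>Mt (- k)\<close> and their duals \<open>Nt k\<close>.\<close>

lemma iso_exists:
  "\<exists>b c. b dvd r \<and> c > 0 \<and> mat_ring b S \<simeq> mat_ring c De"
proof -
  obtain nv v w e g Max rep where nt: "normal_tower (\<kappa> \<one>\<^bsub>A\<^esub>) (\<eta> \<one>\<^bsub>E\<^esub>) (\<kappa> ` L) (\<kappa> ` M0) nv v w t r d n e g Max rep"
    and TD: "lattice_tower.D (\<eta> \<one>\<^bsub>E\<^esub>) (\<kappa> ` M0) = \<eta> ` Dl" and TP: "lattice_tower.P (\<eta> \<one>\<^bsub>E\<^esub>) (\<kappa> ` M0) = \<eta> ` jrad Q"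
    using normal_tower_exists by (elim exE conjE) (rule that)
  interpret T: normal_tower "\<kappa> \<one>\<^bsub>A\<^esub>" "\<eta> \<one>\<^bsub>E\<^esub>" "\<kappa> ` L" "\<kappa> ` M0" nv v w t r d n e g Max rep by (rule nt)
  obtain b cc F G where bc: "b dvd r" "0 < cc"
    and FG_mem: "\<And>\<beta> i. \<beta> < b \<Longrightarrow> i < cc * d \<Longrightarrow> F \<beta> i \<in> T.Mt (- int (i mod d)) \<and> G i \<beta> \<in> T.Nt (int (i mod d))"
    and FG: "\<And>\<beta> \<beta>'. \<beta> < b \<Longrightarrow> \<beta>' < b \<Longrightarrow> mm (cc * d) F G \<beta> \<beta>' = unit_mat (\<kappa> \<one>\<^bsub>A\<^esub>) \<beta> \<beta>'"
    and GF: "\<And>i j. i < cc * d \<Longrightarrow> j < cc * d \<Longrightarrow> mm b G F i j = unit_mat (\<eta> \<one>\<^bsub>E\<^esub>) i j"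
    using T.inverse_matrices by (elim exE conjE) (rule that, auto)
  have H: "T.H (int (i mod d) - int (j mod d)) = entry_set (i mod d) (j mod d)" for i j
    using T.H_index[of "i mod d" "j mod d"] T.d_pos by (simp add: TD TP entry_set_def)
  have "mat_ring b S \<simeq> mat_ring cc De"
  proof (rule matrix_ring_iso[OF T.d_pos _ _ FG GF])
    fix \<beta> \<beta>' i j assume ij: "\<beta> < b" "\<beta>' < b" "i < cc * d" "j < cc * d"
    show "G i \<beta> * a * F \<beta>' j \<in> entry_set (i mod d) (j mod d)" if "a \<in> \<kappa> ` L" for a
      unfolding H[symmetric] using FG_mem ij that by (intro T.Nt_Mt T.Nt_L) auto
    show "F \<beta> i * x * G j \<beta>' \<in> \<kappa> ` L" if "x \<in> entry_set (i mod d) (j mod d)" for x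
      using that unfolding H[symmetric] using FG_mem ij
      by (intro T.Mt_Nt[of _ "int (j mod d)"] T.Mt_H[of _ "int (i mod d)"]) auto
  next
    fix \<beta> i assume "\<beta> < b" "i < cc * d"
    then have "F \<beta> i \<in> T.Mt (- int (i mod d))" using FG_mem by blast
    then show "\<kappa> \<one>\<^bsub>A\<^esub> * F \<beta> i = F \<beta> i" by (auto simp: T.Mt_def mult.assoc[symmetric] T.p_mult_t)
  qed
  then show ?thesis using bc by blast
qed

end

theorem theorem6p5:
  fixes E :: "'e ring" and D :: "'d ring"
    and R K Dl :: "'e set"
    and L :: "(nat \<Rightarrow> nat \<Rightarrow> 'e) set"
    and n r d :: nat
  assumes KDelta: "central_division_algebra E K"
    and R_dvr: "dvr E R"
    and K_frac: "fraction_field E R K"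
    and Delta_max: "maximal_order E R K Dl"
    and D_div: "division_ring D"
    and Delta_mod_rad: "(restr E Dl) Quot (jrad (restr E Dl)) \<simeq> mat_ring r D"
    and n_pos: "n > 0"
    and L_sub: "L \<subseteq> mat_carrier n (restr E Dl)"
    and L_order: "order (mat_ring n E) (scal n E ` R) (scal n E ` K) L"
    and L_normal: "normal_ring (restr (mat_ring n E) L)"
    and L_hered: "hereditary (restr (mat_ring n E) L)"
    and L_simples: "num_simple_classes (restr (mat_ring n E) L) d"
  shows "\<exists>b c. b dvd r \<and> c > 0 \<and>
           mat_ring b (restr (mat_ring n E) L) \<simeq> mat_ring c (Delta_d d (restr E Dl))"
proof -
  have R_subring: "subring R E" using R_dvr by (simp add: dvr_def)
  have Dl_order: "order E R K Dl" using Delta_max by (simp add: maximal_order_def)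
  obtain \<pi> where \<pi>: "\<pi> \<in> R" "\<pi> \<noteq> \<zero>\<^bsub>E\<^esub>" "\<pi> \<notin> Units (restr E R)"
    "\<And>x. x \<in> R \<Longrightarrow> x \<noteq> \<zero>\<^bsub>E\<^esub> \<Longrightarrow> \<exists>u k. u \<in> Units (restr E R) \<and> x = u \<otimes>\<^bsub>E\<^esub> (\<pi> [^]\<^bsub>E\<^esub> (k::nat))"
    using R_dvr unfolding dvr_def by blast
  interpret order_setup E R K Dl L n \<pi>
    by (rule order_setup.intro) (fact KDelta R_subring \<pi> K_frac Dl_order n_pos L_sub L_order L_normal L_hered)+
  obtain s :: nat where s: "\<forall>i<n. \<forall>j<n. \<forall>w\<in>Dl. elt i j (\<pi> [^]\<^bsub>E\<^esub> s \<otimes>\<^bsub>E\<^esub> w) \<in> L" using denominator_elt by blast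
  interpret order_denominator E R K Dl L n \<pi> s
    by unfold_locales (use s in blast)
  obtain y y' where "y \<in> jrad S \<and> y' \<in> carrier A \<and> y \<otimes>\<^bsub>A\<^esub> y' = \<one>\<^bsub>A\<^esub> \<and> y' \<otimes>\<^bsub>A\<^esub> y = \<one>\<^bsub>A\<^esub> \<and>
    jrad S = (\<lambda>a. y \<otimes>\<^bsub>A\<^esub> a) ` L \<and>
    (\<forall>a\<in>L. y \<otimes>\<^bsub>A\<^esub> a \<otimes>\<^bsub>A\<^esub> y' \<in> L \<and> y' \<otimes>\<^bsub>A\<^esub> a \<otimes>\<^bsub>A\<^esub> y \<in> L)"
    using radical_generator by (elim exE) (rule that)
  then interpret tower_setup E R K Dl L n \<pi> s D r d y y'
    using D_div Delta_mod_rad L_simples by unfold_locales blast+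
  show ?thesis by (rule iso_exists)
qed

end
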